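(* Let $\mathcal{M}$ be a semi-finite von Neumann algebra with a distinguished faithful, normal, semi-finite trace $\tau$, and let $1\le p<\infty$. Every closed linear subspace of $L^p(\mathcal{M},\tau)$ either contains almost isometric copies of $\ell^p$ or is strongly embedded in $L^p(\mathcal{M},\tau)$.
   Context: $\mathcal{M}$ acts on a Hilbert space $H$. A closed densely defined operator $x$ affiliated with $\mathcal{M}$ is $\tau$-measurable if for every $\epsilon>0$ there is a projection $p\in\mathcal{M}$ with $p(H)\subseteq \operatorname{dom}(x)$, $\tau(\mathbf{1}-p)<\epsilon$ and $xp\in\mathcal{M}$; $\widetilde{\mathcal{M}}$ is the $*$-algebra of all $\tau$-measurable operators (strong sum, strong product, adjoint). For $x\in\widetilde{\mathcal{M}}$ and $t\ge0$, $\mu_t(x)=\inf\{s\ge 0:\tau(e^{|x|}(s,\infty))\le t\}$, where $e^{|x|}$ is the spectral measure of $|x|$. The measure topology on $\widetilde{\mathcal{M}}$ is the topology of the metric $d(x,y)=\inf\{t\ge0:\mu_t(x-y)\le t\}$. $L^p(\mathcal{M},\tau)$ is the usual non-commutative $L^p$-space, i.e. the set of $x\in\widetilde{\mathcal{M}}$ such that $t\mapsto\mu_t(x)$ belongs to $L^p([0,\infty))$, with the corresponding norm $\|x\|_p=(\int_0^\infty\mu_t(x)^p\,dt)^{1/p}$. A subspace $X$ of $L^p(\mathcal{M},\tau)$ is called strongly embedded in $L^p(\mathcal{M},\tau)$ if the $L^p$-norm topology and the measure topology coincide on $X$. $X$ contains almost isometric copies of $\ell^p$ if for every $\epsilon>0$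 there is a linear isomorphism $T$ from $\ell^p$ onto a subspace of $X$ with $\|T\|\,\|T^{-1}\|\le1+\epsilon$. *)

theory Defs
  imports "HOL-Analysis.Analysis"
begin

section \<open>Complex Hilbert spaces\<close>

text \<open>The real inner product of the underlying real Hilbert space is the real part of the complex
  one, so norm, metric and topology are those of the real structure. The complex inner product is
  linear in its first argument.\<close>

class complex_hilbert_space = real_inner + complete_space +
  fixes scaleC :: "complex \<Rightarrow> 'a \<Rightarrow> 'a"  (infixr "*\<^sub>C" 75)
    and cinner :: "'a \<Rightarrow> 'a \<Rightarrow> complex"
  assumes scaleC_add_right: "c *\<^sub>C (\<xi> + \<eta>) = c *\<^sub>C \<xi> + c *\<^sub>C \<eta>"
    and scaleC_add_left: "(c + d) *\<^sub>C \<xi> = c *\<^sub>C \<xi> + d *\<^sub>C \<xi>"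
    and scaleC_scaleC: "c *\<^sub>C d *\<^sub>C \<xi> = (c * d) *\<^sub>C \<xi>"
    and scaleC_one: "1 *\<^sub>C \<xi> = \<xi>"
    and scaleR_scaleC: "r *\<^sub>R \<xi> = complex_of_real r *\<^sub>C \<xi>"
    and cinner_commute: "cinner \<xi> \<eta> = cnj (cinner \<eta> \<xi>)"
    and cinner_add_left: "cinner (\<xi> + \<eta>) \<zeta> = cinner \<xi> \<zeta> + cinner \<eta> \<zeta>"
    and cinner_scaleC_left: "cinner (c *\<^sub>C \<xi>) \<eta> = c * cinner \<xi> \<eta>"
    and inner_cinner: "inner \<xi> \<eta> = Re (cinner \<xi> \<eta>)"


section \<open>Von Neumann algebras and traces\<close>

type_synonym 'h bop = "'h \<Rightarrow>\<^sub>L 'h"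

definition bounded_ops :: "'h::complex_hilbert_space bop set" where
  "bounded_ops = {A. \<forall>c \<xi>. blinfun_apply A (c *\<^sub>C \<xi>) = c *\<^sub>C A \<xi>}"

definition adj :: "'h::complex_hilbert_space bop \<Rightarrow> 'h bop" where
  "adj A = (THE B. \<forall>\<xi> \<eta>. cinner (A \<xi>) \<eta> = cinner \<xi> (blinfun_apply B \<eta>))"

definition commutant :: "'h::complex_hilbert_space bop set \<Rightarrow> 'h bop set" where
  "commutant S = {A \<in> bounded_ops. \<forall>B\<in>S. A o\<^sub>L B = B o\<^sub>L A}"

definition von_neumann_algebra :: "'h::complex_hilbert_space bop set \<Rightarrow> bool" where
  "von_neumann_algebra M \<longleftrightarrow>
     M \<subseteq> bounded_ops \<and> (\<forall>A\<in>M. adj A \<in> M) \<and> commutant (commutant M) = M"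

definition positive_op :: "'h::complex_hilbert_space bop \<Rightarrow> bool" where
  "positive_op A \<longleftrightarrow>
     A \<in> bounded_ops \<and> (\<forall>\<xi>. cinner (A \<xi>) \<xi> \<in> \<real> \<and> 0 \<le> Re (cinner (A \<xi>) \<xi>))"

definition op_le :: "'h::complex_hilbert_space bop \<Rightarrow> 'h bop \<Rightarrow> bool" where
  "op_le A B \<longleftrightarrow> positive_op (B - A)"

definition is_projection :: "'h::complex_hilbert_space bop \<Rightarrow> bool" where
  "is_projection P \<longleftrightarrow> P \<in> bounded_ops \<and> P o\<^sub>L P = P \<and> adj P = P"

definition positive_cone :: "'h::complex_hilbert_space bop set \<Rightarrow> 'h bop set" where
  "positive_cone M = {A \<in> M. positive_op A}"

text \<open>A trace is an extended-valued function on the positive cone of the algebra; its values at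
  other operators are irrelevant. In \<^typ>\<open>ennreal\<close>, zero times infinity is zero.\<close>

definition is_trace :: "'h::complex_hilbert_space bop set \<Rightarrow> ('h bop \<Rightarrow> ennreal) \<Rightarrow> bool" where
  "is_trace M \<tau> \<longleftrightarrow>
     (\<forall>A\<in>positive_cone M. \<forall>B\<in>positive_cone M. \<tau> (A + B) = \<tau> A + \<tau> B) \<and>
     (\<forall>A\<in>positive_cone M. \<forall>r\<ge>0. \<tau> (r *\<^sub>R A) = ennreal r * \<tau> A) \<and>
     (\<forall>A\<in>M. \<tau> (adj A o\<^sub>L A) = \<tau> (A o\<^sub>L adj A))"

definition faithful_trace :: "'h::complex_hilbert_space bop set \<Rightarrow> ('h bop \<Rightarrow> ennreal) \<Rightarrow> bool" where
  "faithful_trace M \<tau> \<longleftrightarrow> (\<forall>A\<in>positive_cone M. \<tau> A = 0 \<longrightarrow> A = 0)"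

text \<open>Normality: \<open>\<tau>\<close> preserves suprema of bounded upward directed families in the positive cone.\<close>

definition normal_trace :: "'h::complex_hilbert_space bop set \<Rightarrow> ('h bop \<Rightarrow> ennreal) \<Rightarrow> bool" where
  "normal_trace M \<tau> \<longleftrightarrow>
     (\<forall>D A. D \<noteq> {} \<and> D \<subseteq> positive_cone M \<and>
        (\<forall>B\<in>D. \<forall>C\<in>D. \<exists>E\<in>D. op_le B E \<and> op_le C E) \<and>
        A \<in> positive_cone M \<and> (\<forall>B\<in>D. op_le B A) \<and>
        (\<forall>C\<in>positive_cone M. (\<forall>B\<in>D. op_le B C) \<longrightarrow> op_le A C)
      \<longrightarrow> \<tau> A = (SUP B\<in>D. \<tau> B))"

definition semifinite_trace :: "'h::complex_hilbert_space bop set \<Rightarrow> ('h bop \<Rightarrow> ennreal) \<Rightarrow> bool" where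
  "semifinite_trace M \<tau> \<longleftrightarrow>
     (\<forall>A\<in>positive_cone M. A \<noteq> 0 \<longrightarrow>
        (\<exists>B\<in>positive_cone M. B \<noteq> 0 \<and> op_le B A \<and> \<tau> B < \<infinity>))"

definition fns_trace :: "'h::complex_hilbert_space bop set \<Rightarrow> ('h bop \<Rightarrow> ennreal) \<Rightarrow> bool" where
  "fns_trace M \<tau> \<longleftrightarrow>
     is_trace M \<tau> \<and> faithful_trace M \<tau> \<and> normal_trace M \<tau> \<and> semifinite_trace M \<tau>"

definition semifinite_von_neumann_algebra :: "'h::complex_hilbert_space bop set \<Rightarrow> bool" where
  "semifinite_von_neumann_algebra M \<longleftrightarrow> von_neumann_algebra M \<and> (\<exists>\<tau>. fns_trace M \<tau>)"


section \<open>Unbounded operators\<close>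

text \<open>An unbounded operator is identified with its graph: its domain is \<^const>\<open>Domain\<close>, and
  composition is \<^const>\<open>relcomp\<close>, which is read from left to right, so that the operator product
  \<open>xy\<close> is the relation \<open>y O x\<close>.\<close>

type_synonym 'h uop = "('h \<times> 'h) set"

definition graph_of :: "'h::complex_hilbert_space bop \<Rightarrow> 'h uop" where
  "graph_of A = {(\<xi>, A \<xi>) | \<xi>. True}"

definition closed_densely_defined :: "'h::complex_hilbert_space uop \<Rightarrow> bool" where
  "closed_densely_defined x \<longleftrightarrow>
     subspace x \<and> (\<forall>c. \<forall>(\<xi>, \<eta>)\<in>x. (c *\<^sub>C \<xi>, c *\<^sub>C \<eta>) \<in> x) \<and>
     single_valued x \<and> closed x \<and> closure (Domain x) = UNIV"

definition uadj :: "'h::complex_hilbert_space uop \<Rightarrow> 'h uop" where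
  "uadj x = {(\<eta>, \<zeta>). \<forall>(\<xi>, \<xi>')\<in>x. cinner \<xi>' \<eta> = cinner \<xi> \<zeta>}"

definition positive_selfadjoint :: "'h::complex_hilbert_space uop \<Rightarrow> bool" where
  "positive_selfadjoint a \<longleftrightarrow>
     closed_densely_defined a \<and> uadj a = a \<and>
     (\<forall>(\<xi>, \<eta>)\<in>a. cinner \<eta> \<xi> \<in> \<real> \<and> 0 \<le> Re (cinner \<eta> \<xi>))"

text \<open>The absolute value is the positive square root of \<open>x\<^sup>*x\<close>.\<close>

definition uabs :: "'h::complex_hilbert_space uop \<Rightarrow> 'h uop" where
  "uabs x = (THE a. positive_selfadjoint a \<and> a O a = x O uadj x)"

text \<open>Projection-valued Borel measures on the line, set to zero off the Borel sets so that the
  spectral measure of a self-adjoint operator is unique.\<close>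

definition projection_valued_measure :: "(real set \<Rightarrow> 'h::complex_hilbert_space bop) \<Rightarrow> bool" where
  "projection_valued_measure E \<longleftrightarrow>
     (\<forall>S\<in>sets borel. is_projection (E S)) \<and> E UNIV = id_blinfun \<and>
     (\<forall>S\<in>sets borel. \<forall>T\<in>sets borel. E (S \<inter> T) = E S o\<^sub>L E T) \<and>
     (\<forall>S::nat \<Rightarrow> real set. range S \<subseteq> sets borel \<and> disjoint_family S \<longrightarrow>
        (\<forall>\<xi>. (\<lambda>n. E (S n) \<xi>) sums E (\<Union>n. S n) \<xi>)) \<and>
     (\<forall>S. S \<notin> sets borel \<longrightarrow> E S = 0)"

text \<open>The scalar measure \<open>S \<mapsto> \<langle>E(S)\<xi>, \<xi>\<rangle> = \<parallel>E(S)\<xi>\<parallel>\<^sup>2\<close>.\<close>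

definition scalar_measure :: "(real set \<Rightarrow> 'h::complex_hilbert_space bop) \<Rightarrow> 'h \<Rightarrow> real measure" where
  "scalar_measure E \<xi> = measure_of UNIV (sets borel) (\<lambda>S. ennreal ((norm (E S \<xi>))\<^sup>2))"

text \<open>\<open>a = \<integral> \<lambda> dE(\<lambda>)\<close>: the domain of \<open>a\<close> is that of the spectral integral, and on it the
  quadratic forms agree, which by polarization determines the operator.\<close>

definition is_spectral_measure ::
    "'h::complex_hilbert_space uop \<Rightarrow> (real set \<Rightarrow> 'h bop) \<Rightarrow> bool" where
  "is_spectral_measure a E \<longleftrightarrow>
     projection_valued_measure E \<and>
     Domain a = {\<xi>. (\<integral>\<^sup>+ s. ennreal (s\<^sup>2) \<partial>scalar_measure E \<xi>) < \<infinity>} \<and>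
     (\<forall>(\<xi>, \<eta>)\<in>a. cinner \<eta> \<xi> = complex_of_real (LINT s|scalar_measure E \<xi>. s))"

definition spectral_measure :: "'h::complex_hilbert_space uop \<Rightarrow> real set \<Rightarrow> 'h bop" where
  "spectral_measure a = (THE E. is_spectral_measure a E)"


section \<open>Measurable operators and the measure topology\<close>

definition affiliated :: "'h::complex_hilbert_space bop set \<Rightarrow> 'h uop \<Rightarrow> bool" where
  "affiliated M x \<longleftrightarrow> (\<forall>u\<in>commutant M. x O graph_of u \<subseteq> graph_of u O x)"

definition measurable_ops ::
    "'h::complex_hilbert_space bop set \<Rightarrow> ('h bop \<Rightarrow> ennreal) \<Rightarrow> 'h uop set" where
  "measurable_ops M \<tau> = {x. closed_densely_defined x \<and> affiliated M x \<and>
     (\<forall>\<epsilon>>0. \<exists>P\<in>M. is_projection P \<and> range (blinfun_apply P) \<subseteq> Domain x \<and>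
        \<tau> (id_blinfun - P) < ennreal \<epsilon> \<and> (\<exists>B\<in>M. graph_of P O x = graph_of B))}"

text \<open>Strong operations: the closure of the algebraic ones.\<close>

definition strong_add :: "'h::complex_hilbert_space uop \<Rightarrow> 'h uop \<Rightarrow> 'h uop" where
  "strong_add x y = closure {(\<xi>, \<eta> + \<zeta>) | \<xi> \<eta> \<zeta>. (\<xi>, \<eta>) \<in> x \<and> (\<xi>, \<zeta>) \<in> y}"

definition strong_scale :: "complex \<Rightarrow> 'h::complex_hilbert_space uop \<Rightarrow> 'h uop" where
  "strong_scale c x = closure {(\<xi>, c *\<^sub>C \<eta>) | \<xi> \<eta>. (\<xi>, \<eta>) \<in> x}"

definition strong_diff :: "'h::complex_hilbert_space uop \<Rightarrow> 'h uop \<Rightarrow> 'h uop" where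
  "strong_diff x y = strong_add x (strong_scale (-1) y)"

text \<open>The singular value function \<open>t \<mapsto> \<mu>\<^sub>t(x)\<close>; it may be infinite at \<open>t = 0\<close>.\<close>

definition singular_value ::
    "('h::complex_hilbert_space bop \<Rightarrow> ennreal) \<Rightarrow> 'h uop \<Rightarrow> real \<Rightarrow> ennreal" where
  "singular_value \<tau> x t =
     Inf {ennreal s | s. 0 \<le> s \<and> \<tau> (spectral_measure (uabs x) {s<..}) \<le> ennreal t}"

text \<open>The two metrics below are set to zero off their carriers because the locale
  \<^locale>\<open>Metric_space\<close> asks for nonnegativity and symmetry on the whole type.\<close>

definition measure_dist ::
    "'h::complex_hilbert_space bop set \<Rightarrow> ('h bop \<Rightarrow> ennreal) \<Rightarrow> 'h uop \<Rightarrow> 'h uop \<Rightarrow> real" where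
  "measure_dist M \<tau> x y =
     (if x \<in> measurable_ops M \<tau> \<and> y \<in> measurable_ops M \<tau>
      then Inf {t. 0 \<le> t \<and> singular_value \<tau> (strong_diff x y) t \<le> ennreal t} else 0)"

definition measure_topology ::
    "'h::complex_hilbert_space bop set \<Rightarrow> ('h bop \<Rightarrow> ennreal) \<Rightarrow> 'h uop topology" where
  "measure_topology M \<tau> = Metric_space.mtopology (measurable_ops M \<tau>) (measure_dist M \<tau>)"


section \<open>Non-commutative \<open>L\<^sup>p\<close>-spaces\<close>

text \<open>\<^const>\<open>enn2real\<close> is harmless: for a measurable operator \<open>\<mu>\<^sub>t\<close> is finite for all \<open>t > 0\<close>.\<close>

definition Lp_space ::
    "'h::complex_hilbert_space bop set \<Rightarrow> ('h bop \<Rightarrow> ennreal) \<Rightarrow> real \<Rightarrow> 'h uop set" where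
  "Lp_space M \<tau> p = {x \<in> measurable_ops M \<tau>.
     set_integrable lborel {0..} (\<lambda>t. enn2real (singular_value \<tau> x t) powr p)}"

definition Lp_norm :: "('h::complex_hilbert_space bop \<Rightarrow> ennreal) \<Rightarrow> real \<Rightarrow> 'h uop \<Rightarrow> real" where
  "Lp_norm \<tau> p x = (LINT t:{0..}|lborel. enn2real (singular_value \<tau> x t) powr p) powr (1 / p)"

definition Lp_dist ::
    "'h::complex_hilbert_space bop set \<Rightarrow> ('h bop \<Rightarrow> ennreal) \<Rightarrow> real \<Rightarrow> 'h uop \<Rightarrow> 'h uop \<Rightarrow> real" where
  "Lp_dist M \<tau> p x y =
     (if x \<in> Lp_space M \<tau> p \<and> y \<in> Lp_space M \<tau> p then Lp_norm \<tau> p (strong_diff x y) else 0)"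

definition Lp_topology ::
    "'h::complex_hilbert_space bop set \<Rightarrow> ('h bop \<Rightarrow> ennreal) \<Rightarrow> real \<Rightarrow> 'h uop topology" where
  "Lp_topology M \<tau> p = Metric_space.mtopology (Lp_space M \<tau> p) (Lp_dist M \<tau> p)"

text \<open>The zero operator has graph \<open>H \<times> {0}\<close>.\<close>

definition Lp_subspace ::
    "'h::complex_hilbert_space bop set \<Rightarrow> ('h bop \<Rightarrow> ennreal) \<Rightarrow> real \<Rightarrow> 'h uop set \<Rightarrow> bool" where
  "Lp_subspace M \<tau> p X \<longleftrightarrow>
     X \<subseteq> Lp_space M \<tau> p \<and> UNIV \<times> {0} \<in> X \<and>
     (\<forall>x\<in>X. \<forall>y\<in>X. strong_add x y \<in> X) \<and> (\<forall>c. \<forall>x\<in>X. strong_scale c x \<in> X)"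

definition strongly_embedded ::
    "'h::complex_hilbert_space bop set \<Rightarrow> ('h bop \<Rightarrow> ennreal) \<Rightarrow> real \<Rightarrow> 'h uop set \<Rightarrow> bool" where
  "strongly_embedded M \<tau> p X \<longleftrightarrow>
     subtopology (Lp_topology M \<tau> p) X = subtopology (measure_topology M \<tau>) X"


section \<open>Copies of \<open>\<ell>\<^sup>p\<close>\<close>

definition seq_lp :: "real \<Rightarrow> (nat \<Rightarrow> complex) set" where
  "seq_lp p = {a. summable (\<lambda>n. cmod (a n) powr p)}"

definition seq_norm :: "real \<Rightarrow> (nat \<Rightarrow> complex) \<Rightarrow> real" where
  "seq_norm p a = (\<Sum>n. cmod (a n) powr p) powr (1 / p)"

definition lp_linear ::
    "real \<Rightarrow> ((nat \<Rightarrow> complex) \<Rightarrow> 'h::complex_hilbert_space uop) \<Rightarrow> bool" where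
  "lp_linear p T \<longleftrightarrow>
     (\<forall>a\<in>seq_lp p. \<forall>b\<in>seq_lp p. T (\<lambda>n. a n + b n) = strong_add (T a) (T b)) \<and>
     (\<forall>c. \<forall>a\<in>seq_lp p. T (\<lambda>n. c * a n) = strong_scale c (T a))"

text \<open>The norm of a map on \<open>V\<close>, infinite if the map is unbounded on the unit ball of \<open>V\<close>;
  \<open>f\<close> and \<open>g\<close> are the norms on its domain and codomain.\<close>

definition op_norm :: "'a set \<Rightarrow> ('a \<Rightarrow> real) \<Rightarrow> ('b \<Rightarrow> real) \<Rightarrow> ('a \<Rightarrow> 'b) \<Rightarrow> ennreal" where
  "op_norm V f g T = (SUP v\<in>{v\<in>V. f v \<le> 1}. ennreal (g (T v)))"

text \<open>Neither norm in the product vanishes, so the product is finite only if both \<open>T\<close> and its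
  inverse are bounded.\<close>

definition contains_almost_isometric_lp ::
    "('h::complex_hilbert_space bop \<Rightarrow> ennreal) \<Rightarrow> real \<Rightarrow> 'h uop set \<Rightarrow> bool" where
  "contains_almost_isometric_lp \<tau> p X \<longleftrightarrow>
     (\<forall>\<epsilon>>0. \<exists>T. lp_linear p T \<and> inj_on T (seq_lp p) \<and> T ` seq_lp p \<subseteq> X \<and>
        op_norm (seq_lp p) (seq_norm p) (Lp_norm \<tau> p) T *
        op_norm (T ` seq_lp p) (Lp_norm \<tau> p) (seq_norm p) (inv_into (seq_lp p) T)
          \<le> ennreal (1 + \<epsilon>))"

end

(*
  For a closed operator x the resolvent-type operators (1 + x*x)^(-1) and x(1 + x*x)^(-1) come from
  the projection onto the graph of x; they are bounded, and the whole spectral theory of |x| is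
  read off from them. A distribution function s -> tau(e^{|x|}(s, oo)) then replaces the singular
  value function throughout.

  If X is not strongly embedded, it contains vectors z of norm one with tau(e^{|z|}(s, oo)) as small
  as desired for s as small as desired. A gliding hump, carried out on the left and on the right
  supports simultaneously, makes a sequence of such vectors a small perturbation of a sequence of
  bounded operators with pairwise orthogonal left and pairwise orthogonal right supports. The p-th
  power of the norm is additive on the latter, so it spans an isometric copy of l^p.

  Minkowski's inequality comes from the trace: tau((|x| - c)^+) is the supremum of
  Re tau(v* x) - c tau(f) over finite projections f and contractions v supported on f, which makes
  it subadditive jointly in x and c; the p-th power of the norm is an average of these quantities.
*)

theory Submission
  imports Defs "HOL-Probability.Distribution_Functions"
begin

text \<open>\<open>uabs\<close> and \<open>spectral_measure\<close> are definite descriptions, so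
  the square root and the spectral measure must be shown unique as well as existent. Unbounded
  functional calculus is avoided: with C = (1 + |x|^2)^(-1/2) and D = |x| C, two commuting bounded
  contractions, a bound |x| <= s becomes the sign of D - s C, and every graph vector is (C u, Z u)
  with |Z u| = |D u|. All this happens over the real Hilbert space; complex linearity is commutation
  with multiplication by i. Comparison of traces rests on one lemma,
  \<open>trace_le_of_injective\<close>, instead of polar decomposition. The trace may be infinite,
  so projections of arbitrarily small trace take the place of null sets: measurable operators
  agreeing off them are equal. A genuine triangle inequality is called for because
  \<open>Lp_topology\<close> is defined through \<open>Metric_space\<close>; the easy estimate with
  factor 2^p serves only for perturbation errors. The working gauge is \<open>Phi\<close>, the p-th
  power of the norm.\<close>

lemmas blin_simps = blinfun.bilinear_simps

notation blinfun_compose (infixl "oL" 55)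

abbreviation seq_lim :: "(nat \<Rightarrow> 'a::topological_space) \<Rightarrow> 'a \<Rightarrow> bool" ("((_)/ ----> (_))" [60, 60] 60) where
 "X ----> l \<equiv> X \<longlonglongrightarrow> l"

instance complex_hilbert_space \<subseteq> banach ..

section \<open>Orthogonal projections\<close>

text \<open>Stated for real inner product spaces and not for the complex class because it is also
  applied to H x H, where graphs of closed operators are the subspaces. A minimizing sequence is
  Cauchy by the parallelogram law at midpoints, which lie in S.\<close>

lemma orthogonal_decomposition_exists:
 fixes S :: "'a::{real_inner,complete_space} set"
 assumes S: "subspace S" "closed S"
 shows "EX p:S. ALL y:S. inner (x - p) y = 0"
proof -
 define d where "d = Inf ((%y. (norm (x - y))^2) ` S)"
 have ne: "S ~= {}" using S(1) subspace_0 by blast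
 have bdd: "bdd_below ((%y. (norm (x - y))^2) ` S)" by(rule bdd_belowI[of _ 0]) auto
 have dle: "d <= (norm (x - y))^2" if "y : S" for y
  unfolding d_def using bdd that by(simp add: cInf_lower)
 have "EX y:S. (norm (x - y))^2 < d + 1 / real (Suc n)" for n
  using cInf_lessD[of "(%y. (norm (x - y))^2) ` S" "d + 1 / real (Suc n)"] ne
  by(auto simp: d_def)
 then obtain y where y: "!!n. y n : S" "!!n. (norm (x - y n))^2 < d + 1 / real (Suc n)"
  by metis
 have par: "(dist (y m) (y n))^2 <= 2 / real (Suc m) + 2 / real (Suc n)" for m n
 proof -
  have mid: "(1/2) *\<^sub>R (y m + y n) : S" using S(1) y(1) by(simp add: subspace_add subspace_scale)
  have "(norm (y m - y n))^2 = 2 * (norm (x - y m))^2 + 2 * (norm (x - y n))^2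
    - 4 * (norm (x - (1/2) *\<^sub>R (y m + y n)))^2"
   unfolding power2_norm_eq_inner by(simp add: algebra_simps inner_commute)
  thus ?thesis
   using dle[OF mid] y(2)[of m] y(2)[of n] by(simp add: dist_norm)
 qed
 have "Cauchy y"
 proof (rule metric_CauchyI)
  fix e :: real assume "e > 0"
  then obtain N where N: "1 / real (Suc N) < e^2 / 4"
   using reals_Archimedean[of "e^2/4"] by(auto simp: inverse_eq_divide)
  have "dist (y m) (y n) < e" if "m >= N" "n >= N" for m n
  proof -
   have "1 / real (Suc m) <= 1 / real (Suc N)" "1 / real (Suc n) <= 1 / real (Suc N)"
    using that by(simp_all add: frac_le)
   hence "(dist (y m) (y n))^2 < e^2" using par[of m n] N by linarith
   thus ?thesis using `e > 0` by(simp add: power2_less_imp_less)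
  qed
  thus "EX M. ALL m>=M. ALL n>=M. dist (y m) (y n) < e" by blast
 qed
 then obtain p where p: "y ----> p" using Cauchy_convergent convergent_def by blast
 have pS: "p : S" using S(2) y(1) p closed_sequentially by blast
 have "(%n. (norm (x - y n))^2) ----> (norm (x - p))^2" by(intro tendsto_intros p)
 moreover have "(%n. d + 1 / real (Suc n)) ----> d + 0"
  by(intro tendsto_intros LIMSEQ_Suc lim_1_over_n)
 ultimately have "(norm (x - p))^2 <= d + 0"
  by(rule LIMSEQ_le) (use y(2) less_imp_le in blast)
 hence min: "(norm (x - p))^2 <= (norm (x - z))^2" if "z : S" for z
  using order_trans[OF _ dle[OF that]] by(metis add_0_right)
 have "inner (x - p) z = 0" if z: "z : S" for z
 proof (rule ccontr)
  assume nz: "inner (x - p) z ~= 0"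
  hence zz: "inner z z > 0" by auto
  \<comment> \<open>The step along z that minimizes the distance; it strictly improves on p unless
    the inner product vanishes.\<close>
  define t where "t = inner (x - p) z / inner z z"
  have "p + t *\<^sub>R z : S" using S(1) pS z by(simp add: subspace_add subspace_scale)
  from min[OF this] have "(norm (x - p))^2 <= (norm ((x - p) - t *\<^sub>R z))^2"
   by(simp add: algebra_simps)
  also have "... = (norm (x - p))^2 - 2 * t * inner (x - p) z + t^2 * inner z z"
   unfolding power2_norm_eq_inner
   by(simp add: inner_diff_left inner_diff_right power2_eq_square algebra_simps inner_commute)
  also have "... = (norm (x - p))^2 - (inner (x - p) z)^2 / inner z z"
   using zz by(simp add: t_def power2_eq_square field_simps)
  finally show False using nz zz by(simp add: field_simps)
 qed
 thus ?thesis using pS by blast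
qed

definition oproj :: "'a::{real_inner,complete_space} set => 'a => 'a" where
 "oproj S x = (SOME p. p : S & (ALL y:S. inner (x - p) y = 0))"

context
 fixes S :: "'a::{real_inner,complete_space} set"
 assumes S: "subspace S" "closed S"
begin

lemma oproj_in: "oproj S x : S" and oproj_orth: "y : S ==> inner (x - oproj S x) y = 0"
 using someI_ex[of "%p. p : S & (ALL y:S. inner (x - p) y = 0)"]
  orthogonal_decomposition_exists[OF S, of x]
 unfolding oproj_def by blast+

lemma oproj_eqI:
 assumes "p : S" "!!y. y : S ==> inner (x - p) y = 0"
 shows "oproj S x = p"
proof -
 have d: "oproj S x - p : S" using assms(1) oproj_in S(1) by(simp add: subspace_diff)
 have "inner (oproj S x - p) (oproj S x - p) = inner (x - p) (oproj S x - p) - inner (x - oproj S x) (oproj S x - p)"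
  by(simp add: inner_diff_left)
 also have "... = 0" using assms(2)[OF d] oproj_orth[OF d] by simp
 finally show ?thesis by simp
qed

lemma oproj_fix: "x : S ==> oproj S x = x"
 by(rule oproj_eqI) auto

lemma norm_oproj_le: "norm (oproj S x) <= norm x"
proof -
 have "(norm x)^2 = (norm (x - oproj S x))^2 + (norm (oproj S x))^2"
  using oproj_orth[OF oproj_in, of x x] unfolding power2_norm_eq_inner
  by(simp add: inner_diff_left inner_diff_right inner_commute)
 thus ?thesis by(simp add: power2_le_imp_le)
qed

lemma bounded_linear_oproj: "bounded_linear (oproj S)"
proof (rule bounded_linear_intro[where K = 1])
 fix x y :: 'a and r :: real
 show "oproj S (x + y) = oproj S x + oproj S y"
  by(rule oproj_eqI) (use S(1) oproj_in oproj_orth[of _ x] oproj_orth[of _ y] in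
   "auto simp: subspace_add inner_diff_left inner_add_left")
 show "oproj S (r *\<^sub>R x) = r *\<^sub>R oproj S x"
  by(rule oproj_eqI) (use S(1) oproj_in oproj_orth[of _ x] in
   "auto simp: subspace_scale inner_diff_left right_diff_distrib[symmetric]")
qed (use norm_oproj_le in simp)

end

definition Proj :: "'a::{real_inner,complete_space} set => 'a bop" where
 "Proj S = Blinfun (oproj S)"

lemma Proj_apply: "subspace S ==> closed S ==> blinfun_apply (Proj S) = oproj S"
 by(simp add: Proj_def bounded_linear_Blinfun_apply bounded_linear_oproj)


section \<open>Symmetric and positive operators\<close>

definition symm :: "('a::real_inner bop) => bool" where
 "symm A \<longleftrightarrow> (ALL v w. inner (A v) w = inner v (A w))"

text \<open>Over the reals a nonnegative quadratic form does not force symmetry, hence the conjunct.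
  For complex-linear operators it does, see \<open>positive_op_iff\<close>.\<close>

definition psd :: "('a::real_inner bop) => bool" where
 "psd A \<longleftrightarrow> symm A & (ALL v. 0 <= inner (A v) v)"

definition commutes :: "('a::real_inner bop) => ('a bop) => bool" where
 "commutes A B \<longleftrightarrow> A oL B = B oL A"

definition orth_projection :: "('a::real_inner bop) => bool" where
 "orth_projection P \<longleftrightarrow> symm P & P oL P = P"

lemma commutesD: "commutes A B ==> A (B v) = B (A v)"
 for A B :: "'a::real_inner bop"
 unfolding commutes_def by(metis blinfun_apply_blinfun_compose)

lemma commutes_iff: "commutes A B \<longleftrightarrow> (ALL v. A (B v) = B (A v))"
 for A B :: "'a::real_inner bop"
 unfolding commutes_def by(metis blinfun_apply_blinfun_compose blinfun_eqI)

lemma commutesI: "(!!v. A (B v) = B (A v)) ==> commutes A B"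
 for A B :: "'a::real_inner bop"
 unfolding commutes_def by(intro blinfun_eqI) simp

lemma commutes_sym: "commutes A B ==> commutes B A"
 by(simp add: commutes_def)

lemma symmD: "symm A ==> inner (A v) w = inner v (A w)"
 for A :: "'a::real_inner bop"
 by(simp add: symm_def)

lemma psd_symm: "psd A ==> symm A" and psdD: "psd A ==> 0 <= inner (A v) v"
 for A :: "'a::real_inner bop"
 by(simp_all add: psd_def)

lemma commutes_id [simp]: "commutes A id_blinfun" "commutes id_blinfun A"
 by(auto intro!: commutesI)

lemma commutes_self [simp]: "commutes A A"
 by(simp add: commutes_def)

lemma commutes_add: "commutes A B ==> commutes A B' ==> commutes A (B + B')"
 by(simp add: commutes_iff blin_simps)

lemma commutes_diff: "commutes A B ==> commutes A B' ==> commutes A (B - B')"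
 by(simp add: commutes_iff blin_simps)

lemma commutes_scale: "commutes A B ==> commutes A (c *\<^sub>R B)"
 by(simp add: commutes_iff blin_simps)

lemma commutes_compose: "commutes A B ==> commutes A B' ==> commutes A (B oL B')"
 by(simp add: commutes_iff)

lemma commutes_minus: "commutes A B ==> commutes A (- B)"
 by(simp add: commutes_iff blin_simps)

lemma symm_id [simp]: "symm id_blinfun"
 by(simp add: symm_def)

lemma symm_add: "symm A ==> symm B ==> symm (A + B)"
 by(simp add: symm_def blin_simps inner_add_left inner_add_right)

lemma symm_diff: "symm A ==> symm B ==> symm (A - B)"
 by(simp add: symm_def blin_simps inner_diff_left inner_diff_right)

lemma symm_scale: "symm A ==> symm (c *\<^sub>R A)"
 by(simp add: symm_def blin_simps)

lemma symm_compose: "symm A ==> symm B ==> commutes A B ==> symm (A oL B)"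
 unfolding symm_def by(metis blinfun_apply_blinfun_compose commutesD)

lemma symm_limit:
 assumes "!!n. symm (A n)" "A ----> B"
 shows "symm B"
 unfolding symm_def
proof (intro allI)
 fix v w
 have "(%n. inner (A n v) w) ----> inner (B v) w" "(%n. inner v (A n w)) ----> inner v (B w)"
  by(intro tendsto_intros blinfun.tendsto assms)+
 moreover have "(%n. inner (A n v) w) = (%n. inner v (A n w))"
  using assms(1) by(auto simp: symm_def)
 ultimately show "inner (B v) w = inner v (B w)" using LIMSEQ_unique by metis
qed

lemma commutes_limit:
 assumes "!!n. commutes U (A n)" "A ----> B"
 shows "commutes U B"
proof (rule commutesI)
 fix v
 have "(%n. U (A n v)) ----> U (B v)" "(%n. A n (U v)) ----> B (U v)"
  by(intro tendsto_intros blinfun.tendsto assms)+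
 moreover have "(%n. U (A n v)) = (%n. A n (U v))"
  using assms(1) by(auto dest: commutesD)
 ultimately show "U (B v) = B (U v)" using LIMSEQ_unique by metis
qed

lemma psd_square: "symm A ==> psd (A oL A)"
 by(simp add: psd_def symm_compose) (metis inner_ge_zero symmD)

lemma psd_id [simp]: "psd id_blinfun"
 by(simp add: psd_def)

lemma psd_add: "psd A ==> psd B ==> psd (A + B)"
 by(auto simp: psd_def symm_add blin_simps inner_add_left)

lemma psd_scale: "psd A ==> 0 <= c ==> psd (c *\<^sub>R A)"
 by(auto simp: psd_def symm_scale blin_simps)

lemma psd_Cauchy_Schwarz:
 fixes A :: "'a::real_inner bop"
 assumes "psd A"
 shows "(inner (A v) w)^2 <= inner (A v) v * inner (A w) w"
proof -
 let ?a = "inner (A v) v" and ?b = "inner (A v) w" and ?c = "inner (A w) w"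
 have sym: "inner (A w) v = ?b"
  using assms by(metis inner_commute psd_symm symmD)
 have q: "0 <= ?a * t^2 + 2 * t * ?b + ?c" for t
 proof -
  have "0 <= inner (A (t *\<^sub>R v + w)) (t *\<^sub>R v + w)" by(rule psdD[OF assms])
  also have "... = ?a * t^2 + 2 * t * ?b + ?c"
   using sym by(simp add: blin_simps inner_add_left inner_add_right power2_eq_square algebra_simps)
  finally show ?thesis .
 qed
 show ?thesis
 proof (cases "?a = 0")
  case True
  have "?b = 0"
  proof (rule ccontr)
   assume "?b ~= 0"
   \<comment> \<open>The form is affine in t here, and this t gives it the value -1.\<close>
   thus False using q[of "- (?c + 1) / (2 * ?b)"] True by(simp add: field_simps)
  qed
  thus ?thesis using True by simp
 next
  case False
  hence "?a > 0" using psdD[OF assms, of v] by simp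
  thus ?thesis using q[of "- ?b / ?a"] by(simp add: field_simps power2_eq_square)
 qed
qed

lemma psd_zero_vector:
 fixes A :: "'a::real_inner bop"
 assumes "psd A" "inner (A v) v = 0"
 shows "A v = 0"
 using psd_Cauchy_Schwarz[OF assms(1), of v "A v"] assms(2) by simp

text \<open>Cauchy-Schwarz for the form of B, applied to v and B v, bounds |B v|^4 by |v|^2 |B
  v|^2.\<close>

lemma psd_contraction:
 fixes B :: "'a::real_inner bop"
 assumes "psd B" "psd (id_blinfun - B)"
 shows "norm B <= 1"
proof (rule norm_blinfun_bound)
 fix v
 have le: "inner (B w) w <= (norm w)^2" for w
  using psdD[OF assms(2), of w] by(simp add: blin_simps inner_diff_left power2_norm_eq_inner)
 have "(inner (B v) (B v))^2 <= inner (B v) v * inner (B (B v)) (B v)"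
  by(rule psd_Cauchy_Schwarz[OF assms(1)])
 also have "... <= (norm v)^2 * (norm (B v))^2"
  by(intro mult_mono le psdD[OF assms(1)]) auto
 finally have "(norm (B v))^2 * (norm (B v))^2 <= (norm v)^2 * (norm (B v))^2"
  by(simp add: power2_norm_eq_inner) (simp add: power2_eq_square)
 hence "(norm (B v))^2 <= (norm v)^2"
  by(metis mult_le_cancel_right not_le zero_le_power2 power2_eq_square norm_ge_zero zero_less_norm_iff norm_zero mult_zero_left zero_less_power)
 from power2_le_imp_le[OF this norm_ge_zero] show "norm (B v) <= 1 * norm v" by simp
qed simp

lemma psd_one_minus_of_norm_le_1:
 fixes Y :: "'a::real_inner bop"
 assumes "symm Y" "norm Y <= 1"
 shows "psd (id_blinfun - Y)"
proof -
 have "inner (Y v) v <= inner v v" for v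
 proof -
  have "inner (Y v) v <= norm (Y v) * norm v" by(rule norm_cauchy_schwarz)
  also have "... <= (norm Y * norm v) * norm v" by(intro mult_right_mono norm_blinfun) auto
  also have "... <= (1 * norm v) * norm v" by(intro mult_right_mono assms) auto
  finally show ?thesis by(simp add: norm_eq_sqrt_inner)
 qed
 thus ?thesis using assms(1) by(simp add: psd_def symm_diff blin_simps inner_diff_left)
qed

subsection \<open>Square roots\<close>

text \<open>The iteration \<open>Y \<mapsto> (B + Y\<^sup>2)/2\<close> is dominated by its scalar version at \<open>1\<close>; its limit
 solves \<open>(1 - Y)\<^sup>2 = 1 - B\<close>.\<close>

primrec sqrt_iter :: "('a::real_normed_vector bop) => nat => ('a bop)" where
 "sqrt_iter B 0 = 0"
| "sqrt_iter B (Suc n) = (1/2) *\<^sub>R (B + (sqrt_iter B n oL sqrt_iter B n))"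

primrec sqrt_bound :: "nat => real" where
 "sqrt_bound 0 = 0"
| "sqrt_bound (Suc n) = (1 + (sqrt_bound n)^2) / 2"

lemma sqrt_bound_01: "0 <= sqrt_bound n & sqrt_bound n <= 1"
proof (induction n)
 case (Suc n)
 hence "(sqrt_bound n)^2 <= 1" by(simp add: power_le_one)
 thus ?case by simp
qed simp

lemma sqrt_bound_Suc_ge: "sqrt_bound n <= sqrt_bound (Suc n)"
proof -
 have "0 <= (1 - sqrt_bound n)^2" by simp
 thus ?thesis by(simp add: power2_eq_square algebra_simps)
qed

lemma commutes_sqrt_iter: "commutes U B ==> commutes U (sqrt_iter B n)"
 by(induction n) (simp_all add: commutes_scale commutes_add commutes_compose commutes_iff[of U 0] blin_simps)

lemma symm_sqrt_iter: "symm B ==> symm (sqrt_iter B n)"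
 by(induction n) (auto intro!: symm_scale symm_add symm_compose simp: symm_def[of 0])

lemma norm_sqrt_iter: "norm B <= 1 ==> norm (sqrt_iter B n) <= sqrt_bound n"
proof (induction n)
 case (Suc n)
 have "norm (sqrt_iter B n oL sqrt_iter B n) <= norm (sqrt_iter B n) * norm (sqrt_iter B n)"
  by(rule norm_blinfun_compose)
 also have "... <= (sqrt_bound n)^2"
  using Suc sqrt_bound_01 by(auto simp: power2_eq_square intro!: mult_mono)
 finally have "norm (B + (sqrt_iter B n oL sqrt_iter B n)) <= 1 + (sqrt_bound n)^2"
  using norm_triangle_ineq[of B "sqrt_iter B n oL sqrt_iter B n"] Suc.prems by linarith
 thus ?case by simp
qed simp

text \<open>Successive iterates commute, so the difference of their squares factors and is dominated
  by the scalar iteration. Convergence then follows from that of a bounded monotone real sequence,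
  whose limit is never computed.\<close>

lemma norm_sqrt_iter_diff:
 fixes B :: "'a::real_inner bop"
 assumes "norm B <= 1"
 shows "norm (sqrt_iter B (Suc n) - sqrt_iter B n) <= sqrt_bound (Suc n) - sqrt_bound n"
proof (induction n)
 case 0 thus ?case using assms by simp
next
 case (Suc n)
 let ?Y = "sqrt_iter B (Suc n)" and ?X = "sqrt_iter B n"
 \<comment> \<open>Each iterate commutes with everything that commutes with B, in particular with B
   itself and hence with the other iterate.\<close>
 have comm: "commutes ?X ?Y"
  by(rule commutes_sqrt_iter, rule commutes_sym, rule commutes_sqrt_iter) simp
 have "sqrt_iter B (Suc (Suc n)) - ?Y = (1/2) *\<^sub>R ((?Y + ?X) oL (?Y - ?X))"
 proof (rule blinfun_eqI)
  fix v
  have "(sqrt_iter B (Suc (Suc n)) - ?Y) v = (1/2) *\<^sub>R (?Y (?Y v) - ?X (?X v))"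
   by(simp add: blin_simps del: sqrt_iter.simps
     add: sqrt_iter.simps(2)[of B "Suc n"])
    (simp add: sqrt_iter.simps(2)[of B n] blin_simps scaleR_right_diff_distrib[symmetric])
  also have "... = ((1/2) *\<^sub>R ((?Y + ?X) oL (?Y - ?X))) v"
   using commutesD[OF comm, of v] by(simp add: blin_simps del: sqrt_iter.simps)
  finally show "(sqrt_iter B (Suc (Suc n)) - ?Y) v = ((1/2) *\<^sub>R ((?Y + ?X) oL (?Y - ?X))) v" .
 qed
 hence "norm (sqrt_iter B (Suc (Suc n)) - ?Y) = (1/2) * norm ((?Y + ?X) oL (?Y - ?X))"
  by simp
 also have "norm ((?Y + ?X) oL (?Y - ?X)) <= norm (?Y + ?X) * norm (?Y - ?X)"
  by(rule norm_blinfun_compose)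
 also have "... <= (sqrt_bound (Suc n) + sqrt_bound n) * (sqrt_bound (Suc n) - sqrt_bound n)"
  using norm_triangle_ineq[of ?Y ?X] norm_sqrt_iter[OF assms, of "Suc n"] norm_sqrt_iter[OF assms, of n]
   Suc sqrt_bound_01
  by(intro mult_mono) (auto simp del: sqrt_iter.simps sqrt_bound.simps intro: add_nonneg_nonneg)
 also have "(1/2) * ... = sqrt_bound (Suc (Suc n)) - sqrt_bound (Suc n)"
  by(simp add: sqrt_bound.simps(2)[of "Suc n"] power2_eq_square algebra_simps del: sqrt_bound.simps)
   (simp add: power2_eq_square algebra_simps)
 finally show ?case by simp
qed

lemma sqrt_exists_contraction:
 fixes A :: "'a::{real_inner,banach} bop"
 assumes "symm A" "norm (id_blinfun - A) <= 1"
 shows "EX S. psd S & S oL S = A & (ALL U. commutes U A --> commutes U S)"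
proof -
 define B where "B = id_blinfun - A"
 have nB: "norm B <= 1" and sB: "symm B" using assms by(auto simp: B_def symm_diff)
 have diff: "norm (sqrt_iter B (n + k) - sqrt_iter B n) <= sqrt_bound (n + k) - sqrt_bound n" for n k
 proof (induction k)
  case (Suc k)
  thus ?case using norm_sqrt_iter_diff[OF nB, of "n + k"]
    norm_triangle_ineq[of "sqrt_iter B (n + Suc k) - sqrt_iter B (n + k)" "sqrt_iter B (n + k) - sqrt_iter B n"]
   by simp
 qed simp
 have "incseq sqrt_bound" using sqrt_bound_Suc_ge by(rule incseq_SucI)
 hence "convergent sqrt_bound"
  using Bseq_mono_convergent[of sqrt_bound] sqrt_bound_01
  by(metis BseqI' abs_of_nonneg incseq_def real_norm_def)
 hence Cb: "Cauchy sqrt_bound" by(rule convergent_Cauchy)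
 have "Cauchy (sqrt_iter B)"
 proof (rule CauchyI')
  fix e :: real assume "0 < e"
  then obtain N where N: "!!m n. m >= N ==> n >= N ==> norm (sqrt_bound m - sqrt_bound n) < e"
   using CauchyD[OF Cb] by blast
  have "dist (sqrt_iter B m) (sqrt_iter B n) < e" if "m >= N" "n > m" for m n
  proof -
   have "norm (sqrt_iter B n - sqrt_iter B m) <= sqrt_bound n - sqrt_bound m"
    using diff[of m "n - m"] that by simp
   also have "... < e" using N[of n m] that by simp
   finally show ?thesis by(simp add: dist_norm norm_minus_commute)
  qed
  thus "EX M. ALL m>=M. ALL n>m. dist (sqrt_iter B m) (sqrt_iter B n) < e" by blast
 qed
 then obtain Y where Y: "sqrt_iter B ----> Y" using Cauchy_convergent convergent_def by blast
 have sY: "symm Y" by(rule symm_limit[OF symm_sqrt_iter[OF sB] Y])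
 have "norm (sqrt_iter B n) <= 1" for n using norm_sqrt_iter[OF nB, of n] sqrt_bound_01[of n] by linarith
 hence nY: "norm Y <= 1" using Y by(intro Lim_norm_ubound[OF _ Y]) auto
 have "(%n. sqrt_iter B (Suc n)) ----> (1/2) *\<^sub>R (B + (Y oL Y))"
  unfolding sqrt_iter.simps
  by(intro tendsto_intros bounded_bilinear.tendsto[OF bounded_bilinear_blinfun_compose] Y)
 hence eq: "Y = (1/2) *\<^sub>R (B + (Y oL Y))" using LIMSEQ_Suc[OF Y] LIMSEQ_unique by blast
 have "(id_blinfun - Y) oL (id_blinfun - Y) = A"
 proof (rule blinfun_eqI)
  fix v
  have "2 *\<^sub>R Y v = v - A v + Y (Y v)"
   using arg_cong[OF eq, of "%T. 2 *\<^sub>R blinfun_apply T v"]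
   by(simp add: blin_simps B_def)
  hence "Y (Y v) = Y v + Y v - v + A v" by(simp add: scaleR_2 algebra_simps)
  thus "((id_blinfun - Y) oL (id_blinfun - Y)) v = A v"
   by(simp add: blin_simps)
 qed
 moreover have "commutes U (id_blinfun - Y)" if "commutes U A" for U
 proof -
  have "commutes U B" using that by(auto simp: B_def intro: commutes_diff)
  hence "commutes U Y" using commutes_limit[OF commutes_sqrt_iter Y] by blast
  thus ?thesis by(auto intro: commutes_diff)
 qed
 ultimately show ?thesis using psd_one_minus_of_norm_le_1[OF sY nY] by blast
qed

lemma sqrt_exists:
 fixes A :: "'a::{real_inner,banach} bop"
 assumes "psd A"
 shows "EX S. psd S & S oL S = A & (ALL U. commutes U A --> commutes U S)"
proof -
 \<comment> \<open>The summand 1 keeps c positive when A = 0.\<close>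
 define c where "c = norm A + 1"
 have c: "c > 0" by(simp add: c_def add_nonneg_pos)
 define A1 where "A1 = (1/c) *\<^sub>R A"
 have p: "psd A1" using assms c by(simp add: A1_def psd_scale)
 have "norm A1 <= 1" using c by(simp add: A1_def c_def)
 hence q: "psd (id_blinfun - A1)" by(rule psd_one_minus_of_norm_le_1[OF psd_symm[OF p]])
 have "norm (id_blinfun - A1) <= 1" by(rule psd_contraction[OF q]) (simp only: diff_diff_eq2 add_diff_cancel_left' p)
 then obtain S where S: "psd S" "S oL S = A1" "ALL U. commutes U A1 --> commutes U S"
  using sqrt_exists_contraction[OF psd_symm[OF p]] by blast
 have "(sqrt c *\<^sub>R S) oL (sqrt c *\<^sub>R S) = A"
 proof (rule blinfun_eqI)
  fix v
  have "S (S v) = A1 v" using S(2) by(metis blinfun_apply_blinfun_compose)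
  thus "((sqrt c *\<^sub>R S) oL (sqrt c *\<^sub>R S)) v = A v"
   using c by(simp add: blin_simps A1_def)
 qed
 moreover have "psd (sqrt c *\<^sub>R S)" using S(1) c by(simp add: psd_scale)
 moreover have "commutes U (sqrt c *\<^sub>R S)" if "commutes U A" for U
  by(rule commutes_scale) (use S(3) commutes_scale[OF that, of "1/c"] in "simp add: A1_def")
 ultimately show ?thesis by(intro exI[of _ "sqrt c *\<^sub>R S"] conjI allI impI)
qed

text \<open>The commutation clause is part of the choice because it is what later puts roots of
  elements of a von Neumann algebra back into the algebra.\<close>

definition op_sqrt :: "('a::{real_inner,banach} bop) => ('a bop)" where
 "op_sqrt A = (SOME S. psd S & S oL S = A & (ALL U. commutes U A --> commutes U S))"

lemma op_sqrt:
 fixes A :: "'a::{real_inner,banach} bop"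
 assumes "psd A"
 shows psd_op_sqrt: "psd (op_sqrt A)" and op_sqrt_square: "op_sqrt A oL op_sqrt A = A"
  and commutes_op_sqrt: "commutes U A ==> commutes U (op_sqrt A)"
proof -
 have *: "psd (op_sqrt A) & op_sqrt A oL op_sqrt A = A & (ALL U. commutes U A --> commutes U (op_sqrt A))"
  unfolding op_sqrt_def by(rule someI_ex[OF sqrt_exists[OF assms]])
 show "psd (op_sqrt A)" using * by simp
 show "op_sqrt A oL op_sqrt A = A" using * by simp
 show "commutes U (op_sqrt A)" if "commutes U A" using * that by simp
qed

lemma op_sqrt_apply: "psd A ==> op_sqrt A (op_sqrt A v) = A v"
 for A :: "'a::{real_inner,banach} bop"
 using arg_cong[OF op_sqrt_square, of A "%T. blinfun_apply T v"] by simp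

lemma op_sqrt_unique:
 fixes S A :: "'a::{real_inner,banach} bop"
 assumes "psd S" "S oL S = A"
 shows "op_sqrt A = S"
proof (rule blinfun_eqI)
 fix v
 have A: "psd A" using assms psd_square psd_symm by blast
 let ?T = "op_sqrt A"
 have "commutes S A" using assms(2) by(metis blinfun_apply_blinfun_compose commutes_iff)
 hence c: "commutes S ?T" by(rule commutes_op_sqrt[OF A])
 have SS: "S (S u) = A u" for u using assms(2) by(metis blinfun_apply_blinfun_compose)
 \<comment> \<open>S commutes with the chosen root T, so (T + S)(T - S) v = T^2 v - S^2 v = 0;
   positivity then makes both forms vanish at w.\<close>
 define w where "w = ?T v - S v"
 have "?T w + S w = 0"
  by(simp add: w_def blin_simps op_sqrt_apply[OF A] SS commutesD[OF c])
 hence "inner (?T w) w + inner (S w) w = 0" by(metis inner_add_left inner_zero_left)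
 hence "inner (?T w) w = 0" "inner (S w) w = 0"
  using psdD[OF psd_op_sqrt[OF A], of w] psdD[OF assms(1), of w] by linarith+
 hence z: "?T w = 0" "S w = 0" using psd_zero_vector psd_op_sqrt[OF A] assms(1) by blast+
 have "inner w w = inner w (?T v) - inner w (S v)"
  by(simp only: w_def inner_diff_right)
 also have "... = inner (?T w) v - inner (S w) v"
  using symmD[OF psd_symm[OF psd_op_sqrt[OF A]]] symmD[OF psd_symm[OF assms(1)]] by simp
 finally have "inner w w = inner (?T w - S w) v" by(simp add: inner_diff_left)
 thus "?T v = S v" using z by(simp add: w_def)
qed

lemma psd_compose:
 fixes A B :: "'a::{real_inner,banach} bop"
 assumes "psd A" "psd B" "commutes A B"
 shows "psd (A oL B)"
 unfolding psd_def
proof (intro conjI allI)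
 show "symm (A oL B)" using assms by(simp add: symm_compose psd_symm)
 fix v
 let ?S = "op_sqrt B"
 have c: "commutes A ?S" using commutes_op_sqrt assms by blast
 have "inner ((A oL B) v) v = inner (A (?S (?S v))) v" by(simp add: op_sqrt_apply[OF assms(2)])
 also have "... = inner (A (?S v)) (?S v)"
  by(simp only: commutesD[OF c] symmD[OF psd_symm[OF psd_op_sqrt[OF assms(2)]]])
 also have "... >= 0" by(rule psdD[OF assms(1)])
 finally show "0 <= inner ((A oL B) v) v" .
qed

text \<open>Locates the zeros of the form of A B: the root of B moves them to zeros of the form of
  A. This supplies the equality cases in \<open>quot_F_unbounded\<close>.\<close>

lemma psd_compose_eq_0:
 fixes A B :: "'a::{real_inner,banach} bop"
 assumes "psd A" "psd B" "commutes A B" "inner (A (B v)) v = 0"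
 shows "inner (A (op_sqrt B v)) (op_sqrt B v) = 0"
proof -
 let ?S = "op_sqrt B"
 have "inner (A (?S v)) (?S v) = inner (?S (A (?S v))) v"
  by(rule symmD[OF psd_symm[OF psd_op_sqrt[OF assms(2)]], symmetric])
 also have "?S (A (?S v)) = A (B v)"
  using commutesD[OF commutes_op_sqrt[OF assms(2,3)], of "?S v"] op_sqrt_apply[OF assms(2)] by simp
 finally show ?thesis using assms(4) by simp
qed

subsection \<open>Inverses\<close>

text \<open>The lower bound makes the range closed; symmetry makes its orthogonal complement the
  kernel, which is trivial.\<close>

lemma symm_bounded_below_invertible:
 fixes A :: "'a::{real_inner,banach} bop"
 assumes "symm A" "c > 0" "!!v. c * norm v <= norm (A v)"
 obtains B :: "'a bop" where "!!v. A (B v) = v" "!!v. B (A v) = v"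
proof -
 have inj: "v = w" if "A v = A w" for v w
  using assms(2) assms(3)[of "v - w"] that by(simp add: blin_simps mult_le_0_iff)
 have "subspace (range A)" by(intro linear_subspace_image bounded_linear.linear blinfun.bounded_linear_right subspace_UNIV)
 moreover have "closed (range A)"
 proof -
  have "complete (range A)"
   by(rule complete_isometric_image[OF assms(2), of UNIV])
    (use assms(3) in "auto simp: mult.commute blinfun.bounded_linear_right complete_UNIV")
  thus ?thesis by(rule complete_imp_closed)
 qed
 ultimately have S: "subspace (range A)" "closed (range A)" .
 have surj: "EX v. A v = w" for w
 proof -
  let ?p = "oproj (range A) w"
  have "inner (A (w - ?p)) u = 0" for u
   using oproj_orth[OF S, of "A u" w] symmD[OF assms(1), of "w - ?p" u] by simp
  hence "A (w - ?p) = 0" using inner_eq_zero_iff by blast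
  hence "w = ?p" using inj[of "w - ?p" 0] by(simp)
  thus ?thesis using oproj_in[OF S, of w] by(metis imageE)
 qed
 define g where "g w = (SOME v. A v = w)" for w
 have Ag: "A (g w) = w" for w unfolding g_def by(rule someI_ex[OF surj])
 have gA: "g (A v) = v" for v by(rule inj) (rule Ag)
 have "bounded_linear g"
 proof (rule bounded_linear_intro[where K = "1/c"])
  show "g (x + y) = g x + g y" for x y by(rule inj) (simp add: Ag blin_simps)
  show "g (r *\<^sub>R x) = r *\<^sub>R g x" for r x by(rule inj) (simp add: Ag blin_simps)
  show "norm (g x) <= norm x * (1 / c)" for x using assms(2) assms(3)[of "g x"] by(simp add: Ag field_simps)
 qed
 thus ?thesis using that[of "Blinfun g"] by(simp add: bounded_linear_Blinfun_apply Ag gA)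
qed

subsection \<open>Adjoints\<close>

lemma Riesz_representation:
 fixes f :: "'a::{real_inner,complete_space} => real"
 assumes "bounded_linear f"
 shows "EX u. ALL v. f v = inner v u"
proof (cases "ALL v. f v = 0")
 case True thus ?thesis by(intro exI[of _ 0]) simp
next
 case False
 then obtain x0 where x0: "f x0 ~= 0" by blast
 interpret f: bounded_linear f by fact
 let ?K = "{v. f v = 0}"
 have K: "subspace ?K" by(auto simp: subspace_def f.add f.scale f.zero)
 have cl: "closed ?K" by(intro closed_Collect_eq continuous_on_const linear_continuous_on assms)
 define z where "z = x0 - oproj ?K x0"
 have fz: "f z ~= 0" using x0 oproj_in[OF K cl, of x0] by(simp add: z_def f.diff)
 hence zz: "inner z z ~= 0" using f.zero by auto
 have "f v = inner v ((f z / inner z z) *\<^sub>R z)" for v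
 proof -
  have "v - (f v / f z) *\<^sub>R z : ?K" using fz by(simp add: f.diff f.scale)
  from oproj_orth[OF K cl this, of x0] have "inner z (v - (f v / f z) *\<^sub>R z) = 0" by(simp add: z_def)
  hence "inner v z = (f v / f z) * inner z z" by(simp add: inner_diff_right inner_commute)
  thus ?thesis using fz zz by(simp add: field_simps)
 qed
 thus ?thesis by blast
qed

lemma inner_ext_right: "(!!y. inner y u = inner y v) ==> u = v"
 using inner_eq_zero_iff[of "u - v"] by(simp add: inner_diff_right)

lemma real_adjoint_exists:
 fixes A :: "'a::{real_inner,complete_space} bop"
 shows "EX B::'a bop. ALL v w. inner (A v) w = inner v (B w)"
proof -
 have "bounded_linear (%v. inner (A v) w)" for w
  by(intro bounded_linear_intros)
 hence "ALL w. EX u. ALL v. inner (A v) w = inner v u" by(intro allI Riesz_representation)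
 then obtain g where g: "!!v w. inner (A v) w = inner v (g w)" by metis
 have "bounded_linear g"
 proof (rule bounded_linear_intro[where K = "norm A"])
  show "g (x + y) = g x + g y" for x y
   by(rule inner_ext_right) (simp add: g[symmetric] inner_add_right)
  show "g (r *\<^sub>R x) = r *\<^sub>R g x" for r x
   by(rule inner_ext_right) (simp add: g[symmetric])
  show "norm (g x) <= norm x * norm A" for x
  proof -
   have "norm (g x) * norm (g x) = inner (A (g x)) x" by(simp add: g norm_eq_sqrt_inner)
   also have "... <= norm (A (g x)) * norm x" by(rule norm_cauchy_schwarz)
   also have "... <= (norm A * norm (g x)) * norm x" by(intro mult_right_mono norm_blinfun) auto
   finally show ?thesis
    by(cases "g x = 0") (auto simp: mult.commute mult.left_commute mult_le_cancel_left)
  qed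
 qed
 thus ?thesis using g by(intro exI[of _ "Blinfun g"]) (simp add: bounded_linear_Blinfun_apply)
qed

text \<open>Adjoint for the real inner product. It agrees with \<open>adj\<close> on complex-linear
  operators, see \<open>adj_eq_radj\<close>.\<close>

definition radj :: "('a::{real_inner,complete_space} bop) => ('a bop)" where
 "radj A = (SOME B. ALL v w. inner (A v) w = inner v (blinfun_apply B w))"

lemma radj: "inner (A v) w = inner v (radj A w)"
 for A :: "'a::{real_inner,complete_space} bop"
 using someI_ex[OF real_adjoint_exists[of A]] unfolding radj_def by blast

lemma radj': "inner v (A w) = inner (radj A v) w"
 for A :: "'a::{real_inner,complete_space} bop"
 by(metis radj inner_commute)

lemma radj_unique:
 fixes A B :: "'a::{real_inner,complete_space} bop"
 assumes "!!v w. inner (A v) w = inner v (blinfun_apply B w)"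
 shows "radj A = B"
 by(rule blinfun_eqI, rule inner_ext_right) (metis assms radj)

lemma radj_radj [simp]: "radj (radj A) = A"
 by(rule radj_unique) (metis radj inner_commute)

lemma symm_radj: "symm A \<longleftrightarrow> radj A = A"
 by(metis radj radj_unique symm_def)

lemma radj_compose: "radj (A oL B) = radj B oL radj A"
 by(rule radj_unique) (simp add: radj)

lemma radj_add: "radj (A + B) = radj A + radj B"
 by(rule radj_unique) (simp add: blin_simps inner_add_left inner_add_right radj)

lemma radj_id [simp]: "radj id_blinfun = id_blinfun"
 by(rule radj_unique) simp

lemma commutes_radj: "commutes U A ==> commutes (radj U) (radj A)"
 unfolding commutes_def by(metis radj_compose)

lemma commutes_radj_symm: "symm A ==> commutes U A ==> commutes (radj U) A"
 by(metis commutes_radj symm_radj)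

subsection \<open>Projections as operators\<close>

lemma orth_projectionD: "orth_projection P ==> P (P v) = P v" "orth_projection P ==> symm P"
 for P :: "'a::real_inner bop"
 unfolding orth_projection_def by(metis blinfun_apply_blinfun_compose, blast)

lemma orth_projectionI: "symm P ==> (!!v. P (P v) = P v) ==> orth_projection P"
 for P :: "'a::real_inner bop"
 unfolding orth_projection_def by(simp add: blinfun_eqI)

lemma orth_projection_inner: "orth_projection P ==> inner (P v) v = (norm (P v))^2"
 for P :: "'a::real_inner bop"
 by(metis orth_projectionD power2_norm_eq_inner symmD)

lemma psd_projection: "orth_projection P ==> psd P"
 by(simp add: psd_def orth_projectionD orth_projection_inner)

lemma orth_projection_compl: "orth_projection P ==> orth_projection (id_blinfun - P)"
 by(rule orth_projectionI) (auto simp: symm_diff orth_projectionD blin_simps)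

lemma orth_projection_id [simp]: "orth_projection id_blinfun"
 by(rule orth_projectionI) auto

lemma orth_projection_zero [simp]: "orth_projection 0"
 by(rule orth_projectionI) (auto simp: symm_def)

lemma orth_projection_pythagoras:
 "orth_projection P ==> (norm v)^2 = (norm (P v))^2 + (norm (v - P v))^2"
 for P :: "'a::real_inner bop"
 using orth_projection_inner[of P v]
 by(simp add: power2_norm_eq_inner inner_diff_left inner_diff_right inner_commute)

lemma norm_orth_projection_le: "orth_projection P ==> norm (P v) <= norm v"
 for P :: "'a::real_inner bop"
 using orth_projection_pythagoras[of P v] by(simp add: power2_le_imp_le)

lemma orth_projection_Proj: "subspace S ==> closed S ==> orth_projection (Proj S)"
proof (rule orth_projectionI)
 assume S: "subspace S" "closed S"
 show "symm (Proj S)"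
  unfolding symm_def
 proof (intro allI)
  fix v w
  have "inner (v - oproj S v) (oproj S w) = 0" "inner (w - oproj S w) (oproj S v) = 0"
   using oproj_orth[OF S] oproj_in[OF S] by blast+
  thus "inner (Proj S v) w = inner v (Proj S w)"
   by(simp add: Proj_apply[OF S] inner_diff_left inner_diff_right inner_commute)
 qed
 show "Proj S (Proj S v) = Proj S v" for v
  using oproj_fix[OF S] oproj_in[OF S] by(simp add: Proj_apply[OF S])
qed

lemma Proj_fix_iff: "subspace S ==> closed S ==> Proj S v = v \<longleftrightarrow> v : S"
 by(metis Proj_apply oproj_fix oproj_in)

lemma Proj_zero_iff: "subspace S ==> closed S ==> Proj S v = 0 \<longleftrightarrow> (ALL w:S. inner v w = 0)"
 by(metis Proj_apply diff_zero oproj_eqI oproj_orth subspace_0)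

lemma subspace_ker: "subspace {v. blinfun_apply P v = 0}"
 by(auto simp: subspace_def blin_simps)

lemma closed_ker: "closed {v. blinfun_apply P v = 0}"
 by(intro closed_Collect_eq continuous_intros)

text \<open>Inclusion of ranges and reverse inclusion of kernels express the same order. The kernel
  form is preferred below because the kernel of a supremum is an intersection of kernels.\<close>

lemma projection_le_iff:
 fixes P Q :: "'a::{real_inner,complete_space} bop"
 assumes "orth_projection P" "orth_projection Q"
 shows "(ALL v. Q v = 0 --> P v = 0) \<longleftrightarrow> P oL Q = P"
  and "(ALL v. P v = v --> Q v = v) \<longleftrightarrow> Q oL P = P"
  and "P oL Q = P \<longleftrightarrow> Q oL P = P"
proof -
 show "(ALL v. Q v = 0 --> P v = 0) \<longleftrightarrow> P oL Q = P"
 proof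
  assume *: "ALL v. Q v = 0 --> P v = 0"
  show "P oL Q = P"
  proof (rule blinfun_eqI)
   fix v
   have "Q (v - Q v) = 0" by(simp add: blin_simps orth_projectionD assms)
   hence "P (v - Q v) = 0" using * by blast
   thus "(P oL Q) v = P v" by(simp add: blin_simps)
  qed
 qed (metis blinfun.zero_right blinfun_apply_blinfun_compose)
 show "(ALL v. P v = v --> Q v = v) \<longleftrightarrow> Q oL P = P"
  by(metis assms(1) blinfun_apply_blinfun_compose blinfun_eqI orth_projectionD(1))
 show "P oL Q = P \<longleftrightarrow> Q oL P = P"
  by(metis assms orth_projectionD(2) radj_compose symm_radj)
qed

lemma projection_eq_iff_ker:
 fixes P Q :: "'a::{real_inner,complete_space} bop"
 assumes "orth_projection P" "orth_projection Q" "!!v. P v = 0 \<longleftrightarrow> Q v = 0"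
 shows "P = Q"
 by(metis assms projection_le_iff(1,3))

lemma projection_eq_iff_norm:
 fixes P Q :: "'a::{real_inner,complete_space} bop"
 assumes "orth_projection P" "orth_projection Q" "!!v. norm (P v) = norm (Q v)"
 shows "P = Q"
 by(rule projection_eq_iff_ker[OF assms(1,2)]) (metis assms(3) norm_eq_zero)

lemma orth_projection_diff:
 fixes P Q :: "'a::{real_inner,complete_space} bop"
 assumes "orth_projection P" "orth_projection Q" "P oL Q = P"
 shows "orth_projection (Q - P)"
proof -
 have "Q oL P = P" using projection_le_iff(3)[OF assms(1,2)] assms(3) by blast
 hence "Q (P v) = P v" "P (Q v) = P v" for v using assms(3) by(metis blinfun_apply_blinfun_compose)+
 thus ?thesis
  by(intro orth_projectionI) (auto simp: symm_diff orth_projectionD assms blin_simps)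
qed

lemma commutes_Proj:
 fixes U :: "'a::{real_inner,complete_space} bop"
 assumes S: "subspace S" "closed S"
  and "!!v. v : S ==> U v : S" "!!v. v : S ==> radj U v : S"
 shows "commutes U (Proj S)"
proof (rule commutesI)
 fix v
 have "oproj S (U v) = U (oproj S v)"
 proof (rule oproj_eqI[OF S])
  show "U (oproj S v) : S" using assms(3) oproj_in[OF S] by blast
  fix y assume "y : S"
  hence "inner (v - oproj S v) (radj U y) = 0" using assms(4) oproj_orth[OF S] by blast
  thus "inner (U v - U (oproj S v)) y = 0"
   by(simp add: blinfun.diff_right[symmetric] radj)
 qed
 thus "U (Proj S v) = Proj S (U v)" by(simp add: Proj_apply[OF S])
qed

lemma closure_invariant:
 fixes f :: "'a::topological_space => 'a"
 assumes "continuous_on UNIV f" "!!x. x : S ==> f x : S" "x : closure S"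
 shows "f x : closure S"
proof -
 have "f ` closure S \<subseteq> closure (f ` S)"
  using assms(1) by(metis continuous_on_subset top_greatest image_closure_subset closed_closure closure_subset)
 also have "... \<subseteq> closure S" using assms(2) by(intro closure_mono) auto
 finally show ?thesis using assms(3) by auto
qed

lemma subspace_closure:
 fixes S :: "'a::real_normed_vector set"
 assumes "subspace S"
 shows "subspace (closure S)"
proof (rule subspaceI)
 show "0 : closure S" using assms closure_subset subspace_0 by blast
 show "c *\<^sub>R x : closure S" if "x : closure S" for c x
  by(rule closure_invariant[OF _ _ that]) (auto intro!: continuous_intros subspace_scale[OF assms])
 have *: "x + y : closure S" if "x : S" "y : closure S" for x y
  by(rule closure_invariant[OF _ _ that(2)]) (auto intro!: continuous_intros subspace_add[OF assms] that)
 show "x + y : closure S" if "x : closure S" "y : closure S" for x y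
 proof -
  have "x + y : closure (closure S)"
  proof (rule rev_subsetD)
   show "x + y : (%z. z + y) ` closure S" using that by blast
   show "(%z. z + y) ` closure S \<subseteq> closure (closure S)"
    by(rule image_closure_subset) (use * that in "auto intro!: continuous_intros")
  qed
  thus ?thesis by simp
 qed
qed

text \<open>The limit is the projection onto the closure of the union of the ranges. A vector of
  that closure is close to one fixed by some P m, hence by all later projections, and 1 - P n is a
  contraction.\<close>

lemma increasing_projections_converge:
 fixes P :: "nat => ('a::{real_inner,complete_space} bop)"
 assumes P: "!!n. orth_projection (P n)" and mono: "!!n v. P n v = v ==> P (Suc n) v = v"
 obtains Q where "orth_projection Q" "!!v. (%n. P n v) ----> Q v" "!!n v. P n v = v ==> Q v = v"
  "!!v. Q v = 0 \<longleftrightarrow> (ALL n. P n v = 0)"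
proof -
 have mono': "P n v = v" if "P m v = v" "m <= n" for m n v
  using that(2,1) by(induction n rule: dec_induct) (auto intro: mono)
 define R where "R = (\<Union>n. {v. P n v = v})"
 have "subspace R"
 proof (rule subspaceI)
  show "0 : R" by(simp add: R_def)
  show "x + y : R" if xy: "x : R" "y : R" for x y
  proof -
   obtain m n where "P m x = x" "P n y = y" using xy unfolding R_def by blast
   hence "P (max m n) x = x" "P (max m n) y = y" using mono' by(meson max.cobounded1 max.cobounded2)+
   thus ?thesis by(auto simp: R_def blinfun.add_right intro!: exI[of _ "max m n"])
  qed
  show "c *\<^sub>R x : R" if "x : R" for c x
   using that by(auto simp: R_def blinfun.scaleR_right)
 qed
 hence S: "subspace (closure R)" "closed (closure R)" by(simp_all add: subspace_closure)
 let ?Q = "Proj (closure R)"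
 have Q: "orth_projection ?Q" by(rule orth_projection_Proj[OF S])
 have fixQ: "?Q v = v" if "P n v = v" for n v
  using that closure_subset[of R] by(subst Proj_fix_iff[OF S]) (auto simp: R_def)
 have PQ: "P n (?Q v) = P n v" for n v
  using projection_le_iff[OF P[of n] Q] fixQ by(metis blinfun_apply_blinfun_compose)
 have lim: "(%n. P n v) ----> ?Q v" for v
 proof (rule metric_LIMSEQ_I)
  fix r :: real assume "r > 0"
  have "?Q v : closure R" using Proj_fix_iff[OF S] orth_projectionD(1)[OF Q] by blast
  then obtain y where y: "y : R" "dist y (?Q v) < r" using `r > 0` closure_approachable by blast
  then obtain m where m: "P m y = y" by(auto simp: R_def)
  have "dist (P n v) (?Q v) < r" if "n >= m" for n
  proof -
   have yn: "P n y = y" using mono' m that by blast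
   define w where "w = ?Q v - y"
   have "?Q v - P n v = w - P n w" by(simp add: w_def blin_simps PQ yn)
   moreover have "norm (w - P n w) <= norm w"
    using norm_orth_projection_le[OF orth_projection_compl[OF P[of n]], of w] by(simp add: blin_simps)
   moreover have "norm w < r" using y(2) by(simp add: dist_norm norm_minus_commute w_def)
   ultimately show ?thesis
    by(metis dist_commute dist_norm order_le_less_trans)
  qed
  thus "EX no. ALL n>=no. dist (P n v) (?Q v) < r" by blast
 qed
 have "?Q v = 0 \<longleftrightarrow> (ALL n. P n v = 0)" for v
 proof
  assume "?Q v = 0" thus "ALL n. P n v = 0" by(metis PQ blinfun.zero_right)
 next
  assume "ALL n. P n v = 0" thus "?Q v = 0" using lim[of v] by(simp add: LIMSEQ_const_iff)
 qed
 thus ?thesis using that[OF Q lim] fixQ by blast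
qed

lemma decreasing_projections_converge:
 fixes P :: "nat => ('a::{real_inner,complete_space} bop)"
 assumes P: "!!n. orth_projection (P n)" and mono: "!!n v. P n v = 0 ==> P (Suc n) v = 0"
 obtains Q where "orth_projection Q" "!!v. (%n. P n v) ----> Q v" "!!n v. P n v = 0 ==> Q v = 0"
  "!!v. Q v = v \<longleftrightarrow> (ALL n. P n v = v)"
proof -
 obtain R where R: "orth_projection R" "!!v. (%n. (id_blinfun - P n) v) ----> R v"
  "!!n v. (id_blinfun - P n) v = v ==> R v = v" "!!v. R v = 0 \<longleftrightarrow> (ALL n. (id_blinfun - P n) v = 0)"
  by(rule increasing_projections_converge[of "%n. id_blinfun - P n"])
   (use P mono in "auto simp: orth_projection_compl blin_simps")
 show ?thesis
 proof (rule that[of "id_blinfun - R"])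
  show "orth_projection (id_blinfun - R)" by(rule orth_projection_compl[OF R(1)])
  show "(%n. P n v) ----> (id_blinfun - R) v" for v
   using tendsto_diff[OF tendsto_const[of v] R(2)[of v]] by(simp add: blin_simps)
  show "P n v = 0 ==> (id_blinfun - R) v = 0" for n v using R(3)[of n v] by(simp add: blin_simps)
  show "(id_blinfun - R) v = v \<longleftrightarrow> (ALL n. P n v = v)" for v using R(4)[of v] by(auto simp: blin_simps)
 qed
qed

section \<open>Closed operators and their absolute values\<close>

text \<open>Adjoint of a relation for the real inner product; \<open>uadj\<close> reduces to it for
  graphs stable under multiplication by i.\<close>

definition radj_rel :: "('a::real_inner \<times> 'a) set => ('a \<times> 'a) set" where
 "radj_rel x = {(w, u). ALL (v, v'):x. inner v' w = inner v u}"

lemma radj_relI: "(!!v v'. (v, v') : x ==> inner v' w = inner v u) ==> (w, u) : radj_rel x"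
 by(auto simp: radj_rel_def)

lemma radj_relD: "(w, u) : radj_rel x ==> (v, v') : x ==> inner v' w = inner v u"
 by(auto simp: radj_rel_def)

lemma dense_orthogonal_zero:
 fixes u :: "'a::real_inner"
 assumes "closure S = UNIV" "!!v. v : S ==> inner v u = 0"
 shows "u = 0"
proof -
 have "closure S \<subseteq> {v. inner v u = 0}"
  by(rule closure_minimal) (use assms(2) in "auto intro!: closed_Collect_eq continuous_intros")
 hence "inner u u = 0" using assms(1) by blast
 thus ?thesis by simp
qed

lemma compression_invertible:
 fixes T E :: "'a::{real_inner,banach} bop"
 assumes T: "symm T" and E: "orth_projection E" and ET: "commutes E T"
  and c: "0 < c" "!!v. E v = v ==> c * norm v <= norm (T v)"
 shows "EX K. (ALL U. commutes U T --> commutes U E --> commutes U K) & (ALL v. T (K (E v)) = E v)"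
proof -
 \<comment> \<open>A is T on the range of E and the identity on its complement, so inverting T on a
   subspace becomes inverting A on the whole space; commutation passes to the inverse.\<close>
 define A where "A = (T oL E) + (id_blinfun - E)"
 note E1 = orth_projectionD(1)[OF E]
 have symA: "symm A" unfolding A_def
  by(intro symm_add symm_compose symm_diff symm_id T orth_projectionD(2)[OF E] commutes_sym[OF ET])
 have EA: "E (A v) = T (E v)" for v using commutesD[OF ET, of "E v"] by(simp add: A_def blin_simps E1)
 define d where "d = min c 1"
 have d: "0 < d" "d <= c" "d <= 1" using c(1) by(simp_all add: d_def)
 have "d * norm v <= norm (A v)" for v
 proof -
  have "d * norm (E v) <= norm (T (E v))"
   by(rule order_trans[OF mult_right_mono c(2)]) (simp_all add: d E1)
  moreover have "d * norm (v - E v) <= 1 * norm (v - E v)" by(rule mult_right_mono) (simp_all add: d)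
  ultimately have "(d * norm (E v))^2 + (d * norm (v - E v))^2 <= (norm (E (A v)))^2 + (norm (A v - E (A v)))^2"
   using d unfolding EA by(intro add_mono power_mono) (simp_all add: A_def blin_simps)
  hence "(d * norm v)^2 <= (norm (A v))^2"
   unfolding orth_projection_pythagoras[OF E, of v] orth_projection_pythagoras[OF E, of "A v"] power_mult_distrib
   by(simp add: distrib_left)
  thus ?thesis by(rule power2_le_imp_le) simp
 qed
 then obtain K :: "'a bop" where K: "!!v. A (K v) = v" "!!v. K (A v) = v"
  by(rule symm_bounded_below_invertible[OF symA d(1)]) blast
 have KU: "commutes U K" if "commutes U T" "commutes U E" for U
 proof (rule commutesI)
  have "commutes U A" unfolding A_def by(intro commutes_add commutes_compose commutes_diff commutes_id that)
  thus "U (K v) = K (U v)" for v using K commutesD[of U A "K v"] by metis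
 qed
 have "T (K (E v)) = E v" for v
  using EA[of "K v"] K(1)[of v] commutesD[OF KU[OF ET commutes_self], of v] by simp
 thus ?thesis using KU by blast
qed

lemma psd_compression:
 fixes T E :: "'a::real_inner bop"
 assumes T: "symm T" and E: "orth_projection E" and TE: "commutes T E"
  and nonneg: "!!v. E v = v ==> 0 <= inner (T v) v"
 shows "psd (T oL E)"
proof -
 have "inner (T (E v)) v = inner (T (E v)) (E v)" for v
  using symmD[OF orth_projectionD(2)[OF E], of "T (E v)" v] commutesD[OF TE, of "E v"] by(simp add: orth_projectionD(1)[OF E])
 thus ?thesis
  using nonneg by(simp add: psd_def symm_compose T TE orth_projectionD[OF E])
qed

text \<open>A pair of commuting positive contractions with \<open>C\<^sup>2 + D\<^sup>2 = 1\<close> and \<open>C\<close> injective encodes the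
 positive self-adjoint operator \<open>D C\<^sup>-\<^sup>1\<close>; its graph is an isometric image of the whole space.\<close>

locale cd_pair =
 fixes C D :: "'a::{real_inner,banach} bop"
 assumes psd_C: "psd C" and psd_D: "psd D" and CD: "commutes C D"
  and CD_square: "C (C \<xi>) + D (D \<xi>) = \<xi>"
  and C_inj: "C \<xi> = 0 ==> \<xi> = 0"
begin

definition quot :: "('a \<times> 'a) set" where
 "quot = range (%u. (C u, D u))"

lemma CD': "C (D v) = D (C v)"
 by(rule commutesD[OF CD])

lemma C_symm: "inner (C v) w = inner v (C w)" and D_symm: "inner (D v) w = inner v (D w)"
 using psd_C psd_D by(auto simp: psd_def symm_def)

lemma norm_CD: "(norm (C v))^2 + (norm (D v))^2 = (norm v)^2"
proof -
 have "inner (C v) (C v) + inner (D v) (D v) = inner v (C (C v) + D (D v))"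
  by(simp add: C_symm D_symm inner_add_right)
 thus ?thesis by(simp add: CD_square power2_norm_eq_inner)
qed

lemma C_eq_iff: "C v = C w \<longleftrightarrow> v = w"
 using C_inj[of "v - w"] by(auto simp: blin_simps)

lemma dense_range_C: "closure (range C) = UNIV"
proof -
 have S: "subspace (closure (range C))"
  by(intro subspace_closure linear_subspace_image bounded_linear.linear blinfun.bounded_linear_right subspace_UNIV)
 have "v : closure (range C)" for v
 proof -
  let ?p = "oproj (closure (range C)) v"
  have o: "inner (v - ?p) (C u) = 0" for u
  proof (rule oproj_orth[OF S closed_closure])
   show "C u : closure (range C)" using closure_subset[of "range C"] by(meson rangeI subsetD)
  qed
  have "inner (C (v - ?p)) (C (v - ?p)) = inner (v - ?p) (C (C (v - ?p)))" by(rule C_symm)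
  hence "C (v - ?p) = 0" using o[of "C (v - ?p)"] by simp
  hence "v = ?p" using C_inj[of "v - ?p"] by simp
  thus ?thesis using oproj_in[OF S closed_closure] by metis
 qed
 thus ?thesis by blast
qed

lemma subspace_quot: "subspace quot"
 unfolding quot_def
 by(intro linear_subspace_image bounded_linear.linear bounded_linear_Pair blinfun.bounded_linear_right subspace_UNIV)

lemma closed_quot: "closed quot"
proof -
 have "bounded_linear (%u. (C u, D u))" by(intro bounded_linear_intros)
 hence "complete quot"
  unfolding quot_def
  by(intro complete_isometric_image[of 1]) (auto simp: norm_prod_def norm_CD complete_UNIV)
 thus ?thesis by(rule complete_imp_closed)
qed

lemma single_valued_quot: "single_valued quot"
 by(auto simp: single_valued_def quot_def C_eq_iff)

lemma Domain_quot: "Domain quot = range C"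
 by(auto simp: quot_def)

lemma radj_rel_quot: "radj_rel quot = quot"
proof safe
 fix w u
 assume a: "(w, u) : radj_rel quot"
 have "D w = C u"
 proof (rule inner_ext_right)
  fix v
  have "(C v, D v) : quot" by(simp add: quot_def)
  from radj_relD[OF a this] show "inner v (D w) = inner v (C u)" by(simp add: C_symm D_symm)
 qed
 \<comment> \<open>By D w = C u the vector C w + D u is the parameter of (w, u) in the
   graph.\<close>
 hence "C (C w + D u) = C (C w) + D (D w)" "D (C w + D u) = C (C u) + D (D u)"
  using CD'[of w] CD'[of u] by(simp_all add: blin_simps)
 hence "(w, u) = (C (C w + D u), D (C w + D u))" by(simp only: CD_square)
 thus "(w, u) : quot" unfolding quot_def by blast
next
 fix w u
 assume "(w, u) : quot"
 thus "(w, u) : radj_rel quot"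
  by(auto simp: quot_def C_symm D_symm CD' intro!: radj_relI)
qed

lemma quot_positive: "(v, w) : quot ==> 0 <= inner w v"
 using psdD[OF psd_compose[OF psd_C psd_D CD]] by(auto simp: quot_def C_symm)

lemma quot_square: "quot O quot = {(C (C u), D (D u)) | u. True}"
proof safe
 fix v w t
 assume "(v, w) : quot" "(w, t) : quot"
 then obtain u u' where z: "v = C u" "w = D u" "D u = C u'" "t = D u'" by(auto simp: quot_def)
 \<comment> \<open>h is made to satisfy u = C h and u' = D h, which follow from D u = C u' and the
   square identity.\<close>
 define h where "h = C u + D u'"
 have "u = C h" using CD_square[of u] by(simp add: h_def blin_simps CD' z)
 moreover have "u' = D h"
  using CD_square[of u'] by(simp add: h_def blin_simps CD'[symmetric] z(3))
 ultimately show "EX u. (v, t) = (C (C u), D (D u)) & True" using z by blast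
next
 fix u
 have "(C (C u), D (C u)) : quot" "(C (D u), D (D u)) : quot"
  unfolding quot_def by blast+
 thus "(C (C u), D (D u)) : quot O quot" unfolding CD' by blast
qed

end

section \<open>The bounded transform of a closed operator\<close>

locale closed_op =
 fixes x :: "('a::{real_inner,banach} \<times> 'a) set"
 assumes subspace_x: "subspace x" and closed_x: "closed x" and sv_x: "single_valued x"
  and dense_x: "closure (Domain x) = UNIV"
begin

text \<open>\<open>B = (1 + x\<^sup>*x)\<^sup>-\<^sup>1\<close> and \<open>K = x B\<close> come from the projection onto the graph.\<close>

definition opB :: "'a bop" where "opB = Blinfun (%v. fst (oproj x (v, 0)))"
definition opK :: "'a bop" where "opK = Blinfun (%v. snd (oproj x (v, 0)))"

lemma BK_proj: "(opB v, opK v) = oproj x (v, 0)"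
proof -
 have "bounded_linear (%v. oproj x (v, 0::'a))"
  by(rule bounded_linear_compose[OF bounded_linear_oproj[OF subspace_x closed_x]])
   (intro bounded_linear_intros)
 from bounded_linear_compose[OF bounded_linear_fst this] bounded_linear_compose[OF bounded_linear_snd this]
 show ?thesis unfolding opB_def opK_def by(simp add: bounded_linear_Blinfun_apply)
qed

lemma BK_in: "(opB v, opK v) : x"
 unfolding BK_proj by(rule oproj_in[OF subspace_x closed_x])

lemma BK_orth: "(u, u') : x ==> inner (v - opB v) u = inner (opK v) u'"
 using oproj_orth[OF subspace_x closed_x, of "(u, u')" "(v, 0)"]
 unfolding BK_proj[symmetric] by(simp add: inner_prod_def)

lemma K_in_adj: "(opK v, v - opB v) : radj_rel x"
 by(rule radj_relI) (metis BK_orth inner_commute)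

lemma BK_unique:
 assumes "(b, k) : x" "(k, v - b) : radj_rel x"
 shows "opB v = b" "opK v = k"
proof -
 have "oproj x (v, 0) = (b, k)"
 proof (rule oproj_eqI[OF subspace_x closed_x assms(1)])
  fix y assume "y : x"
  then obtain a a' where y: "y = (a, a')" "(a, a') : x" by(cases y) auto
  from radj_relD[OF assms(2) y(2)] show "inner ((v, 0) - (b, k)) y = 0"
   by(simp add: y inner_prod_def inner_commute)
 qed
 thus "opB v = b" "opK v = k" using BK_proj[of v] by auto
qed

lemma inner_K: "inner (opK v) (opK w) = inner (opB v) (w - opB w)"
 by(rule radj_relD[OF K_in_adj BK_in])

text \<open>Orthogonality of the graph projection gives B = B^*B + K^*K, hence symmetry and
  positivity of B; a parallel identity handles 1 - B.\<close>

lemma psd_B: "psd opB" and psd_1B: "psd (id_blinfun - opB)"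
proof -
 have B: "inner (opB v) w = inner (opB v) (opB w) + inner (opK v) (opK w)" for v w
  by(simp add: inner_K inner_diff_right)
 show "psd opB"
  unfolding psd_def symm_def
 proof (intro conjI allI)
  show "inner (opB v) w = inner v (opB w)" for v w
   using B[of v w] B[of w v] by(simp add: inner_commute)
  show "0 <= inner (opB v) v" for v by(subst B) simp
 qed
 hence "symm (id_blinfun - opB)" by(simp add: symm_diff psd_symm)
 moreover have "0 <= inner (v - opB v) v" for v
 proof -
  have "inner (v - opB v) v = inner (v - opB v) (v - opB v) + inner (opK v) (opK v)"
   by(simp add: inner_K inner_diff_right inner_diff_left inner_commute)
  thus ?thesis by simp
 qed
 ultimately show "psd (id_blinfun - opB)" by(simp add: psd_def blin_simps)
qed

lemma B_inj: assumes "opB v = 0" shows "v = 0"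
proof (rule dense_orthogonal_zero[OF dense_x])
 have "inner (opK v) (opK v) = 0" using inner_K[of v v] assms by simp
 hence K: "opK v = 0" by simp
 fix u assume "u : Domain x"
 then obtain u' where "(u, u') : x" by blast
 from BK_orth[OF this, of v] show "inner u v = 0" by(simp add: assms K inner_commute)
qed

lemma square_eq: "x O radj_rel x = {(opB v, v - opB v) | v. True}"
proof safe
 fix b k c assume "(b, k) : x" "(k, c) : radj_rel x"
 hence "opB (b + c) = b" using BK_unique(1)[of b k "b + c"] by simp
 hence "(b, c) = (opB (b + c), b + c - opB (b + c))" by simp
 thus "EX v. (b, c) = (opB v, v - opB v) & True" by blast
qed (use BK_in K_in_adj in blast)

text \<open>C = (1 + x^*x)^(-1/2) and, with \<open>opD\<close>, D = |x| C. Thus |x| = D C^(-1) is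
  encoded by bounded data.\<close>

definition opC :: "'a bop" where "opC = op_sqrt opB"
definition opD :: "'a bop" where "opD = op_sqrt (id_blinfun - opB)"

lemma CC: "opC (opC v) = opB v" and DD: "opD (opD v) = v - opB v"
 by(simp_all add: opC_def opD_def op_sqrt_apply psd_B psd_1B blin_simps)

lemma commutes_CD_of_B: "commutes U opB ==> commutes U opC & commutes U opD"
 unfolding opC_def opD_def by(simp add: commutes_op_sqrt psd_B psd_1B commutes_diff)

end

sublocale closed_op \<subseteq> cd_pair opC opD
proof
 show "psd opC" "psd opD" unfolding opC_def opD_def by(simp_all add: psd_op_sqrt psd_B psd_1B)
 have "commutes opB opC" using commutes_CD_of_B[OF commutes_self] by(rule conjunct1)
 thus "commutes opC opD" by(rule conjunct2[OF commutes_CD_of_B[OF commutes_sym]])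
 show "opC (opC v) + opD (opD v) = v" for v by(simp add: CC DD)
 show "v = 0" if "opC v = 0" for v
  by(rule B_inj) (use that CC[of v] in "simp add:")
qed

context closed_op
begin

lemma quot_square_eq: "quot O quot = x O radj_rel x"
 unfolding quot_square square_eq CC DD ..

text \<open>On vectors a = C u the value is K u, with |K u| = |D C u|. The estimate extends this by
  continuity to the closure of the range of C, which is everything, and closedness of x keeps the
  limit in the graph.\<close>

lemma Z_exists: "EX y. (opC a, y) : x & norm y = norm (opD a)"
proof -
 have K: "(opC (opC u), opK u) : x" "norm (opK u) = norm (opD (opC u))" for u
 proof -
  show "(opC (opC u), opK u) : x" unfolding CC by(rule BK_in)
  have "inner (opK u) (opK u) = inner (opC (opC u)) (opD (opD u))" by(simp add: inner_K CC DD)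
  also have "... = inner (opD (opC u)) (opD (opC u))" by(simp add: C_symm D_symm CD')
  finally show "norm (opK u) = norm (opD (opC u))" by(simp add: norm_eq_sqrt_inner)
 qed
 have "a : closure (range opC)" by(simp add: dense_range_C)
 then obtain w where w: "!!n. w n : range opC" "w ----> a" using closure_sequential by blast
 have "ALL n. EX v. w n = opC v" using w(1) by blast
 from choice[OF this] obtain u where u: "!!n. w n = opC (u n)" by blast
 define k where "k n = opK (u n)" for n
 have kd: "norm (k m - k n) <= norm opD * norm (w m - w n)" for m n
  using K(2)[of "u m - u n"] norm_blinfun[of opD "w m - w n"]
  by(simp add: k_def u blin_simps)
 have "Cauchy k"
 proof (rule CauchyI)
  fix e :: real assume "e > 0"
  define d where "d = e / (norm opD + 1)"
  have "d > 0" using `e > 0` by(simp add: d_def add_nonneg_pos)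
  then obtain N where N: "!!m n. m >= N ==> n >= N ==> norm (w m - w n) < d"
   using CauchyD[OF LIMSEQ_imp_Cauchy[OF w(2)]] by blast
  have "norm (k m - k n) < e" if "m >= N" "n >= N" for m n
  proof -
   have "norm opD * norm (w m - w n) <= norm opD * d" using N[OF that] by(intro mult_left_mono) auto
   also have "... < (norm opD + 1) * d" using `d > 0` by simp
   also have "... = e" by(simp add: d_def add_nonneg_eq_0_iff)
   finally show ?thesis using kd[of m n] by linarith
  qed
  thus "EX M. ALL m>=M. ALL n>=M. norm (k m - k n) < e" by blast
 qed
 then obtain y where y: "k ----> y" using Cauchy_convergent convergent_def by blast
 have "(%n. (opC (w n), k n)) ----> (opC a, y)" by(intro tendsto_intros w y)
 hence "(opC a, y) : x"
  by(rule closed_sequentially[OF closed_x, rotated]) (simp add: u k_def K)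
 moreover have "(%n. norm (k n)) ----> norm y" "(%n. norm (opD (w n))) ----> norm (opD a)"
  by(intro tendsto_intros w y)+
 hence "norm y = norm (opD a)" by(simp add: k_def K(2) u LIMSEQ_unique)
 ultimately show ?thesis by blast
qed

text \<open>Z = x C. Having the same norms as D is the substitute for writing Z as a partial
  isometry times D.\<close>

definition opZ :: "'a bop" where "opZ = Blinfun (%u. SOME w. (opC u, w) : x)"

lemma Z_in: "(opC u, opZ u) : x" and norm_Z: "norm (opZ u) = norm (opD u)"
proof -
 define z where "z u = (SOME w. (opC u, w) : x)" for u
 have z: "(opC u, z u) : x" for u unfolding z_def by(rule someI_ex) (use Z_exists in blast)
 have zu: "z u = w" if "(opC u, w) : x" for u w by(rule single_valuedD[OF sv_x z that])
 have nz: "norm (z u) = norm (opD u)" for u using Z_exists[of u] zu by blast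
 have "bounded_linear z"
 proof (rule bounded_linear_intro[where K = "norm opD"])
  show "z (a + b) = z a + z b" for a b
   using subspace_add[OF subspace_x z[of a] z[of b]] by(intro zu) (simp add: blin_simps)
  show "z (r *\<^sub>R a) = r *\<^sub>R z a" for r a
   using subspace_scale[OF subspace_x z[of a], of r] by(intro zu) (simp add: blin_simps)
  show "norm (z a) <= norm a * norm opD" for a
   using norm_blinfun[of opD a] by(simp add: nz mult.commute)
 qed
 hence "blinfun_apply opZ = z" unfolding opZ_def z_def[symmetric] by(simp add: bounded_linear_Blinfun_apply)
 thus "(opC u, opZ u) : x" "norm (opZ u) = norm (opD u)" by(simp_all add: z nz)
qed

lemma inner_Z: "inner (opZ u) (opZ u') = inner (opD u) (opD u')"
proof -
 have "(norm (opZ (u + u')))^2 = (norm (opD (u + u')))^2" "(norm (opZ u))^2 = (norm (opD u))^2"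
  "(norm (opZ u'))^2 = (norm (opD u'))^2" by(simp_all add: norm_Z)
 thus ?thesis
  unfolding power2_norm_eq_inner by(simp add: blin_simps inner_add_left inner_add_right inner_commute)
qed

text \<open>A graph vector orthogonal to all (C y, Z y) is orthogonal to all (B v, K v);
  \<open>BK_orth\<close> then makes its first component orthogonal to every v.\<close>

lemma x_eq_range_CZ: "x = range (%y. (opC y, opZ y))"
proof safe
 fix u u' assume a: "(u, u') : x"
 let ?G = "range (%y. (opC y, opZ y))"
 have bl: "bounded_linear (%y. (opC y, opZ y))" by(intro bounded_linear_intros)
 have S: "subspace ?G" by(intro linear_subspace_image bounded_linear.linear bl subspace_UNIV)
 have "complete ?G"
  by(intro complete_isometric_image[of 1]) (use bl in "auto simp: norm_prod_def norm_Z norm_CD complete_UNIV")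
 hence clG: "closed ?G" by(rule complete_imp_closed)
 define w where "w = (u, u') - oproj ?G (u, u')"
 have Gx: "?G \<subseteq> x" using Z_in by blast
 have wx: "w : x" unfolding w_def using oproj_in[OF S clG] Gx a subspace_diff[OF subspace_x] by blast
 obtain b b' where w: "w = (b, b')" by(cases w)
 have "inner b v = 0" for v
 proof -
  have "opK v = opZ (opC v)" using single_valuedD[OF sv_x BK_in] Z_in CC by metis
  hence "(opB v, opK v) = (opC (opC v), opZ (opC v))" by(simp add: CC)
  hence "(opB v, opK v) : ?G" by blast
  hence "inner w (opB v, opK v) = 0" unfolding w_def by(rule oproj_orth[OF S clG])
  moreover have "inner (v - opB v) b = inner (opK v) b'" using BK_orth wx w by blast
  ultimately show ?thesis by(simp add: w inner_prod_def inner_diff_left inner_diff_right inner_commute)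
 qed
 hence "b = 0" by(metis inner_eq_zero_iff)
 moreover from this have "b' = 0"
  using wx w single_valuedD[OF sv_x] subspace_0[OF subspace_x] by(metis zero_prod_def)
 ultimately have "w = 0" by(simp add: w zero_prod_def)
 hence "(u, u') = oproj ?G (u, u')" unfolding w_def by simp
 thus "(u, u') : ?G" using oproj_in[OF S clG] by metis
qed (rule Z_in)

text \<open>Invariance under U and its adjoint makes (U B v, U K v) satisfy the two conditions that
  characterize the values of B and K at U v.\<close>

lemma commutes_B_of_x:
 fixes U :: "'a bop"
 assumes "!!v w. (v, w) : x ==> (U v, U w) : x"
  and "!!v w. (v, w) : x ==> (radj U v, radj U w) : x"
 shows "commutes U opB"
proof (rule commutesI)
 fix v
 have "(U (opK v), U v - U (opB v)) : radj_rel x"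
 proof (rule radj_relI)
  fix u u' assume "(u, u') : x"
  from radj_relD[OF K_in_adj assms(2)[OF this], of v]
  show "inner u' (U (opK v)) = inner u (U v - U (opB v))"
   by(simp add: radj' blinfun.diff_right[symmetric])
 qed
 from BK_unique(1)[OF assms(1)[OF BK_in] this] show "U (opB v) = opB (U v)" by simp
qed

lemma commutes_Z_of_x:
 fixes U :: "'a bop"
 assumes "!!v w. (v, w) : x ==> (U v, U w) : x"
  and "!!v w. (v, w) : x ==> (radj U v, radj U w) : x"
 shows "commutes U opZ"
proof (rule commutesI)
 fix u
 have "commutes U opC" using commutes_CD_of_B commutes_B_of_x[OF assms] by blast
 hence "(opC (U u), U (opZ u)) : x" using assms(1)[OF Z_in[of u]] commutesD[of U opC u] by simp
 thus "U (opZ u) = opZ (U u)" using single_valuedD[OF sv_x _ Z_in] by blast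
qed

end

text \<open>A positive self-adjoint square root \<open>a\<close> has \<open>a B\<close> as positive square root of the bounded
 operator \<open>B (1 - B)\<close>, which is unique; this determines \<open>a\<close> on the range of \<open>B\<close>, a core.\<close>

lemma (in closed_op) positive_root_unique:
 assumes a: "closed_op a" and sa: "radj_rel a = a" and pos: "!!v u. (v, u) : a ==> 0 <= inner u v"
  and sq: "a O a = x O radj_rel x"
 shows "a = quot"
proof -
 interpret a: closed_op a by(rule a)
 have sym: "inner y' b = inner y b'" if "(y, y') : a" "(b, b') : a" for y y' b b'
  using radj_relD[of b b' a y y'] that sa by simp
 have B: "a.opB = opB"
 proof (rule blinfun_eqI)
  fix v
  have "(a.opB v, v - a.opB v) : a O a" using a.BK_in a.K_in_adj sa by blast
  then obtain k where "(a.opB v, k) : x" "(k, v - a.opB v) : radj_rel x" unfolding sq by blast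
  from BK_unique(1)[OF this] show "a.opB v = opB v" ..
 qed
 let ?K = "a.opK"
 have Ka: "(?K v, v - opB v) : a" and Ba: "(opB v, ?K v) : a" for v
  using a.K_in_adj[of v] a.BK_in[of v] by(simp_all add: sa B)
 have "inner (?K v) u = inner v (?K u)" for v u
  using sym[OF Ba[of v] Ba[of u]] sym[OF Ka[of v] Ka[of u]]
  by(simp add: inner_diff_left inner_diff_right)
 moreover have "0 <= inner (?K v) v" for v
  using pos[OF Ba[of v]] pos[OF Ka[of v]] by(simp add: inner_diff_left inner_diff_right inner_commute)
 ultimately have K: "psd ?K" by(simp add: psd_def symm_def)
 have KK: "?K (?K v) = opB v - opB (opB v)" for v
 proof -
  have "(?K (opB v), opB v - opB (opB v)) : a" by(rule Ka)
  moreover have "(opB v - opB (opB v), ?K v - ?K (opB v)) : a"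
   using subspace_diff[OF a.subspace_x Ba[of v] Ba[of "opB v"]] by simp
  ultimately show ?thesis using a.BK_unique(2)[of "?K (opB v)" _ "?K v"] sa by simp
 qed
 have "op_sqrt (?K oL ?K) = ?K" by(rule op_sqrt_unique[OF K refl])
 moreover have "op_sqrt (?K oL ?K) = opC oL opD"
 proof (rule op_sqrt_unique[OF psd_compose[OF psd_C psd_D CD]], rule blinfun_eqI)
  fix v
  have "opC (opD (opC (opD v))) = opC (opC (opD (opD v)))" by(simp add: CD')
  also have "... = opB v - opB (opB v)" by(simp only: DD CC) (simp add: blin_simps)
  finally show "((opC oL opD) oL (opC oL opD)) v = (?K oL ?K) v" by(simp add: KK)
 qed
 ultimately have KCD: "?K = opC oL opD" by simp
 have "quot \<subseteq> a"
  unfolding quot_def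
 proof safe
  fix c
  have "c : closure (range opC)" by(simp add: dense_range_C)
  then obtain w where w: "!!n. w n : range opC" "w ----> c" using closure_sequential by blast
  have "(opC (w n), opD (w n)) : a" for n
  proof -
   obtain v where "w n = opC v" using w(1)[of n] by blast
   thus ?thesis using Ba[of v] by(simp add: KCD CC CD')
  qed
  moreover have "(%n. (opC (w n), opD (w n))) ----> (opC c, opD c)" by(intro tendsto_intros w)
  ultimately show "(opC c, opD c) : a" by(rule closed_sequentially[OF a.closed_x])
 qed
 moreover from this have "radj_rel a \<subseteq> radj_rel quot" by(auto simp: radj_rel_def)
 ultimately show ?thesis using sa radj_rel_quot by blast
qed


section \<open>The spectral family of a positive self-adjoint operator\<close>

text \<open>|T| + T is twice the positive part of T, so its kernel is the spectral subspace of T for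
  (-\<infinity>, 0], the kernel of T included.\<close>

definition neg_proj :: "('a::{real_inner,banach} bop) => ('a bop)" where
 "neg_proj T = Proj {v. blinfun_apply (op_sqrt (T oL T) + T) v = 0}"

context
 fixes T :: "'a::{real_inner,banach} bop"
 assumes T: "symm T"
begin

lemma orth_projection_neg_proj: "orth_projection (neg_proj T)"
 unfolding neg_proj_def by(rule orth_projection_Proj[OF subspace_ker closed_ker])

lemma commutes_neg_proj:
 assumes "commutes U T"
 shows "commutes U (neg_proj T)"
proof -
 let ?X = "op_sqrt (T oL T) + T"
 have "commutes V ?X" if "commutes V T" for V
  by(intro commutes_add commutes_op_sqrt psd_square T commutes_compose that)
 hence c: "commutes U ?X" "commutes (radj U) ?X" using assms commutes_radj_symm[OF T assms] by simp_all
 show ?thesis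
  unfolding neg_proj_def
 proof (rule commutes_Proj[OF subspace_ker closed_ker]; clarify)
  fix v assume z: "?X v = 0"
  show "?X (U v) = 0" using commutesD[OF c(1), of v] by(simp only: z blinfun.zero_right)
  show "?X (radj U v) = 0" using commutesD[OF c(2), of v] by(simp only: z blinfun.zero_right)
 qed
qed

lemma neg_proj_fix:
 assumes "neg_proj T v = v"
 shows "inner (T v) v <= 0"
proof -
 have "(op_sqrt (T oL T) + T) v = 0"
  using assms Proj_fix_iff[OF subspace_ker closed_ker] unfolding neg_proj_def by blast
 hence "T v = - op_sqrt (T oL T) v" by(simp add: blin_simps add_eq_0_iff2)
 thus ?thesis using psdD[OF psd_op_sqrt[OF psd_square[OF T]], of v] by simp
qed

lemma neg_proj_zero:
 assumes "neg_proj T v = 0"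
 shows "0 <= inner (T v) v" and "inner (T v) v = 0 ==> v = 0"
proof -
 let ?R = "op_sqrt (T oL T)"
 have R: "psd ?R" "!!w. ?R (?R w) = T (T w)" "commutes T ?R"
  by(simp_all add: psd_op_sqrt psd_square T op_sqrt_apply commutes_op_sqrt commutes_compose)
 have orth: "inner v w = 0" if "?R w + T w = 0" for w
  using assms Proj_zero_iff[OF subspace_ker[of "?R + T"] closed_ker[of "?R + T"], of v] that
  unfolding neg_proj_def by(auto simp: blin_simps)
 \<comment> \<open>The range of |T| - T lies in the kernel of |T| + T, because |T| and T commute and
   have the same square. Hence v is orthogonal to it.\<close>
 have "inner (?R v - T v) w = 0" for w
 proof -
  have "inner v (?R w - T w) = 0"
   by(rule orth) (simp add: blin_simps R commutesD[OF R(3), symmetric])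
  thus ?thesis
   by(simp add: inner_diff_left inner_diff_right symmD[OF T] symmD[OF psd_symm[OF R(1)]])
 qed
 hence eq: "T v = ?R v" by(metis inner_eq_zero_iff right_minus_eq)
 show "0 <= inner (T v) v" unfolding eq by(rule psdD[OF R(1)])
 assume "inner (T v) v = 0"
 hence "?R v = 0" using psd_zero_vector[OF R(1)] eq by simp
 hence "inner v v = 0" by(intro orth) (simp add: eq)
 thus "v = 0" by simp
qed

end

context cd_pair
begin

text \<open>Spectral projection of D C^(-1) for the interval [0, s]: an upper bound s on the
  quotient is read as D - s C <= 0.\<close>

definition F :: "real => ('a bop)" where
 "F s = (if s < 0 then 0 else neg_proj (D - s *\<^sub>R C))"

lemma symm_T: "symm (D - s *\<^sub>R C)"
 using psd_C psd_D by(intro symm_diff symm_scale psd_symm)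

lemma orth_projection_F: "orth_projection (F s)"
 by(simp add: F_def orth_projection_neg_proj symm_T)

lemma commutes_F: "commutes U C ==> commutes U D ==> commutes U (F s)"
 unfolding F_def
 by(auto intro!: commutes_neg_proj symm_T commutes_diff commutes_scale simp: commutes_iff[of U 0] blin_simps)

lemma FC: "F s (C v) = C (F s v)" and FD: "F s (D v) = D (F s v)" and FF: "F s (F t v) = F t (F s v)"
proof -
 have C: "commutes C (F s)" for s by(rule commutes_F[OF commutes_self CD])
 have D: "commutes D (F s)" for s by(rule commutes_F[OF commutes_sym[OF CD] commutes_self])
 have F: "commutes (F s) (F t)" by(rule commutes_F[OF commutes_sym[OF C] commutes_sym[OF D]])
 show "F s (C v) = C (F s v)" by(rule commutesD[OF C, symmetric])
 show "F s (D v) = D (F s v)" by(rule commutesD[OF D, symmetric])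
 show "F s (F t v) = F t (F s v)" by(rule commutesD[OF F])
qed

lemma F_proj: "F s (F s v) = F s v"
 by(rule orth_projectionD[OF orth_projection_F])

lemma F_fix_le:
 assumes "F s v = v" shows "inner (D v) v <= s * inner (C v) v"
proof (cases "s < 0")
 case True
 hence "v = 0" using assms by(simp add: F_def)
 thus ?thesis by simp
next
 case False
 hence "neg_proj (D - s *\<^sub>R C) v = v" using assms by(simp add: F_def)
 from neg_proj_fix[OF symm_T this] show ?thesis by(simp add: blin_simps inner_diff_left)
qed

lemma F_zero_ge:
 assumes "F s v = 0" "0 <= s"
 shows "s * inner (C v) v <= inner (D v) v" and "inner (D v) v = s * inner (C v) v ==> v = 0"
proof -
 have "neg_proj (D - s *\<^sub>R C) v = 0" using assms by(simp add: F_def)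
 from neg_proj_zero[OF symm_T this] show "s * inner (C v) v <= inner (D v) v"
  "inner (D v) v = s * inner (C v) v ==> v = 0"
  by(simp_all add: blin_simps inner_diff_left)
qed

text \<open>A vector in the range of F s and the kernel of F t satisfies opposite form inequalities,
  and on the kernel of F t equality occurs only at 0. The same strictness yields right
  continuity.\<close>

lemma F_mono:
 assumes "s <= t" "F s v = v" shows "F t v = v"
proof (cases "s < 0")
 case True
 hence "v = 0" using assms by(simp add: F_def)
 thus ?thesis by(simp)
next
 case False
 define w where "w = v - F t v"
 have 1: "F s w = w" by(simp add: w_def blin_simps FF[of s t] assms)
 have 2: "F t w = 0" by(simp add: w_def blin_simps F_proj)
 have "inner (D w) w <= s * inner (C w) w" by(rule F_fix_le[OF 1])
 also have "... <= t * inner (C w) w" using assms(1) psdD[OF psd_C] by(rule mult_right_mono)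
 finally have "w = 0" using F_zero_ge[OF 2] False assms(1) by force
 thus ?thesis by(simp add: w_def)
qed

lemma F_right_cont:
 assumes "!!n::nat. F (s + 1 / real (Suc n)) v = v" "0 <= s" shows "F s v = v"
proof -
 define w where "w = v - F s v"
 have 2: "F s w = 0" by(simp add: w_def blin_simps F_proj)
 have "F (s + 1 / real (Suc n)) w = w" for n
  by(simp only: w_def blin_simps FF[of _ s] assms)
 hence "inner (D w) w <= (s + 1 / real (Suc n)) * inner (C w) w" for n by(rule F_fix_le)
 moreover have "(%n. (s + 1 / real (Suc n)) * inner (C w) w) ----> (s + 0) * inner (C w) w"
  by(intro tendsto_intros LIMSEQ_Suc lim_1_over_n)
 ultimately have "inner (D w) w <= (s + 0) * inner (C w) w" by(intro LIMSEQ_le_const) auto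
 hence "w = 0" using F_zero_ge[OF 2 assms(2)] by simp
 thus ?thesis by(simp add: w_def)
qed

lemma F_exhaust:
 assumes "!!n::nat. F (real n) v = 0" shows "v = 0"
proof -
 have "real n * inner (C v) v <= inner (D v) v" for n using F_zero_ge(1)[OF assms] by simp
 hence "inner (C v) v <= 0"
  by(meson linorder_not_less reals_Archimedean3 order_less_le_trans)
 hence "inner (C v) v = 0" using psdD[OF psd_C, of v] by simp
 thus ?thesis using psd_zero_vector[OF psd_C] C_inj by blast
qed

text \<open>On the range of F s the operator (sC - D)(sC + D) is nonnegative, so |D u| <= s |C u|.
  With C^2 + D^2 = 1 this bounds C below there, so C is invertible on that range and the range lies
  in the domain.\<close>

lemma quot_F_bounded:
 assumes "F s v = v"
 obtains w where "(v, w) : quot" "norm w <= s * norm v" "inner w v <= s * (norm v)^2" "F s w = w"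
proof (cases "s < 0")
 case True
 hence "v = 0" using assms by(simp add: F_def)
 moreover have "(0, 0) : quot" using subspace_0[OF subspace_quot] by(simp add: zero_prod_def)
 ultimately show ?thesis by(intro that[of 0]) (simp_all)
next
 case False
 hence s: "0 <= s" by simp
 define A where "A = (s *\<^sub>R C - D) oL F s"
 have comC: "commutes C (s *\<^sub>R C - D)" "commutes C (F s)"
  and comD: "commutes D (s *\<^sub>R C - D)" "commutes D (F s)"
  and comF: "commutes (s *\<^sub>R C - D) (F s)"
  by(simp_all add: commutes_iff blin_simps FC FD CD')
 have A: "psd A" unfolding A_def
 proof (intro psd_compression symm_diff symm_scale psd_symm psd_C psd_D orth_projection_F comF)
  show "0 <= inner ((s *\<^sub>R C - D) u) u" if "F s u = u" for u
   using F_fix_le[OF that] by(simp add: blin_simps inner_diff_left)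
 qed
 have AC: "commutes A C" "commutes A D"
  unfolding A_def by(simp_all add: commutes_iff blin_simps FC FD CD')
 have AD': "commutes A (s *\<^sub>R C + D)" using AC by(intro commutes_add commutes_scale)
 have PD: "psd (s *\<^sub>R C + D)" using s by(intro psd_add psd_scale psd_C psd_D)
 have nD: "norm (D u) <= s * norm (C u)" if "F s u = u" for u
 proof -
  have "0 <= inner (A ((s *\<^sub>R C + D) u)) u" using psdD[OF psd_compose[OF A PD AD'], of u] by simp
  also have "... = inner ((s *\<^sub>R C + D) (A u)) u" by(simp only: commutesD[OF AD'])
  also have "A u = s *\<^sub>R C u - D u" by(simp add: A_def that blin_simps)
  also have "inner ((s *\<^sub>R C + D) (s *\<^sub>R C u - D u)) u = s^2 * inner (C u) (C u) - inner (D u) (D u)"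
   by(simp add: blin_simps inner_add_left inner_diff_left CD' power2_eq_square C_symm D_symm algebra_simps)
  finally have "(norm (D u))^2 <= (s * norm (C u))^2" by(simp add: power2_norm_eq_inner power_mult_distrib)
  thus ?thesis by(rule power2_le_imp_le) (use s in simp)
 qed
 \<comment> \<open>From |u|^2 = |C u|^2 + |D u|^2 <= (1 + s^2) |C u|^2.\<close>
 define c where "c = 1 / sqrt (1 + s^2)"
 have c: "c > 0" "c <= 1" by(auto simp: c_def add_pos_nonneg)
 have c2: "c^2 * (1 + s^2) = 1" by(simp add: c_def power_divide add_nonneg_eq_0_iff)
 have nC: "c * norm u <= norm (C u)" if "F s u = u" for u
 proof -
  have "(norm u)^2 <= (norm (C u))^2 + (s * norm (C u))^2"
   using norm_CD[of u] power_mono[OF nD[OF that], of 2] by simp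
  hence "c^2 * (norm u)^2 <= c^2 * ((1 + s^2) * (norm (C u))^2)"
   by(intro mult_left_mono) (auto simp: algebra_simps power_mult_distrib)
  also have "... = (norm (C u))^2" using c2 by(simp flip: mult.assoc)
  finally have "(c * norm u)^2 <= (norm (C u))^2" by(simp add: power_mult_distrib)
  thus ?thesis by(rule power2_le_imp_le) simp
 qed
 obtain K :: "'a bop" where K: "!!u. C (K (F s u)) = F s u" "!!U. commutes U C ==> commutes U (F s) ==> commutes U K"
  using compression_invertible[OF psd_symm[OF psd_C] orth_projection_F commutes_sym[OF comC(2)] c(1) nC] by blast
 define u where "u = K v"
 have z: "F s u = u" "C u = v"
  using commutesD[OF K(2)[OF commutes_sym[OF comC(2)] commutes_self], of v] K(1)[of v] by(simp_all add: u_def assms)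
 show ?thesis
 proof (rule that[of "D u"])
  show "(v, D u) : quot" using z unfolding quot_def by blast
  show n: "norm (D u) <= s * norm v" using nD[OF z(1)] z(2) by simp
  have "inner (D u) v <= norm (D u) * norm v" by(rule norm_cauchy_schwarz)
  also have "... <= (s * norm v) * norm v" by(intro mult_right_mono n) auto
  finally show "inner (D u) v <= s * (norm v)^2" by(simp add: power2_eq_square)
  show "F s (D u) = D u" by(simp add: FD z)
 qed
qed

text \<open>The counterpart on the kernel of F s, for norms and for forms. The equality cases
  matter: the tail belongs to an open half-line, and the later minimality arguments rest on this
  strictness.\<close>

lemma quot_F_unbounded:
 assumes "F s v = 0" "(v, w) : quot" "0 <= s"
 shows "s * norm v <= norm w" "s * norm v = norm w ==> v = 0"
  "s * (norm v)^2 <= inner w v" "inner w v = s * (norm v)^2 ==> v = 0"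
proof -
 obtain u where z: "v = C u" "w = D u" using assms(2) by(auto simp: quot_def)
 have Fz: "F s u = 0" using assms(1) C_inj by(simp add: z FC)
 define G where "G = id_blinfun - F s"
 define A where "A = (D - s *\<^sub>R C) oL G"
 have comC: "commutes C (D - s *\<^sub>R C)" "commutes C G"
  and comD: "commutes D (D - s *\<^sub>R C)" "commutes D G"
  and comG: "commutes (D - s *\<^sub>R C) G"
  by(simp_all add: G_def commutes_iff blin_simps FC FD CD' scaleR_diff_right)
 have G: "orth_projection G" unfolding G_def by(rule orth_projection_compl[OF orth_projection_F])
 have FG: "F s (G t) = 0" for t by(simp add: G_def blin_simps F_proj)
 have A: "psd A" unfolding A_def
 proof (intro psd_compression symm_T G comG)
  show "0 <= inner ((D - s *\<^sub>R C) t) t" if "G t = t" for t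
   using F_zero_ge(1)[OF FG assms(3), of t] by(simp add: that blin_simps inner_diff_left)
 qed
 have strict: "t = 0" if "inner (A t) t = 0" "F s t = 0" for t
 proof -
  have "G t = t" using that(2) by(simp add: G_def blin_simps)
  thus ?thesis using F_zero_ge(2)[OF that(2) assms(3)] that(1) by(simp add: A_def blin_simps inner_diff_left)
 qed
 have AC: "commutes A C" "commutes A D" "commutes (F s) C" "commutes (F s) D"
  unfolding A_def G_def by(simp_all add: commutes_iff blin_simps FC FD CD' scaleR_diff_right)
 have AD': "commutes A (s *\<^sub>R C + D)" using AC by(intro commutes_add commutes_scale)
 have PD: "psd (s *\<^sub>R C + D)" using assms(3) by(intro psd_add psd_scale psd_C psd_D)
 have Az: "A u = D u - s *\<^sub>R C u" by(simp add: A_def G_def Fz blin_simps)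
 have n1: "inner (A ((s *\<^sub>R C + D) u)) u = (norm w)^2 - (s * norm v)^2"
 proof -
  have "inner (A ((s *\<^sub>R C + D) u)) u = inner ((s *\<^sub>R C + D) (A u)) u" by(simp only: commutesD[OF AD'])
  also have "... = inner (D u) (D u) - s^2 * inner (C u) (C u)"
   unfolding Az by(simp add: blin_simps inner_add_left inner_diff_left CD' power2_eq_square C_symm D_symm algebra_simps)
  finally show ?thesis by(simp add: power2_norm_eq_inner power_mult_distrib z)
 qed
 have n2: "inner (A (C u)) u = inner w v - s * (norm v)^2"
 proof -
  have "inner (A (C u)) u = inner (C (A u)) u" by(simp only: commutesD[OF AC(1)])
  thus ?thesis by(simp add: C_symm Az z inner_diff_left power2_norm_eq_inner)
 qed
 have "0 <= inner (A ((s *\<^sub>R C + D) u)) u"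
  using psdD[OF psd_compose[OF A PD AD'], of u] by(simp only: blinfun_apply_blinfun_compose)
 hence "(s * norm v)^2 <= (norm w)^2" unfolding n1 by simp
 thus "s * norm v <= norm w" by(rule power2_le_imp_le) simp
 show "s * (norm v)^2 <= inner w v"
  using psdD[OF psd_compose[OF A psd_C AC(1)], of u] n2 by simp
 show "v = 0" if "inner w v = s * (norm v)^2"
 proof -
  have "inner (A (C u)) u = 0" using that n2 by simp
  from psd_compose_eq_0[OF A psd_C AC(1) this]
  have "op_sqrt C u = 0"
   by(rule strict) (simp add: commutesD[OF commutes_op_sqrt[OF psd_C AC(3)]] Fz)
  thus ?thesis using op_sqrt_apply[OF psd_C, of u] by(simp add: z)
 qed
 show "v = 0" if "s * norm v = norm w"
 proof -
  let ?P = "s *\<^sub>R C + D"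
  have FP: "commutes (F s) ?P" using AC by(intro commutes_add commutes_scale)
  have "inner (A (?P u)) u = 0" using that n1 by simp
  from psd_compose_eq_0[OF A PD AD' this]
  have "op_sqrt ?P u = 0"
   by(rule strict) (simp add: commutesD[OF commutes_op_sqrt[OF PD FP]] Fz)
  \<comment> \<open>Then D u = - s C u; both forms being nonnegative, they vanish, and the strict
    inequality for F applies.\<close>
  hence "?P u = 0" using op_sqrt_apply[OF PD, of u] by(simp)
  hence "D u = - (s *\<^sub>R C u)" by(simp add: blin_simps add_eq_0_iff)
  hence "inner (D u) u = - (s * inner (C u) u)" by simp
  moreover have "0 <= s * inner (C u) u" "0 <= inner (D u) u" using assms(3) psdD[OF psd_C] psdD[OF psd_D] by auto
  ultimately have "inner (D u) u = s * inner (C u) u" by linarith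
  hence "u = 0" using F_zero_ge(2)[OF Fz assms(3)] by blast
  thus ?thesis by(simp add: z)
 qed
qed

end

section \<open>Projection-valued measures\<close>

lemma projection_eq_iff_fix:
 fixes P Q :: "'a::{real_inner,complete_space} bop"
 assumes P: "orth_projection P" and Q: "orth_projection Q" and eq: "!!v. P v = v \<longleftrightarrow> Q v = v"
 shows "P = Q"
proof -
 have "Q oL P = P" using projection_le_iff(2)[OF P Q] eq by simp
 moreover have "P oL Q = Q" using projection_le_iff(2)[OF Q P] eq by simp
 ultimately show ?thesis using projection_le_iff(3)[OF P Q] by simp
qed

lemma projection_sum_orthogonal:
 fixes P Q :: "'a::{real_inner,complete_space} bop"
 assumes P: "orth_projection P" and Q: "orth_projection Q" and z: "!!v. P (Q v) = 0"
 shows "orth_projection (P + Q)" "!!v. Q (P v) = 0"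
  "!!v. (norm (P v + Q v))^2 = (norm (P v))^2 + (norm (Q v))^2"
proof -
 have z': "Q (P v) = 0" for v
 proof (rule inner_ext_right)
  fix w
  have "inner w (Q (P v)) = inner (P (Q w)) v"
   using symmD[OF orth_projectionD(2)[OF P], of "Q w" v] symmD[OF orth_projectionD(2)[OF Q], of w "P v"] by simp
  thus "inner w (Q (P v)) = inner w 0" by(simp add: z)
 qed
 thus "!!v. Q (P v) = 0" .
 show "orth_projection (P + Q)"
  by(rule orth_projectionI) (simp_all add: symm_add orth_projectionD P Q blin_simps z z')
 show "(norm (P v + Q v))^2 = (norm (P v))^2 + (norm (Q v))^2" for v
 proof -
  have "inner (P v) (Q v) = inner v (P (Q v))" by(rule symmD[OF orth_projectionD(2)[OF P]])
  thus ?thesis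
   by(simp add: power2_norm_eq_inner inner_add_left inner_add_right inner_commute z)
 qed
qed

lemma orthogonal_projections_sum:
 fixes P :: "nat => ('a::{real_inner,complete_space} bop)"
 assumes P: "!!n. orth_projection (P n)" and orth: "!!m n v. m ~= n ==> P m (P n v) = 0"
 obtains Q where "orth_projection Q" "!!v. (%n. P n v) sums Q v"
  "!!v. (%n. (norm (P n v))^2) sums (norm (Q v))^2"
proof -
 define S where "S n = (\<Sum>i<n. P i)" for n
 have SP: "S m (P n v) = 0" if "m <= n" for m n v
  using that by(induction m) (auto simp: S_def orth blin_simps)
 have S: "orth_projection (S n) & (ALL v. (norm (S n v))^2 = (\<Sum>i<n. (norm (P i v))^2))" for n
 proof (induction n)
  case (Suc n)
  have "S (Suc n) = S n + P n" by(simp add: S_def)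
  with Suc projection_sum_orthogonal[OF conjunct1[OF Suc] P[of n] SP[OF order_refl]]
  show ?case by(simp add: blin_simps)
 qed (simp add: S_def)
 have mono: "S (Suc n) v = v" if "S n v = v" for n v
 proof -
  have "P n (S n v) = 0"
   by(rule projection_sum_orthogonal(2)[OF conjunct1[OF S] P SP[OF order_refl]])
  hence "P n v = 0" using that by simp
  thus ?thesis using that by(simp add: S_def blin_simps)
 qed
 obtain Q where Q: "orth_projection Q" "!!v. (%n. S n v) ----> Q v"
  by(rule increasing_projections_converge[of S]) (use S mono in auto)
 show ?thesis
 proof (rule that[OF Q(1)])
  fix v
  have "S n v = (\<Sum>i<n. P i v)" for n by(induction n) (auto simp: S_def blin_simps)
  thus "(%n. P n v) sums Q v" using Q(2)[of v] by(simp add: sums_def)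
  have "(%n. (norm (S n v))^2) ----> (norm (Q v))^2" by(intro tendsto_intros Q)
  thus "(%n. (norm (P n v))^2) sums (norm (Q v))^2" using S by(simp add: sums_def)
 qed
qed

text \<open>Right continuity and exhaustion are assumed only as statements about fixed and killed
  vectors; strong limits follow because monotone sequences of projections converge.\<close>

locale spectral_family =
 fixes F :: "real => ('a::{real_inner,banach} bop)"
 assumes proj: "orth_projection (F s)"
  and mono: "s <= t ==> F s \<xi> = \<xi> ==> F t \<xi> = \<xi>"
  and right_cont: "(!!n::nat. F (s + 1 / real (Suc n)) \<xi> = \<xi>) ==> F s \<xi> = \<xi>"
  and neg: "s < 0 ==> F s = 0"
  and exhaust: "(!!n::nat. F (real n) \<xi> = 0) ==> \<xi> = 0"
begin

lemma F_le: "s <= t ==> F s (F t v) = F s v" and F_le': "s <= t ==> F t (F s v) = F s v"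
proof -
 assume st: "s <= t"
 hence 1: "F t oL F s = F s" using projection_le_iff(2)[OF proj[of s] proj[of t]] mono by blast
 hence 2: "F s oL F t = F s" using projection_le_iff(3)[OF proj[of s] proj[of t]] by simp
 show "F t (F s v) = F s v" using arg_cong[OF 1, of "%A. blinfun_apply A v"] by simp
 show "F s (F t v) = F s v" using arg_cong[OF 2, of "%A. blinfun_apply A v"] by simp
qed

definition cdf_at :: "'a => real => real" where "cdf_at v s = (norm (F s v))^2"

lemma cdf_at_mono: "s <= t ==> cdf_at v s <= cdf_at v t"
 unfolding cdf_at_def using norm_orth_projection_le[OF proj[of s], of "F t v"] F_le[of s t v]
 by(simp add: power_mono)

lemma F_right_limit: "(%n. F (s + 1 / real (Suc n)) v) ----> F s v"
proof -
 have dec: "F (s + 1 / real (Suc (Suc n))) w = 0" if "F (s + 1 / real (Suc n)) w = 0" for n w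
 proof -
  have "F (s + 1 / real (Suc (Suc n))) (F (s + 1 / real (Suc n)) w) = F (s + 1 / real (Suc (Suc n))) w"
   by(rule F_le) (simp add: field_simps)
  thus ?thesis unfolding that blinfun.zero_right by(rule sym)
 qed
 obtain Q where Q: "orth_projection Q" "!!v. (%n. F (s + 1 / real (Suc n)) v) ----> Q v"
  "!!v. Q v = v \<longleftrightarrow> (ALL n. F (s + 1 / real (Suc n)) v = v)"
  by(rule decreasing_projections_converge[of "%n. F (s + 1 / real (Suc n))"]) (use proj dec in auto)
 have "Q = F s"
 proof (rule projection_eq_iff_fix[OF Q(1) proj])
  fix v
  have "F (s + 1 / real (Suc n)) v = v" if "F s v = v" for n by(rule mono[OF _ that]) simp
  thus "Q v = v \<longleftrightarrow> F s v = v" using Q(3)[of v] right_cont[of s v] by blast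
 qed
 thus ?thesis using Q(2) by simp
qed

lemma F_top_limit: "(%n. F (real n) v) ----> v"
proof -
 have step: "F (real (Suc n)) w = w" if "F (real n) w = w" for n w
  by(rule mono[OF _ that]) simp
 obtain Q where Q: "orth_projection Q" "!!v. (%n. F (real n) v) ----> Q v"
  "!!v. Q v = 0 \<longleftrightarrow> (ALL n. F (real n) v = 0)"
  by(rule increasing_projections_converge[of "%n. F (real n)"]) (rule proj, erule step, blast)
 have "Q = id_blinfun"
  by(rule projection_eq_iff_ker[OF Q(1) orth_projection_id]) (use Q(3) exhaust in "auto simp:")
 thus ?thesis using Q(2)[of v] by simp
qed

lemma cdf_at_right_cont: "continuous (at_right s) (cdf_at v)"
 unfolding continuous_within
proof (rule order_tendstoI)
 fix a assume "a < cdf_at v s"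
 hence "a < cdf_at v t" if "t > s" for t using cdf_at_mono[of s t v] that by simp
 thus "eventually (%t. a < cdf_at v t) (at_right s)"
  by(auto simp: eventually_at_right_field intro: exI[of _ "s + 1"])
next
 fix a assume a: "cdf_at v s < a"
 have "(%n. cdf_at v (s + 1 / real (Suc n))) ----> cdf_at v s"
  unfolding cdf_at_def by(intro tendsto_intros F_right_limit)
 from order_tendstoD(2)[OF this a] obtain n where n: "cdf_at v (s + 1 / real (Suc n)) < a"
  by(auto simp: eventually_sequentially)
 have "cdf_at v t < a" if "t < s + 1 / real (Suc n)" for t
  using cdf_at_mono[of t "s + 1 / real (Suc n)" v] that n by linarith
 thus "eventually (%t. cdf_at v t < a) (at_right s)"
  by(auto simp: eventually_at_right_field intro!: exI[of _ "s + 1 / real (Suc n)"])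
qed

lemma cdf_at_bot: "(cdf_at v \<longlongrightarrow> 0) at_bot"
proof (rule tendsto_eventually)
 show "eventually (%s. cdf_at v s = 0) at_bot"
  using eventually_gt_at_bot[of "0::real"] eventually_at_bot_linorder[of "%s. cdf_at v s = 0"]
  by(auto simp: cdf_at_def neg intro!: exI[of _ "-1::real"])
qed

definition meas_at :: "'a => real measure" where "meas_at v = interval_measure (cdf_at v)"

lemma sets_meas_at [simp, measurable_cong]: "sets (meas_at v) = sets borel"
 and space_meas_at [simp]: "space (meas_at v) = UNIV"
 by(simp_all add: meas_at_def)

lemma emeasure_meas_at_atMost: "emeasure (meas_at v) {..s} = ennreal ((norm (F s v))^2)"
 unfolding meas_at_def
 by(subst emeasure_interval_measure_Iic) (simp_all add: cdf_at_mono cdf_at_right_cont cdf_at_bot, simp add: cdf_at_def)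

lemma emeasure_meas_at_UNIV: "emeasure (meas_at v) UNIV = ennreal ((norm v)^2)"
proof -
 have "(%n. emeasure (meas_at v) {..real n}) ----> emeasure (meas_at v) (\<Union>n. {..real n})"
  by(rule Lim_emeasure_incseq) (auto simp: incseq_def)
 moreover have "(\<Union>n. {..real n}) = UNIV" by(auto intro: real_arch_simple)
 moreover have "(%n. ennreal ((norm (F (real n) v))^2)) ----> ennreal ((norm v)^2)"
  by(intro tendsto_intros F_top_limit)
 ultimately show ?thesis unfolding emeasure_meas_at_atMost by(metis LIMSEQ_unique)
qed

lemma finite_meas_at: "emeasure (meas_at v) S ~= \<infinity>"
proof -
 have "emeasure (meas_at v) S <= emeasure (meas_at v) UNIV" using emeasure_space[of "meas_at v" S] by simp
 thus ?thesis by(auto simp: emeasure_meas_at_UNIV top_unique)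
qed

text \<open>Tested on w = Q v, the set T already carries the whole mass |w|^2, so nothing is left
  for S.\<close>

lemma emeasure_disjoint_orthogonal:
 fixes P Q :: "'a bop"
 assumes PQ: "orth_projection P" "orth_projection Q" and ST: "S : sets borel" "T : sets borel" "S \<inter> T = {}"
  and P: "!!v. emeasure (meas_at v) S = ennreal ((norm (P v))^2)"
  and Q: "!!v. emeasure (meas_at v) T = ennreal ((norm (Q v))^2)"
 shows "P (Q v) = 0"
proof -
 let ?w = "Q v"
 have "ennreal ((norm (P ?w))^2 + (norm (Q ?w))^2) = emeasure (meas_at ?w) (S \<union> T)"
  using ST by(simp add: plus_emeasure[symmetric] P Q)
 also have "... <= emeasure (meas_at ?w) UNIV" using ST by(intro emeasure_mono) auto
 finally have "(norm (P ?w))^2 + (norm (Q ?w))^2 <= (norm ?w)^2"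
  by(simp add: emeasure_meas_at_UNIV ennreal_plus[symmetric] del: ennreal_plus)
 thus ?thesis by(simp add: orth_projectionD(1)[OF PQ(2)])
qed

text \<open>Additivity of the scalar measures makes the projections of disjoint sets orthogonal, so the
 sets admitting a projection form a Dynkin system.\<close>

lemma projection_of_borel_exists:
 assumes "S : sets borel"
 shows "EX P. orth_projection P & (ALL v. emeasure (meas_at v) S = ennreal ((norm (P v))^2)) &
  (ALL U::'a bop. (ALL s. commutes U (F s)) --> commutes U P)"
proof -
 have bs: "sets borel = sigma_sets UNIV (range (%a::real. {..a}))" by(simp add: borel_eq_atMost)
 have ist: "Int_stable (range (%a::real. {..a}))" by(auto simp: Int_stable_def)
 have sub: "range (%a::real. {..a}) \<subseteq> Pow UNIV" by simp
 have "S : sigma_sets UNIV (range (%a::real. {..a}))" using assms bs by simp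
 with ist sub show ?thesis
 proof (induction rule: sigma_sets_induct_disjoint)
  case (basic A)
  then obtain s where "A = {..s}" by blast
  thus ?case using proj[of s] by(intro exI[of _ "F s"]) (simp add: emeasure_meas_at_atMost)
 next
  case empty
  show ?case by(intro exI[of _ 0]) (simp add: commutes_iff)
 next
  case (compl A)
  then obtain P where P: "orth_projection P" "!!v. emeasure (meas_at v) A = ennreal ((norm (P v))^2)"
   "!!U::'a bop. (ALL s. commutes U (F s)) ==> commutes U P" by blast
  have A: "A : sets borel" using compl by(simp add: bs)
  have "emeasure (meas_at v) (UNIV - A) = ennreal ((norm (v - P v))^2)" for v
  proof -
   have "emeasure (meas_at v) (space (meas_at v) - A) = emeasure (meas_at v) (space (meas_at v)) - emeasure (meas_at v) A"
    by(rule emeasure_compl) (use A finite_meas_at in auto)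
   thus ?thesis using orth_projection_pythagoras[OF P(1), of v]
    by(simp add: emeasure_meas_at_UNIV P(2) ennreal_minus)
  qed
  thus ?case
   using P(1) P(3) by(intro exI[of _ "id_blinfun - P"] conjI allI impI orth_projection_compl commutes_diff commutes_id)
    (auto simp: blin_simps)
 next
  case (union A)
  hence "ALL i. EX P. orth_projection P & (ALL v. emeasure (meas_at v) (A i) = ennreal ((norm (P v))^2)) &
   (ALL U::'a bop. (ALL s. commutes U (F s)) --> commutes U P)" by blast
  from choice[OF this] obtain P where P: "!!i. orth_projection (P i)"
   "!!i v. emeasure (meas_at v) (A i) = ennreal ((norm (P i v))^2)"
   "!!i (U::'a bop). (ALL s. commutes U (F s)) ==> commutes U (P i)" by blast
  have A: "A i : sets borel" for i using union by(auto simp: bs)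
  have orth: "P m (P n v) = 0" if "m ~= n" for m n v
   by(rule emeasure_disjoint_orthogonal[OF P(1) P(1) A A _ P(2) P(2)])
    (use union(1) that in "auto simp: disjoint_family_on_def")
  obtain Q where Q: "orth_projection Q" "!!v. (%n. P n v) sums Q v"
   "!!v. (%n. (norm (P n v))^2) sums (norm (Q v))^2"
   by(rule orthogonal_projections_sum[of P]) (use P(1) orth in auto)
  have "emeasure (meas_at v) (\<Union>i. A i) = ennreal ((norm (Q v))^2)" for v
  proof -
   have "emeasure (meas_at v) (\<Union>i. A i) = (\<Sum>i. emeasure (meas_at v) (A i))"
    by(rule suminf_emeasure[symmetric]) (use A union(1) in auto)
   also have "... = (\<Sum>i. ennreal ((norm (P i v))^2))" by(simp add: P(2))
   also have "... = ennreal ((norm (Q v))^2)" by(rule suminf_ennreal_eq[OF _ Q(3)]) simp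
   finally show ?thesis .
  qed
  moreover have "commutes U Q" if U: "ALL s. commutes U (F s)" for U :: "'a bop"
  proof (rule commutesI)
   fix v
   have "(%n. U (P n v)) sums U (Q v)" by(rule bounded_linear.sums[OF blinfun.bounded_linear_right Q(2)])
   moreover have "U (P n v) = P n (U v)" for n by(rule commutesD[OF P(3)[OF U]])
   ultimately have "(%n. P n (U v)) sums U (Q v)" by simp
   thus "U (Q v) = Q (U v)" by(rule sums_unique2[OF _ Q(2)])
  qed
  ultimately show ?case using Q(1) by(intro exI[of _ Q] conjI allI impI) auto
 qed
qed

definition pvm :: "real set => ('a bop)" where
 "pvm S = (if S : sets borel then SOME P. orth_projection P &
   (ALL v. emeasure (meas_at v) S = ennreal ((norm (P v))^2)) &
   (ALL U::'a bop. (ALL s. commutes U (F s)) --> commutes U P) else 0)"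

lemma pvm:
 assumes "S : sets borel"
 shows orth_projection_pvm: "orth_projection (pvm S)"
  and emeasure_meas_at: "emeasure (meas_at v) S = ennreal ((norm (pvm S v))^2)"
  and commutes_pvm: "(!!s. commutes U (F s)) ==> commutes U (pvm S)"
proof -
 have *: "orth_projection (pvm S) & (ALL v. emeasure (meas_at v) S = ennreal ((norm (pvm S v))^2)) &
   (ALL U::'a bop. (ALL s. commutes U (F s)) --> commutes U (pvm S))"
  unfolding pvm_def if_P[OF assms] by(rule someI_ex[OF projection_of_borel_exists[OF assms]])
 show "orth_projection (pvm S)" using * by simp
 show "emeasure (meas_at v) S = ennreal ((norm (pvm S v))^2)" using * by simp
 show "commutes U (pvm S)" if "!!s. commutes U (F s)" using * that by simp
qed

lemma pvm_unique:
 assumes "S : sets borel" "orth_projection P" "!!v. emeasure (meas_at v) S = ennreal ((norm (P v))^2)"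
 shows "pvm S = P"
proof (rule projection_eq_iff_norm[OF orth_projection_pvm[OF assms(1)] assms(2)])
 fix v
 have "(norm (pvm S v))^2 = (norm (P v))^2" using assms(3)[of v] emeasure_meas_at[OF assms(1), of v] by simp
 thus "norm (pvm S v) = norm (P v)" by(simp only: power2_eq_iff_nonneg norm_ge_zero)
qed

lemma pvm_atMost: "pvm {..s} = F s"
 by(rule pvm_unique) (simp_all add: proj emeasure_meas_at_atMost)

lemma pvm_UNIV: "pvm UNIV = id_blinfun"
 by(rule pvm_unique) (simp_all add: emeasure_meas_at_UNIV)

lemma pvm_orthogonal:
 assumes "S : sets borel" "T : sets borel" "S \<inter> T = {}"
 shows "pvm S (pvm T v) = 0"
 by(rule emeasure_disjoint_orthogonal[OF orth_projection_pvm orth_projection_pvm assms emeasure_meas_at emeasure_meas_at])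
  (rule assms)+

lemma pvm_Un:
 assumes "S : sets borel" "T : sets borel" "S \<inter> T = {}"
 shows "pvm (S \<union> T) = pvm S + pvm T"
proof (rule pvm_unique)
 note o = projection_sum_orthogonal[OF orth_projection_pvm orth_projection_pvm pvm_orthogonal, OF assms(1,2) assms]
 show "orth_projection (pvm S + pvm T)" by(rule o(1))
 show "emeasure (meas_at v) (S \<union> T) = ennreal ((norm ((pvm S + pvm T) v))^2)" for v
  using assms by(simp add: plus_emeasure[symmetric] emeasure_meas_at blin_simps o(3))
qed (use assms in auto)

lemma pvm_Int:
 assumes "S : sets borel" "T : sets borel"
 shows "pvm (S \<inter> T) = pvm S oL pvm T"
proof (rule blinfun_eqI)
 fix v
 have b: "S \<inter> T : sets borel" "S - T : sets borel" "T - S : sets borel" using assms by auto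
 have S: "pvm S = pvm (S \<inter> T) + pvm (S - T)"
  using pvm_Un[OF b(1,2)] by(simp add: Int_Diff_Un Int_Diff_disjoint)
 have T: "pvm T = pvm (S \<inter> T) + pvm (T - S)"
  using pvm_Un[OF b(1,3)] by(simp add: Int_commute[of S T] Int_Diff_Un Int_Diff_disjoint)
 have z: "pvm (S \<inter> T) (pvm (T - S) w) = 0" "pvm (S - T) (pvm (S \<inter> T) w) = 0" "pvm (S - T) (pvm (T - S) w) = 0" for w
  by(rule pvm_orthogonal; use b in auto)+
 have "(pvm S oL pvm T) v = pvm (S \<inter> T) (pvm (S \<inter> T) v)"
  by(simp add: S T blin_simps z)
 thus "pvm (S \<inter> T) v = (pvm S oL pvm T) v" by(simp add: orth_projectionD(1)[OF orth_projection_pvm[OF b(1)]])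
qed

lemma pvm_sums:
 assumes "range S \<subseteq> sets borel" "disjoint_family S"
 shows "(%n. pvm (S n) v) sums pvm (\<Union>n. S n) v"
proof -
 have S: "S n : sets borel" for n using assms(1) by auto
 have U: "(\<Union>n. S n) : sets borel" using S by auto
 obtain Q where Q: "orth_projection Q" "!!v. (%n. pvm (S n) v) sums Q v"
  "!!v. (%n. (norm (pvm (S n) v))^2) sums (norm (Q v))^2"
 proof (rule orthogonal_projections_sum[of "%n. pvm (S n)"])
  show "pvm (S m) (pvm (S n) v) = 0" if "m ~= n" for m n v
   by(rule pvm_orthogonal[OF S S]) (use assms(2) that in "auto simp: disjoint_family_on_def")
 qed (auto intro: orth_projection_pvm S)
 have "pvm (\<Union>n. S n) = Q"
 proof (rule pvm_unique[OF U Q(1)])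
  fix v
  have "emeasure (meas_at v) (\<Union>i. S i) = (\<Sum>i. emeasure (meas_at v) (S i))"
   by(rule suminf_emeasure[symmetric]) (use S assms(2) in auto)
  also have "... = (\<Sum>i. ennreal ((norm (pvm (S i) v))^2))" by(simp add: emeasure_meas_at[OF S])
  also have "... = ennreal ((norm (Q v))^2)" by(rule suminf_ennreal_eq[OF _ Q(3)]) simp
  finally show "emeasure (meas_at v) (\<Union>i. S i) = ennreal ((norm (Q v))^2)" .
 qed
 thus ?thesis using Q(2) by simp
qed

end

lemma (in cd_pair) spectral_family_F: "spectral_family F"
proof
 show "F s v = v" if h: "!!n::nat. F (s + 1 / real (Suc n)) v = v" for s v
 proof (cases "s < 0")
  case True
  \<comment> \<open>Below 0 a whole right neighbourhood of s stays negative, where the family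
    vanishes.\<close>
  then obtain n where "1 / real (Suc n) < - s" using reals_Archimedean[of "-s"] by(auto simp: inverse_eq_divide)
  hence "F (s + 1 / real (Suc n)) = 0" by(simp add: F_def)
  hence "v = 0" using h[of n] by simp
  thus ?thesis by(simp)
 qed (use F_right_cont h in auto)
 show "F t v = v" if "s <= t" "F s v = v" for s t v by(rule F_mono[OF that])
 show "v = 0" if "!!n::nat. F (real n) v = 0" for v by(rule F_exhaust[OF that])
 show "orth_projection (F s)" for s by(rule orth_projection_F)
 show "F s = 0" if "s < 0" for s using that by(simp add: F_def)
qed

sublocale cd_pair \<subseteq> sf: spectral_family F
 by(rule spectral_family_F)


section \<open>Complex structure\<close>

lemma cinner_scaleC_right: "cinner v (c *\<^sub>C w) = cnj c * cinner v w"
 by(metis cinner_commute cinner_scaleC_left complex_cnj_mult)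

lemma cinner_eq: "cinner v w = Complex (inner v w) (inner v (\<i> *\<^sub>C w))"
 by(simp add: complex_eq_iff inner_cinner cinner_scaleC_right)

lemma inner_scaleC_i: "inner (\<i> *\<^sub>C v) w = - inner v (\<i> *\<^sub>C w)"
 by(simp add: inner_cinner cinner_scaleC_left cinner_scaleC_right)

lemma scaleC_i_i [simp]: "\<i> *\<^sub>C \<i> *\<^sub>C v = - v"
 using scaleR_scaleC[of "-1" v] by(simp add: scaleC_scaleC)

lemma norm_scaleC: "norm (c *\<^sub>C v) = cmod c * norm v"
proof -
 have "inner (c *\<^sub>C v) (c *\<^sub>C v) = Re (c * cnj c * cinner v v)"
  by(simp add: inner_cinner cinner_scaleC_left cinner_scaleC_right algebra_simps)
 also have "... = (cmod c)^2 * inner v v"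
  by(simp add: complex_norm_square[symmetric] inner_cinner Re_power_real flip: of_real_power)
 finally show ?thesis by(simp add: norm_eq_sqrt_inner real_sqrt_mult)
qed

lemma bounded_linear_scaleC: "bounded_linear (%v. c *\<^sub>C (v::'h::complex_hilbert_space))"
proof (rule bounded_linear_intro[where K = "cmod c"])
 show "c *\<^sub>C (r *\<^sub>R v) = r *\<^sub>R (c *\<^sub>C v)" for r and v :: 'h
  by(simp add: scaleR_scaleC scaleC_scaleC mult.commute)
qed (simp_all add: scaleC_add_right norm_scaleC mult.commute)

definition scaleC_op :: "complex => ('h::complex_hilbert_space) bop" where
 "scaleC_op c = Blinfun (%v. c *\<^sub>C v)"

lemma scaleC_op_apply [simp]: "scaleC_op c v = c *\<^sub>C v"
 by(simp add: scaleC_op_def bounded_linear_Blinfun_apply bounded_linear_scaleC)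

lemma scaleC_decompose: "c *\<^sub>C v = Re c *\<^sub>R v + Im c *\<^sub>R (\<i> *\<^sub>C v)"
proof -
 have "c = complex_of_real (Re c) + complex_of_real (Im c) * \<i>" by(simp add: complex_eq_iff)
 hence "c *\<^sub>C v = (complex_of_real (Re c) + complex_of_real (Im c) * \<i>) *\<^sub>C v" by simp
 thus ?thesis by(simp only: scaleC_add_left scaleR_scaleC scaleC_scaleC)
qed

text \<open>Complex linearity becomes one more commutation relation, so every commutation lemma
  proved over the reals also transports complex linearity.\<close>

lemma bounded_ops_iff: "A : bounded_ops \<longleftrightarrow> commutes A (scaleC_op \<i>)"
proof
 assume *: "commutes A (scaleC_op \<i>)"
 have "A (\<i> *\<^sub>C v) = \<i> *\<^sub>C A v" for v using commutesD[OF *, of v] by simp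
 hence "A (c *\<^sub>C v) = c *\<^sub>C A v" for c v
  by(subst (1 2) scaleC_decompose) (simp add: blin_simps)
 thus "A : bounded_ops" by(simp add: bounded_ops_def)
qed (simp add: bounded_ops_def commutes_iff)

lemma bounded_opsD: "A : bounded_ops ==> A (c *\<^sub>C v) = c *\<^sub>C A v"
 by(simp add: bounded_ops_def)

lemma radj_scaleC_i: "radj (scaleC_op \<i>) = - scaleC_op \<i>"
 by(rule radj_unique) (simp add: inner_scaleC_i blin_simps)

lemma radj_bounded_ops: "A : bounded_ops ==> radj A : bounded_ops"
proof -
 assume "A : bounded_ops"
 hence "commutes (radj A) (radj (scaleC_op \<i>))" by(intro commutes_radj) (simp add: bounded_ops_iff)
 hence "commutes (radj A) (- (- scaleC_op \<i>))" unfolding radj_scaleC_i by(rule commutes_minus)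
 thus ?thesis by(simp add: bounded_ops_iff)
qed

lemma adj_eq_radj:
 assumes "A : bounded_ops"
 shows "adj A = radj A"
 unfolding adj_def
proof (rule the_equality)
 show "ALL v w. cinner (A v) w = cinner v (radj A w)"
  by(simp add: cinner_eq radj bounded_opsD[OF radj_bounded_ops[OF assms]])
 show "B = radj A" if "ALL v w. cinner (A v) w = cinner v (blinfun_apply B w)" for B
  by(rule radj_unique[symmetric]) (use that in "simp add: inner_cinner")
qed

lemma is_projection_iff: "is_projection P \<longleftrightarrow> P : bounded_ops & orth_projection P"
 unfolding is_projection_def orth_projection_def symm_radj by(auto simp: adj_eq_radj)

lemma cinner_symm_real:
 assumes "symm A" "A : bounded_ops"
 shows "cinner (A v) v = complex_of_real (inner (A v) v)"
proof -
 have "inner (A v) (\<i> *\<^sub>C v) = - inner (A v) (\<i> *\<^sub>C v)"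
  using symmD[OF assms(1), of v "\<i> *\<^sub>C v"] inner_scaleC_i[of v "A v"]
  by(simp add: bounded_opsD[OF assms(2)] inner_commute)
 thus ?thesis by(simp add: cinner_eq complex_eq_iff)
qed

lemma positive_op_iff: "positive_op A \<longleftrightarrow> A : bounded_ops & psd A"
proof
 assume "A : bounded_ops & psd A"
 thus "positive_op A" by(simp add: positive_op_def cinner_symm_real psd_def)
next
 assume p: "positive_op A"
 hence A: "A : bounded_ops" by(simp add: positive_op_def)
 have im: "inner (A v) (\<i> *\<^sub>C v) = 0" for v
  using p by(auto simp: positive_op_def cinner_eq complex_is_Real_iff)
 have "inner (A v) w = inner v (A w)" for v w
 proof -
  \<comment> \<open>Polarization: the vanishing imaginary part at v - i w forces symmetry of the
    real form.\<close>
  have "inner (A (v - \<i> *\<^sub>C w)) (\<i> *\<^sub>C (v - \<i> *\<^sub>C w)) = 0" by(rule im)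
  moreover have "\<i> *\<^sub>C (v - \<i> *\<^sub>C w) = \<i> *\<^sub>C v + w"
   by(simp add: linear_diff[OF bounded_linear.linear[OF bounded_linear_scaleC]])
  moreover have "inner (A (\<i> *\<^sub>C w)) w = 0"
   using im[of w] by(simp add: bounded_opsD[OF A] inner_scaleC_i)
  ultimately have "inner (A v) w = inner (A (\<i> *\<^sub>C w)) (\<i> *\<^sub>C v)"
   using im[of v] by(simp add: blin_simps inner_diff_left inner_add_right)
  also have "... = inner (A w) v"
   by(simp add: bounded_opsD[OF A] inner_scaleC_i)
  finally show ?thesis by(simp add: inner_commute)
 qed
 moreover have "0 <= inner (A v) v" for v using p by(simp add: positive_op_def cinner_eq)
 ultimately show "A : bounded_ops & psd A" using A by(simp add: psd_def symm_def)
qed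


section \<open>Spectral measures\<close>

lemma projection_valued_measureD:
 assumes "projection_valued_measure E"
 shows "S : sets borel ==> orth_projection (E S)" "S : sets borel ==> E S : bounded_ops"
  "E UNIV = id_blinfun" "S : sets borel ==> T : sets borel ==> E (S \<inter> T) = E S oL E T"
  "range X \<subseteq> sets borel ==> disjoint_family X ==> (%n. E (X n) v) sums E (\<Union>n. X n) v"
  "S \<notin> sets borel ==> E S = 0"
 using assms unfolding projection_valued_measure_def is_projection_iff by simp_all

lemma space_scalar_measure [simp]: "space (scalar_measure E v) = UNIV"
 and sets_scalar_measure [simp, measurable_cong]: "sets (scalar_measure E v) = sets borel"
 by(simp_all add: scalar_measure_def) (metis sets.sigma_sets_eq space_borel)

lemma emeasure_scalar_measure:
 assumes E: "projection_valued_measure E" and S: "S : sets borel"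
 shows "emeasure (scalar_measure E v) S = ennreal ((norm (E S v))^2)"
 unfolding scalar_measure_def
proof (rule emeasure_measure_of_sigma[OF _ _ _ S])
 show "sigma_algebra UNIV (sets (borel :: real measure))"
  using sets.sigma_algebra_axioms[of "borel :: real measure"] by simp
 \<comment> \<open>A constant series converges only if its term is 0, which gives the value at the
   empty set.\<close>
 have "(%n::nat. E {} v) sums E (\<Union>n::nat. {}) v"
  by(rule projection_valued_measureD(5)[OF E]) (auto simp: disjoint_family_on_def)
 hence "(%n::nat. E {} v) ----> 0" by(intro summable_LIMSEQ_zero) (auto simp: sums_iff)
 hence "E {} v = 0" by(simp add: LIMSEQ_const_iff)
 thus "positive (sets borel) (%S. ennreal ((norm (E S v))^2))" by(simp add: positive_def)
 show "countably_additive (sets borel) (%S. ennreal ((norm (E S v))^2))"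
 proof (rule countably_additiveI)
  fix X :: "nat => real set" assume X: "range X \<subseteq> sets borel" "disjoint_family X" "(\<Union>i. X i) : sets borel"
  have "(%n. inner (E (X n) v) v) sums inner (E (\<Union>n. X n) v) v"
   by(rule bounded_linear.sums[OF bounded_linear_inner_left projection_valued_measureD(5)[OF E X(1,2)]])
  moreover have "inner (E (X n) v) v = (norm (E (X n) v))^2" for n
   by(rule orth_projection_inner, rule projection_valued_measureD(1)[OF E]) (use X(1) in auto)
  moreover have "inner (E (\<Union>n. X n) v) v = (norm (E (\<Union>n. X n) v))^2"
   by(rule orth_projection_inner, rule projection_valued_measureD(1)[OF E X(3)])
  ultimately have "(%n. (norm (E (X n) v))^2) sums (norm (E (\<Union>n. X n) v))^2" by simp
  thus "(\<Sum>i. ennreal ((norm (E (X i) v))^2)) = ennreal ((norm (E (\<Union>i. X i) v))^2)"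
   by(intro suminf_ennreal_eq) auto
 qed
qed

lemma finite_measure_scalar_measure:
 "projection_valued_measure E ==> finite_measure (scalar_measure E v)"
 by(rule finite_measureI) (simp add: emeasure_scalar_measure)

text \<open>On each layer of g the measure n exceeds w by at most the width of the layer times y.
  Layers of width h therefore cost at most h times the total mass of y. It is used with n and w in
  either order.\<close>

lemma mass_le_of_layer_bounds:
 fixes y n w :: "real measure" and g :: "real => real"
 assumes sets: "sets y = sets borel" "sets n = sets borel" "sets w = sets borel"
  and fin: "emeasure y UNIV < \<infinity>"
  and g: "g : borel_measurable borel" "!!x. 0 <= g x"
  and lo: "!!u v. 0 <= u ==> u < v ==> ennreal u * emeasure y {x. u < g x & g x <= v} <= emeasure w {x. u < g x & g x <= v}"
  and hi: "!!u v. 0 <= u ==> u < v ==> emeasure n {x. u < g x & g x <= v} <= ennreal v * emeasure y {x. u < g x & g x <= v}"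
  and zero: "emeasure n {x. g x = 0} = 0"
 shows "emeasure n UNIV <= emeasure w UNIV"
proof (rule ennreal_le_epsilon)
 have [measurable_cong]: "sets y = sets borel" "sets n = sets borel" "sets w = sets borel" by(rule sets)+
 note [measurable] = g(1)
 obtain m where m: "emeasure y UNIV = ennreal m" "0 <= m" using fin by(cases "emeasure y UNIV") auto
 fix e :: real assume e: "0 < e"
 \<comment> \<open>The total error h m stays below e; the 1 covers m = 0.\<close>
 define h where "h = e / (m + 1)"
 have h: "0 < h" using e m by(simp add: h_def)
 define I where "I k = {x. real k * h < g x & g x <= real (Suc k) * h}" for k
 have I[measurable]: "I k : sets borel" for k unfolding I_def by measurable
 have "i = j" if "x : I i" "x : I j" for i j x
 proof -
  have "real i * h < real (Suc j) * h" "real j * h < real (Suc i) * h" using that by(auto simp: I_def)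
  thus ?thesis using h by(simp only: mult_less_cancel_right_pos of_nat_less_iff)
 qed
 hence disj: "disjoint_family I" by(auto simp: disjoint_family_on_def)
 have sum: "(\<Sum>k. emeasure L (I k)) = emeasure L (\<Union>k. I k)" if "sets L = sets borel" for L :: "real measure"
  by(rule suminf_emeasure) (use disj I in "auto simp: that")
 have UI: "{x. g x ~= 0} \<subseteq> (\<Union>k. I k)"
 proof safe
  fix x assume "g x ~= 0"
  hence x: "0 < g x" using g(2)[of x] by simp
  define k where "k = nat (\<lceil>g x / h\<rceil> - 1)"
  have "\<lceil>g x / h\<rceil> >= 1" using x h by(simp add: one_le_ceiling)
  hence "real k = real_of_int \<lceil>g x / h\<rceil> - 1" by(simp add: k_def)
  hence "real k < g x / h" "g x / h <= real (Suc k)" by linarith+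
  hence "x : I k" using h by(simp add: I_def field_simps)
  thus "x : (\<Union>k. I k)" by blast
 qed
 have "emeasure n UNIV <= emeasure n ({x. g x = 0} \<union> (\<Union>k. I k))" by(rule emeasure_mono) (use UI in auto)
 also have "... <= emeasure n {x. g x = 0} + emeasure n (\<Union>k. I k)" by(rule emeasure_subadditive) auto
 also have "... = (\<Sum>k. emeasure n (I k))" by(simp add: zero sum sets)
 also have "... <= (\<Sum>k. emeasure w (I k) + ennreal h * emeasure y (I k))"
 proof (intro suminf_le)
  fix k
  have "0 <= real k * h" "real k * h < real (Suc k) * h" using h by simp_all
  note b = hi[OF this] lo[OF this]
  have "ennreal (real (Suc k) * h) = ennreal (real k * h) + ennreal h"
   using h by(simp add: algebra_simps flip: ennreal_plus)
  thus "emeasure n (I k) <= emeasure w (I k) + ennreal h * emeasure y (I k)"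
   using order_trans[OF b(1)[unfolded `ennreal (real (Suc k) * h) = _` distrib_right] add_right_mono[OF b(2)]]
   by(simp add: I_def)
 qed auto
 also have "... = emeasure w (\<Union>k. I k) + ennreal h * emeasure y (\<Union>k. I k)"
  by(simp add: suminf_add[symmetric] ennreal_suminf_cmult sum sets)
 also have "... <= emeasure w UNIV + ennreal h * emeasure y UNIV"
  by(intro add_mono mult_left_mono emeasure_mono) (auto simp: sets)
 also have "ennreal h * emeasure y UNIV <= ennreal e"
  using e m by(simp add: h_def ennreal_mult[symmetric] field_simps ennreal_leI)
 finally show "emeasure n UNIV <= emeasure w UNIV + ennreal e" by(simp add: add_left_mono)
qed

text \<open>If on every level set \<open>u < \<phi> \<le> v\<close> the measure \<open>\<nu>\<close> lies between \<open>u \<mu>\<close> and \<open>v \<mu>\<close>, then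
 \<open>\<nu>\<close> has density \<open>\<phi>\<close>; only the total mass is needed.\<close>

lemma total_mass_eq_nn_integral:
 fixes m n :: "real measure" and g :: "real => real"
 assumes sets: "sets m = sets borel" "sets n = sets borel"
  and fin: "emeasure m UNIV < \<infinity>"
  and g: "g : borel_measurable borel" "!!x. 0 <= g x"
  and lo: "!!u v. 0 <= u ==> u < v ==> ennreal u * emeasure m {x. u < g x & g x <= v} <= emeasure n {x. u < g x & g x <= v}"
  and hi: "!!u v. 0 <= u ==> u < v ==> emeasure n {x. u < g x & g x <= v} <= ennreal v * emeasure m {x. u < g x & g x <= v}"
  and zero: "emeasure n {x. g x = 0} = 0"
 shows "emeasure n UNIV = (\<integral>\<^sup>+ x. ennreal (g x) \<partial>m)"
proof -
 have [measurable_cong]: "sets m = sets borel" by(rule sets)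
 note [measurable] = g(1)
 define k where "k = density m (%x. ennreal (g x))"
 have k: "emeasure k A = (\<integral>\<^sup>+ x\<in>A. ennreal (g x) \<partial>m)" if "A : sets borel" for A
  unfolding k_def using that by(simp add: emeasure_density sets)
 have c: "(\<integral>\<^sup>+ x. ennreal r * indicator A x \<partial>m) = ennreal r * emeasure m A" if "A : sets borel" for r A
  by(rule nn_integral_cmult_indicator) (simp add: sets that)
 have l: "{x. u < g x & g x <= v} : sets borel" for u v by measurable
 have "ennreal u * emeasure m {x. u < g x & g x <= v} <= emeasure k {x. u < g x & g x <= v}"
  "emeasure k {x. u < g x & g x <= v} <= ennreal v * emeasure m {x. u < g x & g x <= v}" for u v
  unfolding k[OF l] c[OF l, symmetric]
  by(intro nn_integral_mono; auto simp: indicator_def intro!: ennreal_leI)+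
 moreover have "emeasure k {x. g x = 0} = 0" by(subst k) (auto simp: nn_integral_0_iff_AE indicator_def)
 ultimately have "emeasure n UNIV = emeasure k UNIV"
  by(intro antisym mass_le_of_layer_bounds[OF _ _ _ fin g] lo hi zero) (simp_all add: sets k_def)
 thus ?thesis by(simp add: k)
qed

section \<open>The spectral theorem for positive self-adjoint operators\<close>

lemma projection_valued_measure_compl:
 assumes E: "projection_valued_measure E" and S: "S : sets borel"
 shows "E (- S) = id_blinfun - E S"
proof (rule projection_eq_iff_norm)
 have S': "- S : sets borel" using S by auto
 show "orth_projection (E (- S))" by(rule projection_valued_measureD(1)[OF E S'])
 have P: "orth_projection (E S)" by(rule projection_valued_measureD(1)[OF E S])
 thus "orth_projection (id_blinfun - E S)" by(rule orth_projection_compl)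
 fix v
 have "emeasure (scalar_measure E v) (S \<union> - S) = emeasure (scalar_measure E v) S + emeasure (scalar_measure E v) (- S)"
  by(rule plus_emeasure[symmetric]) (use S S' in auto)
 hence "ennreal ((norm v)^2) = ennreal ((norm (E S v))^2 + (norm (E (- S) v))^2)"
  using S S' by(simp add: emeasure_scalar_measure[OF E] projection_valued_measureD(3)[OF E])
 hence "(norm (E (- S) v))^2 = (norm (v - E S v))^2"
  using orth_projection_pythagoras[OF P, of v] by(simp del: ennreal_plus)
 thus "norm (E (- S) v) = norm ((id_blinfun - E S) v)"
  by(simp only: power2_eq_iff_nonneg norm_ge_zero blinfun.diff_left blinfun_apply_id_blinfun)
qed

locale complex_cd_pair = cd_pair C D for C D :: "'h::complex_hilbert_space bop" +
 assumes C_complex: "C : bounded_ops" and D_complex: "D : bounded_ops"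
begin

lemma pvm_C: "S : sets borel ==> sf.pvm S (C v) = C (sf.pvm S v)"
 by(rule commutesD[OF commutes_sym[OF sf.commutes_pvm]]) (auto simp: commutes_iff FC)

lemma pvm_D: "S : sets borel ==> sf.pvm S (D v) = D (sf.pvm S v)"
 by(rule commutesD[OF commutes_sym[OF sf.commutes_pvm]]) (auto simp: commutes_iff FD)

lemma F_complex: "F s : bounded_ops"
 unfolding bounded_ops_iff
 by(rule commutes_sym, rule commutes_F; rule commutes_sym) (use C_complex D_complex in "simp_all add: bounded_ops_iff")

lemma projection_valued_measure_pvm: "projection_valued_measure sf.pvm"
 unfolding projection_valued_measure_def is_projection_iff
proof (intro conjI allI ballI impI)
 show "sf.pvm S : bounded_ops" if "S : sets borel" for S
  unfolding bounded_ops_iff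
  by(rule commutes_sym, rule sf.commutes_pvm[OF that], rule commutes_sym)
   (use F_complex in "simp add: bounded_ops_iff")
 show "sf.pvm S = 0" if "S \<notin> sets borel" for S using that by(simp add: sf.pvm_def)
qed (auto intro: sf.orth_projection_pvm sf.pvm_sums simp: sf.pvm_UNIV sf.pvm_Int)

abbreviation "smeas \<equiv> scalar_measure sf.pvm"

lemmas emeasure_smeas = emeasure_scalar_measure[OF projection_valued_measure_pvm]

lemma pvm_Ioc: "u <= v ==> sf.pvm {u<..v} y = F v y - F u y"
proof -
 assume "u <= v"
 hence "{..v} = {..u} \<union> {u<..v}" by auto
 moreover have "{..u} \<inter> {u<..v} = {}" by auto
 ultimately have "sf.pvm {..v} = sf.pvm {..u} + sf.pvm {u<..v}" by(simp only:) (simp add: sf.pvm_Un)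
 thus ?thesis by(simp add: sf.pvm_atMost blin_simps)
qed

text \<open>A vector of the spectral subspace of (u, v] is killed by F u and fixed by F v, so the
  bounds from below and from above both apply.\<close>

lemma quot_Ioc_bounds:
 assumes "0 <= u" "u <= v" "y = sf.pvm {u<..v} y'"
 shows "u * norm (C y) <= norm (D y)" "norm (D y) <= v * norm (C y)"
  "u * (norm (C y))^2 <= inner (D y) (C y)" "inner (D y) (C y) <= v * (norm (C y))^2"
proof -
 have z: "y = F v y' - F u y'" using assms(2,3) by(simp add: pvm_Ioc)
 have q: "(C y, D y) : quot" by(simp add: quot_def)
 have "F u y = 0" unfolding z by(simp add: blin_simps F_proj sf.F_le assms(2))
 hence "F u (C y) = 0" by(simp add: FC)
 from quot_F_unbounded(1,3)[OF this q assms(1)]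
 show "u * norm (C y) <= norm (D y)" "u * (norm (C y))^2 <= inner (D y) (C y)" .
 have "F v y = y" unfolding z by(simp add: blin_simps F_proj sf.F_le' assms(2))
 hence "F v (C y) = C y" by(simp add: FC)
 then obtain w where "(C y, w) : quot" "norm w <= v * norm (C y)" "inner w (C y) <= v * (norm (C y))^2"
  by(rule quot_F_bounded)
 moreover from this(1) have "w = D y" by(rule single_valuedD[OF single_valued_quot _ q])
 ultimately show "norm (D y) <= v * norm (C y)" "inner (D y) (C y) <= v * (norm (C y))^2" by simp_all
qed

lemma D_F0: "D (F 0 u) = 0"
proof -
 have "F 0 (C (F 0 u)) = C (F 0 u)" by(simp add: FC F_proj)
 then obtain w where "(C (F 0 u), w) : quot" "norm w <= 0 * norm (C (F 0 u))"
  by(rule quot_F_bounded)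
 moreover have "(C (F 0 u), D (F 0 u)) : quot" by(simp add: quot_def)
 ultimately show ?thesis using single_valuedD[OF single_valued_quot] by force
qed

text \<open>Since |(D C)^(1/2) y|^2 is the form of D C^(-1) at C y, the scalar measure of this
  vector should have density s with respect to that of C y. This turns the form integral into a
  total mass.\<close>

definition rootDC :: "'h bop" where "rootDC = op_sqrt (D oL C)"

lemma psd_DC: "psd (D oL C)"
 by(rule psd_compose[OF psd_D psd_C commutes_sym[OF CD]])

lemma norm_pvm_rootDC:
 assumes "S : sets borel"
 shows "(norm (sf.pvm S (rootDC u)))^2 = inner (D (sf.pvm S u)) (C (sf.pvm S u))"
proof -
 have "commutes (sf.pvm S) rootDC"
  unfolding rootDC_def by(rule commutes_op_sqrt[OF psd_DC]) (simp add: commutes_iff pvm_C pvm_D assms)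
 hence "(norm (sf.pvm S (rootDC u)))^2 = inner (rootDC (sf.pvm S u)) (rootDC (sf.pvm S u))"
  by(simp add: commutesD power2_norm_eq_inner)
 also have "... = inner (rootDC (rootDC (sf.pvm S u))) (sf.pvm S u)"
  by(rule symmD[symmetric]) (simp add: rootDC_def psd_symm psd_op_sqrt psd_DC)
 also have "... = inner (D (C (sf.pvm S u))) (sf.pvm S u)"
  by(simp add: rootDC_def op_sqrt_apply[OF psd_DC])
 finally show ?thesis
  using D_symm[of "C (sf.pvm S u)" "sf.pvm S u"] by(simp add: inner_commute)
qed

lemma smeas_neg: "emeasure (smeas v) {..<0} = 0"
proof -
 have "{..- (1 / real (Suc n))} : null_sets (smeas v)" for n
  by(simp add: null_sets_def emeasure_smeas sf.pvm_atMost sf.neg)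
 hence "(\<Union>n. {..- (1 / real (Suc n))}) : null_sets (smeas v)" by(intro null_sets_UN) auto
 moreover have "(\<Union>n. {..- (1 / real (Suc n))}) = {..<0::real}"
 proof safe
  fix x :: real and n assume "x <= - (1 / real (Suc n))"
  thus "x < 0" by(smt (verit) divide_pos_pos of_nat_0_less_iff zero_less_Suc)
 next
  fix x :: real assume "x < 0"
  then obtain n where "1 / real (Suc n) < - x" using reals_Archimedean[of "-x"] by(auto simp: inverse_eq_divide)
  hence "x : {..- (1 / real (Suc n))}" by simp
  thus "x : (\<Union>n. {..- (1 / real (Suc n))})" by(rule UN_I[rotated]) simp
 qed
 ultimately show ?thesis by(simp add: null_sets_def)
qed

lemma AE_smeas_nonneg: "AE s in smeas v. 0 <= s"
 by(rule AE_I'[of "{..<0}"]) (auto simp: null_sets_def smeas_neg)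

lemma nn_integral_form: "(\<integral>\<^sup>+ s. ennreal (max s 0) \<partial>smeas (C y)) = ennreal (inner (D y) (C y))"
proof -
 \<comment> \<open>max s 0 stands for s because the density must be nonnegative; for u >= 0 its
   layers are the half-open intervals.\<close>
 have sets_eq: "{x::real. u < max x 0 & max x 0 <= v} = {u<..v}" if "0 <= u" "u < v" for u v
  using that by auto
 have "emeasure (smeas (rootDC y)) UNIV = (\<integral>\<^sup>+ s. ennreal (max s 0) \<partial>smeas (C y))"
 proof (rule total_mass_eq_nn_integral)
  fix u v :: real assume uv: "0 <= u" "u < v"
  note b = quot_Ioc_bounds[OF uv(1) less_imp_le[OF uv(2)] refl]
  show "ennreal u * emeasure (smeas (C y)) {x. u < max x 0 & max x 0 <= v}
    <= emeasure (smeas (rootDC y)) {x. u < max x 0 & max x 0 <= v}"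
   unfolding sets_eq[OF uv] using b(3)[of y] uv
   by(simp add: emeasure_smeas norm_pvm_rootDC pvm_C ennreal_mult[symmetric] ennreal_leI)
  show "emeasure (smeas (rootDC y)) {x. u < max x 0 & max x 0 <= v}
    <= ennreal v * emeasure (smeas (C y)) {x. u < max x 0 & max x 0 <= v}"
   unfolding sets_eq[OF uv] using b(4)[of y] uv
   by(simp add: emeasure_smeas norm_pvm_rootDC pvm_C ennreal_mult[symmetric] ennreal_leI)
 next
  have "{x::real. max x 0 = 0} = {..0}" by auto
  thus "emeasure (smeas (rootDC y)) {x. max x 0 = 0} = 0"
   by(simp add: emeasure_smeas norm_pvm_rootDC) (simp add: sf.pvm_atMost D_F0)
 qed (simp_all add: emeasure_smeas sf.pvm_UNIV)
 thus ?thesis by(simp add: emeasure_smeas norm_pvm_rootDC) (simp add: sf.pvm_UNIV)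
qed

text \<open>The scalar measure of D y plays the role that the one of \<open>rootDC y\<close> has for
  the form, now with density s^2 relative to that of C y.\<close>

lemma nn_integral_square: "(\<integral>\<^sup>+ s. ennreal ((max s 0)^2) \<partial>smeas (C y)) = ennreal ((norm (D y))^2)"
proof -
 have sets_eq: "{x::real. u < (max x 0)^2 & (max x 0)^2 <= v} = {sqrt u<..sqrt v}" if "0 <= u" "u < v" for u v
 proof -
  have "u < (max x 0)^2 \<longleftrightarrow> sqrt u < x" for x
  proof -
   have "u < (max x 0)^2 \<longleftrightarrow> sqrt u < sqrt ((max x 0)^2)" by(rule real_sqrt_less_iff[symmetric])
   also have "... \<longleftrightarrow> sqrt u < x" using that by(simp add: less_max_iff_disj)
   finally show ?thesis .
  qed
  moreover have "(max x 0)^2 <= v \<longleftrightarrow> x <= sqrt v" for x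
  proof -
   have "(max x 0)^2 <= v \<longleftrightarrow> sqrt ((max x 0)^2) <= sqrt v" by(rule real_sqrt_le_iff[symmetric])
   also have "... \<longleftrightarrow> x <= sqrt v" using that real_sqrt_ge_zero[of v] by auto
   finally show ?thesis .
  qed
  ultimately show ?thesis by auto
 qed
 have "emeasure (smeas (D y)) UNIV = (\<integral>\<^sup>+ s. ennreal ((max s 0)^2) \<partial>smeas (C y))"
 proof (rule total_mass_eq_nn_integral)
  fix u v :: real assume uv: "0 <= u" "u < v"
  have s: "0 <= sqrt u" "sqrt u <= sqrt v" "(sqrt u)^2 = u" "(sqrt v)^2 = v" using uv by simp_all
  note b = quot_Ioc_bounds[OF s(1,2) refl]
  have "(sqrt u * norm (C (sf.pvm {sqrt u<..sqrt v} y)))^2 <= (norm (D (sf.pvm {sqrt u<..sqrt v} y)))^2"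
   by(rule power_mono[OF b(1)]) (use s in simp)
  thus "ennreal u * emeasure (smeas (C y)) {x. u < (max x 0)^2 & (max x 0)^2 <= v}
    <= emeasure (smeas (D y)) {x. u < (max x 0)^2 & (max x 0)^2 <= v}"
   unfolding sets_eq[OF uv] using uv
   by(simp add: emeasure_smeas pvm_C pvm_D power_mult_distrib s ennreal_mult[symmetric] ennreal_leI)
  have "(norm (D (sf.pvm {sqrt u<..sqrt v} y)))^2 <= (sqrt v * norm (C (sf.pvm {sqrt u<..sqrt v} y)))^2"
   by(rule power_mono[OF b(2)]) simp
  thus "emeasure (smeas (D y)) {x. u < (max x 0)^2 & (max x 0)^2 <= v}
    <= ennreal v * emeasure (smeas (C y)) {x. u < (max x 0)^2 & (max x 0)^2 <= v}"
   unfolding sets_eq[OF uv] using uv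
   by(simp add: emeasure_smeas pvm_C pvm_D power_mult_distrib s ennreal_mult[symmetric] ennreal_leI)
 next
  have "{x::real. (max x 0)^2 = 0} = {..0}" by auto
  thus "emeasure (smeas (D y)) {x. (max x 0)^2 = 0} = 0"
   by(simp add: emeasure_smeas sf.pvm_atMost FD D_F0)
 qed (simp_all add: emeasure_smeas sf.pvm_UNIV)
 thus ?thesis by(simp add: emeasure_smeas sf.pvm_UNIV)
qed

lemma nn_integral_square': "(\<integral>\<^sup>+ s. ennreal (s^2) \<partial>smeas v) = (\<integral>\<^sup>+ s. ennreal ((max s 0)^2) \<partial>smeas v)"
 using AE_smeas_nonneg[of v] by(intro nn_integral_cong_AE) (auto elim!: eventually_mono)

text \<open>For the reverse inclusion the vector is truncated by F n. The values D (u n) have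
  orthogonal increments and norms bounded by the second moment, so they converge, and closedness of
  the graph gives the value.\<close>

lemma Domain_quot_eq: "Domain quot = {v. (\<integral>\<^sup>+ s. ennreal (s^2) \<partial>smeas v) < \<infinity>}"
proof safe
 fix v y assume "(v, y) : quot"
 then obtain u where "v = C u" by(auto simp: quot_def)
 thus "(\<integral>\<^sup>+ s. ennreal (s^2) \<partial>smeas v) < \<infinity>" by(simp add: nn_integral_square' nn_integral_square)
next
 fix v assume fin: "(\<integral>\<^sup>+ s. ennreal (s^2) \<partial>smeas v) < \<infinity>"
 then obtain c where c: "(\<integral>\<^sup>+ s. ennreal (s^2) \<partial>smeas v) = ennreal c" "0 <= c"
  by(cases "\<integral>\<^sup>+ s. ennreal (s^2) \<partial>smeas v") auto
 have "EX u. F (real n) v = C u" for n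
 proof -
  obtain y where "(F (real n) v, y) : quot" by(rule quot_F_bounded[OF F_proj])
  thus ?thesis by(auto simp: quot_def)
 qed
 then obtain u where z: "!!n. F (real n) v = C (u n)" by metis
 define w where "w n = (norm (D (u n)))^2" for n
 have Fz: "F (real m) (u n) = u m" if "m <= n" for m n
 proof -
  have "C (F (real m) (u n)) = C (u m)" using that by(simp add: FC[symmetric] z[symmetric] sf.F_le)
  thus ?thesis by(simp add: C_eq_iff)
 qed
 have wc: "w n <= c" for n
 proof -
  have "ennreal (w n) = (\<integral>\<^sup>+ s. ennreal (s^2) \<partial>smeas (F (real n) v))"
   by(simp add: w_def z nn_integral_square' nn_integral_square)
  also have "... <= (\<integral>\<^sup>+ s. ennreal (s^2) \<partial>smeas v)"
  proof (rule nn_integral_mono_measure)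
   show "smeas (F (real n) v) <= smeas v"
   proof (rule less_eq_measure.intros(3))
    show "emeasure (smeas (F (real n) v)) <= emeasure (smeas v)"
    proof (rule le_funI)
     fix S :: "real set"
     show "emeasure (smeas (F (real n) v)) S <= emeasure (smeas v) S"
     proof (cases "S : sets borel")
      case True
      have "commutes (F (real n)) (sf.pvm S)" by(rule sf.commutes_pvm[OF True]) (simp add: commutes_iff FF)
      hence "sf.pvm S (F (real n) v) = F (real n) (sf.pvm S v)" by(rule commutesD[symmetric])
      thus ?thesis using norm_orth_projection_le[OF orth_projection_F, of "real n" "sf.pvm S v"]
       by(simp add: emeasure_smeas True ennreal_leI power_mono)
     qed (simp add: emeasure_notin_sets)
    qed
   qed simp_all
  qed simp_all
  finally show ?thesis by(simp add: c)
 qed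
 have wdiff: "(norm (D (u n) - D (u m)))^2 = w n - w m" if "m <= n" for m n
 proof -
  have "F (real m) (D (u n)) = D (u m)" using Fz[OF that] by(simp add: FD)
  thus ?thesis using orth_projection_pythagoras[OF orth_projection_F, of "D (u n)" "real m"]
   by(simp add: w_def)
 qed
 have "incseq w" using wdiff by(intro incseq_SucI) (metis diff_ge_0_iff_ge le_SucI order_refl zero_le_power2)
 moreover have "Bseq w" by(rule BseqI'[of _ c]) (use wc w_def in auto)
 ultimately have "Cauchy w"
  by(intro convergent_Cauchy Bseq_mono_convergent) (auto simp: incseq_def)
 have "Cauchy (%n. D (u n))"
 proof (rule CauchyI')
  fix e :: real assume "e > 0"
  then obtain N where N: "!!m n. m >= N ==> n >= N ==> norm (w m - w n) < e^2"
   using CauchyD[OF `Cauchy w`, of "e^2"] by auto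
  have "dist (D (u m)) (D (u n)) < e" if "m >= N" "n > m" for m n
  proof -
   have "(norm (D (u n) - D (u m)))^2 < e^2" using wdiff[of m n] N[of n m] that by simp
   hence "norm (D (u n) - D (u m)) < e" by(rule power2_less_imp_less) (use `e > 0` in simp)
   thus ?thesis by(simp add: dist_norm norm_minus_commute)
  qed
  thus "EX M. ALL m>=M. ALL n>m. dist (D (u m)) (D (u n)) < e" by blast
 qed
 then obtain y where y: "(%n. D (u n)) ----> y" using Cauchy_convergent convergent_def by blast
 have "(%n. (C (u n), D (u n))) ----> (v, y)"
  using sf.F_top_limit[of v] by(intro tendsto_Pair y) (simp add: z)
 hence "(v, y) : quot"
  by(rule closed_sequentially[OF closed_quot, rotated]) (simp add: quot_def)
 thus "v : Domain quot" by blast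
qed

lemma quot_form:
 assumes "(v, w) : quot"
 shows "cinner w v = complex_of_real (inner w v)"
proof -
 obtain u where z: "v = C u" "w = D u" using assms by(auto simp: quot_def)
 have DC: "D oL C : bounded_ops"
  using C_complex D_complex by(simp add: bounded_ops_def)
 have "inner (D u) (\<i> *\<^sub>C C u) = inner (D (C u)) (\<i> *\<^sub>C u)"
  using C_symm[of "D u" "\<i> *\<^sub>C u"] by(simp add: bounded_opsD[OF C_complex] CD')
 also have "... = 0"
  using cinner_symm_real[OF psd_symm[OF psd_DC] DC, of u] by(simp add: cinner_eq complex_eq_iff)
 finally show ?thesis by(simp add: z cinner_eq complex_eq_iff)
qed

theorem is_spectral_measure_pvm: "is_spectral_measure quot sf.pvm"
 unfolding is_spectral_measure_def
proof (intro conjI projection_valued_measure_pvm Domain_quot_eq; clarify)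
 fix v w assume q: "(v, w) : quot"
 then obtain u where z: "v = C u" "w = D u" by(auto simp: quot_def)
 have "(LINT s|smeas v. s) = (LINT s|smeas v. max s 0)"
  using AE_smeas_nonneg[of v] by(intro integral_cong_AE) (auto elim!: eventually_mono)
 also have "... = enn2real (\<integral>\<^sup>+ s. ennreal (max s 0) \<partial>smeas v)"
  by(rule integral_eq_nn_integral) auto
 also have "... = inner w v"
  using quot_positive[OF q] by(simp add: z nn_integral_form)
 finally show "cinner w v = complex_of_real (LINT s|smeas v. s)" using quot_form[OF q] by simp
qed

lemma closed_op_quot: "closed_op quot"
 by standard (simp_all add: subspace_quot closed_quot single_valued_quot Domain_quot dense_range_C)

text \<open>C and D are recovered from the graph: C^2 is the operator (1 + q^*q)^(-1) of the
  quotient q, and positive roots are unique.\<close>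

lemma commutes_F_of_quot:
 fixes P :: "'h bop"
 assumes "symm P" "!!v w. (v, w) : quot ==> (P v, P w) : quot"
 shows "commutes P (F s)"
proof -
 interpret q: closed_op quot by(rule closed_op_quot)
 have "radj P = P" using assms(1) by(simp add: symm_radj)
 hence PB: "commutes P q.opB" using assms(2) by(intro q.commutes_B_of_x) simp_all
 have B: "q.opB v = C (C v)" for v
 proof (rule q.BK_unique(1))
  show "(C (C v), D (C v)) : quot" by(simp add: quot_def)
  have "D (C v) = C (D v)" "v - C (C v) = D (D v)" using CD_square[of v] by(simp_all add: CD' algebra_simps)
  hence "(D (C v), v - C (C v)) : quot" by(simp add: quot_def)
  thus "(D (C v), v - C (C v)) : radj_rel quot" by(simp add: radj_rel_quot)
 qed
 have PCC: "commutes P (C oL C)" using commutesD[OF PB] by(simp add: commutes_iff B)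
 have "op_sqrt (C oL C) = C" by(rule op_sqrt_unique[OF psd_C refl])
 hence PC: "commutes P C" using commutes_op_sqrt[OF psd_square[OF psd_symm[OF psd_C]] PCC] by simp
 have "D (D v) = v - C (C v)" for v using CD_square[of v] by(simp add: algebra_simps)
 hence PDD: "commutes P (D oL D)" using commutesD[OF PCC] by(simp add: commutes_iff blin_simps)
 have "op_sqrt (D oL D) = D" by(rule op_sqrt_unique[OF psd_D refl])
 hence PD: "commutes P D" using commutes_op_sqrt[OF psd_square[OF psd_symm[OF psd_D]] PDD] by simp
 show ?thesis by(rule commutes_F[OF PC PD])
qed

end

text \<open>Uniqueness half of the spectral theorem. Only the domain and the quadratic form are
  prescribed for E, so invariance of the graph under E S has to be derived first, from the absence
  of cross terms in the form.\<close>

locale spectral_measure_of_quot = complex_cd_pair +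
 fixes E :: "real set => 'a bop"
 assumes E: "is_spectral_measure quot E"
begin

lemma pvmE: "projection_valued_measure E"
 and DomainE: "Domain quot = {v. (\<integral>\<^sup>+ s. ennreal (s^2) \<partial>scalar_measure E v) < \<infinity>}"
 and formE: "(v, w) : quot ==> inner w v = (LINT s|scalar_measure E v. s)"
 using E unfolding is_spectral_measure_def by(auto simp: inner_cinner)

lemmas projE = projection_valued_measureD(1)[OF pvmE]
 and emeasureE = emeasure_scalar_measure[OF pvmE]

lemma E_idem: "S : sets borel ==> E S (E S v) = E S v"
 using orth_projectionD(1)[OF projE] by blast

lemma scalar_measure_E:
 assumes S: "S : sets borel"
 shows "scalar_measure E (E S v) = density (scalar_measure E v) (indicator S)"
proof (rule measure_eqI)
 fix T assume "T : sets (scalar_measure E (E S v))"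
 hence T: "T : sets borel" by simp
 have "E T (E S v) = E (S \<inter> T) v"
  using projection_valued_measureD(4)[OF pvmE T S] by(simp add: Int_commute)
 thus "emeasure (scalar_measure E (E S v)) T = emeasure (density (scalar_measure E v) (indicator S)) T"
  using S T by(subst emeasure_restricted) (auto simp: emeasureE)
qed simp

lemma E_Domain:
 assumes S: "S : sets borel" and x: "v : Domain quot"
 shows "E S v : Domain quot"
proof -
 have "(\<integral>\<^sup>+ s. ennreal (s^2) \<partial>scalar_measure E (E S v)) = (\<integral>\<^sup>+ s. indicator S s * ennreal (s^2) \<partial>scalar_measure E v)"
  unfolding scalar_measure_E[OF S] using S by(subst nn_integral_density) auto
 also have "... <= (\<integral>\<^sup>+ s. ennreal (s^2) \<partial>scalar_measure E v)"
  by(intro nn_integral_mono) (auto simp: indicator_def)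
 also have "... < \<infinity>" using x DomainE by blast
 finally show ?thesis using DomainE by blast
qed

lemma integrableE:
 assumes "v : Domain quot"
 shows "integrable (scalar_measure E v) (%s. s)"
proof (rule integrableI_bounded)
 have "(\<integral>\<^sup>+ s. ennreal (norm s) \<partial>scalar_measure E v) <= (\<integral>\<^sup>+ s. 1 + ennreal (s^2) \<partial>scalar_measure E v)"
 proof (intro nn_integral_mono)
  fix s :: real
  have "(\<bar>s\<bar> - 1)^2 = 1 + s^2 - 2 * \<bar>s\<bar>" by(simp add: power2_eq_square algebra_simps)
  hence "2 * \<bar>s\<bar> <= 1 + s^2" using zero_le_power2[of "\<bar>s\<bar> - 1"] by linarith
  hence "\<bar>s\<bar> <= 1 + s^2" by linarith
  hence "ennreal \<bar>s\<bar> <= ennreal (1 + s^2)" by(rule ennreal_leI)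
  thus "ennreal (norm s) <= 1 + ennreal (s^2)" by simp
 qed
 also have "... = emeasure (scalar_measure E v) UNIV + (\<integral>\<^sup>+ s. ennreal (s^2) \<partial>scalar_measure E v)"
  by(subst nn_integral_add) auto
 also have "... < \<infinity>" using assms DomainE by(auto simp: emeasureE)
 finally show "(\<integral>\<^sup>+ s. ennreal (norm s) \<partial>scalar_measure E v) < \<infinity>" .
qed simp

lemma form_E:
 assumes S: "S : sets borel" and "(v, w) : quot" "(E S v, w') : quot"
 shows "inner w' (E S v) = (LINT s|scalar_measure E v. indicator S s * s)"
proof -
 have "inner w' (E S v) = (LINT s|density (scalar_measure E v) (%s. ennreal (indicator S s)). s)"
  by(simp add: formE[OF assms(3)] scalar_measure_E[OF S] ennreal_indicator)
 also have "... = (LINT s|scalar_measure E v. indicator S s * s)"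
  using S by(subst integral_density) auto
 finally show ?thesis .
qed

lemma form_split:
 assumes S: "S : sets borel" and q: "(v, \<eta>) : quot" "(E S v, \<eta>1) : quot" "(v - E S v, \<eta>2) : quot"
 shows "inner \<eta> v = inner \<eta>1 (E S v) + inner \<eta>2 (v - E S v)"
proof -
 have S': "- S : sets borel" using S by auto
 have c: "E (- S) v = v - E S v" by(simp add: projection_valued_measure_compl[OF pvmE S] blin_simps)
 have i: "integrable (scalar_measure E v) (%s. s)" using q(1) by(intro integrableE) blast
 have "inner \<eta>1 (E S v) + inner \<eta>2 (v - E S v)
   = (LINT s|scalar_measure E v. indicator S s * s) + (LINT s|scalar_measure E v. indicator (- S) s * s)"
  using form_E[OF S q(1,2)] form_E[OF S' q(1)] q(3) by(simp add: c)
 also have "... = (LINT s|scalar_measure E v. indicator S s * s + indicator (- S) s * s)"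
  using integrable_mult_indicator[OF _ i, of S] integrable_mult_indicator[OF _ i, of "- S"] S S'
  by(intro Bochner_Integration.integral_add[symmetric]) (auto simp: mult.commute)
 also have "... = (LINT s|scalar_measure E v. s)" by(intro Bochner_Integration.integral_cong) (auto simp: indicator_def)
 finally show ?thesis using formE[OF q(1)] by simp
qed

lemma quot_E:
 assumes S: "S : sets borel" and a: "(v, v') : quot" "E S v = v"
 shows "E S v' = v'"
proof -
 have symP: "inner (E S y) w = inner y (E S w)" for y w
  by(rule symmD[OF orth_projectionD(2)[OF projE[OF S]]])
 have "v' - E S v' = 0"
 proof (rule dense_orthogonal_zero[of "Domain quot"])
  show "closure (Domain quot) = UNIV" by(simp add: Domain_quot dense_range_C)
  fix u assume d: "u : Domain quot"
  then obtain u' where d': "(u, u') : quot" by blast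
  obtain c' where e': "(E S u, c') : quot" using E_Domain[OF S d] by blast
  \<comment> \<open>The part of u in the complement of E S. Additivity of the form on v + \<beta>
    says that the cross term of v' with \<beta> vanishes.\<close>
  define \<beta> \<beta>' where "\<beta> = u - E S u" and "\<beta>' = u' - c'"
  have b: "(\<beta>, \<beta>') : quot" using subspace_diff[OF subspace_quot d' e'] by(simp add: \<beta>_def \<beta>'_def)
  have Eb: "E S \<beta> = 0" by(simp add: \<beta>_def blin_simps E_idem[OF S])
  have ab: "(v + \<beta>, v' + \<beta>') : quot" using subspace_add[OF subspace_quot a(1) b] by simp
  have "inner (v' + \<beta>') (v + \<beta>) = inner v' v + inner \<beta>' \<beta>"
   using form_split[OF S ab, of v' \<beta>'] a b by(simp add: blin_simps Eb)
  moreover have "inner v' \<beta> = inner v \<beta>'"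
   using b radj_rel_quot by(intro radj_relD[OF _ a(1)]) simp
  ultimately have "inner v' \<beta> = 0" by(simp add: inner_add_left inner_add_right inner_commute)
  moreover have "inner u (v' - E S v') = inner v' u - inner (E S v') u"
   by(simp add: inner_diff_right inner_commute)
  ultimately show "inner u (v' - E S v') = 0" by(simp add: \<beta>_def inner_diff_right symP)
 qed
 from this[unfolded right_minus_eq] show ?thesis by(rule sym)
qed

lemma quot_E_invariant:
 assumes S: "S : sets borel" and q: "(v, \<eta>) : quot"
 shows "(E S v, E S \<eta>) : quot"
proof -
 have S': "- S : sets borel" using S by auto
 note c = projection_valued_measure_compl[OF pvmE S]
 obtain \<eta>1 where 1: "(E S v, \<eta>1) : quot" using E_Domain[OF S] q by blast
 have 2: "(v - E S v, \<eta> - \<eta>1) : quot" using subspace_diff[OF subspace_quot q 1] by simp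
 have "E S \<eta>1 = \<eta>1" by(rule quot_E[OF S 1 E_idem[OF S]])
 moreover have "E (- S) (\<eta> - \<eta>1) = \<eta> - \<eta>1"
  by(rule quot_E[OF S' 2]) (simp add: c blin_simps E_idem[OF S])
 hence "E S \<eta> - E S \<eta>1 = 0" by(simp add: c blin_simps)
 ultimately show ?thesis using 1 by simp
qed

lemma E_F_commute: "S : sets borel ==> commutes (E S) (F s)"
 by(rule commutes_F_of_quot[OF orth_projectionD(2)[OF projE]]) (auto intro: quot_E_invariant)

lemma AE_in:
 assumes "S : sets borel" "E S a = a"
 shows "AE s in scalar_measure E a. s : S"
proof (rule AE_I'[of "- S"])
 have "E (- S) a = 0" using assms by(simp add: projection_valued_measure_compl[OF pvmE assms(1)] blin_simps)
 thus "- S : null_sets (scalar_measure E a)" using assms(1) by(simp add: null_sets_def emeasureE)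
qed auto

lemma form_shift:
 assumes "(a, a') : quot"
 shows "(LINT s|scalar_measure E a. s - c) = inner a' a - c * (norm a)^2"
  and "integrable (scalar_measure E a) (%s. s - c)"
proof -
 interpret finite_measure "scalar_measure E a" by(rule finite_measure_scalar_measure[OF pvmE])
 have i: "integrable (scalar_measure E a) (%s. s)" using assms by(intro integrableE) blast
 thus "integrable (scalar_measure E a) (%s. s - c)" by simp
 have "measure (scalar_measure E a) UNIV = (norm a)^2"
  by(simp add: measure_def emeasureE projection_valued_measureD(3)[OF pvmE])
 thus "(LINT s|scalar_measure E a. s - c) = inner a' a - c * (norm a)^2"
  using i by(simp add: formE[OF assms])
qed

lemma AE_False_zero: "AE s in scalar_measure E a. False ==> a = 0"
proof -
 assume "AE s in scalar_measure E a. False"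
 hence "emeasure (scalar_measure E a) UNIV = 0"
  by(simp add: AE_iff_null_sets[of UNIV, symmetric] AE_iff_measurable[OF _ refl])
 thus ?thesis by(simp add: emeasureE projection_valued_measureD(3)[OF pvmE])
qed

lemma form_le:
 assumes "S : sets borel" "E S a = a" "(a, a') : quot" "S \<subseteq> {..c}"
 shows "inner a' a <= c * (norm a)^2"
  and "S \<subseteq> {..<c} ==> inner a' a = c * (norm a)^2 ==> a = 0"
proof -
 have le: "AE s in scalar_measure E a. 0 <= c - s"
  using AE_in[OF assms(1,2)] assms(4) by(auto elim!: eventually_mono)
 have I: "(LINT s|scalar_measure E a. c - s) = c * (norm a)^2 - inner a' a" "integrable (scalar_measure E a) (%s. c - s)"
  using form_shift[OF assms(3), of c] Bochner_Integration.integral_minus[of "scalar_measure E a" "%s. s - c"]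
   Bochner_Integration.integrable_minus[of "scalar_measure E a" "%s. s - c"] by simp_all
 show "inner a' a <= c * (norm a)^2" using integral_nonneg_AE[OF le] I(1) by simp
 show "a = 0" if "S \<subseteq> {..<c}" "inner a' a = c * (norm a)^2"
 proof (rule AE_False_zero)
  have "AE s in scalar_measure E a. c - s = 0"
   using integral_nonneg_eq_0_iff_AE[OF I(2) le] I(1) that(2) by simp
  with AE_in[OF assms(1,2)] show "AE s in scalar_measure E a. False"
   by eventually_elim (use that(1) in auto)
 qed
qed

lemma form_gt:
 assumes "S : sets borel" "E S a = a" "(a, a') : quot" "S \<subseteq> {c<..}"
 shows "c * (norm a)^2 <= inner a' a" and "inner a' a = c * (norm a)^2 ==> a = 0"
proof -
 have le: "AE s in scalar_measure E a. 0 <= s - c"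
  using AE_in[OF assms(1,2)] assms(4) by(auto elim!: eventually_mono)
 note I = form_shift[OF assms(3), of c]
 show "c * (norm a)^2 <= inner a' a" using integral_nonneg_AE[OF le] I(1) by simp
 show "a = 0" if "inner a' a = c * (norm a)^2"
 proof (rule AE_False_zero)
  have "AE s in scalar_measure E a. s - c = 0"
   using integral_nonneg_eq_0_iff_AE[OF I(2) le] I(1) that by simp
  with AE_in[OF assms(1,2)] show "AE s in scalar_measure E a. False"
   by eventually_elim (use assms(4) in auto)
 qed
qed

lemma bounded_Domain:
 assumes "S : sets borel" "E S a = a" "S \<subseteq> {-b..b}"
 shows "a : Domain quot"
proof -
 have "(\<integral>\<^sup>+ s. ennreal (s^2) \<partial>scalar_measure E a) <= (\<integral>\<^sup>+ s. ennreal (b^2) \<partial>scalar_measure E a)"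
 proof (rule nn_integral_mono_AE)
  show "AE s in scalar_measure E a. ennreal (s^2) <= ennreal (b^2)"
   using AE_in[OF assms(1,2)]
  proof eventually_elim
   case (elim s)
   hence "s : {- b..b}" using assms(3) by blast
   hence "\<bar>s\<bar> <= b" by(simp add: abs_le_iff)
   hence "\<bar>s\<bar>^2 <= b^2" by(intro power_mono) auto
   thus ?case by(simp add: ennreal_leI)
  qed
 qed
 also have "... < \<infinity>" by(simp add: emeasureE ennreal_mult_less_top)
 finally show ?thesis using DomainE by blast
qed

lemma E_neg: "emeasure (scalar_measure E u) {..<0} = 0"
proof -
 have "E {- real n..<0} u = 0" for n
 proof -
  define v where "v = E {- real n..<0} u"
  have a: "E {- real n..<0} v = v" by(simp add: v_def E_idem)
  obtain v' where a': "(v, v') : quot" using bounded_Domain[OF _ a, of "real n"] by force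
  have "inner v' v <= 0 * (norm v)^2" by(rule form_le(1)[OF _ a a']) auto
  hence "inner v' v = 0 * (norm v)^2" using quot_positive[OF a'] by simp
  hence "v = 0" by(intro form_le(2)[OF _ a a', of 0]) auto
  thus ?thesis by(simp add: v_def)
 qed
 hence "{- real n..<0} : null_sets (scalar_measure E u)" for n by(simp add: null_sets_def emeasureE)
 hence "(\<Union>n. {- real n..<0}) : null_sets (scalar_measure E u)" by(intro null_sets_UN) auto
 moreover have "(\<Union>n. {- real n..<0}) = {..<0::real}"
 proof safe
  fix x :: real assume "x < 0"
  moreover obtain n where "- x <= real n" using real_arch_simple by blast
  ultimately show "x : (\<Union>n. {- real n..<0})" by(intro UN_I[of n]) auto
 qed simp
 ultimately show ?thesis by(simp add: null_sets_def)
qed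

text \<open>E and F commute, so a vector of one range leaves a component w that the other projection
  kills. The form at w is bounded by s |w|^2 from both sides, and the equality case makes w =
  0.\<close>

lemma E_atMost: "E {..s} = F s"
proof (cases "s < 0")
 case True
 have "E {..s} u = 0" for u
 proof -
  have "emeasure (scalar_measure E u) {..s} <= emeasure (scalar_measure E u) {..<0}"
   using True by(intro emeasure_mono) auto
  thus ?thesis by(simp add: E_neg emeasureE)
 qed
 thus ?thesis using True by(intro blinfun_eqI) (simp add: sf.neg)
next
 case False
 hence s: "0 <= s" by simp
 \<comment> \<open>Membership in the domain is known for bounded sets; the negative half-line is
   null, which leaves [0, s].\<close>
 have dom: "v : Domain quot" if "E {..s} v = v" for v
 proof (rule bounded_Domain[where b = s])
  have "emeasure (scalar_measure E v) ({..<0} \<union> {0..s}) = emeasure (scalar_measure E v) {..<0} + emeasure (scalar_measure E v) {0..s}"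
   by(rule plus_emeasure[symmetric]) auto
  moreover have "{..<0} \<union> {0..s} = {..s}" using s by auto
  ultimately have "(norm (E {0..s} v))^2 = (norm v)^2" by(simp add: E_neg emeasureE that)
  thus "E {0..s} v = v" using orth_projection_pythagoras[OF projE, of "{0..s}" v] by simp
 qed auto
 note comm = E_F_commute[of "{..s}" s]
 show ?thesis
 proof (rule projection_eq_iff_fix[OF projE orth_projection_F])
  fix v
  show "E {..s} v = v \<longleftrightarrow> F s v = v"
  proof
   assume a: "E {..s} v = v"
   define w where "w = v - F s v"
   have e1: "E {..s} w = w" using commutesD[OF comm, of v] by(simp add: w_def blin_simps a)
   have e2: "F s w = 0" by(simp add: w_def blin_simps F_proj)
   obtain w' where e': "(w, w') : quot" using dom[OF e1] by blast
   have "inner w' w <= s * (norm w)^2" by(rule form_le(1)[OF _ e1 e']) auto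
   hence "inner w' w = s * (norm w)^2" using quot_F_unbounded(3)[OF e2 e' s] by simp
   hence "w = 0" by(rule quot_F_unbounded(4)[OF e2 e' s])
   thus "F s v = v" by(simp add: w_def)
  next
   assume a: "F s v = v"
   define w where "w = v - E {..s} v"
   have e1: "F s w = w" using commutesD[OF comm, of v] by(simp add: w_def blin_simps a)
   have c: "E {s<..} = id_blinfun - E {..s}"
    using projection_valued_measure_compl[OF pvmE, of "{..s}"] by simp
   have e2: "E {s<..} w = w"
    unfolding c by(simp add: w_def blin_simps E_idem)
   obtain w' where e': "(w, w') : quot" "inner w' w <= s * (norm w)^2" by(rule quot_F_bounded[OF e1])
   have "s * (norm w)^2 <= inner w' w" by(rule form_gt(1)[OF _ e2 e'(1)]) auto
   hence "inner w' w = s * (norm w)^2" using e'(2) by simp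
   hence "w = 0" by(intro form_gt(2)[OF _ e2 e'(1), of s]) auto
   thus "E {..s} v = v" by(simp add: w_def)
  qed
 qed simp
qed

lemma E_eq_pvm: "E = sf.pvm"
proof
 fix S
 show "E S = sf.pvm S"
 proof (cases "S : sets borel")
  case True
  show ?thesis
  proof (rule projection_eq_iff_norm[OF projE[OF True] sf.orth_projection_pvm[OF True]])
   fix v
   have gt: "E {x<..} = id_blinfun - E {..x}" "sf.pvm {x<..} = id_blinfun - sf.pvm {..x}" for x
    using projection_valued_measure_compl[OF pvmE, of "{..x}"]
     projection_valued_measure_compl[OF projection_valued_measure_pvm, of "{..x}"] by simp_all
   have "scalar_measure E v = smeas v"
   proof (rule measure_eqI_lessThan)
    show "emeasure (scalar_measure E v) {x<..} < \<infinity>" for x by(simp add: emeasureE)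
    show "emeasure (scalar_measure E v) {x<..} = emeasure (smeas v) {x<..}" for x
     by(simp add: emeasureE emeasure_smeas gt E_atMost sf.pvm_atMost)
   qed simp_all
   hence "(norm (E S v))^2 = (norm (sf.pvm S v))^2"
    using emeasureE[OF True, of v] emeasure_smeas[OF True, of v] by simp
   thus "norm (E S v) = norm (sf.pvm S v)" by(simp only: power2_eq_iff_nonneg norm_ge_zero)
  qed
 qed (simp add: projection_valued_measureD(6)[OF pvmE] sf.pvm_def)
qed

end

lemma (in complex_cd_pair) spectral_measure_quot: "spectral_measure quot = sf.pvm"
 unfolding spectral_measure_def
proof (rule the_equality)
 show "is_spectral_measure quot sf.pvm" by(rule is_spectral_measure_pvm)
 fix E assume "is_spectral_measure quot E"
 then interpret spectral_measure_of_quot C D E by unfold_locales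
 show "E = sf.pvm" by(rule E_eq_pvm)
qed


section \<open>Tail projections\<close>

text \<open>Testing the real adjoint relation at (v, v') and at its multiple by i gives both parts
  of the complex one.\<close>

lemma uadj_eq_radj_rel:
 assumes "!!v w. (v, w) : x ==> (\<i> *\<^sub>C v, \<i> *\<^sub>C w) : x"
 shows "uadj x = radj_rel x"
proof safe
 fix w u assume "(w, u) : uadj x"
 thus "(w, u) : radj_rel x" by(auto simp: uadj_def inner_cinner intro!: radj_relI)
next
 fix w u assume a: "(w, u) : radj_rel x"
 have "cinner v' w = cinner v u" if "(v, v') : x" for v v'
  using radj_relD[OF a that] radj_relD[OF a assms[OF that]] by(simp add: cinner_eq inner_scaleC_i)
 thus "(w, u) : uadj x" by(auto simp: uadj_def)
qed

locale cdd_op =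
 fixes x :: "'h::complex_hilbert_space uop"
 assumes cdd: "closed_densely_defined x"

sublocale cdd_op \<subseteq> closed_op x
 using cdd by unfold_locales (simp_all add: closed_densely_defined_def)

context cdd_op
begin

lemma scaleC_x: "(v, w) : x ==> (c *\<^sub>C v, c *\<^sub>C w) : x"
 using cdd by(auto simp: closed_densely_defined_def)

lemma scaleC_op_x: "(v, w) : x ==> (scaleC_op \<i> v, scaleC_op \<i> w) : x"
 "(v, w) : x ==> (radj (scaleC_op \<i>) v, radj (scaleC_op \<i>) w) : x"
 using scaleC_x subspace_scale[OF subspace_x scaleC_x[of v w \<i>], of "-1"]
 by(simp_all add: radj_scaleC_i blin_simps)

lemma opC_complex: "opC : bounded_ops" and opD_complex: "opD : bounded_ops" and opZ_complex: "opZ : bounded_ops"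
proof -
 have "commutes (scaleC_op \<i>) opC & commutes (scaleC_op \<i>) opD"
  by(rule commutes_CD_of_B[OF commutes_B_of_x[OF scaleC_op_x]])
 thus "opC : bounded_ops" "opD : bounded_ops" unfolding bounded_ops_iff by(auto intro: commutes_sym)
 show "opZ : bounded_ops" unfolding bounded_ops_iff by(rule commutes_sym[OF commutes_Z_of_x[OF scaleC_op_x]])
qed

end

sublocale cdd_op \<subseteq> ccd: complex_cd_pair opC opD
 by unfold_locales (simp_all add: opC_complex opD_complex)

context cdd_op
begin

lemma uabs_eq: "uabs x = quot"
 unfolding uabs_def
proof (rule the_equality)
 have q: "(c *\<^sub>C v, c *\<^sub>C w) : quot" if "(v, w) : quot" for c v w
  using that by(auto simp: quot_def bounded_opsD[OF opC_complex, symmetric] bounded_opsD[OF opD_complex, symmetric])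
 have u: "uadj x = radj_rel x" by(rule uadj_eq_radj_rel) (rule scaleC_x)
 have "closed_densely_defined quot"
  using q by(auto simp: closed_densely_defined_def subspace_quot single_valued_quot closed_quot Domain_quot dense_range_C)
 moreover have "uadj quot = quot" using uadj_eq_radj_rel[of quot] q radj_rel_quot by simp
 moreover have "cinner w v : \<real> & 0 <= Re (cinner w v)" if "(v, w) : quot" for v w
  using ccd.quot_form[OF that] quot_positive[OF that] by simp
 ultimately show "positive_selfadjoint quot & quot O quot = x O uadj x"
  unfolding positive_selfadjoint_def using quot_square_eq u by auto
 fix a assume a: "positive_selfadjoint a & a O a = x O uadj x"
 then interpret a: cdd_op a by unfold_locales (simp add: positive_selfadjoint_def)
 have "uadj a = radj_rel a" by(rule uadj_eq_radj_rel) (rule a.scaleC_x)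
 thus "a = quot"
  using a u by(intro positive_root_unique a.closed_op_axioms) (auto simp: positive_selfadjoint_def inner_cinner)
qed

lemma tail_eq: "spectral_measure (uabs x) {s<..} = id_blinfun - F s"
proof -
 have "sf.pvm {s<..} = id_blinfun - sf.pvm {..s}"
  using projection_valued_measure_compl[OF ccd.projection_valued_measure_pvm, of "{..s}"] by simp
 thus ?thesis by(simp add: uabs_eq ccd.spectral_measure_quot sf.pvm_atMost)
qed

end

definition tail :: "'h::complex_hilbert_space uop => real => 'h bop" where
 "tail x s = spectral_measure (uabs x) {s<..}"

context cdd_op
begin

lemma tail_F: "tail x s = id_blinfun - F s"
 by(simp add: tail_def tail_eq)

lemma tail_apply: "tail x s v = v - F s v"
 by(simp add: tail_F blin_simps)

lemma orth_projection_tail: "orth_projection (tail x s)"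
 unfolding tail_F by(rule orth_projection_compl[OF orth_projection_F])

lemma tail_C: "tail x s (opC u) = opC (tail x s u)"
 by(simp add: tail_apply FC blin_simps)

lemma tail_D: "tail x s (opD u) = opD (tail x s u)"
 by(simp add: tail_apply FD blin_simps)

lemma x_iff: "(v, w) : x \<longleftrightarrow> (EX u. v = opC u & w = opZ u)"
proof
 assume "(v, w) : x"
 hence "(v, w) : range (%u. (opC u, opZ u))" by(rule subsetD[OF equalityD1[OF x_eq_range_CZ]])
 thus "EX u. v = opC u & w = opZ u" by auto
qed (use Z_in in auto)

lemma tail_bounded:
 assumes "tail x s v = 0"
 obtains w where "(v, w) : x" "norm w <= s * norm v"
proof -
 have "F s v = v" using assms by(simp add: tail_apply)
 then obtain w where e: "(v, w) : quot" "norm w <= s * norm v" by(rule quot_F_bounded)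
 then obtain u where "v = opC u" "w = opD u" by(auto simp: quot_def)
 thus ?thesis using that[of "opZ u"] Z_in[of u] e(2) by(simp add: norm_Z)
qed

text \<open>The tail belongs to an open half-line, so on its range x strictly exceeds s. Together
  with \<open>tail_bounded\<close> this separates the two subspaces and drives
  \<open>lam_le\<close>.\<close>

lemma tail_strict:
 assumes "(v, w) : x" "tail x s v = v" "0 <= s" "norm w <= s * norm v"
 shows "v = 0"
proof -
 obtain u where z: "v = opC u" "w = opZ u" using assms(1) by(auto simp: x_iff)
 have F: "F s v = 0" using assms(2) by(simp add: tail_apply)
 have q: "(v, opD u) : quot" by(simp add: quot_def z)
 have "s * norm v = norm (opD u)"
  using quot_F_unbounded(1)[OF F q assms(3)] assms(4) by(simp add: z norm_Z)
 thus ?thesis by(rule quot_F_unbounded(2)[OF F q assms(3)])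
qed

text \<open>x maps the spectral subspace and its complement to orthogonal subspaces, because Z and D
  have the same inner products and D commutes with the tail.\<close>

lemma Z_orth: "inner (opZ (tail x s u)) (opZ (u' - tail x s u')) = 0"
proof -
 have "inner (opZ (tail x s u)) (opZ (u' - tail x s u')) = inner (tail x s (opD u)) (opD u' - tail x s (opD u'))"
  by(subst inner_Z) (simp add: tail_D blin_simps)
 also have "... = inner (opD u) (tail x s (opD u' - tail x s (opD u')))"
  by(rule symmD[OF orth_projectionD(2)[OF orth_projection_tail]])
 also have "... = 0"
  by(simp add: blin_simps orth_projectionD(1)[OF orth_projection_tail])
 finally show ?thesis .
qed

lemma tail_mono:
 assumes "s <= t"
 shows "tail x t (tail x s v) = tail x t v" "tail x s (tail x t v) = tail x t v"
 by(simp_all add: tail_apply blin_simps sf.F_le[OF assms] sf.F_le'[OF assms])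

lemma tail_right_limit: "(%n. tail x (s + 1 / real (Suc n)) v) ----> tail x s v"
 unfolding tail_apply by(intro tendsto_intros sf.F_right_limit)

lemma tail_top_limit: "(%n. tail x (real n) v) ----> 0"
 using tendsto_diff[OF tendsto_const sf.F_top_limit[of v], of v] by(simp add: tail_apply)

lemma commutes_of_x:
 assumes "!!v w. (v, w) : x ==> (blinfun_apply U v, U w) : x"
  and "!!v w. (v, w) : x ==> (radj U v, radj U w) : x"
 shows "commutes U (tail x s)" "commutes U opC" "commutes U opZ"
proof -
 note CD = commutes_CD_of_B[OF commutes_B_of_x[OF assms]]
 show "commutes U opC" using CD by simp
 show "commutes U opZ" by(rule commutes_Z_of_x[OF assms])
 show "commutes U (tail x s)"
  unfolding tail_F using CD by(intro commutes_diff commutes_id commutes_F) simp_all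
qed

end


section \<open>Projections in a von Neumann algebra\<close>

lemma symm_zero_form:
 fixes A :: "'a::real_inner bop"
 assumes "symm A" "!!v. inner (A v) v = 0"
 shows "A = 0"
proof (rule blinfun_eqI)
 fix v
 have "psd A" using assms by(simp add: psd_def)
 thus "A v = (0 :: 'a bop) v" using psd_zero_vector[OF _ assms(2)] by simp
qed

locale vna =
 fixes M :: "'h::complex_hilbert_space bop set"
 assumes vna: "von_neumann_algebra M"
begin

abbreviation "M' \<equiv> commutant M"

lemma M_bounded_ops: "A : M ==> A : bounded_ops"
 using vna by(auto simp: von_neumann_algebra_def)

lemma J_M': "scaleC_op \<i> : M'"
proof -
 have "scaleC_op \<i> : bounded_ops" by(simp add: bounded_ops_iff)
 moreover have "commutes (scaleC_op \<i>) A" if "A : M" for A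
  using M_bounded_ops[OF that] unfolding bounded_ops_iff by(rule commutes_sym)
 ultimately show ?thesis by(simp add: commutant_def commutes_def)
qed

lemma radj_M: "A : M ==> radj A : M"
 using vna M_bounded_ops adj_eq_radj unfolding von_neumann_algebra_def by metis

lemma M'_commutes: "U : M' ==> A : M ==> commutes U A"
 by(simp add: commutant_def commutes_def)

lemma M'_bounded_ops: "U : M' ==> U : bounded_ops"
 by(simp add: commutant_def)

lemma radj_M': "U : M' ==> radj U : M'"
proof -
 assume U: "U : M'"
 have "commutes (radj U) A" if "A : M" for A
  using commutes_radj[OF M'_commutes[OF U radj_M[OF that]]] by simp
 thus ?thesis using radj_bounded_ops[OF M'_bounded_ops[OF U]] by(simp add: commutant_def commutes_def)
qed

text \<open>The bicommutant condition as a membership test: every construction below enters M by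
  commuting with M'. Complex linearity comes along, since multiplication by i lies in M'.\<close>

lemma M_I:
 assumes "!!U. U : M' ==> commutes U A"
 shows "A : M"
proof -
 have "A : bounded_ops" unfolding bounded_ops_iff by(rule commutes_sym[OF assms[OF J_M']])
 hence "A : commutant M'" using assms by(simp add: commutant_def commutes_def)
 thus ?thesis using vna by(simp add: von_neumann_algebra_def)
qed

lemma id_M [simp]: "id_blinfun : M"
 and zero_M [simp]: "0 : M"
 by(rule M_I; simp add: commutes_iff blin_simps)+

lemma add_M: "A : M ==> B : M ==> A + B : M"
 by(rule M_I) (simp add: commutes_add M'_commutes)

lemma diff_M: "A : M ==> B : M ==> A - B : M"
 by(rule M_I) (simp add: commutes_diff M'_commutes)

lemma scaleR_M: "A : M ==> c *\<^sub>R A : M"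
 by(rule M_I) (simp add: commutes_scale M'_commutes)

lemma compose_M: "A : M ==> B : M ==> A oL B : M"
 by(rule M_I) (simp add: commutes_compose M'_commutes)

lemma scaleC_M: "scaleC_op c : M' "
proof -
 have "commutes (scaleC_op c) A" if "A : bounded_ops" for A :: "'h bop"
  by(simp add: commutes_iff bounded_opsD[OF that])
 moreover have "(scaleC_op c :: 'h bop) : bounded_ops" by(simp add: bounded_ops_def scaleC_scaleC mult.commute)
 ultimately show ?thesis by(auto simp: commutant_def commutes_def M_bounded_ops)
qed

lemma scaleC_compose_M: "A : M ==> scaleC_op c oL A : M"
proof (rule M_I)
 fix U assume U: "U : M'" "A : M"
 show "commutes U (scaleC_op c oL A)"
  using commutesD[OF M'_commutes[OF U]] by(simp add: commutes_iff bounded_opsD[OF M'_bounded_ops[OF U(1)]])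
qed

lemma op_sqrt_M: "A : M ==> psd A ==> op_sqrt A : M"
 by(rule M_I) (simp add: commutes_op_sqrt M'_commutes)

lemma neg_proj_M: "A : M ==> symm A ==> neg_proj A : M"
 by(rule M_I) (simp add: commutes_neg_proj M'_commutes)

lemma Proj_M:
 assumes "subspace S" "closed S" "!!U v. U : M' ==> v : S ==> U v : S"
 shows "Proj S : M"
proof (rule M_I)
 fix U assume "U : M'"
 thus "commutes U (Proj S)" using assms(3) radj_M' by(intro commutes_Proj[OF assms(1,2)]) blast+
qed

definition Pr :: "'h bop set" where "Pr = {P : M. orth_projection P}"

lemma PrD: "P : Pr ==> P : M" "P : Pr ==> orth_projection P" "P : Pr ==> P (P v) = P v"
 by(auto simp: Pr_def orth_projectionD)

lemma Pr_symm: "P : Pr ==> inner (P v) w = inner v (P w)"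
 using symmD[OF orth_projectionD(2)[OF PrD(2)]] by blast

lemma Pr_compl: "P : Pr ==> id_blinfun - P : Pr"
 by(simp add: Pr_def diff_M orth_projection_compl)

lemma Pr_zero [simp]: "0 : Pr" and Pr_id [simp]: "id_blinfun : Pr"
 by(simp_all add: Pr_def)

lemma Pr_le_apply:
 assumes "P : Pr" "Q : Pr" "!!v. Q v = 0 ==> P v = 0"
 shows "P (Q v) = P v" "Q (P v) = P v"
proof -
 have 1: "P oL Q = P" using projection_le_iff(1)[OF PrD(2)[OF assms(1)] PrD(2)[OF assms(2)]] assms(3) by simp
 hence 2: "Q oL P = P" using projection_le_iff(3)[OF PrD(2)[OF assms(1)] PrD(2)[OF assms(2)]] by simp
 show "P (Q v) = P v" using arg_cong[OF 1, of "%A. blinfun_apply A v"] by simp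
 show "Q (P v) = P v" using arg_cong[OF 2, of "%A. blinfun_apply A v"] by simp
qed

lemma Pr_diff:
 assumes "P : Pr" "Q : Pr" "!!v. Q v = 0 ==> P v = 0"
 shows "Q - P : Pr"
proof -
 have "P oL Q = P" using projection_le_iff(1)[OF PrD(2)[OF assms(1)] PrD(2)[OF assms(2)]] assms(3) by simp
 thus ?thesis using assms by(simp add: Pr_def diff_M orth_projection_diff)
qed

text \<open>Projections are named by their kernels: the supremum of projections has the intersection
  of the kernels as kernel, so joins involve no closures of sums.\<close>

definition pr_ker :: "'h set => 'h bop" where "pr_ker S = id_blinfun - Proj S"

lemma pr_ker:
 assumes "subspace S" "closed S" "!!U v. U : M' ==> v : S ==> U v : S"
 shows "pr_ker S : Pr" "pr_ker S v = 0 \<longleftrightarrow> v : S"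
proof -
 show "pr_ker S : Pr"
  unfolding pr_ker_def using Proj_M[OF assms] orth_projection_Proj[OF assms(1,2)] by(intro Pr_compl) (simp add: Pr_def)
 show "pr_ker S v = 0 \<longleftrightarrow> v : S"
  unfolding pr_ker_def using Proj_fix_iff[OF assms(1,2), of v] by(auto simp: blin_simps)
qed

lemma ker_invariant: "A : M ==> U : M' ==> A v = 0 ==> A (U v) = 0"
 using commutesD[OF M'_commutes, of U A v] by(simp)

definition join :: "'h bop => 'h bop => 'h bop" where
 "join P Q = pr_ker {v. P v = 0 & Q v = 0}"

lemma join:
 assumes "P : M" "Q : M"
 shows join_Pr: "join P Q : Pr" and join_zero_iff: "join P Q v = 0 \<longleftrightarrow> P v = 0 & Q v = 0"
proof -
 let ?S = "{v. P v = 0 & Q v = 0}"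
 have S: "subspace ?S" "closed ?S"
  by(auto simp: subspace_def blin_simps intro!: closed_Collect_conj closed_Collect_eq continuous_intros)
 have "U v : ?S" if "U : M'" "v : ?S" for U v using that ker_invariant assms by blast
 from pr_ker[OF S this] show "join P Q : Pr" "join P Q v = 0 \<longleftrightarrow> P v = 0 & Q v = 0"
  unfolding join_def by blast+
qed

definition Join :: "(nat => 'h bop) => 'h bop" where
 "Join P = pr_ker {v. ALL n. P n v = 0}"

lemma Join:
 assumes "!!n. P n : M"
 shows Join_Pr: "Join P : Pr" and Join_zero_iff: "Join P v = 0 \<longleftrightarrow> (ALL n. P n v = 0)"
proof -
 let ?S = "{v. ALL n. P n v = 0}"
 have S: "subspace ?S" "closed ?S"
  by(auto simp: subspace_def blin_simps intro!: closed_Collect_all closed_Collect_eq continuous_intros)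
 have "U v : ?S" if "U : M'" "v : ?S" for U v using that ker_invariant assms by blast
 from pr_ker[OF S this] show "Join P : Pr" "Join P v = 0 \<longleftrightarrow> (ALL n. P n v = 0)"
  unfolding Join_def by blast+
qed

end


section \<open>Traces of projections\<close>

locale traced_vna = vna M for M :: "'h::complex_hilbert_space bop set" +
 fixes \<tau> :: "'h bop => ennreal"
 assumes trace: "fns_trace M \<tau>"
begin

lemma cone_iff: "A : positive_cone M \<longleftrightarrow> A : M & psd A"
 using M_bounded_ops by(auto simp: positive_cone_def positive_op_iff)

lemma op_le_iff: "A : M ==> B : M ==> op_le A B \<longleftrightarrow> psd (B - A)"
 using M_bounded_ops[OF diff_M, of B A] by(simp add: op_le_def positive_op_iff)

lemma trace_add: "A : M ==> psd A ==> B : M ==> psd B ==> \<tau> (A + B) = \<tau> A + \<tau> B"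
 using trace cone_iff by(simp add: fns_trace_def is_trace_def)

lemma trace_tracial: "A : M ==> \<tau> (radj A oL A) = \<tau> (A oL radj A)"
proof -
 assume A: "A : M"
 have "ALL A:M. \<tau> (adj A oL A) = \<tau> (A oL adj A)" using trace unfolding fns_trace_def is_trace_def by blast
 from bspec[OF this A] show ?thesis by(simp only: adj_eq_radj[OF M_bounded_ops[OF A]])
qed

lemma trace_faithful: "A : M ==> psd A ==> \<tau> A = 0 ==> A = 0"
 using trace cone_iff by(simp add: fns_trace_def faithful_trace_def)

lemma trace_zero [simp]: "\<tau> 0 = 0"
proof -
 have "0 : positive_cone M" by(simp add: cone_iff psd_def symm_def)
 hence "\<tau> (0 *\<^sub>R 0) = ennreal 0 * \<tau> 0" using trace unfolding fns_trace_def is_trace_def by blast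
 thus ?thesis by simp
qed

lemma Pr_psd: "P : Pr ==> psd P"
 by(rule psd_projection[OF PrD(2)])

lemma trace_diff:
 assumes "P : Pr" "Q : Pr" "!!v. Q v = 0 ==> P v = 0"
 shows "\<tau> Q = \<tau> (Q - P) + \<tau> P"
 using trace_add[of "Q - P" P] Pr_diff[OF assms] assms PrD(1) Pr_psd by simp

lemma trace_mono:
 assumes "P : Pr" "Q : Pr" "!!v. Q v = 0 ==> P v = 0"
 shows "\<tau> P <= \<tau> Q"
 by(subst trace_diff[OF assms]) auto

lemma trace_small_zero:
 assumes "P : Pr" "!!e. 0 < e ==> \<tau> P <= ennreal e"
 shows "P = 0"
proof (rule trace_faithful[OF PrD(1)[OF assms(1)] Pr_psd[OF assms(1)]])
 have "\<tau> P <= 0" by(rule ennreal_le_epsilon) (use assms(2) in simp)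
 thus "\<tau> P = 0" by simp
qed

text \<open>Normality concerns suprema of directed families in the operator order. The strong limit
  of an increasing sequence is such a supremum, which is checked on quadratic forms.\<close>

lemma trace_increasing_limit:
 assumes P: "!!n. P n : Pr" and Q: "Q : Pr" and mono: "!!n v. P (Suc n) v = 0 ==> P n v = 0"
  and lim: "!!v. (%n. P n v) ----> Q v"
 shows "\<tau> Q = (SUP n. \<tau> (P n))"
proof -
 have mono': "P m v = 0" if "P n v = 0" "m <= n" for m n v
  using that(2,1) by(induction n rule: dec_induct) (auto intro: mono)
 have le: "psd (P n - P m)" if "m <= n" for m n
  by(rule Pr_psd, rule Pr_diff[OF P P]) (use mono' that in blast)
 have ub: "psd (Q - P n)" for n
 proof (rule Pr_psd, rule Pr_diff[OF P Q])
  fix v assume z: "Q v = 0"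
  have "norm (P n v) <= norm (P m v)" if "n <= m" for m
  proof -
   have "P n (P m v) = P n v" by(rule Pr_le_apply[OF P P]) (use mono' that in blast)
   thus ?thesis using norm_orth_projection_le[OF PrD(2)[OF P], of n "P m v"] by simp
  qed
  hence "eventually (%m. norm (P n v) <= norm (P m v)) sequentially"
   by(auto simp: eventually_sequentially)
  moreover have "(%m. norm (P m v)) ----> norm (Q v)" by(intro tendsto_intros lim)
  ultimately have "norm (P n v) <= norm (Q v)" by(intro tendsto_lowerbound) auto
  thus "P n v = 0" by(simp add: z)
 qed
 have least: "psd (C - Q)" if C: "C : positive_cone M" "ALL B:range P. op_le B C" for C
  unfolding psd_def
 proof (intro conjI allI)
  have "C : M" "psd C" using C(1) by(simp_all add: cone_iff)
  hence "psd (C - P n)" for n using C(2) op_le_iff[OF PrD(1)[OF P]] by blast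
  hence "0 <= inner ((C - P n) v) v" for n v by(rule psdD)
  hence "inner (P n v) v <= inner (C v) v" for n v by(simp add: blin_simps inner_diff_left)
  hence "inner (Q v) v <= inner (C v) v" for v
   by(intro LIMSEQ_le_const2[of "%n. inner (P n v) v"] tendsto_intros lim) blast
  thus "0 <= inner ((C - Q) v) v" for v by(simp add: blin_simps inner_diff_left)
  show "symm (C - Q)" using `psd C` Pr_psd[OF Q] by(intro symm_diff psd_symm)
 qed
 have N: "D ~= {} & D \<subseteq> positive_cone M & (ALL B:D. ALL C:D. EX E:D. op_le B E & op_le C E) &
   A : positive_cone M & (ALL B:D. op_le B A) & (ALL C:positive_cone M. (ALL B:D. op_le B C) --> op_le A C)
   ==> \<tau> A = (SUP B\<in>D. \<tau> B)" for D A
  using trace unfolding fns_trace_def normal_trace_def by blast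
 have "\<tau> Q = (SUP B\<in>range P. \<tau> B)"
 proof (rule N, intro conjI ballI impI)
  show "range P \<subseteq> positive_cone M" using P PrD(1) Pr_psd by(auto simp: cone_iff)
  show "Q : positive_cone M" using Q PrD(1) Pr_psd by(auto simp: cone_iff)
  show "op_le B Q" if "B : range P" for B using that ub op_le_iff[OF PrD(1)[OF P] PrD(1)[OF Q]] by auto
  show "op_le Q C" if "C : positive_cone M" "ALL B:range P. op_le B C" for C
   using least[OF that] op_le_iff[OF PrD(1)[OF Q]] that(1) by(simp add: cone_iff)
  fix B C assume "B : range P" "C : range P"
  then obtain m n where mn: "B = P m" "C = P n" by blast
  have "op_le (P m) (P (max m n)) & op_le (P n) (P (max m n))"
   using le[of m "max m n"] le[of n "max m n"] op_le_iff[OF PrD(1)[OF P] PrD(1)[OF P]] by simp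
  thus "EX E:range P. op_le B E & op_le C E" unfolding mn by blast
 qed simp
 thus ?thesis by(simp add: image_image)
qed

text \<open>The comparison principle behind all trace estimates. On the spectral subspaces of \<open>T\<^sup>*T\<close> away
 from zero, \<open>T |T|\<^sup>-\<^sup>1\<close> is a partial isometry, and these subspaces exhaust the range of \<open>P\<close>.\<close>

lemma trace_le_of_injective:
 assumes P: "P : Pr" and Q: "Q : Pr" and T: "T : M"
  and inj: "!!v. P v = v ==> T v = 0 ==> v = 0"
  and ran: "!!v. P v = v ==> Q (T v) = T v"
 shows "\<tau> P <= \<tau> Q"
proof -
 define V where "V = T oL P"
 define S where "S = radj V oL V"
 have VM: "V : M" unfolding V_def by(rule compose_M[OF T PrD(1)[OF P]])
 have SM: "S : M" unfolding S_def by(rule compose_M[OF radj_M[OF VM] VM])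
 have Sform: "inner (S v) w = inner (V v) (V w)" for v w
  by(simp add: S_def radj)
 have symS: "symm S" by(simp add: symm_def) (metis Sform inner_commute)
 have psdS: "psd S" by(simp add: psd_def symS Sform)
 define c where "c n = 1 / real (Suc n)" for n
 have c: "c n > 0" "c (Suc n) < c n" for n by(simp_all add: c_def field_simps)
 \<comment> \<open>Spectral projections of S for (c n, \<infinity>); they increase to the support of
   S, which is P by injectivity.\<close>
 define e where "e n = id_blinfun - neg_proj (S - c n *\<^sub>R id_blinfun)" for n
 have symSc: "symm (S - c n *\<^sub>R id_blinfun)" for n by(intro symm_diff symm_scale symS symm_id)
 have np: "neg_proj (S - c n *\<^sub>R id_blinfun) : Pr" for n
  unfolding Pr_def by(simp add: neg_proj_M orth_projection_neg_proj symSc diff_M SM scaleR_M)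
 have ePr: "e n : Pr" for n unfolding e_def by(rule Pr_compl[OF np])
 have np_apply: "neg_proj (S - c n *\<^sub>R id_blinfun) v = v - e n v" for n v
  by(simp add: e_def blin_simps)
 have e_ge: "c n * (norm v)^2 <= inner (S v) v" if "e n v = v" for n v
  using neg_proj_zero(1)[OF symSc, of n v] that
  by(simp add: np_apply blin_simps inner_diff_left power2_norm_eq_inner)
 have e_le: "inner (S v) v <= c n * (norm v)^2" if "e n v = 0" for n v
  using neg_proj_fix[OF symSc, of n v] that
  by(simp add: np_apply blin_simps inner_diff_left power2_norm_eq_inner)
 have comm_e: "commutes U (e n)" if "commutes U S" for U n
  unfolding e_def by(intro commutes_diff commutes_id commutes_neg_proj symSc commutes_scale that)
 have Se: "S (e n v) = e n (S v)" for n v by(rule commutesD[OF comm_e]) simp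
 have ee: "e m (e n v) = e n (e m v)" for m n v
  by(rule commutesD[OF comm_e[OF commutes_sym[OF comm_e]]]) simp
 have e_mono: "e n v = 0" if "e (Suc n) v = 0" for n v
 proof -
  define w where "w = e n v"
  have 1: "e n w = w" by(simp add: w_def PrD(3)[OF ePr])
  have 2: "e (Suc n) w = 0" by(simp only: w_def ee[of "Suc n"] that blinfun.zero_right)
  have "c n * (norm w)^2 <= c (Suc n) * (norm w)^2" using e_ge[OF 1] e_le[OF 2] by linarith
  hence "(norm w)^2 <= 0" using c(2)[of n] by(simp add: mult_le_cancel_right)
  thus ?thesis by(simp add: w_def)
 qed
 have e_zero: "(ALL n. e n v = 0) \<longleftrightarrow> P v = 0" for v
 proof
  assume z: "ALL n. e n v = 0"
  have "inner (S v) v <= c n * (norm v)^2" for n using e_le z by blast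
  moreover have "(%n. c n * (norm v)^2) ----> 0 * (norm v)^2"
   unfolding c_def by(intro tendsto_intros LIMSEQ_Suc lim_1_over_n)
  ultimately have "inner (S v) v <= 0 * (norm v)^2" by(intro LIMSEQ_le_const) auto
  hence "inner (V v) (V v) = 0" using inner_ge_zero[of "V v"] by(simp add: Sform)
  hence "V v = 0" by simp
  thus "P v = 0" using inj[of "P v"] by(simp add: V_def PrD(3)[OF P])
 next
  assume z: "P v = 0"
  hence Sz: "S v = 0" by(simp add: S_def V_def)
  show "ALL n. e n v = 0"
  proof
   fix n
   have "c n * (norm (e n v))^2 <= inner (S (e n v)) (e n v)" by(rule e_ge) (rule PrD(3)[OF ePr])
   hence "c n * (norm (e n v))^2 <= 0" by(simp add: Se Sz)
   thus "e n v = 0" using c(1)[of n] by(simp add: mult_le_0_iff)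
  qed
 qed
 have e_fix: "e (Suc n) v = v" if "e n v = v" for n v
  using Pr_le_apply(2)[OF ePr[of n] ePr[of "Suc n"] e_mono, of v] that by simp
 obtain R where R: "orth_projection R" "!!v. (%n. e n v) ----> R v" "!!v. R v = 0 \<longleftrightarrow> (ALL n. e n v = 0)"
  by(rule increasing_projections_converge[of e]) (rule PrD(2)[OF ePr], erule e_fix, blast)
 have "R = P" by(rule projection_eq_iff_ker[OF R(1) PrD(2)[OF P]]) (simp add: R(3) e_zero)
 hence "\<tau> P = (SUP n. \<tau> (e n))"
  by(intro trace_increasing_limit ePr P) (erule e_mono, use R(2) in simp)
 moreover have "\<tau> (e n) <= \<tau> Q" for n
 proof -
  let ?R = "op_sqrt S"
  have R: "psd ?R" "?R (?R v) = S v" for v by(simp_all add: psd_op_sqrt op_sqrt_apply psdS)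
  have RM: "?R : M" by(rule op_sqrt_M[OF SM psdS])
  have Re: "commutes (e n) ?R" by(rule commutes_op_sqrt[OF psdS commutes_sym[OF comm_e]]) simp
  have normR: "c n * (norm (e n v))^2 <= (norm (?R (e n v)))^2" for v
   using e_ge[OF PrD(3)[OF ePr], of n v] symmD[OF psd_symm[OF R(1)], of "?R (e n v)" "e n v"]
   by(simp add: R(2) power2_norm_eq_inner)
  have low: "sqrt (c n) * norm v <= norm (?R v)" if "e n v = v" for v
   by(rule power2_le_imp_le) (use normR[of v] c(1)[of n] that in "simp_all add: power_mult_distrib less_imp_le")
  obtain K :: "'h bop" where K: "!!v. ?R (K (e n v)) = e n v" "!!U. commutes U ?R ==> commutes U (e n) ==> commutes U K"
   using compression_invertible[OF psd_symm[OF R(1)] PrD(2)[OF ePr] Re _ low] c(1)[of n] by auto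
  have KM: "K : M" by(rule M_I, rule K(2); rule M'_commutes) (auto intro: RM PrD(1)[OF ePr])
  have Ke: "e n (K v) = K (e n v)" for v by(rule commutesD[OF K(2)[OF Re commutes_self]])
  \<comment> \<open>K inverts the root of S on the range of e n, so W is V |V|^(-1) there: a partial
    isometry with initial projection e n and final projection below Q.\<close>
  define W where "W = V oL K oL e n"
  have WM: "W : M" unfolding W_def by(intro compose_M VM KM PrD(1)[OF ePr])
  have nW: "inner (W v) (W v) = inner (e n v) v" for v
  proof -
   define k where "k = K (e n v)"
   have Rk: "?R k = e n v" by(simp add: k_def K)
   have "inner (W v) (W v) = inner (S k) k" by(simp add: W_def k_def Sform)
   also have "... = inner (?R k) (?R k)"
    using symmD[OF psd_symm[OF R(1)], of "?R k" k] by(simp add: R(2))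
   also have "... = inner (e n v) v"
    by(simp add: Rk orth_projection_inner[OF PrD(2)[OF ePr]] power2_norm_eq_inner)
   finally show ?thesis .
  qed
  have WW: "radj W oL W = e n"
  proof -
   have "(radj W oL W) - e n = 0"
   proof (rule symm_zero_form)
    have "symm (radj W oL W)" by(simp add: symm_radj radj_compose)
    thus "symm ((radj W oL W) - e n)" by(intro symm_diff orth_projectionD(2)[OF PrD(2)[OF ePr]])
    show "inner (((radj W oL W) - e n) v) v = 0" for v
     using nW[of v] by(simp add: blin_simps inner_diff_left inner_diff_right radj'[symmetric] inner_commute radj)
   qed
   thus ?thesis by simp
  qed
  have We: "W (e n v) = W v" for v by(simp add: W_def PrD(3)[OF ePr])
  define G where "G = W oL radj W"
  have GM: "G : M" unfolding G_def by(rule compose_M[OF WM radj_M[OF WM]])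
  have GPr: "G : Pr" unfolding Pr_def
  proof (intro CollectI conjI GM orth_projectionI)
   show "symm G" by(simp add: G_def symm_radj radj_compose)
   have "radj W (W u) = e n u" for u using WW by(metis blinfun_apply_blinfun_compose)
   thus "G (G v) = G v" for v by(simp add: G_def We)
  qed
  have QW: "Q (W v) = W v" for v
   using ran[of "P (K (e n v))"] by(simp add: W_def V_def PrD(3)[OF P])
  have "\<tau> (e n) = \<tau> G" unfolding G_def WW[symmetric] by(rule trace_tracial[OF WM])
  also have "... <= \<tau> Q"
  proof (rule trace_mono[OF GPr Q])
   fix v assume "Q v = 0"
   hence "inner (G v) v = 0"
    using Pr_symm[OF Q, of "G v" v] QW[of "radj W v"] by(simp add: G_def)
   thus "G v = 0" by(simp add: orth_projection_inner[OF PrD(2)[OF GPr]])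
  qed
  finally show ?thesis .
 qed
 ultimately show ?thesis by(simp add: SUP_le_iff)
qed

text \<open>The case T = P of \<open>trace_le_of_injective\<close>.\<close>

lemma trace_le_of_disjoint:
 assumes "E : Pr" "P : Pr" "!!v. E v = v ==> P v = 0 ==> v = 0"
 shows "\<tau> E <= \<tau> P"
 by(rule trace_le_of_injective[OF assms(1,2) PrD(1)[OF assms(2)]]) (use assms(3) PrD(3)[OF assms(2)] in auto)

text \<open>A substitute for Kaplansky's formula: a vector in the range of the difference is killed
  by P, so if Q kills it too, the join does.\<close>

lemma trace_join_diff:
 assumes P: "P : Pr" and Q: "Q : Pr"
 shows "join P Q - P : Pr" "\<tau> (join P Q - P) <= \<tau> Q"
proof -
 note J = join[OF PrD(1)[OF P] PrD(1)[OF Q]]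
 have le: "join P Q v = 0 ==> P v = 0" for v by(simp add: J(2))
 show D: "join P Q - P : Pr" by(rule Pr_diff[OF P J(1) le])
 show "\<tau> (join P Q - P) <= \<tau> Q"
 proof (rule trace_le_of_disjoint[OF D Q])
  fix v assume f: "(join P Q - P) v = v" and z: "Q v = 0"
  have "P ((join P Q - P) v) = 0"
   using Pr_le_apply(1)[OF P J(1) le, of v] by(simp add: blin_simps PrD(3)[OF P])
  hence "P v = 0" by(simp only: f)
  hence "join P Q v = 0" using z by(simp add: J(2))
  thus "v = 0" using f `P v = 0` by(simp add: blin_simps)
 qed
qed

lemma trace_join:
 assumes P: "P : Pr" and Q: "Q : Pr"
 shows "\<tau> (join P Q) <= \<tau> P + \<tau> Q"
proof -
 note J = join[OF PrD(1)[OF P] PrD(1)[OF Q]]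
 have "\<tau> (join P Q) = \<tau> (join P Q - P) + \<tau> P" by(rule trace_diff[OF P J(1)]) (simp add: J(2))
 thus ?thesis using trace_join_diff(2)[OF assms] by(simp add: add.commute add_left_mono)
qed

lemma trace_Join:
 assumes P: "!!n. P n : Pr"
 shows "\<tau> (Join P) <= (\<Sum>n. \<tau> (P n))"
proof -
 define Q where "Q = rec_nat 0 (%n q. join q (P n))"
 have Q0: "Q 0 = 0" and QS: "Q (Suc n) = join (Q n) (P n)" for n by(simp_all add: Q_def)
 have Q: "Q n : Pr" for n
  by(induction n) (simp_all add: Q0 QS join_Pr PrD(1) P)
 have Qz: "Q n v = 0 \<longleftrightarrow> (ALL k<n. P k v = 0)" for n v
  by(induction n) (auto simp: Q0 QS join_zero_iff PrD(1) P Q less_Suc_eq)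
 have Qt: "\<tau> (Q n) <= (\<Sum>k<n. \<tau> (P k))" for n
 proof (induction n)
  case (Suc n)
  have "\<tau> (Q (Suc n)) <= \<tau> (Q n) + \<tau> (P n)" unfolding QS by(rule trace_join[OF Q P])
  also have "... <= (\<Sum>k<n. \<tau> (P k)) + \<tau> (P n)" by(intro add_right_mono Suc)
  finally show ?case by simp
 qed (simp add: Q0)
 have mono: "Q n v = 0" if "Q (Suc n) v = 0" for n v using that by(simp add: Qz)
 have fixQ: "Q (Suc n) v = v" if "Q n v = v" for n v
  using Pr_le_apply(2)[OF Q[of n] Q[of "Suc n"] mono, of v] that by simp
 obtain R where R: "orth_projection R" "!!v. (%n. Q n v) ----> R v" "!!v. R v = 0 \<longleftrightarrow> (ALL n. Q n v = 0)"
  by(rule increasing_projections_converge[of Q]) (rule PrD(2)[OF Q], erule fixQ, blast)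
 note J = Join[of P, OF PrD(1)[OF P]]
 have "R = Join P"
  by(rule projection_eq_iff_ker[OF R(1) PrD(2)[OF J(1)]]) (auto simp: R(3) Qz J(2))
 hence "\<tau> (Join P) = (SUP n. \<tau> (Q n))"
  by(intro trace_increasing_limit Q J(1)) (erule mono, use R(2) in simp)
 also have "... <= (\<Sum>n. \<tau> (P n))"
  by(rule SUP_least) (rule order_trans[OF Qt], rule sum_le_suminf, auto)
 finally show ?thesis .
qed

text \<open>Normality speaks of increasing families and e may have infinite trace, so the limit G is
  compared with e directly: G - e lies below the join minus e, whose trace is at most that of P
  k.\<close>

lemma join_shrinking_limit:
 assumes e: "e : Pr" and P: "!!k. P k : Pr" and dec: "!!k v. P k v = 0 ==> P (Suc k) v = 0"
  and small: "!!u. 0 < u ==> EX k. \<tau> (P k) <= ennreal u"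
 shows "(%k. join e (P k) v) ----> e v"
proof -
 note J = join[OF PrD(1)[OF e] PrD(1)[OF P]]
 obtain G where G: "orth_projection G" "!!v. (%k. join e (P k) v) ----> G v"
  "!!k v. join e (P k) v = 0 ==> G v = 0" "!!v. G v = v \<longleftrightarrow> (ALL k. join e (P k) v = v)"
  by(rule decreasing_projections_converge[of "%k. join e (P k)"])
   (rule PrD(2)[OF J(1)], simp add: J(2) dec, blast)
 have "G : M"
 proof (rule M_I, rule commutesI)
  fix U v assume U: "U : M'"
  have "(%k. U (join e (P k) v)) ----> U (G v)" by(intro tendsto_intros G)
  moreover have "U (join e (P k) v) = join e (P k) (U v)" for k
   by(rule commutesD[OF M'_commutes[OF U PrD(1)[OF J(1)]]])
  ultimately have "(%k. join e (P k) (U v)) ----> U (G v)" by simp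
  thus "U (G v) = G (U v)" by(rule LIMSEQ_unique[OF _ G(2)])
 qed
 hence GPr: "G : Pr" using G(1) by(simp add: Pr_def)
 have eJ: "e v = 0" if "join e (P k) v = 0" for k v using that by(simp add: J(2))
 have eG: "e v = 0" if "G v = 0" for v
 proof -
  have "e (join e (P k) v) = e v" for k by(rule Pr_le_apply(1)[OF e J(1) eJ])
  moreover have "(%k. e (join e (P k) v)) ----> e (G v)" by(intro tendsto_intros G)
  ultimately have "(%k::nat. e v) ----> e (G v)" by simp
  thus ?thesis using that by(simp add: LIMSEQ_const_iff)
 qed
 have D: "G - e : Pr" by(rule Pr_diff[OF e GPr eG])
 have "G - e = 0"
 proof (rule trace_small_zero[OF D])
  fix u :: real assume "0 < u"
  then obtain k where k: "\<tau> (P k) <= ennreal u" using small by blast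
  have "\<tau> (G - e) <= \<tau> (join e (P k) - e)"
  proof (rule trace_mono[OF D trace_join_diff(1)[OF e P]])
   fix v assume z: "(join e (P k) - e) v = 0"
   have "G (join e (P k) v) = G v" by(rule Pr_le_apply(1)[OF GPr J(1) G(3)])
   moreover have "G (e v) = e v" by(rule Pr_le_apply(2)[OF e GPr eG])
   ultimately show "(G - e) v = 0" using z by(simp add: blin_simps)
  qed
  also have "... <= \<tau> (P k)" by(rule trace_join_diff(2)[OF e P])
  finally show "\<tau> (G - e) <= ennreal u" using k by simp
 qed
 thus ?thesis using G(2) by simp
qed

end

section \<open>Measurable operators\<close>

lemma scaleC_minus_one [simp]: "(-1) *\<^sub>C v = - v"
 using scaleR_scaleC[of "-1" v] by simp

lemma dense_of_orthogonal:
 fixes S :: "'a::{real_inner,complete_space} set"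
 assumes "subspace S" "!!u. (!!v. v : S ==> inner u v = 0) ==> u = 0"
 shows "closure S = UNIV"
proof -
 have S: "subspace (closure S)" "closed (closure S)" using assms(1) by(simp_all add: subspace_closure)
 have "y : closure S" for y
 proof -
  have "y - oproj (closure S) y = 0"
  proof (rule assms(2))
   fix v assume "v : S"
   hence "v : closure S" using closure_subset[of S] by blast
   thus "inner (y - oproj (closure S) y) v = 0" by(rule oproj_orth[OF S])
  qed
  thus ?thesis using oproj_in[OF S, of y] by simp
 qed
 thus ?thesis by blast
qed

context traced_vna
begin

section \<open>Left and right support projections\<close>

definition lproj :: "'h bop => 'h bop" where "lproj A = pr_ker {v. radj A v = 0}"
definition rproj :: "'h bop => 'h bop" where "rproj A = pr_ker {v. A v = 0}"

lemma rproj: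
 assumes A: "A : M"
 shows rproj_Pr: "rproj A : Pr" and rproj_zero_iff: "rproj A v = 0 \<longleftrightarrow> A v = 0"
  and rproj_apply: "A (rproj A v) = A v"
proof -
 have "U v : {v. A v = 0}" if "U : M'" "v : {v. A v = 0}" for U v using that ker_invariant[OF A] by blast
 note p = pr_ker[OF subspace_ker closed_ker this]
 show Pr: "rproj A : Pr" unfolding rproj_def using p(1) by blast
 show z: "rproj A v = 0 \<longleftrightarrow> A v = 0" for v unfolding rproj_def using p(2) by blast
 have "rproj A (v - rproj A v) = 0" by(simp add: blin_simps PrD(3)[OF Pr])
 hence "A (v - rproj A v) = 0" by(simp only: z)
 thus "A (rproj A v) = A v" by(simp add: blin_simps)
qed

lemma lproj_rproj: "lproj A = rproj (radj A)"
 by(simp add: lproj_def rproj_def)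

lemma lproj:
 assumes A: "A : M"
 shows lproj_Pr: "lproj A : Pr" and lproj_zero_iff: "lproj A v = 0 \<longleftrightarrow> radj A v = 0"
  and lproj_apply: "lproj A (A v) = A v"
proof -
 note r = rproj[OF radj_M[OF A]]
 show Pr: "lproj A : Pr" "lproj A v = 0 \<longleftrightarrow> radj A v = 0" unfolding lproj_rproj using r by simp_all
 show "lproj A (A v) = A v"
 proof (rule inner_ext_right)
  fix w
  have "inner w (lproj A (A v)) = inner (radj A (lproj A w)) v"
   using Pr_symm[OF Pr(1), of w "A v"] radj'[of "lproj A w" A v] by simp
  thus "inner w (lproj A (A v)) = inner w (A v)" by(simp add: lproj_rproj r(3) radj')
 qed
qed

text \<open>A is injective on its right support, so \<open>trace_le_of_injective\<close> applies
  with T = A. Together with \<open>trace_lproj\<close> it shows that the two supports have the same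
  trace.\<close>

lemma trace_rproj:
 assumes A: "A : M" and Q: "Q : Pr" and QA: "!!v. Q (A v) = A v"
 shows "\<tau> (rproj A) <= \<tau> Q"
proof (rule trace_le_of_injective[OF rproj_Pr[OF A] Q A _ QA])
 fix v assume "rproj A v = v" "A v = 0"
 thus "v = 0" using rproj_zero_iff[OF A, of v] by simp
qed

lemma trace_lproj:
 assumes A: "A : M" and P: "P : Pr" and AP: "!!v. A (P v) = A v"
 shows "\<tau> (lproj A) <= \<tau> P"
 unfolding lproj_rproj
proof (rule trace_rproj[OF radj_M[OF A] P], rule inner_ext_right)
 fix v w
 have "inner w (P (radj A v)) = inner (A (P w)) v" using Pr_symm[OF P, of w "radj A v"] radj[of A "P w" v] by simp
 thus "inner w (P (radj A v)) = inner w (radj A v)" by(simp add: AP radj)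
qed

section \<open>Distribution functions of measurable operators\<close>

abbreviation "MO \<equiv> measurable_ops M \<tau>"

definition lam :: "'h uop => real => ennreal" where "lam x s = \<tau> (tail x s)"

lemma MO_cdd: "x : MO ==> cdd_op x"
 by(simp add: measurable_ops_def cdd_op_def)

lemma MO_invariant: "x : MO ==> U : M' ==> (v, w) : x ==> (U v, U w) : x"
proof -
 assume x: "x : MO" "U : M'" "(v, w) : x"
 hence "x O graph_of U \<subseteq> graph_of U O x" by(simp add: measurable_ops_def affiliated_def)
 moreover have "(v, U w) : x O graph_of U" using x(3) by(auto simp: graph_of_def)
 ultimately show ?thesis by(auto simp: graph_of_def)
qed

lemma MO_single: "x : MO ==> (v, w) : x ==> (v, w') : x ==> w = w'"
 by(rule single_valuedD[of x]) (auto simp: measurable_ops_def closed_densely_defined_def)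

lemma MO_closed: "x : MO ==> closed x" and MO_subspace: "x : MO ==> subspace x"
 using cdd_op.cdd[OF MO_cdd] by(auto simp: closed_densely_defined_def)

lemma MO_commutes:
 assumes x: "x : MO" and U: "U : M'"
 shows "commutes U (tail x s)" "commutes U (closed_op.opC x)" "commutes U (closed_op.opZ x)"
proof -
 interpret cdd_op x by(rule MO_cdd[OF x])
 note i = MO_invariant[OF x U] MO_invariant[OF x radj_M'[OF U]]
 show "commutes U (tail x s)" "commutes U opC" "commutes U opZ"
  using commutes_of_x[of U, OF i] by blast+
qed

lemma tail_Pr: "x : MO ==> tail x s : Pr"
 unfolding Pr_def using cdd_op.orth_projection_tail[OF MO_cdd] M_I MO_commutes(1) by blast

text \<open>Minimality of the tail: off P the operator is bounded by s, while on the tail it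
  strictly exceeds s, so the two subspaces meet only in 0. Most upper estimates of
  \<open>lam\<close> are instances.\<close>

lemma lam_le:
 assumes x: "x : MO" and P: "P : Pr" and s: "0 <= s"
  and b: "!!v. P v = 0 ==> EX w. (v, w) : x & norm w <= s * norm v"
 shows "lam x s <= \<tau> P"
 unfolding lam_def
proof (rule trace_le_of_disjoint[OF tail_Pr[OF x] P])
 interpret cdd_op x by(rule MO_cdd[OF x])
 fix v assume "tail x s v = v" "P v = 0"
 thus "v = 0" using b tail_strict s by blast
qed

lemma tail_good:
 assumes x: "x : MO" and z: "tail x s v = 0"
 obtains w where "(v, w) : x" "norm w <= s * norm v"
 using cdd_op.tail_bounded[OF MO_cdd[OF x] z] by blast

lemma lam_antimono: "x : MO ==> s <= t ==> lam x t <= lam x s"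
 unfolding lam_def
proof (rule trace_mono[OF tail_Pr tail_Pr])
 fix v assume x: "x : MO" "s <= t" "tail x s v = 0"
 thus "tail x t v = 0"
  using cdd_op.tail_mono(1)[OF MO_cdd[OF x(1)] x(2), of v] by(simp)
qed

lemma lam_small:
 assumes x: "x : MO" and e: "0 < u"
 obtains s where "0 <= s" "lam x s < ennreal u"
proof -
 from x e obtain P B where P: "P : M" "is_projection P" "\<tau> (id_blinfun - P) < ennreal u"
  and B: "B : M" "graph_of P O x = graph_of B"
  unfolding measurable_ops_def by blast
 have Pr: "P : Pr" using P by(simp add: Pr_def is_projection_iff)
 have "lam x (norm B) <= \<tau> (id_blinfun - P)"
 proof (rule lam_le[OF x Pr_compl[OF Pr]])
  fix v assume "(id_blinfun - P) v = 0"
  hence f: "P v = v" by(simp add: blin_simps)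
  have "(v, B v) : graph_of P O x" unfolding B(2) by(simp add: graph_of_def)
  hence "(v, B v) : x" using f by(auto simp: graph_of_def)
  thus "EX w. (v, w) : x & norm w <= norm B * norm v" using norm_blinfun[of B v] by blast
 qed simp
 thus ?thesis using that[of "norm B"] P(3) by simp
qed

lemma lam_right_cont:
 assumes x: "x : MO"
 shows "lam x s = (SUP n. lam x (s + 1 / real (Suc n)))"
 unfolding lam_def
proof (rule trace_increasing_limit[OF tail_Pr[OF x] tail_Pr[OF x]])
 interpret cdd_op x by(rule MO_cdd[OF x])
 show "(%n. tail x (s + 1 / real (Suc n)) v) ----> tail x s v" for v by(rule tail_right_limit)
 fix n v assume z: "tail x (s + 1 / real (Suc (Suc n))) v = 0"
 have "s + 1 / real (Suc (Suc n)) <= s + 1 / real (Suc n)" by(simp add: field_simps)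
 from tail_mono(1)[OF this, of v] show "tail x (s + 1 / real (Suc n)) v = 0"
  by(simp only: z blinfun.zero_right)
qed

text \<open>Left-hand analogue of the tail projection: the left support of the large part of \<open>x\<close>.\<close>

lemma left_tail:
 assumes x: "x : MO" and s: "0 <= s"
 obtains Q where "Q : Pr" "\<tau> Q <= lam x s" "!!v w. (v, w) : x ==> norm (w - Q w) <= s * norm v"
proof -
 interpret cdd_op x by(rule MO_cdd[OF x])
 let ?e = "tail x s"
 have ZM: "opZ : M" by(rule M_I) (rule MO_commutes(3)[OF x])
 have e: "?e : Pr" by(rule tail_Pr[OF x])
 have A: "opZ oL ?e : M" by(rule compose_M[OF ZM PrD(1)[OF e]])
 \<comment> \<open>The left support of the part of Z on the tail, whose trace is at most that of the
   tail.\<close>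
 define Q where "Q = lproj (opZ oL ?e)"
 note Q = lproj[OF A, folded Q_def]
 show ?thesis
 proof (rule that[OF Q(1)])
  show "\<tau> Q <= lam x s"
   unfolding Q_def lam_def by(rule trace_lproj[OF A e]) (simp add: PrD(3)[OF e])
  fix v w assume "(v, w) : x"
  then obtain u where z: "v = opC u" "w = opZ u" by(auto simp: x_iff)
  define h where "h = u - ?e u"
  have eta: "w = (opZ oL ?e) u + opZ h" by(simp add: z h_def blin_simps)
  have Q1: "Q ((opZ oL ?e) u) = (opZ oL ?e) u" by(rule Q(3))
  have "w - Q w = opZ h - Q (opZ h)" unfolding eta blinfun.add_right Q1 by simp
  also have "norm ... <= norm (opZ h)"
   using norm_orth_projection_le[OF PrD(2)[OF Pr_compl[OF Q(1)]], of "opZ h"] by(simp add: blin_simps)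
  also have "... <= s * norm (opC h)"
  proof -
   have "?e (opC h) = 0" by(simp add: tail_C) (simp add: h_def blin_simps PrD(3)[OF e])
   then obtain t where "(opC h, t) : x" "norm t <= s * norm (opC h)" by(rule tail_bounded)
   moreover from this(1) have "t = opZ h" using Z_in by(rule single_valuedD[OF sv_x])
   ultimately show ?thesis by simp
  qed
  also have "opC h = v - ?e v" by(simp add: h_def z tail_C blin_simps)
  also have "s * norm (v - ?e v) <= s * norm v"
   using norm_orth_projection_le[OF PrD(2)[OF Pr_compl[OF e]], of v] s
   by(intro mult_left_mono) (simp_all add: blin_simps)
  finally show "norm (w - Q w) <= s * norm v" .
 qed
qed

text \<open>The infimum of small projections fixing w has trace 0, hence is 0 by faithfulness. It is
  built as the complement of the join of the complements.\<close>

lemma small_vector: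
 assumes "!!e. 0 < e ==> EX Q:Pr. \<tau> Q < ennreal e & Q w = w"
 shows "w = 0"
proof -
 have "ALL n. EX Q. Q : Pr & \<tau> Q < ennreal (1 / real (Suc n)) & Q w = w"
  using assms[of "1 / real (Suc _)"] by(auto simp: Bex_def)
 from choice[OF this] obtain Q where Q: "!!n. Q n : Pr" "!!n. \<tau> (Q n) < ennreal (1 / real (Suc n))" "!!n. Q n w = w"
  by blast
 note J = Join[of "%n. id_blinfun - Q n", OF PrD(1)[OF Pr_compl[OF Q(1)]]]
 define R where "R = id_blinfun - Join (%n. id_blinfun - Q n)"
 have R: "R : Pr" unfolding R_def by(rule Pr_compl[OF J(1)])
 have Rfix: "R v = v \<longleftrightarrow> (ALL n. Q n v = v)" for v
  using J(2)[of v] by(auto simp: R_def blin_simps)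
 have "R = 0"
 proof (rule trace_small_zero[OF R])
  fix e :: real assume "0 < e"
  then obtain n where n: "1 / real (Suc n) < e" using reals_Archimedean by(auto simp: inverse_eq_divide)
  have "\<tau> R <= \<tau> (Q n)"
   by(rule trace_le_of_disjoint[OF R Q(1)]) (use Rfix in metis)
  also have "... <= ennreal e" using Q(2)[of n] n by(metis ennreal_leI less_imp_le order_trans)
  finally show "\<tau> R <= ennreal e" .
 qed
 moreover have "R w = w" using Rfix Q(3) by blast
 ultimately show ?thesis by simp
qed

text \<open>The right estimate gives a dense domain and the bounded restrictions. The left estimate
  gives closability: if (0, u) lies in the closure, u is fixed by projections of arbitrarily small
  trace and hence is 0.\<close>

lemma measurable_closureI:
 assumes sub: "subspace y"
  and inv: "!!U v \<eta>. U : M' ==> (v, \<eta>) : y ==> (U v, U \<eta>) : y"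
  and right: "!!w. 0 < w ==> EX P:Pr. \<tau> P < ennreal w & (EX K. ALL v. P v = 0 --> (EX \<eta>. (v, \<eta>) : y & norm \<eta> <= K * norm v))"
  and left: "!!w. 0 < w ==> EX Q:Pr. \<tau> Q < ennreal w & (EX K. ALL v \<eta>. (v, \<eta>) : y --> norm (\<eta> - Q \<eta>) <= K * norm v)"
 shows "closure y : MO"
proof -
 have sc: "subspace (closure y)" by(rule subspace_closure[OF sub])
 have invc: "(U v, U \<eta>) : closure y" if "U : M'" "(v, \<eta>) : closure y" for U v \<eta>
 proof -
  have "(%p. (U (fst p), U (snd p))) (v, \<eta>) : closure y"
   by(rule closure_invariant[OF _ _ that(2)]) (use inv[OF that(1)] in "auto intro!: continuous_intros")
  thus ?thesis by simp
 qed
 have sv: "single_valued (closure y)"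
 proof (rule single_valuedI)
  fix v \<eta>1 \<eta>2 assume "(v, \<eta>1) : closure y" "(v, \<eta>2) : closure y"
  from subspace_diff[OF sc this] have z: "(0, \<eta>1 - \<eta>2) : closure y" by simp
  have "\<eta>1 - \<eta>2 = 0"
  proof (rule small_vector)
   fix w :: real assume "0 < w"
   from left[OF this] obtain Q K where Q: "Q : Pr" "\<tau> Q < ennreal w"
    "!!v \<eta>. (v, \<eta>) : y ==> norm (\<eta> - Q \<eta>) <= K * norm v" by blast
   have "closure y \<subseteq> {p. norm (snd p - Q (snd p)) <= K * norm (fst p)}"
    by(rule closure_minimal) (use Q(3) in "auto intro!: closed_Collect_le continuous_intros")
   hence "norm ((\<eta>1 - \<eta>2) - Q (\<eta>1 - \<eta>2)) <= 0" using z by auto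
   thus "EX Q:Pr. \<tau> Q < ennreal w & Q (\<eta>1 - \<eta>2) = \<eta>1 - \<eta>2" using Q(1,2) by auto
  qed
  thus "\<eta>1 = \<eta>2" by simp
 qed
 have scale: "(c *\<^sub>C v, c *\<^sub>C \<eta>) : closure y" if "(v, \<eta>) : closure y" for c v \<eta>
  using invc[OF scaleC_M that, of c] by simp
 have dense: "closure (Domain (closure y)) = UNIV"
 proof (rule dense_of_orthogonal)
  have "subspace (fst ` closure y)" by(intro linear_subspace_image sc bounded_linear.linear bounded_linear_fst)
  thus "subspace (Domain (closure y))" by(simp add: Domain_fst)
  fix u assume u: "!!g. g : Domain (closure y) ==> inner u g = 0"
  show "u = 0"
  proof (rule small_vector)
   fix w :: real assume "0 < w"
   from right[OF this] obtain P where P: "P : Pr" "\<tau> P < ennreal w" "!!v. P v = 0 ==> v : Domain y" by blast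
   have "P (u - P u) = 0" by(simp add: blin_simps PrD(3)[OF P(1)])
   hence "u - P u : Domain (closure y)" using P(3) closure_subset[of y] by blast
   hence "inner u (u - P u) = 0" by(rule u)
   moreover have "inner (P u) (u - P u) = 0"
    using Pr_symm[OF P(1), of u "u - P u"] `P (u - P u) = 0` by simp
   ultimately have "inner (u - P u) (u - P u) = 0" by(simp only: inner_diff_left)
   hence "P u = u" by simp
   thus "EX Q:Pr. \<tau> Q < ennreal w & Q u = u" using P by blast
  qed
 qed
 have "affiliated M (closure y)"
  unfolding affiliated_def
 proof (intro ballI subsetI)
  fix U p assume U: "U : M'" and p: "p : closure y O graph_of U"
  obtain v \<eta> where p': "p = (v, U \<eta>)" "(v, \<eta>) : closure y" using p by(auto simp: graph_of_def)
  have "(v, U v) : graph_of U" by(simp add: graph_of_def)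
  thus "p : graph_of U O closure y" using invc[OF U p'(2)] p'(1) by blast
 qed
 moreover have "EX P:M. is_projection P & range (blinfun_apply P) \<subseteq> Domain (closure y) &
    \<tau> (id_blinfun - P) < ennreal w & (EX B:M. graph_of P O closure y = graph_of B)" if e: "0 < w" for w :: real
 proof -
  from right[OF e] obtain P K where P: "P : Pr" "\<tau> P < ennreal w"
   "!!v. P v = 0 ==> EX \<eta>. (v, \<eta>) : y & norm \<eta> <= K * norm v" by blast
  define E where "E = id_blinfun - P"
  have E: "E : Pr" unfolding E_def by(rule Pr_compl[OF P(1)])
  have PE: "P (E v) = 0" for v by(simp add: E_def blin_simps PrD(3)[OF P(1)])
  have "ALL v. EX \<eta>. (E v, \<eta>) : closure y & norm \<eta> <= K * norm (E v)"
   using P(3)[OF PE] closure_subset[of y] by blast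
  from choice[OF this] obtain b where b: "!!v. (E v, b v) : closure y" "!!v. norm (b v) <= K * norm (E v)" by blast
  have bu: "b v = \<eta>" if "(E v, \<eta>) : closure y" for v \<eta> by(rule single_valuedD[OF sv b(1) that])
  have bl: "bounded_linear b"
  proof (rule bounded_linear_intro[where K = "\<bar>K\<bar>"])
   show "b (a + d) = b a + b d" for a d
    using subspace_add[OF sc b(1)[of a] b(1)[of d]] by(intro bu) (simp add: blin_simps)
   show "b (r *\<^sub>R a) = r *\<^sub>R b a" for r a
    using subspace_scale[OF sc b(1)[of a], of r] by(intro bu) (simp add: blin_simps)
   show "norm (b a) <= norm a * \<bar>K\<bar>" for a
   proof -
    have "norm (b a) <= \<bar>K\<bar> * norm (E a)" using b(2)[of a] by(meson abs_ge_self mult_right_mono norm_ge_zero order_trans)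
    also have "... <= \<bar>K\<bar> * norm a" by(intro mult_left_mono norm_orth_projection_le[OF PrD(2)[OF E]]) simp
    finally show ?thesis by(simp add: mult.commute)
   qed
  qed
  define B where "B = Blinfun b"
  have B: "blinfun_apply B = b" unfolding B_def by(rule bounded_linear_Blinfun_apply[OF bl])
  have "B : M"
  proof (rule M_I, rule commutesI)
   fix U v assume U: "U : M'"
   have "(E (U v), U (b v)) : closure y"
    using invc[OF U b(1)[of v]] commutesD[OF M'_commutes[OF U PrD(1)[OF E]], of v] by simp
   thus "U (B v) = B (U v)" unfolding B by(rule bu[symmetric])
  qed
  moreover have "graph_of E O closure y = graph_of B"
   using b(1) bu by(fastforce simp: graph_of_def B)
  moreover have "range (blinfun_apply E) \<subseteq> Domain (closure y)" using b(1) by blast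
  moreover have "is_projection E" "E : M"
   using E M_bounded_ops by(auto simp: Pr_def is_projection_iff)
  moreover have "\<tau> (id_blinfun - E) < ennreal w" using P(2) by(simp add: E_def)
  ultimately show ?thesis by blast
 qed
 ultimately show ?thesis
  unfolding measurable_ops_def closed_densely_defined_def using sc sv scale dense by auto
qed

text \<open>Good projections of small trace need not be nested. The joins of the tails of a sequence
  with geometric traces are, and they remain good because goodness passes to larger
  projections.\<close>

lemma shrinking_sequence:
 assumes small: "!!e. 0 < e ==> EX P:Pr. \<tau> P < ennreal e & good P"
  and up: "!!P Q. P : Pr ==> Q : Pr ==> good P ==> (!!v. Q v = 0 ==> P v = 0) ==> good Q"
 obtains P where "!!k. P k : Pr" "!!k. good (P k)" "!!k v. P k v = 0 ==> P (Suc k) v = 0"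
  "!!e. 0 < e ==> EX k. \<tau> (P k) <= ennreal e"
proof -
 have "ALL n. EX P. P : Pr & \<tau> P < ennreal ((1/2) ^ Suc n) & good P"
 proof
  fix n show "EX P. P : Pr & \<tau> P < ennreal ((1/2) ^ Suc n) & good P"
   using small[of "(1/2) ^ Suc n"] by auto
 qed
 from choice[OF this] obtain Q where Q: "!!n. Q n : Pr" "!!n. \<tau> (Q n) < ennreal ((1/2) ^ Suc n)" "!!n. good (Q n)" by blast
 define P where "P k = Join (%j. Q (k + j))" for k
 have J: "P k : Pr" "P k v = 0 \<longleftrightarrow> (ALL j. Q (k + j) v = 0)" for k v
  unfolding P_def using Join[of "%j. Q (k + j)", OF PrD(1)[OF Q(1)]] by blast+
 show ?thesis
 proof (rule that[of P])
  show "P k : Pr" for k by(rule J(1))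
  show "good (P k)" for k
   by(rule up[OF Q(1)[of k] J(1) Q(3)]) (use J(2)[of k] in "metis add_0_right")
  show "P (Suc k) v = 0" if "P k v = 0" for k v
   using that J(2)[of k v] J(2)[of "Suc k" v] by(metis add_Suc_shift)
  fix e :: real assume "0 < e"
  then obtain k where k: "(1/2::real) ^ k < e" using real_arch_pow_inv[of e "1/2"] by auto
  have s: "(%j. (1/2::real) ^ Suc (k + j)) sums (1/2) ^ k"
  proof -
   have "(%j. (1/2) ^ Suc k * (1/2::real) ^ j) sums ((1/2) ^ Suc k * (1 / (1 - 1/2)))"
    by(intro sums_mult geometric_sums) simp
   thus ?thesis by(simp add: power_add)
  qed
  have "\<tau> (P k) <= (\<Sum>j. \<tau> (Q (k + j)))" unfolding P_def by(rule trace_Join[OF Q(1)])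
  also have "... <= (\<Sum>j. ennreal ((1/2) ^ Suc (k + j)))" using Q(2) by(intro suminf_le) (auto intro: less_imp_le)
  also have "... = ennreal ((1/2) ^ k)" by(rule suminf_ennreal_eq[OF _ s]) simp
  also have "... <= ennreal e" using k by(intro ennreal_leI) simp
  finally show "EX k. \<tau> (P k) <= ennreal e" by blast
 qed
qed

text \<open>The vectors killed by a tail projection and by a small projection form a core.\<close>

lemma measurable_subset:
 assumes x: "x : MO" and y: "y : MO"
  and agree: "!!c. 0 < c ==> EX P:Pr. \<tau> P < ennreal c & (ALL v. P v = 0 --> (EX w. (v, w) : x & (v, w) : y))"
 shows "x \<subseteq> y"
proof -
 interpret cdd_op x by(rule MO_cdd[OF x])
 obtain P where P: "!!k. P k : Pr" "!!k. ALL v. P k v = 0 --> (EX w. (v, w) : x & (v, w) : y)"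
  "!!k v. P k v = 0 ==> P (Suc k) v = 0" "!!c. 0 < c ==> EX k. \<tau> (P k) <= ennreal c"
  by(rule shrinking_sequence[of "%P. ALL v. P v = 0 --> (EX w. (v, w) : x & (v, w) : y)", OF agree]) blast+
 have core: "(opC h, opZ h) : y" if om: "tail x (real n) h = 0" for n h
 proof -
  let ?e = "tail x (real n)"
  have e: "?e : Pr" by(rule tail_Pr[OF x])
  note J = join[OF PrD(1)[OF e] PrD(1)[OF P(1)]]
  define v where "v = opC h"
  have exi: "?e v = 0" by(simp add: v_def tail_C om)
  \<comment> \<open>a k is killed by the tail and by P k, hence lies where x and y agree, and it
    tends to v.\<close>
  define a where "a k = v - join ?e (P k) v" for k
  have "(%k. join ?e (P k) v) ----> ?e v"
   by(rule join_shrinking_limit[OF e P(1)]) (use P(3,4) in blast)+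
  hence lim: "(%k. join ?e (P k) v) ----> 0" by(simp add: exi)
  hence a: "a ----> v" unfolding a_def using tendsto_diff[OF tendsto_const lim, of v] by simp
  have "join ?e (P k) (a k) = 0" for k by(simp add: a_def blin_simps PrD(3)[OF J(1)])
  hence z: "?e (a k) = 0" "P k (a k) = 0" for k by(simp_all add: J(2))
  have "ALL k. EX b. (a k, b) : x & (a k, b) : y" using P(2) z(2) by blast
  from choice[OF this] obtain b where b: "!!k. (a k, b k) : x" "!!k. (a k, b k) : y" by blast
  \<comment> \<open>Both vectors lie off the tail, where x is bounded by n; this makes the values
    converge although x is unbounded.\<close>
  have nb: "norm (b k - opZ h) <= real n * norm (a k - v)" for k
  proof -
   have "?e (a k - v) = 0" by(simp add: blin_simps z exi)
   then obtain d where t: "(a k - v, d) : x" "norm d <= real n * norm (a k - v)" by(rule tail_bounded)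
   have "(a k - v, b k - opZ h) : x"
    using subspace_diff[OF subspace_x b(1)[of k] Z_in[of h]] by(simp add: v_def)
   with t show ?thesis using single_valuedD[OF sv_x t(1)] by blast
  qed
  have "(%k. real n * norm (a k - v)) ----> 0"
   using tendsto_mult_right_zero[OF tendsto_norm_zero[OF LIM_zero[OF a]]] by simp
  hence "(%k. b k - opZ h) ----> 0"
   by(rule Lim_null_comparison[OF always_eventually, rotated]) (use nb in blast)
  hence "b ----> opZ h" by(rule LIM_zero_cancel)
  hence "(%k. (a k, b k)) ----> (v, opZ h)" by(intro tendsto_Pair a)
  thus ?thesis unfolding v_def[symmetric]
   by(rule closed_sequentially[OF MO_closed[OF y], rotated]) (rule b(2))
 qed
 show "x \<subseteq> y"
 proof
  fix p assume "p : x"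
  then obtain u where p: "p = (opC u, opZ u)" by(cases p) (auto simp: x_iff)
  define h where "h n = u - tail x (real n) u" for n
  have "h ----> u" unfolding h_def using tendsto_diff[OF tendsto_const tail_top_limit[of u], of u] by simp
  hence "(%n. (opC (h n), opZ (h n))) ----> p" unfolding p by(intro tendsto_intros)
  moreover have "(opC (h n), opZ (h n)) : y" for n
   by(rule core[of n]) (simp add: h_def blin_simps orth_projectionD(1)[OF orth_projection_tail])
  ultimately show "p : y" using closed_sequentially[OF MO_closed[OF y], of "%n. (opC (h n), opZ (h n))"] by blast
 qed
qed

lemma measurable_eqI:
 assumes "x : MO" "y : MO"
  and "!!e. 0 < e ==> EX P:Pr. \<tau> P < ennreal e & (ALL v. P v = 0 --> (EX w. (v, w) : x & (v, w) : y))"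
 shows "x = y"
 by(intro equalityI measurable_subset assms(1,2)) (use assms(3) in blast)+

lemma small_join:
 assumes "P : Pr" "Q : Pr" "\<tau> P < ennreal (e / 2)" "\<tau> Q < ennreal (e / 2)" "0 < e"
 shows "\<tau> (join P Q) < ennreal e"
proof -
 have "\<tau> (join P Q) <= \<tau> P + \<tau> Q" by(rule trace_join[OF assms(1,2)])
 also have "... < ennreal (e / 2) + ennreal (e / 2)" using assms(3,4) by(rule add_strict_mono)
 also have "... = ennreal e" using assms(5) by(simp flip: ennreal_plus)
 finally show ?thesis .
qed

lemma common_domain2:
 assumes x: "x : MO" and y: "y : MO" and e: "0 < u"
 shows "EX P:Pr. \<tau> P < ennreal u & (ALL v. P v = 0 --> v : Domain x & v : Domain y)"
proof -
 have e2: "0 < u / 2" using e by simp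
 obtain s where s: "0 <= s" "lam x s < ennreal (u / 2)" using lam_small[OF x e2] .
 obtain r where r: "0 <= r" "lam y r < ennreal (u / 2)" using lam_small[OF y e2] .
 note J = join[OF PrD(1)[OF tail_Pr[OF x, of s]] PrD(1)[OF tail_Pr[OF y, of r]]]
 have "\<tau> (join (tail x s) (tail y r)) < ennreal u"
  using s r e by(intro small_join tail_Pr x y) (simp_all add: lam_def)
 moreover have "v : Domain x & v : Domain y" if "join (tail x s) (tail y r) v = 0" for v
 proof -
  have "tail x s v = 0" "tail y r v = 0" using that by(simp_all add: J(2))
  thus ?thesis using tail_good[OF x] tail_good[OF y] by(meson DomainI)
 qed
 ultimately show ?thesis using J(1) by blast
qed

text \<open>Reduces the laws of the strong operations to pointwise identities. Four domains serve
  the longest of them, \<open>strong_add_interchange\<close>; shorter ones repeat an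
  operand.\<close>

lemma measurable_eqI4:
 assumes xy: "x : MO" "y : MO" and abcd: "a : MO" "b : MO" "c : MO" "d : MO"
  and agree: "!!v k j g i. (v, k) : a ==> (v, j) : b ==> (v, g) : c ==> (v, i) : d ==>
   EX w. (v, w) : x & (v, w) : y"
 shows "x = y"
proof (rule measurable_eqI[OF xy])
 fix u :: real assume e: "0 < u"
 hence e2: "0 < u / 2" by simp
 obtain P where P: "P : Pr" "\<tau> P < ennreal (u / 2)" "ALL v. P v = 0 --> v : Domain a & v : Domain b"
  using common_domain2[OF abcd(1,2) e2] by blast
 obtain Q where Q: "Q : Pr" "\<tau> Q < ennreal (u / 2)" "ALL v. Q v = 0 --> v : Domain c & v : Domain d"
  using common_domain2[OF abcd(3,4) e2] by blast
 note J = join[OF PrD(1)[OF P(1)] PrD(1)[OF Q(1)]]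
 have "EX w. (v, w) : x & (v, w) : y" if "join P Q v = 0" for v
  using that P(3) Q(3) agree unfolding J(2) by(meson DomainE)
 thus "EX P:Pr. \<tau> P < ennreal u & (ALL v. P v = 0 --> (EX w. (v, w) : x & (v, w) : y))"
  using J(1) small_join[OF P(1) Q(1) P(2) Q(2) e] by blast
qed


subsection \<open>The algebra of measurable operators\<close>

lemma strong_addI: "(v, w) : x ==> (v, u) : y ==> (v, w + u) : strong_add x y"
 unfolding strong_add_def by(rule subsetD[OF closure_subset]) blast

lemma strong_scaleI: "(v, w) : x ==> (v, c *\<^sub>C w) : strong_scale c x"
 unfolding strong_scale_def by(rule subsetD[OF closure_subset]) blast

lemma strong_diffI: "(v, w) : x ==> (v, u) : y ==> (v, w - u) : strong_diff x y"
 unfolding strong_diff_def using strong_addI[OF _ strong_scaleI, of v w x u y "-1"]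
 by simp

lemma strong_add_MO:
 assumes x: "x : MO" and y: "y : MO"
 shows "strong_add x y : MO"
 unfolding strong_add_def
proof (rule measurable_closureI)
 let ?y = "{(v, w + u) | v w u. (v, w) : x & (v, u) : y}"
 show "subspace ?y"
 proof (rule subspaceI)
  have "(0, 0) : x" "(0, 0) : y" using subspace_0[OF MO_subspace[OF x]] subspace_0[OF MO_subspace[OF y]] by(simp_all add: zero_prod_def)
  hence "(0, 0 + 0) : ?y" by blast
  thus "0 : ?y" by(simp add: zero_prod_def)
  fix p q assume "p : ?y" "q : ?y"
  then obtain v w u v' w' u' where pq: "p = (v, w + u)" "(v, w) : x" "(v, u) : y"
   "q = (v', w' + u')" "(v', w') : x" "(v', u') : y" by blast
  have "(v + v', w + w') : x" "(v + v', u + u') : y"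
   using subspace_add[OF MO_subspace[OF x] pq(2,5)] subspace_add[OF MO_subspace[OF y] pq(3,6)] by simp_all
  moreover have "p + q = (v + v', (w + w') + (u + u'))" by(simp add: pq)
  ultimately show "p + q : ?y" by blast
 next
  fix c :: real and p assume "p : ?y"
  then obtain v w u where p: "p = (v, w + u)" "(v, w) : x" "(v, u) : y" by blast
  have "(c *\<^sub>R v, c *\<^sub>R w) : x" "(c *\<^sub>R v, c *\<^sub>R u) : y"
   using subspace_scale[OF MO_subspace[OF x] p(2)] subspace_scale[OF MO_subspace[OF y] p(3)] by simp_all
  moreover have "c *\<^sub>R p = (c *\<^sub>R v, c *\<^sub>R w + c *\<^sub>R u)" by(simp add: p scaleR_add_right)
  ultimately show "c *\<^sub>R p : ?y" by blast
 qed
 show "(U v, U w) : ?y" if U: "U : M'" and p: "(v, w) : ?y" for U v w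
 proof -
  obtain a g where "w = a + g" "(v, a) : x" "(v, g) : y" using p by blast
  hence "U w = U a + U g" "(U v, U a) : x" "(U v, U g) : y"
   using MO_invariant[OF x U] MO_invariant[OF y U] by(auto simp: blin_simps)
  thus ?thesis by blast
 qed
 fix b :: real assume e: "0 < b"
 hence e2: "0 < b / 2" by simp
 obtain s where s: "0 <= s" "lam x s < ennreal (b / 2)" using lam_small[OF x e2] .
 obtain r where r: "0 <= r" "lam y r < ennreal (b / 2)" using lam_small[OF y e2] .
 note J = join[OF PrD(1)[OF tail_Pr[OF x, of s]] PrD(1)[OF tail_Pr[OF y, of r]]]
 have "\<tau> (join (tail x s) (tail y r)) < ennreal b"
  using s r e by(intro small_join tail_Pr x y) (simp_all add: lam_def)
 moreover have "EX w. (v, w) : ?y & norm w <= (s + r) * norm v" if z: "join (tail x s) (tail y r) v = 0" for v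
 proof -
  have "tail x s v = 0" "tail y r v = 0" using z by(simp_all add: J(2))
  then obtain w u where "(v, w) : x" "norm w <= s * norm v" "(v, u) : y" "norm u <= r * norm v"
   using tail_good[OF x] tail_good[OF y] by metis
  thus ?thesis using norm_triangle_ineq[of w u]
   by(intro exI[of _ "w + u"]) (auto simp: distrib_right)
 qed
 ultimately show "EX P:Pr. \<tau> P < ennreal b & (EX K. ALL v. P v = 0 --> (EX w. (v, w) : ?y & norm w <= K * norm v))"
  using J(1) by blast
 obtain Qx where Qx: "Qx : Pr" "\<tau> Qx <= lam x s" "!!v w. (v, w) : x ==> norm (w - Qx w) <= s * norm v"
  by(rule left_tail[OF x s(1)]) blast
 obtain Qy where Qy: "Qy : Pr" "\<tau> Qy <= lam y r" "!!v w. (v, w) : y ==> norm (w - Qy w) <= r * norm v"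
  by(rule left_tail[OF y r(1)]) blast
 let ?Q = "join Qx Qy"
 note J = join[OF PrD(1)[OF Qx(1)] PrD(1)[OF Qy(1)]]
 have "\<tau> ?Q < ennreal b" using Qx Qy s r e by(intro small_join) (auto intro: le_less_trans)
 moreover have "norm (d - ?Q d) <= (s + r) * norm v" if t0: "(v, d) : ?y" for v d
 proof -
  obtain w u where t: "d = w + u" "(v, w) : x" "(v, u) : y" using t0 by blast
  \<comment> \<open>A larger projection leaves a smaller residue, so the left estimates for x and y
    survive for the join.\<close>
  have le: "norm (a - ?Q a) <= norm (a - R a)" if "R : Pr" "!!v. ?Q v = 0 ==> R v = 0" for R a
  proof -
   have "?Q (R a) = R a" by(rule Pr_le_apply(2)[OF that(1) J(1) that(2)])
   hence "a - ?Q a = (id_blinfun - ?Q) (a - R a)" by(simp add: blin_simps)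
   thus ?thesis using norm_orth_projection_le[OF PrD(2)[OF Pr_compl[OF J(1)]]] by simp
  qed
  have "norm (d - ?Q d) <= norm (w - ?Q w) + norm (u - ?Q u)"
   using norm_triangle_ineq[of "w - ?Q w" "u - ?Q u"] by(simp add: t blin_simps add_diff_add)
  also have "... <= norm (w - Qx w) + norm (u - Qy u)"
   by(intro add_mono le Qx Qy) (simp_all add: J(2))
  also have "... <= s * norm v + r * norm v" by(intro add_mono Qx Qy t)
  finally show ?thesis by(simp add: distrib_right)
 qed
 ultimately show "EX Q:Pr. \<tau> Q < ennreal b & (EX K. ALL v w. (v, w) : ?y --> norm (w - Q w) <= K * norm v)"
  using J(1) by blast
qed

lemma strong_scale_MO:
 assumes x: "x : MO"
 shows "strong_scale c x : MO"
 unfolding strong_scale_def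
proof (rule measurable_closureI)
 let ?y = "{(v, c *\<^sub>C w) | v w. (v, w) : x}"
 have yeq: "?y = (%p. (fst p, scaleC_op c (snd p))) ` x" by force
 show "subspace ?y" unfolding yeq
  by(intro linear_subspace_image MO_subspace[OF x] bounded_linear.linear bounded_linear_Pair bounded_linear_fst
    bounded_linear_compose[OF blinfun.bounded_linear_right bounded_linear_snd])
 show "(U v, U w) : ?y" if U: "U : M'" and p: "(v, w) : ?y" for U v w
  using p MO_invariant[OF x U] bounded_opsD[OF M'_bounded_ops[OF U]] by fastforce
 fix a :: real assume e: "0 < a"
 obtain s where s: "0 <= s" "lam x s < ennreal a" using lam_small[OF x e] .
 have "EX w. (v, w) : ?y & norm w <= (cmod c * s) * norm v" if "tail x s v = 0" for v
 proof -
  obtain w where "(v, w) : x" "norm w <= s * norm v" using tail_good[OF x `tail x s v = 0`] .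
  thus ?thesis
   by(intro exI[of _ "c *\<^sub>C w"]) (auto simp: norm_scaleC mult.assoc intro!: mult_left_mono)
 qed
 thus "EX P:Pr. \<tau> P < ennreal a & (EX K. ALL v. P v = 0 --> (EX w. (v, w) : ?y & norm w <= K * norm v))"
  using s(2) tail_Pr[OF x, of s] unfolding lam_def by blast
 obtain Q where Q: "Q : Pr" "\<tau> Q <= lam x s" "!!v w. (v, w) : x ==> norm (w - Q w) <= s * norm v"
  by(rule left_tail[OF x s(1)]) blast
 have "norm (u - Q u) <= (cmod c * s) * norm v" if t0: "(v, u) : ?y" for v u
 proof -
  obtain w where t: "u = c *\<^sub>C w" "(v, w) : x" using t0 by blast
  have "u - Q u = c *\<^sub>C (w - Q w)"
   by(simp add: t bounded_opsD[OF M_bounded_ops[OF PrD(1)[OF Q(1)]]]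
     linear_diff[OF bounded_linear.linear[OF bounded_linear_scaleC]])
  thus ?thesis using Q(3)[OF t(2)] by(simp add: norm_scaleC mult.assoc mult_left_mono)
 qed
 thus "EX Q:Pr. \<tau> Q < ennreal a & (EX K. ALL v w. (v, w) : ?y --> norm (w - Q w) <= K * norm v)"
  using Q(1,2) s(2) le_less_trans by blast
qed

lemma strong_diff_MO: "x : MO ==> y : MO ==> strong_diff x y : MO"
 unfolding strong_diff_def by(intro strong_add_MO strong_scale_MO)

lemma graph_of_iff [simp]: "(v, w) : graph_of A \<longleftrightarrow> w = A v"
 by(auto simp: graph_of_def)

lemma graph_of_MO: "A : M ==> graph_of A : MO"
proof -
 assume A: "A : M"
 have eq: "graph_of A = range (%v. (v, A v))" by(auto simp: graph_of_def)
 have "graph_of A = {p. snd p = A (fst p)}" by auto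
 hence cl: "closed (graph_of A)" by(auto intro!: closed_Collect_eq continuous_intros)
 have "closure (graph_of A) : MO"
 proof (rule measurable_closureI)
  show "subspace (graph_of A)" unfolding eq
   by(intro linear_subspace_image bounded_linear.linear bounded_linear_Pair bounded_linear_ident blinfun.bounded_linear_right subspace_UNIV)
  show "(U v, U w) : graph_of A" if "U : M'" "(v, w) : graph_of A" for U v w
   using that commutesD[OF M'_commutes[OF that(1) A]] by simp
  fix e :: real assume "0 < e"
  thus "EX P:Pr. \<tau> P < ennreal e & (EX K. ALL v. P v = 0 --> (EX w. (v, w) : graph_of A & norm w <= K * norm v))"
   using norm_blinfun[of A] by(intro bexI[of _ 0]) auto
  from `0 < e` show "EX Q:Pr. \<tau> Q < ennreal e & (EX K. ALL v w. (v, w) : graph_of A --> norm (w - Q w) <= K * norm v)"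
   using norm_blinfun[of A] by(intro bexI[of _ 0]) auto
 qed
 thus ?thesis using cl by simp
qed

lemma zero_op: "UNIV \<times> {0} = graph_of 0"
 by auto

lemma zero_op_MO: "UNIV \<times> {0} : MO"
 unfolding zero_op by(rule graph_of_MO) simp

lemmas MO_intros = strong_add_MO strong_scale_MO strong_diff_MO graph_of_MO zero_op_MO
lemmas strong_intros = strong_addI strong_scaleI strong_diffI

lemma strong_add_commute: "x : MO ==> y : MO ==> strong_add x y = strong_add y x"
 by(rule measurable_eqI4[of _ _ x y x y]) (auto intro: MO_intros, metis strong_addI add.commute)

lemma strong_add_interchange:
 assumes "a : MO" "b : MO" "c : MO" "d : MO"
 shows "strong_add (strong_add a b) (strong_add c d) = strong_add (strong_add a c) (strong_add b d)"
proof (rule measurable_eqI4[OF _ _ assms])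
 fix v e w u y assume h: "(v, e) : a" "(v, w) : b" "(v, u) : c" "(v, y) : d"
 have "(v, (e + w) + (u + y)) : strong_add (strong_add a b) (strong_add c d)"
  "(v, (e + u) + (w + y)) : strong_add (strong_add a c) (strong_add b d)" by(intro strong_addI h)+
 moreover have "(e + u) + (w + y) = (e + w) + (u + y)" by simp
 ultimately show "EX g. (v, g) : strong_add (strong_add a b) (strong_add c d) & (v, g) : strong_add (strong_add a c) (strong_add b d)"
  by metis
qed (intro MO_intros assms)+

lemma strong_add_zero: "x : MO ==> strong_add x (UNIV \<times> {0}) = x"
proof (rule measurable_eqI4[of _ _ x x x x])
 show "EX w. (v, w) : strong_add x (UNIV \<times> {0}) & (v, w) : x" if "(v, a) : x" for v a
  using strong_addI[OF that, of 0 "UNIV \<times> {0}"] that by auto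
qed (auto intro: MO_intros)

lemma strong_scale_add:
 assumes x: "x : MO" and y: "y : MO"
 shows "strong_scale c (strong_add x y) = strong_add (strong_scale c x) (strong_scale c y)"
proof (rule measurable_eqI4[OF _ _ x y x y])
 fix v a b assume h: "(v, a) : x" "(v, b) : y"
 have "(v, c *\<^sub>C (a + b)) : strong_scale c (strong_add x y)"
  "(v, c *\<^sub>C a + c *\<^sub>C b) : strong_add (strong_scale c x) (strong_scale c y)" by(intro strong_intros h)+
 thus "EX w. (v, w) : strong_scale c (strong_add x y) & (v, w) : strong_add (strong_scale c x) (strong_scale c y)"
  by(metis scaleC_add_right)
qed (intro MO_intros x y)+

lemma strong_scale_left_add:
 assumes x: "x : MO"
 shows "strong_scale (c + d) x = strong_add (strong_scale c x) (strong_scale d x)"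
proof (rule measurable_eqI4[OF _ _ x x x x])
 fix v a assume h: "(v, a) : x"
 have "(v, (c + d) *\<^sub>C a) : strong_scale (c + d) x"
  "(v, c *\<^sub>C a + d *\<^sub>C a) : strong_add (strong_scale c x) (strong_scale d x)" by(intro strong_intros h)+
 thus "EX w. (v, w) : strong_scale (c + d) x & (v, w) : strong_add (strong_scale c x) (strong_scale d x)"
  by(metis scaleC_add_left)
qed (intro MO_intros x)+

lemma strong_scale_scale:
 assumes x: "x : MO"
 shows "strong_scale c (strong_scale d x) = strong_scale (c * d) x"
proof (rule measurable_eqI4[OF _ _ x x x x])
 fix v a assume h: "(v, a) : x"
 have "(v, c *\<^sub>C d *\<^sub>C a) : strong_scale c (strong_scale d x)"
  "(v, (c * d) *\<^sub>C a) : strong_scale (c * d) x" by(intro strong_intros h)+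
 thus "EX w. (v, w) : strong_scale c (strong_scale d x) & (v, w) : strong_scale (c * d) x"
  by(metis scaleC_scaleC)
qed (intro MO_intros x)+

lemma strong_scale_one: "x : MO ==> strong_scale 1 x = x"
proof (rule measurable_eqI4[of _ _ x x x x])
 show "EX w. (v, w) : strong_scale 1 x & (v, w) : x" if "(v, a) : x" for v a
  using strong_scaleI[OF that, of 1] that by(auto simp: scaleC_one)
qed (auto intro: MO_intros)

lemma strong_diff_add:
 assumes x: "x : MO" and y: "y : MO"
 shows "strong_add (strong_diff x y) y = x"
proof (rule measurable_eqI4[OF _ x x y x y])
 fix v a b assume h: "(v, a) : x" "(v, b) : y"
 have "(v, (a - b) + b) : strong_add (strong_diff x y) y" by(intro strong_intros h)
 thus "EX w. (v, w) : strong_add (strong_diff x y) y & (v, w) : x" using h(1) by auto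
qed (intro MO_intros x y)+

lemma strong_diff_trans:
 assumes x: "x : MO" and y: "y : MO" and z: "z : MO"
 shows "strong_add (strong_diff x y) (strong_diff y z) = strong_diff x z"
proof (rule measurable_eqI4[OF _ _ x y z z])
 fix v a b c assume h: "(v, a) : x" "(v, b) : y" "(v, c) : z"
 have "(v, (a - b) + (b - c)) : strong_add (strong_diff x y) (strong_diff y z)"
  "(v, a - c) : strong_diff x z" by(intro strong_intros h)+
 thus "EX w. (v, w) : strong_add (strong_diff x y) (strong_diff y z) & (v, w) : strong_diff x z" by auto
qed (intro MO_intros x y z)+

lemma strong_diff_swap:
 assumes x: "x : MO" and y: "y : MO"
 shows "strong_scale (-1) (strong_diff x y) = strong_diff y x"
proof (rule measurable_eqI4[OF _ _ x y x y])
 fix v a b assume h: "(v, a) : x" "(v, b) : y"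
 have "(v, (-1) *\<^sub>C (a - b)) : strong_scale (-1) (strong_diff x y)" "(v, b - a) : strong_diff y x"
  by(intro strong_intros h)+
 moreover have "(-1) *\<^sub>C (a - b) = b - a" by simp
 ultimately show "EX w. (v, w) : strong_scale (-1) (strong_diff x y) & (v, w) : strong_diff y x" by auto
qed (intro MO_intros x y)+

lemma strong_diff_interchange:
 assumes "a : MO" "b : MO" "c : MO" "d : MO"
 shows "strong_diff (strong_add a b) (strong_add c d) = strong_add (strong_diff a c) (strong_diff b d)"
proof (rule measurable_eqI4[OF _ _ assms])
 fix v e w u y assume h: "(v, e) : a" "(v, w) : b" "(v, u) : c" "(v, y) : d"
 have "(v, (e + w) - (u + y)) : strong_diff (strong_add a b) (strong_add c d)"
  "(v, (e - u) + (w - y)) : strong_add (strong_diff a c) (strong_diff b d)" by(intro strong_intros h)+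
 moreover have "(e - u) + (w - y) = (e + w) - (u + y)" by simp
 ultimately show "EX g. (v, g) : strong_diff (strong_add a b) (strong_add c d) & (v, g) : strong_add (strong_diff a c) (strong_diff b d)"
  by metis
qed (intro MO_intros assms)+

lemma strong_diff_scale:
 assumes x: "x : MO" and y: "y : MO"
 shows "strong_diff (strong_scale c x) (strong_scale c y) = strong_scale c (strong_diff x y)"
proof (rule measurable_eqI4[OF _ _ x y x y])
 fix v a b assume h: "(v, a) : x" "(v, b) : y"
 have "(v, c *\<^sub>C a - c *\<^sub>C b) : strong_diff (strong_scale c x) (strong_scale c y)"
  "(v, c *\<^sub>C (a - b)) : strong_scale c (strong_diff x y)" by(intro strong_intros h)+
 moreover have "c *\<^sub>C (a - b) = c *\<^sub>C a - c *\<^sub>C b"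
  by(rule linear_diff[OF bounded_linear.linear[OF bounded_linear_scaleC]])
 ultimately show "EX w. (v, w) : strong_diff (strong_scale c x) (strong_scale c y) & (v, w) : strong_scale c (strong_diff x y)"
  by metis
qed (intro MO_intros x y)+

lemma strong_diff_zero: "x : MO ==> strong_diff x (UNIV \<times> {0}) = x"
proof (rule measurable_eqI4[of _ _ x x x x])
 show "EX w. (v, w) : strong_diff x (UNIV \<times> {0}) & (v, w) : x" if "(v, a) : x" for v a
  using strong_diffI[OF that, of 0 "UNIV \<times> {0}"] that by auto
qed (auto intro: MO_intros)

lemma strong_diff_eq_zero:
 assumes x: "x : MO" and y: "y : MO" and z: "strong_diff x y = UNIV \<times> {0}"
 shows "x = y"
 using strong_diff_add[OF x y] strong_add_commute[OF zero_op_MO y] strong_add_zero[OF y] by(simp add: z)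

lemma graph_of_add: "A : M ==> B : M ==> strong_add (graph_of A) (graph_of B) = graph_of (A + B)"
proof (rule measurable_eqI4[of _ _ "graph_of A" "graph_of B" "graph_of A" "graph_of B"])
 show "EX w. (v, w) : strong_add (graph_of A) (graph_of B) & (v, w) : graph_of (A + B)" for v
  using strong_addI[of v "A v" "graph_of A" "B v" "graph_of B"] by(auto simp: blin_simps)
qed (auto intro: MO_intros add_M)

lemma graph_of_scale: "A : M ==> strong_scale c (graph_of A) = graph_of (scaleC_op c oL A)"
proof (rule measurable_eqI4[of _ _ "graph_of A" "graph_of A" "graph_of A" "graph_of A"])
 show "EX w. (v, w) : strong_scale c (graph_of A) & (v, w) : graph_of (scaleC_op c oL A)" for v
  using strong_scaleI[of v "A v" "graph_of A" c] by auto
qed (auto intro: MO_intros scaleC_compose_M)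

lemma graph_of_diff: "A : M ==> B : M ==> strong_diff (graph_of A) (graph_of B) = graph_of (A - B)"
proof (rule measurable_eqI4[of _ _ "graph_of A" "graph_of B" "graph_of A" "graph_of B"])
 show "EX w. (v, w) : strong_diff (graph_of A) (graph_of B) & (v, w) : graph_of (A - B)" for v
  using strong_diffI[of v "A v" "graph_of A" "B v" "graph_of B"] by(auto simp: blin_simps)
qed (auto intro: MO_intros diff_M)

section \<open>Distribution functions under sums and multiples\<close>

lemma lam_add:
 assumes x: "x : MO" and y: "y : MO" and s: "0 <= s" and r: "0 <= r"
 shows "lam (strong_add x y) (s + r) <= lam x s + lam y r"
proof -
 note J = join[OF PrD(1)[OF tail_Pr[OF x, of s]] PrD(1)[OF tail_Pr[OF y, of r]]]
 have "lam (strong_add x y) (s + r) <= \<tau> (join (tail x s) (tail y r))"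
 proof (rule lam_le[OF strong_add_MO[OF x y] J(1)])
  fix v assume "join (tail x s) (tail y r) v = 0"
  hence "tail x s v = 0" "tail y r v = 0" by(simp_all add: J(2))
  then obtain w u where "(v, w) : x" "norm w <= s * norm v" "(v, u) : y" "norm u <= r * norm v"
   using tail_good[OF x] tail_good[OF y] by metis
  thus "EX w. (v, w) : strong_add x y & norm w <= (s + r) * norm v" using norm_triangle_ineq[of w u]
   by(intro exI[of _ "w + u"]) (auto simp: distrib_right intro: strong_addI)
 qed (use s r in simp)
 also have "... <= lam x s + lam y r" unfolding lam_def by(rule trace_join[OF tail_Pr[OF x] tail_Pr[OF y]])
 finally show ?thesis .
qed

lemma lam_scale_le:
 assumes x: "x : MO" and s: "0 <= s"
 shows "lam (strong_scale c x) (cmod c * s) <= lam x s"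
 unfolding lam_def[of x]
proof (rule lam_le[OF strong_scale_MO[OF x] tail_Pr[OF x]])
 fix v assume "tail x s v = 0"
 then obtain w where "(v, w) : x" "norm w <= s * norm v" using tail_good[OF x] by metis
 thus "EX w. (v, w) : strong_scale c x & norm w <= cmod c * s * norm v"
  by(intro exI[of _ "c *\<^sub>C w"]) (auto simp: norm_scaleC mult.assoc intro!: mult_left_mono strong_scaleI)
qed (use s in simp)

lemma lam_scale:
 assumes x: "x : MO" and s: "0 <= s" and c: "c ~= 0"
 shows "lam (strong_scale c x) s = lam x (s / cmod c)"
proof (rule antisym)
 show "lam (strong_scale c x) s <= lam x (s / cmod c)"
  using lam_scale_le[OF x, of "s / cmod c" c] s c by simp
 have "strong_scale (1 / c) (strong_scale c x) = x"
  using c by(simp add: strong_scale_scale[OF x] strong_scale_one[OF x])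
 thus "lam x (s / cmod c) <= lam (strong_scale c x) s"
  using lam_scale_le[OF strong_scale_MO[OF x] s, of "1 / c" c] by(simp add: norm_divide)
qed

lemma lam_diff_swap: "x : MO ==> y : MO ==> 0 <= s ==> lam (strong_diff x y) s = lam (strong_diff y x) s"
 using lam_scale[OF strong_diff_MO, of x y s "-1"] by(simp add: strong_diff_swap)

lemma lam_bounded:
 assumes A: "A : M" and b: "!!v. norm (A v) <= b * norm v" and s: "b <= s" "0 <= s"
 shows "lam (graph_of A) s = 0"
proof -
 have "lam (graph_of A) s <= \<tau> 0"
 proof (rule lam_le[OF graph_of_MO[OF A] Pr_zero s(2)])
  fix v
  have "norm (A v) <= s * norm v" using b[of v] s(1) by(meson mult_right_mono norm_ge_zero order_trans)
  thus "EX w. (v, w) : graph_of A & norm w <= s * norm v" by simp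
 qed
 thus ?thesis by simp
qed

lemma lam_zero_op: "0 <= s ==> lam (UNIV \<times> {0}) s = 0"
 unfolding zero_op by(rule lam_bounded[where b = 0]) auto

lemma lam_graph_le:
 assumes A: "A : M" and P: "P : Pr" and z: "!!v. P v = 0 ==> A v = 0" and s: "0 <= s"
 shows "lam (graph_of A) s <= \<tau> P"
 by(rule lam_le[OF graph_of_MO[OF A] P s]) (use z s in simp)

lemma zero_op_of_lam:
 assumes x: "x : MO" and z: "!!s. 0 < s ==> lam x s = 0"
 shows "x = UNIV \<times> {0}"
proof (rule measurable_eqI[OF x zero_op_MO])
 have t: "tail x s = 0" if "0 < s" for s
  using trace_faithful[OF PrD(1) Pr_psd] tail_Pr[OF x] z[OF that] by(simp add: lam_def)
 have "(v, 0) : x" for v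
 proof -
  obtain w where e: "(v, w) : x" using tail_good[OF x, of 1 v] t[of 1] by auto
  have h: "norm w <= s * norm v" if s: "0 < s" for s
  proof -
   obtain u where "(v, u) : x" "norm u <= s * norm v" using tail_good[OF x, of s v] t[OF s] by auto
   thus ?thesis using MO_single[OF x e] by blast
  qed
  have "norm w <= 0 + e" if "0 < e" for e
   using that h[of 1] h[of "e / norm v"] by(cases "v = 0") auto
  hence "norm w <= 0" by(rule field_le_epsilon)
  thus ?thesis using e by simp
 qed
 thus "EX P:Pr. \<tau> P < ennreal y & (ALL v. P v = 0 --> (EX w. (v, w) : x & (v, w) : UNIV \<times> {0}))" if "0 < y" for y
  using that by(intro bexI[of _ 0]) auto
qed

end

section \<open>The \<open>L\<^sup>p\<close> gauge\<close>

lemma emeasure_lborel_Ioi: "emeasure lborel {0::real<..} = \<infinity>"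
proof (rule ccontr)
 assume "emeasure lborel {0::real<..} ~= \<infinity>"
 then obtain r where r: "0 <= r" "emeasure lborel {0::real<..} = ennreal r" by(cases "emeasure lborel {0::real<..}") auto
 have "emeasure lborel {0::real<..<r + 1} <= emeasure lborel {0::real<..}" by(intro emeasure_mono) auto
 thus False using r by(simp add: ennreal_le_iff)
qed

text \<open>Superlevel sets of decreasing functions on the half-line have this shape; measurability
  of layer functions and of singular values rests on it.\<close>

lemma down_closed_borel:
 fixes S :: "real set"
 assumes pos: "S \<subseteq> {0<..}" and down: "!!a b. a : S ==> 0 < b ==> b < a ==> b : S"
 shows "S : sets borel"
proof (cases "bdd_above S & S ~= {}")
 case True
 have "b : S" if "0 < b" "b < Sup S" for b
  using less_cSupD[of S b] True that down by blast
 moreover have "a <= Sup S" if "a : S" for a using True that by(simp add: cSup_upper)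
 ultimately have "S = {0<..<Sup S} \<or> S = {0<..Sup S}"
  using pos by(cases "Sup S : S") (force simp: order_less_le)+
 thus ?thesis by(elim disjE ssubst) simp_all
next
 case False
 hence "S = {} \<or> (ALL b. EX a:S. b < a)" unfolding bdd_above_def by(meson not_le)
 hence "S = {} \<or> S = {0<..}" using pos down by blast
 thus ?thesis by auto
qed

context
 fixes p :: real
 assumes p: "0 < p"
begin

text \<open>With u = s^p this is the integral of p s^(p-1) f(s), the layer form of a p-th moment. In
  this parametrization a dilation of f is a linear substitution.\<close>

definition lay :: "(real => ennreal) => ennreal" where
 "lay f = (\<integral>\<^sup>+ u. indicator {0<..} u * f (u powr (1 / p)) \<partial>lborel)"

definition decreasing :: "(real => ennreal) => bool" where
 "decreasing f \<longleftrightarrow> (ALL s t. 0 < s --> s <= t --> f t <= f s)"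

lemma lay_measurable:
 assumes "decreasing f" "0 < c"
 shows "(%u. indicator {0<..} u * f (c * u powr (1 / p))) : borel_measurable borel"
proof (rule borel_measurableI_greater)
 fix y :: ennreal
 have "{u. y < indicator {0<..} u * f (c * u powr (1 / p))} : sets borel"
 proof (rule down_closed_borel)
  show "{u. y < indicator {0<..} u * f (c * u powr (1 / p))} \<subseteq> {0<..}"
   by(auto simp: indicator_def split: if_splits)
  fix a b :: real
  assume a: "a : {u. y < indicator {0<..} u * f (c * u powr (1 / p))}" and b: "0 < b" "b < a"
  have "c * b powr (1 / p) <= c * a powr (1 / p)" "0 < c * b powr (1 / p)"
   using b assms(2) p by(simp_all add: powr_mono2)
  hence "f (c * a powr (1 / p)) <= f (c * b powr (1 / p))" using assms(1) by(simp add: decreasing_def)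
  thus "b : {u. y < indicator {0<..} u * f (c * u powr (1 / p))}"
   using a b by(auto simp: less_le_trans)
 qed
 thus "{x : space borel. y < indicator {0<..} x * f (c * x powr (1 / p))} : sets borel" by simp
qed

lemmas lay_measurable1 = lay_measurable[where c = 1, simplified]

lemma lay_dilate:
 assumes f: "decreasing f" and c: "0 < c"
 shows "lay (%s. f (c * s)) = ennreal (c powr (- p)) * lay f"
proof -
 have m: "(%u. indicator {0<..} u * f (u powr (1 / p))) : borel_measurable borel"
  by(rule lay_measurable1[OF f])
 have "lay f = \<bar>c powr p\<bar> * (\<integral>\<^sup>+ u. indicator {0<..} (0 + c powr p * u) * f ((0 + c powr p * u) powr (1 / p)) \<partial>lborel)"
  unfolding lay_def by(rule nn_integral_real_affine[OF m]) (use c in simp)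
 also have "(\<integral>\<^sup>+ u. indicator {0<..} (0 + c powr p * u) * f ((0 + c powr p * u) powr (1 / p)) \<partial>lborel) = lay (%s. f (c * s))"
  unfolding lay_def
 proof (rule nn_integral_cong)
  fix u :: real
  show "indicator {0<..} (0 + c powr p * u) * f ((0 + c powr p * u) powr (1 / p)) = indicator {0<..} u * f (c * u powr (1 / p))"
  proof (cases "0 < u")
   case True
   hence "(c powr p * u) powr (1 / p) = c * u powr (1 / p)"
    using c p by(simp add: powr_mult powr_powr)
   thus ?thesis using True c by(simp add: indicator_def)
  qed (use c in "simp add: indicator_def zero_less_mult_iff")
 qed
 finally have "lay f = ennreal (c powr p) * lay (%s. f (c * s))" by simp
 hence "ennreal (c powr (- p)) * lay f = ennreal (c powr (- p) * c powr p) * lay (%s. f (c * s))"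
  by(simp add: ennreal_mult mult.assoc)
 also have "c powr (- p) * c powr p = 1" using c by(simp flip: powr_add)
 finally show ?thesis by simp
qed

lemma lay_mono: "(!!s. 0 < s ==> f s <= g s) ==> lay f <= lay g"
 unfolding lay_def by(intro nn_integral_mono) (auto simp: indicator_def)

lemma lay_add:
 assumes "decreasing f" "decreasing g"
 shows "lay (%s. f s + g s) = lay f + lay g"
proof -
 have "lay (%s. f s + g s) = (\<integral>\<^sup>+ u. indicator {0<..} u * f (u powr (1 / p)) + indicator {0<..} u * g (u powr (1 / p)) \<partial>lborel)"
  unfolding lay_def by(intro nn_integral_cong) (simp add: distrib_left)
 also have "... = lay f + lay g"
  unfolding lay_def using lay_measurable1[OF assms(1)] lay_measurable1[OF assms(2)] by(intro nn_integral_add) auto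
 finally show ?thesis .
qed

text \<open>Chebyshev's inequality, since f is at least f s on the whole interval (0, s].\<close>

lemma lay_ge:
 assumes f: "decreasing f" and s: "0 < s"
 shows "ennreal (s powr p) * f s <= lay f"
proof -
 have "ennreal (s powr p) * f s = (\<integral>\<^sup>+ u. f s * indicator {0<..s powr p} u \<partial>lborel)"
  by(subst nn_integral_cmult_indicator) (auto simp: mult.commute)
 also have "... <= lay f"
  unfolding lay_def
 proof (rule nn_integral_mono)
  fix u :: real
  show "f s * indicator {0<..s powr p} u <= indicator {0<..} u * f (u powr (1 / p))"
  proof (cases "0 < u & u <= s powr p")
   case True
   hence "u powr (1 / p) <= (s powr p) powr (1 / p)" using p by(intro powr_mono2) auto
   hence "u powr (1 / p) <= s" using s p by(simp add: powr_powr)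
   thus ?thesis using True f by(auto simp: decreasing_def indicator_def)
  qed (auto simp: indicator_def)
 qed
 finally show ?thesis .
qed

lemma lay_indicator:
 assumes "0 <= b"
 shows "lay (%s. indicator {..<b} s * c) = ennreal (b powr p) * c"
proof -
 have "lay (%s. indicator {..<b} s * c) = (\<integral>\<^sup>+ u. c * indicator {0<..<b powr p} u \<partial>lborel)"
  unfolding lay_def
 proof (rule nn_integral_cong)
  fix u :: real
  have "u powr (1 / p) < b \<longleftrightarrow> u < b powr p" if "0 < u"
  proof -
   have "u = (u powr (1 / p)) powr p" using that p by(simp add: powr_powr)
   thus ?thesis using assms p that
    by(metis less_eq_real_def not_less powr_ge_zero powr_less_mono2 powr_mono2)
  qed
  thus "indicator {0<..} u * (indicator {..<b} (u powr (1 / p)) * c) = c * indicator {0<..<b powr p} u"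
   by(auto simp: indicator_def)
 qed
 also have "... = ennreal (b powr p) * c" by(subst nn_integral_cmult_indicator) (auto simp: mult.commute)
 finally show ?thesis .
qed

end

locale lp_vna = traced_vna M \<tau> for M :: "'h::complex_hilbert_space bop set" and \<tau> +
 fixes p :: real
 assumes p_ge_1: "1 <= p"
begin

lemma p_pos: "0 < p"
 using p_ge_1 by simp

abbreviation "L \<equiv> lay p"
abbreviation "LP \<equiv> Lp_space M \<tau> p"
text \<open>The p-th power of the norm by \<open>nn_integral_mu\<close>, but extended valued, so
  that it can be estimated before membership in \<open>LP\<close> is known.\<close>

definition Phi :: "'h uop => ennreal" where "Phi x = L (lam x)"

lemma decreasing_lam: "x : MO ==> decreasing (lam x)"
 unfolding decreasing_def[OF p_pos] by(simp add: lam_antimono)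

text \<open>The infimum defining the singular value is attained because \<open>lam\<close> is right
  continuous. This adjunction lets \<open>lam\<close> replace singular values.\<close>

lemma sv_le_iff:
 assumes x: "x : MO" and s: "0 <= s"
 shows "singular_value \<tau> x t <= ennreal s \<longleftrightarrow> lam x s <= ennreal t"
proof
 assume "lam x s <= ennreal t"
 thus "singular_value \<tau> x t <= ennreal s"
  unfolding singular_value_def using s by(intro Inf_lower) (auto simp: lam_def tail_def)
next
 assume le: "singular_value \<tau> x t <= ennreal s"
 have "lam x (s + 1 / real (Suc n)) <= ennreal t" for n
 proof -
  have "singular_value \<tau> x t < ennreal (s + 1 / real (Suc n))"
   by(rule le_less_trans[OF le]) (use s in "simp add: ennreal_less_iff")
  then obtain r where r: "0 <= r" "lam x r <= ennreal t" "ennreal r < ennreal (s + 1 / real (Suc n))"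
   unfolding singular_value_def Inf_less_iff by(auto simp: lam_def tail_def)
  hence "lam x (s + 1 / real (Suc n)) <= lam x r"
   by(intro lam_antimono[OF x]) (simp add: ennreal_less_iff)
  thus ?thesis using r(2) by simp
 qed
 thus "lam x s <= ennreal t" unfolding lam_right_cont[OF x, of s] by(rule SUP_least)
qed

lemma sv_finite: "x : MO ==> 0 < t ==> singular_value \<tau> x t < \<infinity>"
proof -
 assume x: "x : MO" and t: "0 < t"
 obtain s where "0 <= s" "lam x s < ennreal t" by(rule lam_small[OF x t])
 hence "singular_value \<tau> x t <= ennreal s" using sv_le_iff[OF x] by(simp add: less_imp_le)
 thus ?thesis by(simp add: le_less_trans)
qed

definition mu :: "'h uop => real => real" where "mu x t = enn2real (singular_value \<tau> x t)"

lemma mu_le_iff: "x : MO ==> 0 < t ==> 0 <= s ==> mu x t <= s \<longleftrightarrow> lam x s <= ennreal t"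
proof -
 assume x: "x : MO" and t: "0 < t" and s: "0 <= s"
 have "ennreal (mu x t) = singular_value \<tau> x t" using sv_finite[OF x t] by(simp add: mu_def)
 hence "mu x t <= s \<longleftrightarrow> singular_value \<tau> x t <= ennreal s" using s by(metis ennreal_le_iff)
 thus ?thesis using sv_le_iff[OF x s] by simp
qed

lemma mu_nonneg: "0 <= mu x t"
 by(simp add: mu_def)

lemma mu_antimono: "x : MO ==> 0 < t ==> t <= r ==> mu x r <= mu x t"
 using mu_le_iff[of x r "mu x t"] mu_le_iff[of x t "mu x t"] mu_nonneg
 by(auto intro: order_trans ennreal_leI)

lemma mu_measurable:
 assumes x: "x : MO"
 shows "(%t. indicator {0..} t *\<^sub>R (mu x t powr p)) : borel_measurable borel"
proof -
 have "(%t. indicator {0<..} t * ennreal (mu x t powr p)) : borel_measurable borel"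
 proof (rule borel_measurableI_greater)
  fix y :: ennreal
  have "{t. y < indicator {0<..} t * ennreal (mu x t powr p)} : sets borel"
  proof (rule down_closed_borel)
   show "{t. y < indicator {0<..} t * ennreal (mu x t powr p)} \<subseteq> {0<..}"
    by(auto simp: indicator_def split: if_splits)
   fix a b :: real assume a: "a : {t. y < indicator {0<..} t * ennreal (mu x t powr p)}" and b: "0 < b" "b < a"
   have "mu x a powr p <= mu x b powr p" using mu_antimono[OF x, of b a] b mu_nonneg p_pos by(intro powr_mono2) auto
   hence "ennreal (mu x a powr p) <= ennreal (mu x b powr p)" by(rule ennreal_leI)
   thus "b : {t. y < indicator {0<..} t * ennreal (mu x t powr p)}"
    using a b by(auto simp: less_le_trans)
  qed
  thus "{t : space borel. y < indicator {0<..} t * ennreal (mu x t powr p)} : sets borel" by simp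
 qed
 hence [measurable]: "(%t. enn2real (indicator {0<..} t * ennreal (mu x t powr p))) : borel_measurable borel" by measurable
 \<comment> \<open>The point 0 is separated because monotonicity of \<open>mu\<close> is available
   only for positive arguments.\<close>
 have "(%t. indicator {0..} t *\<^sub>R (mu x t powr p)) =
  (%t. if t = 0 then mu x 0 powr p else enn2real (indicator {0<..} t * ennreal (mu x t powr p)))"
  by(auto simp: indicator_def fun_eq_iff)
 thus ?thesis by simp
qed

text \<open>Layer cake: \<open>u < \<mu>\<^sub>t\<^sup>p\<close> iff \<open>t\<close> is less than the distribution function at \<open>u\<^sup>1\<^sup>/\<^sup>p\<close>.\<close>

lemma nn_integral_mu:
 assumes x: "x : MO"
 shows "(\<integral>\<^sup>+ t. ennreal (indicator {0..} t *\<^sub>R (mu x t powr p)) \<partial>lborel) = Phi x"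
proof -
 define g where "g u = indicator {0<..} u * lam x (u powr (1 / p))" for u :: real
 have [measurable]: "g : borel_measurable borel"
  unfolding g_def by(rule lay_measurable1[OF p_pos decreasing_lam[OF x]])
 define k :: "real => real => ennreal" where "k t u = (if 0 < t & 0 < u & ennreal t < g u then 1 else 0)" for t u
 have [measurable]: "(%(t, u). k t u) : borel_measurable (lborel \<Otimes>\<^sub>M lborel)"
  unfolding k_def by measurable
 have 1: "(\<integral>\<^sup>+ u. k t u \<partial>lborel) = ennreal (indicator {0..} t *\<^sub>R (mu x t powr p))" if "t ~= 0" for t
 proof (cases "0 < t")
  case True
  have "k t u = indicator {0<..<mu x t powr p} u" for u
  proof (cases "0 < u")
   case u: True
   have "ennreal t < g u \<longleftrightarrow> \<not> mu x t <= u powr (1 / p)"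
    using mu_le_iff[OF x True, of "u powr (1 / p)"] u by(simp add: g_def not_le)
   also have "... \<longleftrightarrow> u < mu x t powr p"
   proof -
    have e: "u = (u powr (1 / p)) powr p" using u p_pos by(simp add: powr_powr)
    show ?thesis
    proof
     assume "\<not> mu x t <= u powr (1 / p)"
     hence "(u powr (1 / p)) powr p < mu x t powr p" using p_pos by(intro powr_less_mono2) auto
     thus "u < mu x t powr p" using e by simp
    next
     assume a: "u < mu x t powr p"
     show "\<not> mu x t <= u powr (1 / p)"
     proof
      assume "mu x t <= u powr (1 / p)"
      hence "mu x t powr p <= (u powr (1 / p)) powr p" using p_pos mu_nonneg by(intro powr_mono2) auto
      thus False using a e by simp
     qed
    qed
   qed
   finally show ?thesis using True u by(simp add: k_def)
  qed (simp add: k_def)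
  hence "(\<integral>\<^sup>+ u. k t u \<partial>lborel) = emeasure lborel {0<..<mu x t powr p}" by simp
  thus ?thesis using True by simp
 qed (use that in "simp add: k_def")
 have 2: "(\<integral>\<^sup>+ t. k t u \<partial>lborel) = g u" for u
 proof (cases "0 < u")
  case True
  show ?thesis
  proof (cases "g u")
   case (real r)
   have "k t u = indicator {0<..<r} t" for t using True real by(auto simp: k_def ennreal_less_iff)
   thus ?thesis using real by simp
  next
   case top
   have "k t u = indicator {0<..} t" for t using True top by(auto simp: k_def)
   thus ?thesis using top emeasure_lborel_Ioi by simp
  qed
 qed (simp add: k_def g_def)
 have "(\<integral>\<^sup>+ t. ennreal (indicator {0..} t *\<^sub>R (mu x t powr p)) \<partial>lborel) = (\<integral>\<^sup>+ t. \<integral>\<^sup>+ u. k t u \<partial>lborel \<partial>lborel)"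
  using AE_lborel_singleton[of "0::real"] by(intro nn_integral_cong_AE) (auto simp: 1)
 also have "... = (\<integral>\<^sup>+ u. \<integral>\<^sup>+ t. k t u \<partial>lborel \<partial>lborel)"
  by(rule lborel_pair.Fubini'[symmetric]) simp
 also have "... = Phi x" by(simp add: 2 Phi_def lay_def[OF p_pos] g_def)
 finally show ?thesis .
qed

lemma LP_iff: "x : LP \<longleftrightarrow> x : MO & Phi x < \<infinity>"
proof -
 have "set_integrable lborel {0..} (%t. enn2real (singular_value \<tau> x t) powr p) \<longleftrightarrow> Phi x < \<infinity>" if x: "x : MO"
 proof -
  have "set_integrable lborel {0..} (%t. enn2real (singular_value \<tau> x t) powr p) \<longleftrightarrow>
   integrable lborel (%t. indicator {0..} t *\<^sub>R (mu x t powr p))"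
   by(simp add: set_integrable_def mu_def)
  also have "... \<longleftrightarrow> (\<integral>\<^sup>+ t. ennreal (norm (indicator {0..} t *\<^sub>R (mu x t powr p))) \<partial>lborel) < \<infinity>"
   using mu_measurable[OF x] by(simp add: integrable_iff_bounded)
  also have "(%t. norm (indicator {0..} t *\<^sub>R (mu x t powr p))) = (%t. indicator {0..} t *\<^sub>R (mu x t powr p))"
   by(auto simp: fun_eq_iff indicator_def)
  finally show ?thesis using nn_integral_mu[OF x] by simp
 qed
 thus ?thesis by(auto simp: Lp_space_def)
qed

lemma LP_MO: "x : LP ==> x : MO" and LP_finite: "x : LP ==> Phi x < \<infinity>"
 by(simp_all add: LP_iff)

lemma Lp_norm_eq: "x : MO ==> Lp_norm \<tau> p x = enn2real (Phi x) powr (1 / p)"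
proof -
 assume x: "x : MO"
 have "(LINT t:{0..}|lborel. enn2real (singular_value \<tau> x t) powr p) = (LINT t|lborel. indicator {0..} t *\<^sub>R (mu x t powr p))"
  by(simp add: set_lebesgue_integral_def mu_def)
 also have "... = enn2real (\<integral>\<^sup>+ t. ennreal (indicator {0..} t *\<^sub>R (mu x t powr p)) \<partial>lborel)"
  by(rule integral_eq_nn_integral) (use mu_measurable[OF x] in "auto simp: indicator_def")
 finally show ?thesis using nn_integral_mu[OF x] by(simp add: Lp_norm_def)
qed

text \<open>The level s is split as (1 - v) s + v s and each piece is undone by a dilation. The
  resulting factors are too large for a norm inequality but suffice for closure under sums and for
  perturbations.\<close>

lemma Phi_add:
 assumes x: "x : MO" and y: "y : MO" and t: "0 < v" "v < 1"
 shows "Phi (strong_add x y) <= ennreal ((1 - v) powr (- p)) * Phi x + ennreal (v powr (- p)) * Phi y"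
proof -
 have t1: "0 < 1 - v" using t by simp
 have d: "decreasing (%s. f (c * s))" if "decreasing f" "0 < c" for f :: "real => ennreal" and c
  using that by(auto simp: decreasing_def[OF p_pos] mult_left_mono)
 have "Phi (strong_add x y) <= L (%s. lam x ((1 - v) * s) + lam y (v * s))"
  unfolding Phi_def
 proof (rule lay_mono[OF p_pos])
  fix s :: real assume s: "0 < s"
  have "lam (strong_add x y) ((1 - v) * s + v * s) <= lam x ((1 - v) * s) + lam y (v * s)"
   using s t by(intro lam_add x y) auto
  thus "lam (strong_add x y) s <= lam x ((1 - v) * s) + lam y (v * s)" by(simp add: algebra_simps)
 qed
 also have "... = L (%s. lam x ((1 - v) * s)) + L (%s. lam y (v * s))"
  by(rule lay_add[OF p_pos d[OF decreasing_lam[OF x] t1] d[OF decreasing_lam[OF y] t(1)]])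
 also have "... = ennreal ((1 - v) powr (- p)) * Phi x + ennreal (v powr (- p)) * Phi y"
  unfolding Phi_def by(simp only: lay_dilate[OF p_pos decreasing_lam[OF x] t1] lay_dilate[OF p_pos decreasing_lam[OF y] t(1)])
 finally show ?thesis .
qed

lemma Phi_add2:
 assumes x: "x : MO" and y: "y : MO"
 shows "Phi (strong_add x y) <= ennreal (2 powr p) * (Phi x + Phi y)"
 using Phi_add[OF x y, of "1/2"] by(simp add: powr_minus powr_divide distrib_left)

lemma Phi_cong: "(!!s. 0 < s ==> lam x s = lam y s) ==> Phi x = Phi y"
 unfolding Phi_def by(intro antisym lay_mono[OF p_pos]) simp_all

lemma Phi_swap: "x : MO ==> y : MO ==> Phi (strong_diff x y) = Phi (strong_diff y x)"
 by(intro Phi_cong lam_diff_swap) auto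

lemma Phi_zero: "Phi (UNIV \<times> {0}) = 0"
proof -
 have "Phi (UNIV \<times> {0}) <= L (%s. 0)" unfolding Phi_def by(rule lay_mono[OF p_pos]) (simp add: lam_zero_op)
 thus ?thesis by(simp add: lay_def[OF p_pos])
qed

lemma strong_scale_0: "x : MO ==> strong_scale 0 x = UNIV \<times> {0}"
proof (rule measurable_eqI4[of _ _ x x x x])
 show "EX w. (v, w) : strong_scale 0 x & (v, w) : UNIV \<times> {0}" if "(v, a) : x" for v a
  using strong_scaleI[OF that, of 0] scaleR_scaleC[of 0 a] by(intro exI[of _ 0]) simp
qed (auto intro: MO_intros)

lemma Phi_scale:
 assumes x: "x : MO"
 shows "Phi (strong_scale c x) = ennreal (cmod c powr p) * Phi x"
proof (cases "c = 0")
 case True thus ?thesis using p_pos by(simp add: strong_scale_0[OF x] Phi_zero)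
next
 case False
 hence c: "0 < 1 / cmod c" by simp
 have "Phi (strong_scale c x) = L (%s. lam x ((1 / cmod c) * s))"
  unfolding Phi_def by(intro antisym lay_mono[OF p_pos]; simp add: lam_scale[OF x _ False])
 also have "... = ennreal ((1 / cmod c) powr (- p)) * Phi x"
  unfolding Phi_def by(rule lay_dilate[OF p_pos decreasing_lam[OF x] c])
 also have "(1 / cmod c) powr (- p) = cmod c powr p" by(simp add: powr_minus powr_divide)
 finally show ?thesis .
qed

lemma Phi_ge: "x : MO ==> 0 < s ==> ennreal (s powr p) * lam x s <= Phi x"
 unfolding Phi_def by(rule lay_ge[OF p_pos decreasing_lam])

lemma Phi_eq_0: "x : MO ==> Phi x = 0 ==> x = UNIV \<times> {0}"
proof (rule zero_op_of_lam)
 fix s :: real assume x: "x : MO" "Phi x = 0" "0 < s"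
 hence "ennreal (s powr p) * lam x s = 0" using Phi_ge[of x s] by simp
 thus "lam x s = 0" using x(3) by simp
qed

lemma LP_add: "x : LP ==> y : LP ==> strong_add x y : LP"
 unfolding LP_iff using Phi_add2[of x y] strong_add_MO
 by(auto simp: ennreal_mult_less_top intro: le_less_trans)

lemma LP_scale: "x : LP ==> strong_scale c x : LP"
 unfolding LP_iff using strong_scale_MO by(auto simp: Phi_scale ennreal_mult_less_top)

lemma LP_diff: "x : LP ==> y : LP ==> strong_diff x y : LP"
 unfolding strong_diff_def by(intro LP_add LP_scale)

lemma Phi_bounded:
 assumes A: "A : M" and b: "!!v. norm (A v) <= b * norm v" "0 <= b" and P: "P : Pr"
  and z: "!!v. P v = 0 ==> A v = 0"
 shows "Phi (graph_of A) <= ennreal (b powr p) * \<tau> P"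
proof -
 have "Phi (graph_of A) <= L (%s. indicator {..<b} s * \<tau> P)"
  unfolding Phi_def
 proof (rule lay_mono[OF p_pos])
  fix s :: real assume s: "0 < s"
  show "lam (graph_of A) s <= indicator {..<b} s * \<tau> P"
  proof (cases "s < b")
   case True thus ?thesis using lam_graph_le[OF A P z] s by simp
  next
   case False thus ?thesis using lam_bounded[OF A b(1), of s] s by simp
  qed
 qed
 thus ?thesis by(simp add: lay_indicator[OF p_pos b(2)])
qed

text \<open>The condition on the range is traded for one on the kernel through the right support,
  whose trace is at most that of Q.\<close>

lemma Phi_bounded_left:
 assumes A: "A : M" and b: "!!v. norm (A v) <= b * norm v" "0 <= b" and Q: "Q : Pr"
  and z: "!!v. Q (A v) = A v"
 shows "Phi (graph_of A) <= ennreal (b powr p) * \<tau> Q"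
proof -
 have "Phi (graph_of A) <= ennreal (b powr p) * \<tau> (rproj A)"
  by(rule Phi_bounded[OF A b rproj_Pr[OF A]]) (simp add: rproj_zero_iff[OF A])
 also have "... <= ennreal (b powr p) * \<tau> Q" by(intro mult_left_mono trace_rproj A Q z) simp
 finally show ?thesis .
qed


subsection \<open>Completeness\<close>

lemma geometric_tail: "(%j. (1/2::real) ^ (k + j)) sums (2 * (1/2) ^ k)"
proof -
 have "(%j. (1/2) ^ k * (1/2::real) ^ j) sums ((1/2) ^ k * (1 / (1 - 1/2)))"
  by(intro sums_mult geometric_sums) simp
 thus ?thesis by(simp add: power_add mult.commute)
qed

lemma trace_Join_geometric:
 assumes P: "!!j. P j : Pr" and t: "!!j. \<tau> (P j) <= ennreal (c * (1/2) ^ (k + j))" and c: "0 <= c"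
 shows "\<tau> (Join P) <= ennreal (c * (2 * (1/2) ^ k))"
proof -
 have "\<tau> (Join P) <= (\<Sum>j. \<tau> (P j))" by(rule trace_Join[OF P])
 also have "... <= (\<Sum>j. ennreal (c * (1/2) ^ (k + j)))" by(intro suminf_le t) auto
 also have "... = ennreal (c * (2 * (1/2) ^ k))"
  by(rule suminf_ennreal_eq[OF _ sums_mult[OF geometric_tail]]) (use c in simp)
 finally show ?thesis .
qed

lemma geometric_increments:
 fixes u :: "nat => 'b::banach"
 assumes inc: "!!k. m <= k ==> norm (u (Suc k) - u k) <= (1/2) ^ k * c" and c: "0 <= c"
 shows "convergent u" and "m <= k ==> u ----> l ==> norm (l - u k) <= 2 * (1/2) ^ k * c"
proof -
 have le: "norm (u (k + j) - u k) <= 2 * (1/2) ^ k * c" if k: "m <= k" for k j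
 proof -
  have "norm (u (k + j) - u k) <= (\<Sum>i<j. (1/2) ^ (k + i) * c)"
  proof (induction j)
   case (Suc j)
   have "norm (u (k + Suc j) - u k) <= norm (u (Suc (k + j)) - u (k + j)) + norm (u (k + j) - u k)"
    using norm_triangle_ineq[of "u (Suc (k + j)) - u (k + j)" "u (k + j) - u k"] by simp
   also have "... <= (1/2) ^ (k + j) * c + (\<Sum>i<j. (1/2) ^ (k + i) * c)"
    by(intro add_mono inc Suc) (use k in simp)
   finally show ?case by simp
  qed simp
  also have "... <= (\<Sum>i. (1/2) ^ (k + i)) * c"
   using sums_summable[OF geometric_tail[of k]] c
   by(simp add: sum_distrib_right[symmetric] mult_right_mono sum_le_suminf)
  also have "(\<Sum>i. (1/2::real) ^ (k + i)) = 2 * (1/2) ^ k" by(rule sums_unique[OF geometric_tail, symmetric])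
  finally show ?thesis .
 qed
 have "Cauchy u"
 proof (rule CauchyI')
  fix e :: real assume "0 < e"
  hence "0 < e / (4 * (c + 1))" using c by simp
  then obtain k where k: "(1/2::real) ^ k < e / (4 * (c + 1))" using real_arch_pow_inv[of _ "1/2"] by auto
  have "dist (u a) (u b) < e" if ab: "a >= max m k" "b > a" for a b
  proof -
   have "norm (u b - u a) <= 2 * (1/2) ^ a * c" using le[of a "b - a"] ab by simp
   also have "... <= 2 * (1/2) ^ k * (c + 1)"
    using ab c by(intro mult_mono) (auto intro: power_decreasing)
   also have "... < 2 * (e / (4 * (c + 1))) * (c + 1)" using k c by(intro mult_strict_right_mono) auto
   also have "... = e / 2" using c by(simp add: field_simps)
   finally show ?thesis using `0 < e` by(simp add: dist_norm norm_minus_commute)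
  qed
  thus "EX M. ALL m>=M. ALL n>m. dist (u m) (u n) < e" by blast
 qed
 thus "convergent u" by(rule Cauchy_convergent)
 assume k: "m <= k" and l: "u ----> l"
 have "(%j. norm (u (k + j) - u k)) ----> norm (l - u k)"
  using LIMSEQ_ignore_initial_segment[OF l, of k] by(intro tendsto_intros) (simp add: add.commute)
 thus "norm (l - u k) <= 2 * (1/2) ^ k * c" by(rule LIMSEQ_le_const2) (use le[OF k] in blast)
qed

text \<open>The limit graph y collects pointwise limits along vectors lying in all domains. Off the
  join \<open>PT m\<close> of right tails the increments are geometrically small; a join of left
  tails does the same for the residues, and \<open>measurable_closureI\<close> asks for
  both.\<close>

lemma measure_complete:
 assumes w: "!!k. w k : MO"
  and fast: "!!k. lam (strong_diff (w (Suc k)) (w k)) ((1/2) ^ k) <= ennreal ((1/2) ^ k)"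
 obtains y where "y : MO" "!!k. lam (strong_diff y (w k)) (2 * (1/2) ^ k) <= ennreal (2 * (1/2) ^ k)"
proof -
 define D where "D k = strong_diff (w (Suc k)) (w k)" for k
 have D: "D k : MO" for k unfolding D_def by(rule strong_diff_MO[OF w w])
 have pos: "0 <= (1/2::real) ^ k" for k by simp
 define y where "y = {(v, u). EX g. (ALL k. (v, g k) : w k) & g ----> u}"
 have yI: "(v, u) : y" if "!!k. (v, g k) : w k" "g ----> u" for v u g using that by(auto simp: y_def)
 define PT where "PT m = Join (%j. tail (D (m + j)) ((1/2) ^ (m + j)))" for m
 have tD: "tail (D k) s : Pr" for k s by(rule tail_Pr[OF D])
 have PT: "PT m : Pr" "PT m v = 0 ==> m <= k ==> tail (D k) ((1/2) ^ k) v = 0" for m k v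
 proof -
  note J = Join[of "%j. tail (D (m + j)) ((1/2) ^ (m + j))", OF PrD(1)[OF tD]]
  show "PT m : Pr" unfolding PT_def by(rule J(1))
  assume "PT m v = 0" "m <= k"
  hence "tail (D (m + (k - m))) ((1/2) ^ (m + (k - m))) v = 0" unfolding PT_def J(2) by blast
  thus "tail (D k) ((1/2) ^ k) v = 0" using `m <= k` by simp
 qed
 have PTt: "\<tau> (PT m) <= ennreal (2 * (1/2) ^ m)" for m
  using trace_Join_geometric[of "%j. tail (D (m + j)) ((1/2) ^ (m + j))" 1 m, OF tD] fast
  unfolding PT_def D_def lam_def by simp
 have dom: "EX R:Pr. \<tau> R < ennreal i & (ALL v. R v = 0 --> (ALL k. v : Domain (w k)))" if e: "0 < i" for i
 proof -
  have "ALL k. EX R. R : Pr & \<tau> R < ennreal (i/4 * (1/2) ^ k) & (ALL v. R v = 0 --> v : Domain (w k))"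
  proof
   fix k
   have "0 < i/4 * (1/2::real) ^ k" using e by simp
   from common_domain2[OF w w this, of k k]
   show "EX R. R : Pr & \<tau> R < ennreal (i/4 * (1/2) ^ k) & (ALL v. R v = 0 --> v : Domain (w k))" by blast
  qed
  from choice[OF this] obtain R where R: "!!k. R k : Pr" "!!k. \<tau> (R k) < ennreal (i/4 * (1/2) ^ k)"
   "!!k v. R k v = 0 ==> v : Domain (w k)" by blast
  note J = Join[of R, OF PrD(1)[OF R(1)]]
  have "\<tau> (Join R) <= ennreal (i/4 * (2 * (1/2) ^ 0))"
   by(rule trace_Join_geometric[OF R(1)]) (use R(2) e in "auto intro: less_imp_le")
  also have "... < ennreal i" using e by(simp add: ennreal_less_iff)
  finally show ?thesis using J R(3) by blast
 qed
 have seq: "EX g u. (ALL k. (v, g k) : w k) & g ----> u & (ALL k>=m. norm (u - g k) <= 2 * (1/2) ^ k * norm v)"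
  if z: "PT m v = 0" and d: "ALL k. v : Domain (w k)" for m v
 proof -
  have "ALL k. EX g. (v, g) : w k" using d by blast
  from choice[OF this] obtain g where g: "!!k. (v, g k) : w k" by blast
  have inc: "norm (g (Suc k) - g k) <= (1/2) ^ k * norm v" if k: "m <= k" for k
  proof -
   obtain r where t: "(v, r) : D k" "norm r <= (1/2) ^ k * norm v" by(rule tail_good[OF D PT(2)[OF z k]])
   have "(v, g (Suc k) - g k) : D k" unfolding D_def by(intro strong_diffI g)
   thus ?thesis using MO_single[OF D t(1)] t(2) by blast
  qed
  obtain u where u: "g ----> u" using geometric_increments(1)[of m g "norm v", OF inc] convergent_def by auto
  have "norm (u - g k) <= 2 * (1/2) ^ k * norm v" if "m <= k" for k
   by(rule geometric_increments(2)[of m g "norm v", OF inc _ that u]) auto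
  thus ?thesis using g u by blast
 qed
 have MO: "closure y : MO"
 proof (rule measurable_closureI)
  show "subspace y"
  proof (rule subspaceI)
   have "(0, 0) : w k" for k using subspace_0[OF MO_subspace[OF w]] by(simp add: zero_prod_def)
   thus "0 : y" unfolding zero_prod_def by(rule yI) simp
   fix a b assume "a : y" and "b : y"
   from `b : y` obtain v' u' g' where b: "b = (v', u')" "!!k. (v', g' k) : w k" "g' ----> u'"
    by(auto simp: y_def)
   from `a : y` obtain v u g where a: "a = (v, u)" "!!k. (v, g k) : w k" "g ----> u" by(auto simp: y_def)
   have "(v + v', g k + g' k) : w k" for k using subspace_add[OF MO_subspace[OF w] a(2) b(2)] by simp
   hence "(v + v', u + u') : y" by(rule yI) (intro tendsto_intros a b)
   thus "a + b : y" by(simp add: a b)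
  next
   fix c :: real and a assume "a : y"
   then obtain v u g where a: "a = (v, u)" "!!k. (v, g k) : w k" "g ----> u" by(auto simp: y_def)
   have "(c *\<^sub>R v, c *\<^sub>R g k) : w k" for k using subspace_scale[OF MO_subspace[OF w] a(2)] by simp
   hence "(c *\<^sub>R v, c *\<^sub>R u) : y" by(rule yI) (intro tendsto_intros a)
   thus "c *\<^sub>R a : y" by(simp add: a)
  qed
  show "(U v, U u) : y" if U: "U : M'" and h: "(v, u) : y" for U v u
  proof -
   obtain g where z: "!!k. (v, g k) : w k" "g ----> u" using h by(auto simp: y_def)
   show ?thesis by(rule yI[of _ "%k. U (g k)"]) (rule MO_invariant[OF w U z(1)], intro tendsto_intros z)
  qed
  fix i :: real assume e: "0 < i"
  hence e4: "0 < i/4" "0 < i/2" by simp_all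
  \<comment> \<open>Then 2 (1/2)^m < i/4, the room reserved for the right join and for the left
    join.\<close>
  obtain m where m: "(1/2::real) ^ m < i/8" using real_arch_pow_inv[of "i/8" "1/2"] e by auto
  have small: "\<tau> Q < ennreal (i/4)" if "\<tau> Q <= ennreal (2 * (1/2) ^ m)" for Q
   by(rule le_less_trans[OF that]) (use m in "simp add: ennreal_less_iff")
  obtain s where s: "0 <= s" "lam (w m) s < ennreal (i/4)" by(rule lam_small[OF w e4(1)])
  have ts: "tail (w m) s : Pr" by(rule tail_Pr[OF w])
  obtain R where R: "R : Pr" "\<tau> R < ennreal (i/2)" "!!v. R v = 0 ==> ALL k. v : Domain (w k)" using dom[OF e4(2)] by blast
  let ?P1 = "join (PT m) (tail (w m) s)"
  note J1 = join[OF PrD(1)[OF PT(1)[of m]] PrD(1)[OF ts]]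
  have t1: "\<tau> ?P1 < ennreal (i/2)"
   by(rule small_join[OF PT(1) ts]) (use small[OF PTt] s e in "simp_all add: lam_def")
  note J2 = join[OF PrD(1)[OF J1(1)] PrD(1)[OF R(1)]]
  have "\<tau> (join ?P1 R) < ennreal i" by(rule small_join[OF J1(1) R(1) t1 R(2) e])
  moreover have "EX u. (v, u) : y & norm u <= (s + 2) * norm v" if z: "join ?P1 R v = 0" for v
  proof -
   have z': "PT m v = 0" "tail (w m) s v = 0" "R v = 0" using z by(simp_all add: J1(2) J2(2))
   obtain g u where ze: "!!k. (v, g k) : w k" "g ----> u" "!!k. m <= k ==> norm (u - g k) <= 2 * (1/2) ^ k * norm v"
    using seq[OF z'(1) R(3)[OF z'(3)]] by blast
   obtain r where "(v, r) : w m" "norm r <= s * norm v" by(rule tail_good[OF w z'(2)])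
   hence "norm (g m) <= s * norm v" using MO_single[OF w ze(1)] by blast
   moreover have "norm (u - g m) <= 2 * norm v"
   proof -
    have "2 * (1/2::real) ^ m <= 2 * 1" by(intro mult_left_mono power_le_one) auto
    hence "2 * (1/2) ^ m * norm v <= 2 * 1 * norm v" by(rule mult_right_mono) simp
    thus ?thesis using ze(3)[of m] by simp
   qed
   ultimately have "norm u <= (s + 2) * norm v"
    using norm_triangle_ineq[of "u - g m" "g m"] by(simp add: distrib_right)
   thus ?thesis using yI[OF ze(1,2)] by blast
  qed
  ultimately show "EX P:Pr. \<tau> P < ennreal i & (EX K. ALL v. P v = 0 --> (EX u. (v, u) : y & norm u <= K * norm v))"
   using J2(1) by blast
  have "ALL k. EX Q. Q : Pr & \<tau> Q <= lam (D k) ((1/2) ^ k) & (ALL v u. (v, u) : D k --> norm (u - Q u) <= (1/2) ^ k * norm v)"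
   using left_tail[OF D pos] by metis
  from choice[OF this] obtain Q where Q: "!!k. Q k : Pr" "!!k. \<tau> (Q k) <= lam (D k) ((1/2) ^ k)"
   "!!k v u. (v, u) : D k ==> norm (u - Q k u) <= (1/2) ^ k * norm v" by blast
  define QT where "QT = Join (%j. Q (m + j))"
  note JQ = Join[of "%j. Q (m + j)", OF PrD(1)[OF Q(1)], folded QT_def]
  have "\<tau> (Q k) <= ennreal ((1/2) ^ k)" for k using order_trans[OF Q(2) fast[of k, folded D_def]] .
  hence "\<tau> QT <= ennreal (2 * (1/2) ^ m)"
   using trace_Join_geometric[of "%j. Q (m + j)" 1 m] Q(1) unfolding QT_def by simp
  hence tQT: "\<tau> QT < ennreal (i/4)" by(rule small)
  obtain Qw where Qw: "Qw : Pr" "\<tau> Qw <= lam (w m) s" "!!v u. (v, u) : w m ==> norm (u - Qw u) <= s * norm v"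
   by(rule left_tail[OF w s(1)]) blast
  let ?Q = "join QT Qw"
  note J = join[OF PrD(1)[OF JQ(1)] PrD(1)[OF Qw(1)]]
  have "\<tau> ?Q < ennreal (i/2)"
   by(rule small_join[OF JQ(1) Qw(1)]) (use tQT Qw(2) s(2) e in "auto intro: le_less_trans")
  hence "\<tau> ?Q < ennreal i" by(rule less_trans) (use e in "simp add: ennreal_less_iff")
  moreover have "norm (u - ?Q u) <= (s + 2) * norm v" if h: "(v, u) : y" for v u
  proof -
   obtain g where z: "!!k. (v, g k) : w k" "g ----> u" using h by(auto simp: y_def)
   have le: "norm (l - ?Q l) <= norm (l - T l)" if "T : Pr" "!!v. ?Q v = 0 ==> T v = 0" for T l
   proof -
    have "?Q (T l) = T l" by(rule Pr_le_apply(2)[OF that(1) J(1) that(2)])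
    hence "l - ?Q l = (id_blinfun - ?Q) (l - T l)" by(simp add: blin_simps)
    thus ?thesis using norm_orth_projection_le[OF PrD(2)[OF Pr_compl[OF J(1)]]] by simp
   qed
   \<comment> \<open>Residues of the approximants; their increments are controlled by the left
     tails, so the estimate survives the limit.\<close>
   define n where "n k = g k - ?Q (g k)" for k
   have inc: "norm (n (Suc k) - n k) <= (1/2) ^ k * norm v" if k: "m <= k" for k
   proof -
    have "(v, g (Suc k) - g k) : D k" unfolding D_def by(intro strong_diffI z)
    note d = Q(3)[OF this]
    have "Q (m + (k - m)) l = 0" if "?Q l = 0" for l using that JQ(2)[of l] by(simp add: J(2))
    hence Qk: "?Q l = 0 ==> Q k l = 0" for l using k by simp
    have "n (Suc k) - n k = (g (Suc k) - g k) - ?Q (g (Suc k) - g k)"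
     by(simp add: n_def blin_simps)
    also have "norm ... <= norm ((g (Suc k) - g k) - Q k (g (Suc k) - g k))" by(rule le[OF Q(1) Qk])
    finally show ?thesis using d by linarith
   qed
   have lim: "n ----> u - ?Q u" unfolding n_def by(intro tendsto_intros z)
   have "norm ((u - ?Q u) - n m) <= 2 * (1/2) ^ m * norm v"
    by(rule geometric_increments(2)[of m n "norm v", OF inc _ order_refl lim]) auto
   also have "... <= 2 * 1 * norm v" by(intro mult_right_mono mult_left_mono power_le_one) auto
   finally have a: "norm ((u - ?Q u) - n m) <= 2 * norm v" by simp
   have "norm (n m) <= norm (g m - Qw (g m))" unfolding n_def by(rule le[OF Qw(1)]) (simp add: J(2))
   also have "... <= s * norm v" by(rule Qw(3)[OF z(1)])
   finally show ?thesis using a norm_triangle_ineq[of "(u - ?Q u) - n m" "n m"] by(simp add: distrib_right)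
  qed
  ultimately show "EX Q:Pr. \<tau> Q < ennreal i & (EX K. ALL v u. (v, u) : y --> norm (u - Q u) <= K * norm v)"
   using J(1) by blast
 qed
 show ?thesis
 proof (rule that[OF MO])
  fix k
  show "lam (strong_diff (closure y) (w k)) (2 * (1/2) ^ k) <= ennreal (2 * (1/2) ^ k)"
  proof (rule ennreal_le_epsilon)
   fix e :: real assume e: "0 < e"
   obtain R where R: "R : Pr" "\<tau> R < ennreal e" "!!v. R v = 0 ==> ALL k. v : Domain (w k)" using dom[OF e] by blast
   note J = join[OF PrD(1)[OF PT(1)[of k]] PrD(1)[OF R(1)]]
   have "lam (strong_diff (closure y) (w k)) (2 * (1/2) ^ k) <= \<tau> (join (PT k) R)"
   proof (rule lam_le[OF strong_diff_MO[OF MO w] J(1)])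
    fix v assume z: "join (PT k) R v = 0"
    hence z': "PT k v = 0" "R v = 0" by(simp_all add: J(2))
    obtain g u where ze: "!!k. (v, g k) : w k" "g ----> u" "norm (u - g k) <= 2 * (1/2) ^ k * norm v"
     using seq[OF z'(1) R(3)[OF z'(2)]] by blast
    have "(v, u) : closure y" using yI[OF ze(1,2)] closure_subset by blast
    hence "(v, u - g k) : strong_diff (closure y) (w k)" by(intro strong_diffI ze)
    thus "EX u. (v, u) : strong_diff (closure y) (w k) & norm u <= 2 * (1/2) ^ k * norm v" using ze(3) by blast
   qed simp
   also have "... <= \<tau> (PT k) + \<tau> R" by(rule trace_join[OF PT(1) R(1)])
   also have "... <= ennreal (2 * (1/2) ^ k) + ennreal e" by(intro add_mono PTt less_imp_le R)
   finally show "lam (strong_diff (closure y) (w k)) (2 * (1/2) ^ k) <= ennreal (2 * (1/2) ^ k) + ennreal e" .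
  qed
 qed
qed

text \<open>A subsequence is fast in measure, which gives z. Fatou's lemma then transfers the Cauchy
  bound to z; the limit is compared with the distribution functions at half the level, which costs
  2^p.\<close>

lemma Phi_complete:
 fixes y :: "nat => 'h uop"
 assumes y: "!!n. y n : MO"
  and cauchy: "!!v. 0 < v ==> EX N. ALL m>=N. ALL n>=N. Phi (strong_diff (y m) (y n)) <= ennreal v"
 obtains z where "z : MO" "!!v. 0 < v ==> EX N. ALL n>=N. Phi (strong_diff z (y n)) <= ennreal v"
proof -
 have "EX N. ALL m>=N. ALL n>=N. lam (strong_diff (y m) (y n)) ((1/2) ^ k) <= ennreal ((1/2) ^ k)" for k
 proof -
  define s where "s = (1/2::real) ^ k"
  have s: "0 < s" by(simp add: s_def)
  obtain N where N: "ALL m>=N. ALL n>=N. Phi (strong_diff (y m) (y n)) <= ennreal (s powr p * s)"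
   using cauchy[of "s powr p * s"] s by auto
  have "lam (strong_diff (y m) (y n)) s <= ennreal s" if "m >= N" "n >= N" for m n
  proof -
   have "ennreal (s powr p) * lam (strong_diff (y m) (y n)) s <= Phi (strong_diff (y m) (y n))"
    by(rule Phi_ge[OF strong_diff_MO[OF y y] s])
   also have "... <= ennreal (s powr p) * ennreal s" using N that s by(simp add: ennreal_mult[symmetric])
   finally show ?thesis using s by(subst (asm) ennreal_mult_le_mult_iff) auto
  qed
  thus ?thesis unfolding s_def by blast
 qed
 then obtain N :: "nat => nat" where N: "!!k m n. m >= N k ==> n >= N k ==> lam (strong_diff (y m) (y n)) ((1/2) ^ k) <= ennreal ((1/2) ^ k)"
  by(metis (no_types))
 \<comment> \<open>r k dominates N i for all i <= k, so r k and r (Suc k) both pass N k.\<close>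
 define r where "r k = (MAX i\<in>{..k}. N i) + k" for k
 have rk: "r k >= k" for k by(simp add: r_def)
 have rN: "r k >= N i" if "i <= k" for i k using Max_ge[of "N ` {..k}" "N i"] that by(simp add: r_def trans_le_add1)
 obtain z where z: "z : MO" "!!k. lam (strong_diff z (y (r k))) (2 * (1/2) ^ k) <= ennreal (2 * (1/2) ^ k)"
  by(rule measure_complete[of "%k. y (r k)"]) (use y N[OF rN rN] in auto)
 have lim: "EX K. ALL k>=K. lam (strong_diff z (y (r k))) s <= ennreal e" if s: "0 < s" and e: "0 < e" for s e
 proof -
  obtain K where K: "(1/2::real) ^ K < min s e / 2" using real_arch_pow_inv[of "min s e / 2" "1/2"] s e by auto
  have "lam (strong_diff z (y (r k))) s <= ennreal e" if "k >= K" for k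
  proof -
   have "(1/2::real) ^ k <= (1/2) ^ K" using that by(intro power_decreasing) auto
   hence "2 * (1/2::real) ^ k <= s" "2 * (1/2::real) ^ k <= e" using K by linarith+
   hence "lam (strong_diff z (y (r k))) s <= lam (strong_diff z (y (r k))) (2 * (1/2) ^ k)"
    "ennreal (2 * (1/2) ^ k) <= ennreal e" by(simp_all add: lam_antimono strong_diff_MO z y ennreal_leI)
   thus ?thesis using z(2)[of k] by(meson order_trans)
  qed
  thus ?thesis by blast
 qed
 show ?thesis
 proof (rule that[OF z(1)])
  fix v :: real assume e: "0 < v"
  \<comment> \<open>Division by 2^p offsets the dilation by 1/2 in h.\<close>
  hence "0 < v / 2 powr p" by simp
  from cauchy[OF this] obtain N0 where N0: "!!m n. m >= N0 ==> n >= N0 ==> Phi (strong_diff (y m) (y n)) <= ennreal (v / 2 powr p)" by blast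
  have "Phi (strong_diff z (y n)) <= ennreal v" if n: "n >= N0" for n
  proof -
   define h where "h k u = indicator {0<..} u * lam (strong_diff (y (r k)) (y n)) (1/2 * u powr (1 / p))" for k and u :: real
   have hm: "h k : borel_measurable lborel" for k
    unfolding h_def using lay_measurable[OF p_pos decreasing_lam[OF strong_diff_MO[OF y y]], of "1/2"] by simp
   have hL: "(\<integral>\<^sup>+ u. h k u \<partial>lborel) = ennreal (2 powr p) * Phi (strong_diff (y (r k)) (y n))" for k
   proof -
    have "(\<integral>\<^sup>+ u. h k u \<partial>lborel) = L (%s. lam (strong_diff (y (r k)) (y n)) (1/2 * s))"
     by(simp add: h_def lay_def[OF p_pos])
    also have "... = ennreal ((1/2) powr (- p)) * Phi (strong_diff (y (r k)) (y n))"
     unfolding Phi_def by(rule lay_dilate[OF p_pos decreasing_lam[OF strong_diff_MO[OF y y]]]) simp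
    finally show ?thesis by(simp add: powr_minus powr_divide)
   qed
   have le: "lam (strong_diff z (y n)) s <= liminf (%k. lam (strong_diff (y (r k)) (y n)) (1/2 * s))" if s: "0 < s" for s
   proof (rule ennreal_le_epsilon)
    fix e :: real assume e: "0 < e"
    obtain K where K: "!!k. k >= K ==> lam (strong_diff z (y (r k))) (1/2 * s) <= ennreal e" using lim[of "1/2 * s" e] s e by auto
    have ev: "lam (strong_diff z (y n)) s <= lam (strong_diff (y (r k)) (y n)) (1/2 * s) + ennreal e" if "k >= K" for k
    proof -
     have "strong_add (strong_diff z (y (r k))) (strong_diff (y (r k)) (y n)) = strong_diff z (y n)"
      by(rule strong_diff_trans[OF z(1) y y])
     hence "lam (strong_diff z (y n)) (1/2 * s + 1/2 * s) <= lam (strong_diff z (y (r k))) (1/2 * s) + lam (strong_diff (y (r k)) (y n)) (1/2 * s)"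
      using lam_add[OF strong_diff_MO[OF z(1) y] strong_diff_MO[OF y y], of "1/2 * s" "1/2 * s" "r k" "r k" n] s by simp
     also have "... <= ennreal e + lam (strong_diff (y (r k)) (y n)) (1/2 * s)" by(intro add_right_mono K that)
     finally show ?thesis by(simp add: add.commute)
    qed
    show "lam (strong_diff z (y n)) s <= liminf (%k. lam (strong_diff (y (r k)) (y n)) (1/2 * s)) + ennreal e"
    proof (rule ccontr)
     assume "\<not> ?thesis"
     hence lt: "liminf (%k. lam (strong_diff (y (r k)) (y n)) (1/2 * s)) + ennreal e < lam (strong_diff z (y n)) s" by simp
     have "lam (strong_diff z (y n)) s - ennreal e <= liminf (%k. lam (strong_diff (y (r k)) (y n)) (1/2 * s))"
     proof (rule Liminf_bounded)
      show "\<forall>\<^sub>F k in sequentially. lam (strong_diff z (y n)) s - ennreal e <= lam (strong_diff (y (r k)) (y n)) (1/2 * s)"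
       using ev by(auto simp: eventually_sequentially ennreal_minus_le_iff add.commute)
     qed
     hence "lam (strong_diff z (y n)) s <= liminf (%k. lam (strong_diff (y (r k)) (y n)) (1/2 * s)) + ennreal e"
      by(simp add: ennreal_minus_le_iff add.commute)
     thus False using lt by simp
    qed
   qed
   have "Phi (strong_diff z (y n)) <= (\<integral>\<^sup>+ u. liminf (%k. h k u) \<partial>lborel)"
    unfolding Phi_def lay_def[OF p_pos]
   proof (rule nn_integral_mono)
    fix u :: real
    show "indicator {0<..} u * lam (strong_diff z (y n)) (u powr (1 / p)) <= liminf (%k. h k u)"
     by(cases "0 < u") (use le[of "u powr (1 / p)"] in "auto simp: h_def")
   qed
   also have "... <= liminf (%k. \<integral>\<^sup>+ u. h k u \<partial>lborel)" by(rule nn_integral_liminf[OF hm])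
   also have "... <= limsup (%k. \<integral>\<^sup>+ u. h k u \<partial>lborel)" by(rule Liminf_le_Limsup) simp
   also have "... <= ennreal v"
   proof (rule Limsup_bounded)
    have "(\<integral>\<^sup>+ u. h k u \<partial>lborel) <= ennreal v" if "k >= N0" for k
    proof -
     have "(\<integral>\<^sup>+ u. h k u \<partial>lborel) <= ennreal (2 powr p) * ennreal (v / 2 powr p)"
      unfolding hL using rk[of k] that n by(intro mult_left_mono N0) auto
     also have "... = ennreal v" using e by(simp add: ennreal_mult[symmetric])
     finally show ?thesis .
    qed
    thus "\<forall>\<^sub>F k in sequentially. (\<integral>\<^sup>+ u. h k u \<partial>lborel) <= ennreal v" by(auto simp: eventually_sequentially)
   qed
   finally show ?thesis .
  qed
  thus "EX N. ALL n>=N. Phi (strong_diff z (y n)) <= ennreal v" by blast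
 qed
qed

end

section \<open>Disjoint bounded operators\<close>

context lp_vna
begin

text \<open>The images of the tail part of v and of the rest are orthogonal and sum to 0, so both
  vanish; strictness on the tail then forces the tail part to be 0.\<close>

lemma tail_kernel:
 assumes x: "x : MO" and s: "0 <= s" and z: "(v, 0) : x"
 shows "tail x s v = 0"
proof -
 interpret cdd_op x by(rule MO_cdd[OF x])
 obtain u where u: "v = opC u" "0 = opZ u" using z x_iff by blast
 have "inner (opZ (tail x s u)) (opZ (u - tail x s u)) = 0" by(rule Z_orth)
 moreover have "opZ (u - tail x s u) = - opZ (tail x s u)" using u(2) by(simp add: blin_simps)
 ultimately have "opZ (tail x s u) = 0" by simp
 hence "(tail x s v, 0) : x" unfolding u(1) tail_C x_iff by metis
 thus ?thesis using s tail_strict[of "tail x s v" 0 s] by(simp add: PrD(3)[OF tail_Pr[OF x]])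
qed

lemma tail_graph_kernel: "A : M ==> 0 <= s ==> A v = 0 ==> tail (graph_of A) s v = 0"
 by(rule tail_kernel[OF graph_of_MO]) simp_all

lemma rproj_orthogonal:
 assumes A: "A : M" and B: "B : M" and r: "!!v. A (radj B v) = 0"
 shows "rproj A (rproj B v) = 0"
proof -
 note b = rproj[OF B]
 have "B (radj A w) = 0" for w
 proof -
  have "inner (B (radj A w)) u = 0" for u
   using radj[of B "radj A w" u] radj'[of w A "radj B u"] r by simp
  thus ?thesis by(rule inner_eq_zero_iff[THEN iffD1])
 qed
 hence "inner (A (rproj B v)) w = 0" for w
  using radj[of A "rproj B v" w] Pr_symm[OF b(1), of v "radj A w"] by(simp add: b(2)[THEN iffD2])
 hence "A (rproj B v) = 0" by(rule inner_eq_zero_iff[THEN iffD1])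
 thus ?thesis by(simp add: rproj_zero_iff[OF A])
qed

text \<open>Orthogonal right supports make e and f orthogonal, and orthogonal ranges make |(A + B)
  v|^2 split. So e + f bounds the tail of A + B by minimality, and a vector in its range killed by
  that tail is 0; the traces agree by these two comparisons.\<close>

lemma lam_disjoint:
 assumes A: "A : M" and B: "B : M" and l: "!!\<xi>. radj B (A \<xi>) = 0" and r: "!!\<xi>. A (radj B \<xi>) = 0" and s: "0 <= s"
 shows "lam (graph_of (A + B)) s = lam (graph_of A) s + lam (graph_of B) s"
proof -
 note AB = add_M[OF A B]
 define e f g where "e = tail (graph_of A) s" and "f = tail (graph_of B) s" and "g = tail (graph_of (A + B)) s"
 have e: "e : Pr" and f: "f : Pr" and g: "g : Pr" by(simp_all add: e_def f_def g_def tail_Pr graph_of_MO A B AB)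
 have orth: "inner (A \<xi>) (B u) = 0" for \<xi> u using radj'[of "A \<xi>" B u] l by simp
 have ekill: "e \<xi> = 0" if "A \<xi> = 0" for \<xi> unfolding e_def by(rule tail_graph_kernel[OF A s that])
 have fkill: "f \<xi> = 0" if "B \<xi> = 0" for \<xi> unfolding f_def by(rule tail_graph_kernel[OF B s that])
 define a b where "a = rproj A" and "b = rproj B"
 note a = rproj[OF A, folded a_def] and b = rproj[OF B, folded b_def]
 have ab: "a (b \<xi>) = 0" for \<xi> unfolding a_def b_def by(rule rproj_orthogonal[OF A B r])
 note sab = projection_sum_orthogonal[OF PrD(2)[OF a(1)] PrD(2)[OF b(1)] ab]
 have ea: "e (a \<xi>) = e \<xi>" "a (e \<xi>) = e \<xi>" for \<xi> using Pr_le_apply[OF e a(1)] a(2) ekill by auto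
 have fb: "f (b \<xi>) = f \<xi>" "b (f \<xi>) = f \<xi>" for \<xi> using Pr_le_apply[OF f b(1)] b(2) fkill by auto
 have Af: "A (f \<xi>) = 0" for \<xi> using ab[of "f \<xi>"] a(2) fb(2) by simp
 have Be: "B (e \<xi>) = 0" for \<xi> using sab(2)[of "e \<xi>"] b(2) ea(2) by simp
 have ef: "e (f \<xi>) = 0" for \<xi> by(rule ekill[OF Af])
 note sum = projection_sum_orthogonal[OF PrD(2)[OF e] PrD(2)[OF f] ef]
 have P: "e + f : Pr" using sum(1) add_M[OF PrD(1)[OF e] PrD(1)[OF f]] by(simp add: Pr_def)
 have "\<tau> (e + f) = \<tau> e + \<tau> f" by(rule trace_add) (use e f in "simp_all add: PrD Pr_psd")
 moreover have "\<tau> g <= \<tau> (e + f)"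
  unfolding g_def lam_def[symmetric]
 proof (rule lam_le[OF graph_of_MO[OF AB] P s])
  fix \<xi> assume z: "(e + f) \<xi> = 0"
  have "e ((e + f) \<xi>) = e \<xi>" by(simp add: blin_simps ef PrD(3)[OF e])
  hence ez: "e \<xi> = 0" using z by(simp)
  hence fz: "f \<xi> = 0" using z by(simp add: blinfun.add_left)
  have "norm (A (a \<xi>)) <= s * norm (a \<xi>)"
   using tail_good[OF graph_of_MO[OF A], of s "a \<xi>", folded e_def] ea(1) ez by auto
  moreover have "norm (B (b \<xi>)) <= s * norm (b \<xi>)"
   using tail_good[OF graph_of_MO[OF B], of s "b \<xi>", folded f_def] fb(1) fz by auto
  ultimately have "(norm (A \<xi>))^2 + (norm (B \<xi>))^2 <= (s * norm (a \<xi>))^2 + (s * norm (b \<xi>))^2"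
   by(intro add_mono power_mono) (simp_all add: a(3) b(3))
  also have "... = s^2 * (norm (a \<xi> + b \<xi>))^2" by(simp add: sab(3) power_mult_distrib distrib_left)
  also have "... <= s^2 * (norm \<xi>)^2"
   using norm_orth_projection_le[OF sab(1), of \<xi>] by(intro mult_left_mono power_mono) (simp_all add: blinfun.add_left)
  also have "(norm (A \<xi>))^2 + (norm (B \<xi>))^2 = (norm ((A + B) \<xi>))^2"
   using orth[of \<xi> \<xi>] by(simp add: blinfun.add_left power2_norm_eq_inner inner_add inner_commute)
  finally have "norm ((A + B) \<xi>) <= s * norm \<xi>" using s by(simp flip: power_mult_distrib add: power2_le_iff_abs_le)
  thus "EX u. (\<xi>, u) : graph_of (A + B) & norm u <= s * norm \<xi>" by simp
 qed
 moreover have "\<tau> (e + f) <= \<tau> g"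
 proof (rule trace_le_of_disjoint[OF P g])
  fix \<xi> assume fx: "(e + f) \<xi> = \<xi>" and z: "g \<xi> = 0"
  have \<xi>: "\<xi> = e \<xi> + f \<xi>" using fx by(simp add: blinfun.add_left)
  have A\<xi>: "A \<xi> = A (e \<xi>)" by(subst \<xi>) (simp add: blinfun.add_right Af)
  have B\<xi>: "B \<xi> = B (f \<xi>)" by(subst \<xi>) (simp add: blinfun.add_right Be)
  have "norm ((A + B) \<xi>) <= s * norm \<xi>"
   using tail_good[OF graph_of_MO[OF AB], of s \<xi>, folded g_def] z by auto
  hence "(norm ((A + B) \<xi>))^2 <= (s * norm \<xi>)^2" by(rule power_mono) simp
  also have "(norm ((A + B) \<xi>))^2 = (norm (A (e \<xi>)))^2 + (norm (B (f \<xi>)))^2"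
   using orth[of "e \<xi>" "f \<xi>"] by(simp add: blinfun.add_left A\<xi> B\<xi> power2_norm_eq_inner inner_add inner_commute)
  also have "(s * norm \<xi>)^2 = (s * norm (e \<xi>))^2 + (s * norm (f \<xi>))^2"
   using sum(3)[of \<xi>] \<xi> by(simp add: power_mult_distrib distrib_left)
  finally have le: "(norm (A (e \<xi>)))^2 + (norm (B (f \<xi>)))^2 <= (s * norm (e \<xi>))^2 + (s * norm (f \<xi>))^2" .
  have es: "norm (A (e \<xi>)) <= s * norm (e \<xi>) ==> e \<xi> = 0"
   using cdd_op.tail_strict[OF MO_cdd[OF graph_of_MO[OF A]], of "e \<xi>" "A (e \<xi>)" s, folded e_def] s
   by(simp add: PrD(3)[OF e])
  have fs: "norm (B (f \<xi>)) <= s * norm (f \<xi>) ==> f \<xi> = 0"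
   using cdd_op.tail_strict[OF MO_cdd[OF graph_of_MO[OF B]], of "f \<xi>" "B (f \<xi>)" s, folded f_def] s
   by(simp add: PrD(3)[OF f])
  have lt: "(s * norm v)^2 < (norm w)^2" if "\<not> norm w <= s * norm v" for v w :: 'h
   using that s by(intro power_strict_mono) auto
  show "\<xi> = 0"
  proof (rule ccontr)
   assume "\<xi> ~= 0"
   hence "e \<xi> ~= 0 \<or> f \<xi> ~= 0" using \<xi> by auto
   thus False
   proof
    assume "e \<xi> ~= 0"
    hence A1: "(s * norm (e \<xi>))^2 < (norm (A (e \<xi>)))^2" using es lt by blast
    have "norm (B (f \<xi>)) <= s * norm (f \<xi>)" by(rule ccontr) (use lt[of "B (f \<xi>)" "f \<xi>"] le A1 in linarith)
    hence "f \<xi> = 0" by(rule fs)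
    thus False using le A1 by(simp)
   next
    assume "f \<xi> ~= 0"
    hence B1: "(s * norm (f \<xi>))^2 < (norm (B (f \<xi>)))^2" using fs lt by blast
    have "norm (A (e \<xi>)) <= s * norm (e \<xi>)" by(rule ccontr) (use lt[of "A (e \<xi>)" "e \<xi>"] le B1 in linarith)
    hence "e \<xi> = 0" by(rule es)
    thus False using le B1 by(simp)
   qed
  qed
 qed
 ultimately show ?thesis by(simp add: lam_def e_def f_def g_def)
qed

lemma Phi_disjoint:
 assumes A: "A : M" and B: "B : M" and l: "!!v. radj B (A v) = 0" and r: "!!v. A (radj B v) = 0"
 shows "Phi (graph_of (A + B)) = Phi (graph_of A) + Phi (graph_of B)"
proof -
 have "Phi (graph_of (A + B)) = L (%s. lam (graph_of A) s + lam (graph_of B) s)"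
  unfolding Phi_def by(intro antisym lay_mono[OF p_pos]) (simp_all add: lam_disjoint[OF A B l r])
 thus ?thesis
  unfolding Phi_def using lay_add[OF p_pos decreasing_lam decreasing_lam] graph_of_MO A B by simp
qed

definition csum :: "(nat => complex) => (nat => 'h bop) => nat => 'h bop" where
 "csum a W n = (\<Sum>k<n. scaleC_op (a k) oL W k)"

lemma csum_M: "(!!k. W k : M) ==> csum a W n : M"
 by(induction n) (simp_all add: csum_def add_M scaleC_compose_M)

lemma Phi_csum:
 assumes W: "!!k. W k : M" and l: "!!j k v. j ~= k ==> radj (W j) (W k v) = 0"
  and r: "!!j k v. j ~= k ==> W j (radj (W k) v) = 0"
 shows "Phi (graph_of (csum a W n)) = (\<Sum>k<n. ennreal (cmod (a k) powr p) * Phi (graph_of (W k)))"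
proof (induction n)
 case 0 thus ?case using Phi_zero by(simp add: csum_def zero_op)
next
 case (Suc n)
 let ?B = "scaleC_op (a n) oL W n"
 have comm: "A (c *\<^sub>C v) = c *\<^sub>C A v" if "A : M" for A :: "'h bop" and c v
  using commutesD[OF M'_commutes[OF scaleC_M[of c] that], of v] by simp
 have rB: "radj ?B v = radj (W n) (radj (scaleC_op (a n)) v)" for v by(simp add: radj_compose)
 have "Phi (graph_of (csum a W n + ?B)) = Phi (graph_of (csum a W n)) + Phi (graph_of ?B)"
 proof (rule Phi_disjoint[OF csum_M[OF W] scaleC_compose_M[OF W]])
  fix v
  have "radj (W n) (radj (scaleC_op (a n)) (csum a W n v)) = radj (scaleC_op (a n)) (radj (W n) (csum a W n v))"
   using commutesD[OF M'_commutes[OF radj_M'[OF scaleC_M[of "a n"]] radj_M[OF W[of n]]], of "csum a W n v"] by simp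
  also have "radj (W n) (csum a W n v) = (\<Sum>k<n. a k *\<^sub>C radj (W n) (W k v))"
   by(simp add: csum_def blinfun.sum_left blinfun.sum_right comm[OF radj_M[OF W]])
  also have "... = 0" by(intro sum.neutral ballI) (use l[of n] scaleC_op_apply[of _ 0] in "auto simp:")
  finally show "radj ?B (csum a W n v) = 0" by(simp add: rB)
  have "csum a W n (radj (W n) w) = (\<Sum>k<n. a k *\<^sub>C W k (radj (W n) w))" for w
   by(simp add: csum_def blinfun.sum_left)
  also have "... w = 0" for w by(intro sum.neutral ballI) (use r[of _ n] scaleC_op_apply[of _ 0] in "auto simp:")
  finally show "csum a W n (radj ?B v) = 0" by(simp add: rB)
 qed
 thus ?case
  using Suc by(simp add: csum_def graph_of_scale[OF W, symmetric] Phi_scale[OF graph_of_MO[OF W]])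
qed


section \<open>Bounded truncations\<close>

lemma truncation_exists:
 assumes x: "x : MO" and b: "0 <= b"
 obtains A where "A : M" "!!v. (v - tail x b v, A v) : x" "!!v. norm (A v) <= b * norm v"
proof -
 define e where "e = tail x b"
 have e: "e : Pr" unfolding e_def by(rule tail_Pr[OF x])
 have "ALL v. EX w. (v - e v, w) : x & norm w <= b * norm (v - e v)"
 proof
  fix v
  have "e (v - e v) = 0" by(simp add: blin_simps PrD(3)[OF e])
  thus "EX w. (v - e v, w) : x & norm w <= b * norm (v - e v)"
   unfolding e_def by(rule tail_good[OF x]) blast
 qed
 from choice[OF this] obtain f where f: "!!v. (v - e v, f v) : x" "!!v. norm (f v) <= b * norm (v - e v)" by blast
 have fb: "norm (f v) <= b * norm v" for v
  using f(2)[of v] norm_orth_projection_le[OF orth_projection_compl[OF PrD(2)[OF e]], of v] b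
  by(auto simp: blinfun.diff_left intro: order_trans mult_left_mono)
 have "bounded_linear f"
 proof (rule bounded_linear_intro)
  fix v w :: 'h and c :: real
  show "f (v + w) = f v + f w"
   using subspace_add[OF MO_subspace[OF x] f(1)[of v] f(1)[of w]] f(1)[of "v + w"] MO_single[OF x]
   by(simp add: blin_simps algebra_simps)
  show "f (c *\<^sub>R v) = c *\<^sub>R f v"
   using subspace_scale[OF MO_subspace[OF x] f(1)[of v], of c] f(1)[of "c *\<^sub>R v"] MO_single[OF x]
   by(simp add: blin_simps algebra_simps)
  show "norm (f v) <= norm v * b" using fb[of v] by(simp add: mult.commute)
 qed
 hence F: "blinfun_apply (Blinfun f) = f" by(rule bounded_linear_Blinfun_apply)
 have "Blinfun f : M"
 proof (rule M_I)
  fix U assume U: "U : M'"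
  have "f (U v) = U (f v)" for v
  proof -
   have "(U (v - e v), U (f v)) : x" by(rule MO_invariant[OF x U f(1)])
   moreover have "U (v - e v) = U v - e (U v)"
    using commutesD[OF M'_commutes[OF U PrD(1)[OF e]], of v] by(simp add: blinfun.diff_right)
   ultimately show ?thesis using f(1)[of "U v"] MO_single[OF x] by simp
  qed
  thus "commutes U (Blinfun f)" by(auto simp: commutes_def F blinfun_eqI)
 qed
 thus ?thesis using that[of "Blinfun f"] f(1) fb by(simp add: F e_def)
qed

text \<open>Y is z on the spectral interval (s, N], with support of small trace when
  \<open>lam z s\<close> is small; Z is z on (u, s], with small norm. What remains of z lives on
  [0, u] and (N, \<infinity>).\<close>

lemma truncation_bounds:
 assumes z: "z : MO" and d: "0 < u" "u < s" "s < N"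
 obtains Y Z where "Y : M" "Z : M" "!!v. norm (Y v) <= N * norm v" "!!v. norm (Z v) <= s * norm v"
  "\<tau> (rproj Y) <= lam z s" "\<tau> (rproj Z) <= lam z u"
  "!!t. 0 < t ==> lam (strong_diff z (graph_of (Y + Z))) t <= lam z t"
  "!!t. u <= t ==> lam (strong_diff z (graph_of (Y + Z))) t <= lam z N"
proof -
 have N0: "0 <= N" using d by simp
 obtain A where A: "A : M" "!!v. (v - tail z N v, A v) : z" "!!v. norm (A v) <= N * norm v"
  by(rule truncation_exists[OF z N0]) blast
 note t = tail_Pr[OF z] and mono = cdd_op.tail_mono[OF MO_cdd[OF z]]
 define G where "G = tail z u - tail z s"
 have kill: "tail z b v = 0" if "tail z a v = 0" "a <= b" for a b v
  using mono(1)[OF that(2), of v] that(1) by(simp)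
 have G: "G : Pr" unfolding G_def by(rule Pr_diff[OF t t]) (use kill d in force)
 define Y where "Y = A oL tail z s"
 define Z where "Z = A oL G"
 have YM: "Y : M" and ZM: "Z : M" by(simp_all add: Y_def Z_def compose_M A PrD(1)[OF t] PrD(1)[OF G])
 have W: "(Y + Z) v = A (tail z u v)" for v by(simp add: Y_def Z_def G_def blin_simps)
 have D: "strong_diff z (graph_of (Y + Z)) : MO" by(intro strong_diff_MO z graph_of_MO add_M YM ZM)
 have R: "tail z u - tail z N : Pr" by(rule Pr_diff[OF t t]) (use kill d in force)
 have sub: "EX y. (v, y) : strong_diff z (graph_of (Y + Z)) & norm y <= r * norm v"
  if h: "(v, w) : z" and r: "0 <= r" "tail z r (v - tail z u v + tail z N v) = 0" for v w r
 proof -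
  \<comment> \<open>The component of v outside the spectral interval (u, N]; z - Y - Z acts on v as
    z acts on c.\<close>
  define c where "c = v - tail z u v + tail z N v"
  have "(tail z u v - tail z N v, (Y + Z) v) : z" using A(2)[of "tail z u v"] mono(1)[of u N v] d by(simp add: W[unfolded blinfun.add_left] blinfun.add_left)
  from subspace_diff[OF MO_subspace[OF z] h this] have m: "(c, w - (Y + Z) v) : z" by(simp add: c_def algebra_simps)
  obtain y where "(c, y) : z" "norm y <= r * norm c" by(rule tail_good[OF z r(2)[folded c_def]])
  hence "norm (w - (Y + Z) v) <= r * norm c" using MO_single[OF z m] by blast
  also have "norm c <= norm v"
   using norm_orth_projection_le[OF orth_projection_compl[OF PrD(2)[OF R]], of v] by(simp add: c_def blin_simps algebra_simps)
  finally have "norm (w - (Y + Z) v) <= r * norm v" using r(1) by(simp add: mult_left_mono)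
  moreover have "(v, w - (Y + Z) v) : strong_diff z (graph_of (Y + Z))" by(rule strong_diffI[OF h]) simp
  ultimately show ?thesis by blast
 qed
 show ?thesis
 proof (rule that[OF YM ZM])
  fix v
  have "norm (Y v) <= N * norm (tail z s v)" using A(3) by(simp add: Y_def)
  also have "... <= N * norm v" by(intro mult_left_mono norm_orth_projection_le PrD(2)[OF t] N0)
  finally show "norm (Y v) <= N * norm v" .
  have s0: "tail z s (G v) = 0" using mono(1)[of u s v] d by(simp add: G_def blin_simps PrD(3)[OF t])
  hence N0: "tail z N (G v) = 0" by(rule kill) (use d in simp)
  obtain y where "(G v, y) : z" "norm y <= s * norm (G v)" by(rule tail_good[OF z s0])
  moreover have "(G v, Z v) : z" using A(2)[of "G v"] N0 by(simp add: Z_def)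
  ultimately have "norm (Z v) <= s * norm (G v)" using MO_single[OF z] by blast
  also have "... <= s * norm v" by(intro mult_left_mono norm_orth_projection_le PrD(2)[OF G]) (use d in simp)
  finally show "norm (Z v) <= s * norm v" .
 next
  show "\<tau> (rproj Y) <= lam z s" unfolding lam_def
   by(rule trace_mono[OF rproj_Pr[OF YM] t], unfold rproj_zero_iff[OF YM]) (simp add: Y_def)
  show "\<tau> (rproj Z) <= lam z u" unfolding lam_def
   by(rule trace_mono[OF rproj_Pr[OF ZM] t], unfold rproj_zero_iff[OF ZM])
    (use kill[of u _ s] d in "simp add: Z_def G_def blin_simps")
 next
  fix r :: real assume r: "0 < r"
  show "lam (strong_diff z (graph_of (Y + Z))) r <= lam z r"
   unfolding lam_def[of z]
  proof (rule lam_le[OF D t])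
   fix v assume z0: "tail z r v = 0"
   obtain w where h: "(v, w) : z" "norm w <= r * norm v" by(rule tail_good[OF z z0])
   have "tail z r (tail z u v) = 0"
   proof (cases "u <= r")
    case True thus ?thesis using mono(1)[of u r v] z0 by simp
   next
    case False thus ?thesis using kill[OF z0, of u] by(simp)
   qed
   moreover have "tail z r (tail z N v) = 0"
   proof (cases "N <= r")
    case True thus ?thesis using mono(1)[of N r v] z0 by simp
   next
    case False thus ?thesis using kill[OF z0, of N] by(simp)
   qed
   ultimately have "tail z r (v - tail z u v + tail z N v) = 0" using z0 by(simp add: blin_simps)
   thus "EX y. (v, y) : strong_diff z (graph_of (Y + Z)) & norm y <= r * norm v"
    using r by(intro sub[OF h(1)]) simp_all
  qed (use r in simp)
 next
  fix r :: real assume r: "u <= r"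
  show "lam (strong_diff z (graph_of (Y + Z))) r <= lam z N"
   unfolding lam_def[of z]
  proof (rule lam_le[OF D t])
   fix v assume z0: "tail z N v = 0"
   obtain w where h: "(v, w) : z" "norm w <= N * norm v" by(rule tail_good[OF z z0])
   have "tail z r (v - tail z u v) = 0"
    by(rule kill[OF _ r]) (simp add: blin_simps PrD(3)[OF t])
   thus "EX y. (v, y) : strong_diff z (graph_of (Y + Z)) & norm y <= r * norm v"
    using r d z0 by(intro sub[OF h(1)]) simp_all
  qed (use r d in simp)
 qed
qed

lemma lam_top:
 assumes x: "x : MO" and b: "!!n. real n <= b n"
 shows "(%n. lam x (b n)) ----> 0"
proof (rule order_tendstoI)
 fix a :: ennreal assume a: "0 < a"
 obtain e where e: "0 < e" "ennreal e <= a" using a by(cases a) (auto intro: that[of 1])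
 obtain r where r: "0 <= r" "lam x r < ennreal e" by(rule lam_small[OF x e(1)])
 obtain m where m: "r < real m" using reals_Archimedean2 by blast
 have "lam x (b n) < a" if "n >= m" for n
 proof -
  have "lam x (b n) <= lam x r" by(rule lam_antimono[OF x]) (use that m b[of n] in linarith)
  thus ?thesis using r(2) e(2) by(meson le_less_trans less_le_trans)
 qed
 thus "\<forall>\<^sub>F n in sequentially. lam x (b n) < a" by(auto simp: eventually_sequentially)
qed simp

text \<open>The lower cut tends to 0 and the upper one to \<infinity>, and the remainder vanishes in
  \<open>Phi\<close> by dominated convergence. Chebyshev's inequality at the lower cut makes the
  support of Z finite in trace.\<close>

lemma truncation:
 assumes z: "z : MO" "Phi z < \<infinity>" and s: "0 < s" and c: "0 < c"
 obtains Y Z N where "Y : M" "Z : M" "0 <= N" "!!v. norm (Y v) <= N * norm v" "!!v. norm (Z v) <= s * norm v"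
  "\<tau> (rproj Y) <= lam z s" "\<tau> (rproj Z) < \<infinity>" "Phi (strong_diff z (graph_of (Y + Z))) <= ennreal c"
proof -
 define d where "d n = s / real (n + 2)" for n
 define N where "N n = s + real (Suc n)" for n
 have dN: "0 < d n" "d n < s" "s < N n" for n
  using s by(simp_all add: d_def N_def pos_divide_less_eq)
 \<comment> \<open>Majorant of the distribution function of the remainder: the trivial bound below d
   n, the trace of the tail at N n from d n on.\<close>
 define g where "g n t = (if t < d n then lam z t else min (lam z t) (lam z (N n)))" for n t
 have dec: "decreasing (g n)" for n
  unfolding decreasing_def[OF p_pos]
 proof (intro allI impI)
  fix a b :: real assume "0 < a" "a <= b"
  hence "lam z b <= lam z a" by(intro lam_antimono z)
  thus "g n b <= g n a" using `a <= b` by(auto simp: g_def min.coboundedI1 min.coboundedI2 intro: order_trans)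
 qed
 have lamN: "(%n. lam z (N n)) ----> 0"
  by(rule lam_top[OF z(1)]) (use s in "simp add: N_def")
 have "(%n. \<integral>\<^sup>+ u. indicator {0<..} u * g n (u powr (1 / p)) \<partial>lborel) ----> (\<integral>\<^sup>+ u. (0::ennreal) \<partial>(lborel :: real measure))"
 proof (rule nn_integral_dominated_convergence[where w = "%u. indicator {0<..} u * lam z (u powr (1 / p))"])
  show "(%u. indicator {0<..} u * g n (u powr (1 / p))) : borel_measurable lborel" for n
   using lay_measurable1[OF p_pos dec] by simp
  show "(%u. indicator {0<..} u * lam z (u powr (1 / p))) : borel_measurable lborel"
   using lay_measurable1[OF p_pos decreasing_lam[OF z(1)]] by simp
  show "AE u in lborel. indicator {0<..} u * g n (u powr (1 / p)) <= indicator {0<..} u * lam z (u powr (1 / p))" for n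
   by(auto simp: g_def indicator_def)
  show "(\<integral>\<^sup>+ u. indicator {0<..} u * lam z (u powr (1 / p)) \<partial>lborel) < \<infinity>"
   using z(2) by(simp add: Phi_def lay_def[OF p_pos])
  have "(%n. g n t) ----> 0" if t: "0 < t" for t
  proof (rule tendsto_sandwich[OF _ _ tendsto_const lamN])
   obtain m where "s / t < real m" using reals_Archimedean2 by blast
   hence m: "s < real m * t" using t by(simp add: pos_divide_less_eq)
   have "g n t <= lam z (N n)" if "n >= m" for n
   proof -
    have "real m * t <= real (n + 2) * t" using that t by(intro mult_right_mono) auto
    hence "d n <= t" using m by(simp add: d_def pos_divide_le_eq mult.commute)
    thus ?thesis by(simp add: g_def)
   qed
   thus "\<forall>\<^sub>F n in sequentially. g n t <= lam z (N n)" by(auto simp: eventually_sequentially)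
  qed simp
  hence "(%n. indicator {0<..} u * g n (u powr (1 / p))) ----> 0" for u by(cases "0 < u") simp_all
  thus "AE u in lborel. (%n. indicator {0<..} u * g n (u powr (1 / p))) ----> 0" by simp
 qed simp
 hence "(%n. L (g n)) ----> 0" by(simp add: lay_def[OF p_pos])
 hence "\<forall>\<^sub>F n in sequentially. L (g n) < ennreal c" by(rule order_tendstoD) (use c in simp)
 then obtain n where n: "L (g n) < ennreal c" by(auto simp: eventually_sequentially)
 obtain Y Z where YZ: "Y : M" "Z : M" "!!v. norm (Y v) <= N n * norm v" "!!v. norm (Z v) <= s * norm v"
  "\<tau> (rproj Y) <= lam z s" "\<tau> (rproj Z) <= lam z (d n)"
  "!!t. 0 < t ==> lam (strong_diff z (graph_of (Y + Z))) t <= lam z t"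
  "!!t. d n <= t ==> lam (strong_diff z (graph_of (Y + Z))) t <= lam z (N n)"
  by(rule truncation_bounds[OF z(1) dN[of n]]) blast
 have "ennreal (d n powr p) * lam z (d n) < \<infinity>" using Phi_ge[OF z(1) dN(1)[of n]] z(2) by(rule le_less_trans)
 hence fin: "\<tau> (rproj Z) < \<infinity>" using YZ(6) dN(1)[of n] by(auto simp: ennreal_mult_less_top intro: le_less_trans)
 have "Phi (strong_diff z (graph_of (Y + Z))) <= L (g n)"
  unfolding Phi_def by(rule lay_mono[OF p_pos]) (use YZ(7,8) in "simp add: g_def")
 hence "Phi (strong_diff z (graph_of (Y + Z))) <= ennreal c" using n by simp
 thus ?thesis using that[OF YZ(1,2) _ YZ(3,4,5) fin] dN(3)[of n] s by simp
qed

end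

section \<open>A gliding hump\<close>

context lp_vna
begin

text \<open>\<open>later\<close> joins the supports of the large parts after k; \<open>cover\<close>
  joins those of all large parts and of the bounded parts before k. Large parts have small support,
  so earlier terms can afford to lose it. A bounded part has a tiny bound, so it can afford to lose
  a support of large but finite trace.\<close>

definition later :: "(nat => 'h bop) => nat => 'h bop" where
 "later e k = Join (%j. e (Suc k + j))"

primrec cover :: "(nat => 'h bop) => (nat => 'h bop) => nat => 'h bop" where
 "cover e F 0 = Join e"
| "cover e F (Suc k) = join (cover e F k) (F k)"

lemma
 assumes e: "!!k. e k : Pr"
 shows later_Pr: "later e k : Pr" and later_zero_iff: "later e k v = 0 \<longleftrightarrow> (ALL j>k. e j v = 0)"
proof -
 note J = Join[of "%j. e (Suc k + j)", OF PrD(1)[OF e]]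
 show "later e k : Pr" unfolding later_def by(rule J(1))
 have "(ALL j. e (Suc k + j) v = 0) \<longleftrightarrow> (ALL j>k. e j v = 0)"
  by(metis le_add1 less_eq_Suc_le nat_le_iff_add)
 thus "later e k v = 0 \<longleftrightarrow> (ALL j>k. e j v = 0)" unfolding later_def J(2) .
qed

lemma
 assumes e: "!!k. e k : Pr" and F: "!!k. F k : Pr"
 shows cover_Pr: "cover e F k : Pr"
  and cover_zero_iff: "cover e F k v = 0 \<longleftrightarrow> (ALL j. e j v = 0) & (ALL j<k. F j v = 0)"
proof (induction k)
 case 0
 note J = Join[of e, OF PrD(1)[OF e]]
 case 1 show ?case by(simp add: J(1))
 case 2 show ?case by(simp add: J(2))
next
 case (Suc k)
 note J = join[OF PrD(1)[OF Suc(1)] PrD(1)[OF F[of k]]]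
 case 1 show ?case by(simp add: J(1))
 case 2 show ?case using Suc(2) by(auto simp: J(2) less_Suc_eq)
qed

lemma hump_trace:
 assumes e: "!!k. e k : Pr" and F: "!!k. F k : Pr"
  and te: "!!k. \<tau> (e k) <= ennreal (h k)" and tF: "!!k. \<tau> (F k) <= ennreal (f k)"
  and h: "!!k. 0 <= h k" "!!k. h (Suc k) <= h k / 2" and f: "!!k. 0 <= f k"
 shows "\<tau> (later e k) <= ennreal (2 * h (Suc k))" "\<tau> (cover e F k) <= ennreal (2 * h 0 + (\<Sum>j<k. f j))"
proof -
 have hj: "h (k + j) <= h k * (1/2) ^ (0 + j)" for k j
 proof (induction j)
  case (Suc j)
  thus ?case using h(2)[of "k + j"] by simp
 qed simp
 have te': "\<tau> (e (k + j)) <= ennreal (h k * (1/2) ^ (0 + j))" for k j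
  using te[of "k + j"] ennreal_leI[OF hj] by(rule order_trans)
 show "\<tau> (later e k) <= ennreal (2 * h (Suc k))"
  using trace_Join_geometric[of "%j. e (Suc k + j)", OF e te' h(1)] by(simp add: later_def mult.commute)
 show "\<tau> (cover e F k) <= ennreal (2 * h 0 + (\<Sum>j<k. f j))"
 proof (induction k)
  case 0
  have "\<tau> (e j) <= ennreal (h 0 * (1/2) ^ (0 + j))" for j using te'[of 0 j] by simp
  from trace_Join_geometric[of e, OF e this h(1)] show ?case by(simp add: mult.commute)
 next
  case (Suc k)
  have "\<tau> (cover e F (Suc k)) <= \<tau> (cover e F k) + \<tau> (F k)" by(simp add: trace_join cover_Pr e F)
  also have "... <= ennreal (2 * h 0 + (\<Sum>j<k. f j)) + ennreal (f k)" by(intro add_mono Suc tF)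
  finally show ?case using h(1)[of 0] f by(simp add: ennreal_plus[symmetric] sum_nonneg add.assoc del: ennreal_plus)
 qed
qed

text \<open>For j < k the range of the adjoint of w k has two kinds of vectors: those from Y k are
  fixed by both projections subtracted in w j, and those off \<open>cover e F k\<close> are killed
  by Y j and Z j. The case k < j follows by adjoints. The factors C and D are left free so that the
  lemma serves both sides.\<close>

lemma hump_disjoint:
 assumes e: "!!k. e k : Pr" and F: "!!k. F k : Pr" and Y: "!!k. Y k : M" and Z: "!!k. Z k : M"
  and eY: "!!k u. e k u = 0 ==> Y k u = 0" and FZ: "!!k u. F k u = 0 ==> Z k u = 0"
  and w: "!!k. w k = (C k oL Y k oL (id_blinfun - later e k)) + (D k oL Z k oL (id_blinfun - cover e F k))"
  and jk: "j ~= k"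
 shows "w j (radj (w k) u) = 0"
proof -
 note A = later_Pr[of e, OF e] and A0 = later_zero_iff[of e, OF e] and B = cover_Pr[of e F, OF e F] and B0 = cover_zero_iff[of e F, OF e F]
 have wa: "w k v = C k (Y k (v - later e k v)) + D k (Z k (v - cover e F k v))" for k v
  by(simp add: w blin_simps)
 have rP: "radj (id_blinfun - P) = id_blinfun - P" if "P : Pr" for P
  using orth_projectionD(2)[OF PrD(2)[OF Pr_compl[OF that]]] symm_radj by blast
 have rw: "radj (w k) v = (radj (Y k) (radj (C k) v) - later e k (radj (Y k) (radj (C k) v)))
  + (radj (Z k) (radj (D k) v) - cover e F k (radj (Z k) (radj (D k) v)))" for k v
  by(simp add: w radj_add radj_compose rP A B blin_simps)
 have main: "w j (radj (w k) u) = 0" if jk: "j < k" for j k u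
 proof -
  have "w j (\<theta> - later e k \<theta>) = 0" if \<theta>: "\<theta> = radj (Y k) v" for \<theta> v
  proof -
   have "inner (e k \<theta>) y = inner \<theta> y" for y
   proof -
    have "Y k (y - e k y) = 0" by(rule eY) (simp add: blin_simps PrD(3)[OF e])
    hence "Y k (e k y) = Y k y" by(simp add: blin_simps)
    thus ?thesis unfolding \<theta> Pr_symm[OF e] radj'[symmetric] by simp
   qed
   hence e\<theta>: "e k \<theta> = \<theta>" by(metis vector_eq_rdot)
   have 1: "later e j \<theta> = \<theta>"
    using Pr_le_apply(2)[OF e[of k] A[of j], of \<theta>] A0[of j] jk e\<theta> by auto
   have 2: "later e j (later e k \<theta>) = later e k \<theta>"
    by(rule Pr_le_apply(2)[OF A A]) (use A0 jk in auto)
   have 3: "cover e F j \<theta> = \<theta>"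
    using Pr_le_apply(2)[OF e[of k] B[of j], of \<theta>] B0[of j] e\<theta> by auto
   have 4: "cover e F j (later e k \<theta>) = later e k \<theta>"
    by(rule Pr_le_apply(2)[OF A B]) (use A0 B0 in auto)
   show ?thesis by(simp add: wa blinfun.diff_right 1 2 3 4)
  qed
  moreover have "w j (\<theta> - cover e F k \<theta>) = 0" for \<theta>
  proof -
   have h: "cover e F k (\<theta> - cover e F k \<theta>) = 0" by(simp add: blin_simps PrD(3)[OF B])
   define g where "g = \<theta> - cover e F k \<theta>"
   have "ALL i. e i g = 0" "ALL i<k. F i g = 0" using h B0[of k g] by(auto simp: g_def)
   hence "later e j g = 0" "cover e F j g = 0" "Y j g = 0" "Z j g = 0"
    using A0[of j g] B0[of j g] jk eY FZ by auto
   thus ?thesis unfolding g_def[symmetric] wa by(simp)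
  qed
  ultimately show ?thesis unfolding rw by(simp add: blinfun.add_right)
 qed
 show ?thesis
 proof (cases "j < k")
  case True thus ?thesis by(rule main)
 next
  case False
  hence kj: "k < j" using jk by simp
  have "inner (w j (radj (w k) u)) v = 0" for v
   using radj[of "w j" "radj (w k) u" v] radj[of "w k" "radj (w j) v" u] main[OF kj, of v]
   by(simp add: inner_commute)
  thus ?thesis by(rule inner_eq_zero_iff[THEN iffD1])
 qed
qed

text \<open>The error is Y P + Q Y (1 - P): one piece with small right support, one with small left
  support, both bounded by b.\<close>

lemma Phi_cut:
 assumes Y: "Y : M" and b: "!!v. norm (Y v) <= b * norm v" "0 <= b" and P: "P : Pr" and Q: "Q : Pr"
  and t: "\<tau> P <= ennreal t" "\<tau> Q <= ennreal t" "b powr p * t <= c" "0 <= t"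
 shows "Phi (graph_of (Y - ((id_blinfun - Q) oL Y oL (id_blinfun - P)))) <= ennreal (2 powr p * (2 * c))"
proof -
 define U where "U = Y oL P"
 define V where "V = Q oL Y oL (id_blinfun - P)"
 have UM: "U : M" and VM: "V : M" by(simp_all add: U_def V_def compose_M Y PrD(1)[OF P] PrD(1)[OF Q] diff_M)
 have UV: "Y - ((id_blinfun - Q) oL Y oL (id_blinfun - P)) = U + V"
  by(rule blinfun_eqI) (simp add: U_def V_def blin_simps)
 have le: "ennreal (b powr p) * \<tau> R <= ennreal c" if "\<tau> R <= ennreal t" for R
 proof -
  have "ennreal (b powr p) * \<tau> R <= ennreal (b powr p) * ennreal t" by(intro mult_left_mono that) simp
  also have "... = ennreal (b powr p * t)" using t(4) by(simp add: ennreal_mult)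
  also have "... <= ennreal c" by(rule ennreal_leI[OF t(3)])
  finally show ?thesis .
 qed
 have nP: "norm (R v) <= norm v" if "R : Pr" for R v by(rule norm_orth_projection_le[OF PrD(2)[OF that]])
 have bb: "norm (Y w) <= b * norm v" if "norm w <= norm v" for w v
  using b(1)[of w] mult_left_mono[OF that b(2)] by linarith
 have "Phi (graph_of U) <= ennreal (b powr p) * \<tau> P"
 proof (rule Phi_bounded[OF UM _ b(2) P])
  show "norm (U v) <= b * norm v" for v unfolding U_def using bb[OF nP[OF P]] by simp
 qed (simp add: U_def)
 moreover have "Phi (graph_of V) <= ennreal (b powr p) * \<tau> Q"
 proof (rule Phi_bounded_left[OF VM _ b(2) Q])
  show "norm (V v) <= b * norm v" for v
   unfolding V_def using order_trans[OF nP[OF Q] bb[OF nP[OF Pr_compl[OF P]]]] by simp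
 qed (simp add: V_def PrD(3)[OF Q])
 ultimately have "Phi (graph_of U) + Phi (graph_of V) <= ennreal c + ennreal c"
  using le[OF t(1)] le[OF t(2)] by(intro add_mono) (auto intro: order_trans)
 moreover have "0 <= c" using t b(2) by(meson mult_nonneg_nonneg order_trans powr_ge_zero)
 ultimately have sum: "Phi (graph_of U) + Phi (graph_of V) <= ennreal (2 * c)" by(simp add: ennreal_plus[symmetric] del: ennreal_plus)
 have "Phi (graph_of (U + V)) <= ennreal (2 powr p) * (Phi (graph_of U) + Phi (graph_of V))"
  using Phi_add2[OF graph_of_MO[OF UM] graph_of_MO[OF VM]] by(simp add: graph_of_add UM VM)
 also have "... <= ennreal (2 powr p) * ennreal (2 * c)" by(intro mult_left_mono sum) simp
 also have "... = ennreal (2 powr p * (2 * c))" using `0 <= c` by(simp add: ennreal_mult)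
 finally show ?thesis by(simp only: UV)
qed

lemma hump_step:
 assumes X: "X \<subseteq> LP" and H: "!!s w. 0 < s ==> 0 < w ==> EX z:X. Phi z = 1 & lam z s <= ennreal w"
  and c: "0 < c" and u: "0 <= u" and h: "0 < h"
 shows "EX z Y Z N s. z : X & Phi z = 1 & Y : M & Z : M & 0 <= N & (ALL v. norm (Y v) <= N * norm v) &
  0 <= s & (ALL v. norm (Z v) <= s * norm v) & s powr p * (1 + u) <= c &
  \<tau> (rproj Y) <= ennreal h & \<tau> (rproj Z) < \<infinity> & Phi (strong_diff z (graph_of (Y + Z))) <= ennreal c"
proof -
 \<comment> \<open>Solves s^p (1 + u) = c, where u will be the trace used by earlier bounded
   parts.\<close>
 define s where "s = (c / (1 + u)) powr (1 / p)"
 have s: "0 < s" using c u by(simp add: s_def)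
 have sp: "s powr p * (1 + u) = c" using c u p_pos by(simp add: s_def powr_powr)
 obtain z where z: "z : X" "Phi z = 1" "lam z s <= ennreal h" using H[OF s h] by blast
 have "z : MO" using z(1) X LP_MO by blast
 moreover have "Phi z < \<infinity>" by(simp add: z(2))
 ultimately obtain Y Z N where "Y : M" "Z : M" "0 <= N" "!!v. norm (Y v) <= N * norm v" "!!v. norm (Z v) <= s * norm v"
  "\<tau> (rproj Y) <= lam z s" "\<tau> (rproj Z) < \<infinity>" "Phi (strong_diff z (graph_of (Y + Z))) <= ennreal c"
  by(rule truncation[OF _ _ s c]) blast
 moreover have "\<tau> (rproj Y) <= ennreal h" using `\<tau> (rproj Y) <= lam z s` z(3) by(rule order_trans)
 ultimately show ?thesis using z s sp by(intro exI[of _ z] exI[of _ Y] exI[of _ Z] exI[of _ N] exI[of _ s]) auto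
qed

lemma gliding_hump:
 assumes X: "X \<subseteq> LP" and H: "!!s u. 0 < s ==> 0 < u ==> EX z:X. Phi z = 1 & lam z s <= ennreal u"
  and g: "!!k. 0 < g k"
 obtains z :: "nat => 'h uop" and w :: "nat => 'h bop" where "!!k. z k : X" "!!k. Phi (z k) = 1" "!!k. w k : M"
  "!!j k v. j ~= k ==> radj (w j) (w k v) = 0" "!!j k v. j ~= k ==> w j (radj (w k) v) = 0"
  "!!k. Phi (strong_diff (z k) (graph_of (w k))) <= ennreal (g k)"
proof -
 \<comment> \<open>With a = 2^p the final estimate is (a + 6 a^3) c k: two quasi-triangle
   inequalities on top of the errors of the two cuts.\<close>
 define c where "c k = g k / (2 powr p + 6 * 2 powr p * 2 powr p * 2 powr p)" for k
 have den: "0 < 2 powr p + 6 * 2 powr p * 2 powr p * 2 powr p" by(intro add_pos_pos mult_pos_pos) auto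
 have c: "0 < c k" for k using g[of k] den by(simp add: c_def)
 define good where "good \<sigma> h c t \<longleftrightarrow> (case t of (z, Y, Z, N, s) => z : X & Phi z = 1 & Y : M & Z : M & 0 <= N & (ALL v. norm (Y v) <= N * norm v) &
  0 <= s & (ALL v. norm (Z v) <= s * norm v) & s powr p * (1 + \<sigma>) <= c &
  \<tau> (rproj Y) <= ennreal h & \<tau> (rproj Z) < \<infinity> & Phi (strong_diff z (graph_of (Y + Z))) <= ennreal c)"
  for \<sigma> h c :: real and t :: "'h uop \<times> 'h bop \<times> 'h bop \<times> real \<times> real"
 define st where "st \<sigma> h c = (SOME t. good \<sigma> h c t)" for \<sigma> h c
 have st: "good \<sigma> h c (st \<sigma> h c)" if "0 < c" "0 <= \<sigma>" "0 < h" for \<sigma> h c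
  unfolding st_def
 proof (rule someI_ex)
  show "EX t. good \<sigma> h c t" unfolding good_def using hump_step[OF X H that] by(simp add: split_paired_Ex)
 qed
 \<comment> \<open>The state holds the total trace of the supports of earlier Z and the allowance
   for the next support of Y. The allowance is halved, so that tails are geometric, and kept below c
   k / (N^p + 1), so that removing later supports from Y k is cheap; the 1 avoids division by
   0.\<close>
 define nxt where "nxt k q = (case st (fst q) (snd q) (c k) of (z, Y, Z, N, s) =>
  (fst q + enn2real (\<tau> (rproj Z)), min (snd q / 2) (c k / (N powr p + 1))))" for k and q :: "real \<times> real"
 \<comment> \<open>The start 1/4 gives 2 h 0 <= 1, matching the 1 in 1 + \<sigma> k.\<close>
 define q where "q = rec_nat (0, 1/4) nxt"
 have q0: "q 0 = (0, 1/4)" and qS: "q (Suc k) = nxt k (q k)" for k by(simp_all add: q_def)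
 define \<sigma> h where "\<sigma> k = fst (q k)" and "h k = snd (q k)" for k
 define t where "t k = st (\<sigma> k) (h k) (c k)" for k
 define z Y Z N s where "z k = fst (t k)" and "Y k = fst (snd (t k))" and "Z k = fst (snd (snd (t k)))"
  and "N k = fst (snd (snd (snd (t k))))" and "s k = snd (snd (snd (snd (t k))))" for k
 have \<sigma>S: "\<sigma> (Suc k) = \<sigma> k + enn2real (\<tau> (rproj (Z k)))" and hS: "h (Suc k) = min (h k / 2) (c k / (N k powr p + 1))" for k
  by(simp_all add: \<sigma>_def h_def qS nxt_def t_def Z_def N_def case_prod_beta)
 have \<sigma>: "0 <= \<sigma> k & (\<sigma> k = (\<Sum>j<k. enn2real (\<tau> (rproj (Z j)))))" for k
  by(induction k) (simp_all add: \<sigma>S, simp add: \<sigma>_def q0)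
 have h0: "0 < h k" for k
 proof (induction k)
  case (Suc k)
  have "0 < N k powr p + 1" by(simp add: add_nonneg_pos)
  thus ?case using Suc c[of k] by(simp add: hS)
 qed (simp add: h_def q0)
 have "good (\<sigma> k) (h k) (c k) (t k)" for k unfolding t_def by(rule st) (use \<sigma>[of k, THEN conjunct1] c h0 in auto)
 hence good: "z k : X" "Phi (z k) = 1" "Y k : M" "Z k : M" "0 <= N k" "!!v. norm (Y k v) <= N k * norm v"
  "0 <= s k" "!!v. norm (Z k v) <= s k * norm v" "s k powr p * (1 + \<sigma> k) <= c k"
  "\<tau> (rproj (Y k)) <= ennreal (h k)" "\<tau> (rproj (Z k)) < \<infinity>" "Phi (strong_diff (z k) (graph_of (Y k + Z k))) <= ennreal (c k)" for k
  by(simp_all add: good_def case_prod_beta z_def Y_def Z_def N_def s_def)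
 define e F e' F' where "e k = rproj (Y k)" and "F k = rproj (Z k)" and "e' k = lproj (Y k)" and "F' k = lproj (Z k)" for k
 have Pr: "e k : Pr" "F k : Pr" "e' k : Pr" "F' k : Pr" for k
  by(simp_all add: e_def F_def e'_def F'_def rproj_Pr lproj_Pr good)
 have te: "\<tau> (e k) <= ennreal (h k)" for k using good(10) by(simp add: e_def)
 have tF: "\<tau> (F k) <= ennreal (enn2real (\<tau> (F k)))" for k using good(11) by(simp add: F_def)
 have te': "\<tau> (e' k) <= ennreal (h k)" for k
  using trace_lproj[OF good(3) Pr(1)[of k, unfolded e_def] rproj_apply[OF good(3)]] te[of k]
  by(auto simp: e'_def e_def intro: order_trans)
 have tF': "\<tau> (F' k) <= ennreal (enn2real (\<tau> (F k)))" for k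
  using trace_lproj[OF good(4) Pr(2)[of k, unfolded F_def] rproj_apply[OF good(4)]] tF[of k]
  by(auto simp: F'_def F_def intro: order_trans)
 have hh: "0 <= h k" "h (Suc k) <= h k / 2" for k using h0[of k] unfolding hS by(simp_all only: less_imp_le min.cobounded1)
 note tr = hump_trace[of e F h, OF Pr(1) Pr(2) te tF hh enn2real_nonneg] and tl = hump_trace[of e' F' h, OF Pr(3) Pr(4) te' tF' hh enn2real_nonneg]
 have tB: "2 * h 0 + (\<Sum>j<k. enn2real (\<tau> (F j))) <= 1 + \<sigma> k" for k
  using \<sigma>[of k] by(simp add: h_def q0 F_def)
 define w where "w k = ((id_blinfun - later e' k) oL Y k oL (id_blinfun - later e k)) +
  ((id_blinfun - cover e' F' k) oL Z k oL (id_blinfun - cover e F k))" for k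
 note AB = later_Pr[of e, OF Pr(1)] cover_Pr[of e F, OF Pr(1,2)] later_Pr[of e', OF Pr(3)] cover_Pr[of e' F', OF Pr(3,4)]
 have YM: "(id_blinfun - later e' k) oL Y k oL (id_blinfun - later e k) : M"
  and ZM: "(id_blinfun - cover e' F' k) oL Z k oL (id_blinfun - cover e F k) : M" for k
  by(intro compose_M diff_M id_M good PrD(1) AB)+
 have wM: "w k : M" for k unfolding w_def by(intro add_M YM ZM)
 have right: "w j (radj (w k) v) = 0" if "j ~= k" for j k v
  by(rule hump_disjoint[where e = e and F = F and Y = Y and Z = Z, OF Pr(1,2) good(3,4) _ _ w_def that])
   (simp_all add: e_def F_def rproj_zero_iff good)
 have rP: "radj (id_blinfun - P) = id_blinfun - P" if "P : Pr" for P
  using orth_projectionD(2)[OF PrD(2)[OF Pr_compl[OF that]]] symm_radj by blast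
 have rw: "radj (w k) = ((id_blinfun - later e k) oL radj (Y k) oL (id_blinfun - later e' k)) +
  ((id_blinfun - cover e F k) oL radj (Z k) oL (id_blinfun - cover e' F' k))" for k
  by(rule blinfun_eqI) (simp add: w_def radj_add radj_compose rP AB blinfun.add_left)
 \<comment> \<open>The adjoints of the w k have the same form with left and right projections
   exchanged.\<close>
 have left: "radj (w j) (w k v) = 0" if "j ~= k" for j k v
  using hump_disjoint[where w = "%k. radj (w k)" and e = e' and F = F' and Y = "%k. radj (Y k)" and Z = "%k. radj (Z k)", OF Pr(3,4) radj_M[OF good(3)] radj_M[OF good(4)] _ _ rw that, of v]
  by(simp add: e'_def F'_def lproj_zero_iff good)
 have close: "Phi (strong_diff (z k) (graph_of (w k))) <= ennreal (g k)" for k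
 proof -
  define a where "a = (2::real) powr p"
  have a: "0 < a" by(simp add: a_def)
  define U where "U = Y k - ((id_blinfun - later e' k) oL Y k oL (id_blinfun - later e k))"
  define V where "V = Z k - ((id_blinfun - cover e' F' k) oL Z k oL (id_blinfun - cover e F k))"
  have UM: "U : M" and VM: "V : M" unfolding U_def V_def by(intro diff_M good YM ZM)+
  have "N k powr p * h (Suc k) <= c k"
  proof -
   have "N k powr p * h (Suc k) <= (N k powr p + 1) * (c k / (N k powr p + 1))"
    using hh(1)[of "Suc k"] by(intro mult_mono) (auto simp: hS)
   also have "... = c k" using powr_ge_zero[of "N k" p] by(simp add: add_nonneg_eq_0_iff)
   finally show ?thesis .
  qed
  hence "Phi (graph_of U) <= ennreal (2 powr p * (2 * (2 * c k)))"
   unfolding U_def using hh(1) by(intro Phi_cut[OF good(3) good(6) good(5) AB(1) AB(3) tr(1) tl(1)]) (auto simp: mult.left_commute)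
  moreover have "Phi (graph_of V) <= ennreal (2 powr p * (2 * c k))"
   unfolding V_def using \<sigma>[of k] good(9)[of k]
   by(intro Phi_cut[OF good(4) good(8) good(7) AB(2) AB(4) order_trans[OF tr(2) ennreal_leI[OF tB]] order_trans[OF tl(2) ennreal_leI[OF tB]]]) auto
  ultimately have "Phi (graph_of U) + Phi (graph_of V) <= ennreal (2 powr p * (2 * (2 * c k))) + ennreal (2 powr p * (2 * c k))"
   by(rule add_mono)
  also have "... = ennreal (6 * a * c k)"
   using c[of k] a by(subst ennreal_plus[symmetric]) (simp_all add: a_def)
  finally have UV: "Phi (graph_of U) + Phi (graph_of V) <= ennreal (6 * a * c k)" .
  have eq: "(Y k + Z k) - w k = U + V" by(simp add: w_def U_def V_def)
  have YZ: "Y k + Z k : M" by(intro add_M good)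
  have zMO: "z k : MO" using good(1) X LP_MO by blast
  have "strong_add (strong_diff (z k) (graph_of (Y k + Z k))) (strong_diff (graph_of (Y k + Z k)) (graph_of (w k))) = strong_diff (z k) (graph_of (w k))"
   by(intro strong_diff_trans zMO graph_of_MO YZ wM)
  moreover have "strong_diff (graph_of (Y k + Z k)) (graph_of (w k)) = strong_add (graph_of U) (graph_of V)"
   by(simp only: graph_of_diff[OF YZ wM] eq graph_of_add[OF UM VM])
  ultimately have "strong_diff (z k) (graph_of (w k)) = strong_add (strong_diff (z k) (graph_of (Y k + Z k))) (strong_add (graph_of U) (graph_of V))" by simp
  hence "Phi (strong_diff (z k) (graph_of (w k))) <= ennreal a * (Phi (strong_diff (z k) (graph_of (Y k + Z k))) + Phi (strong_add (graph_of U) (graph_of V)))"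
   unfolding a_def by(simp only:) (intro Phi_add2 MO_intros zMO YZ UM VM)
  also have "... <= ennreal a * (ennreal (c k) + ennreal a * ennreal (6 * a * c k))"
  proof (intro mult_left_mono add_mono good(12))
   have "Phi (strong_add (graph_of U) (graph_of V)) <= ennreal a * (Phi (graph_of U) + Phi (graph_of V))"
    unfolding a_def by(intro Phi_add2 MO_intros UM VM)
   also have "... <= ennreal a * ennreal (6 * a * c k)" by(intro mult_left_mono UV) simp
   finally show "Phi (strong_add (graph_of U) (graph_of V)) <= ennreal a * ennreal (6 * a * c k)" .
  qed simp
  also have "... = ennreal (a * (c k + a * (6 * a * c k)))"
   using a c[of k] by(simp add: ennreal_mult[symmetric] ennreal_plus[symmetric] del: ennreal_plus)
  also have "a * (c k + a * (6 * a * c k)) = (a + 6 * a * a * a) * c k" by(simp add: algebra_simps)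
  also have "... = g k" using den by(simp add: c_def a_def)
  finally show ?thesis .
 qed
 show ?thesis by(rule that[OF good(1,2) wM left right close])
qed

end

section \<open>Minkowski's inequality\<close>

lemma radj_bound:
 fixes A :: "'a::{real_inner,complete_space} bop"
 assumes b: "!!v. norm (A v) <= b * norm v"
 shows "norm (radj A v) <= b * norm v"
proof (cases "radj A v = 0")
 case True
 have "0 <= b * norm v" using order_trans[OF norm_ge_zero b] .
 thus ?thesis by(simp add: True)
next
 case False
 have "norm (radj A v) * norm (radj A v) = inner (A (radj A v)) v"
  by(simp only: radj power2_norm_eq_inner[symmetric] power2_eq_square)
 also have "... <= b * norm (radj A v) * norm v"
  using norm_cauchy_schwarz[of "A (radj A v)" v] mult_right_mono[OF b[of "radj A v"], of "norm v"] by simp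
 finally show ?thesis using False by(simp add: mult.assoc mult.left_commute)
qed

lemma radj_scaleR: "radj (r *\<^sub>R A) = r *\<^sub>R radj A"
 by(rule radj_unique) (simp add: blinfun.scaleR_left blinfun.scaleR_right radj)

context traced_vna
begin

lemma trace_scaleR: "A : M ==> psd A ==> 0 <= r ==> \<tau> (r *\<^sub>R A) = ennreal r * \<tau> A"
 using trace cone_iff by(simp add: fns_trace_def is_trace_def)

lemma trace_psd_mono: "A : M ==> psd A ==> B : M ==> psd (B - A) ==> \<tau> A <= \<tau> B"
 using trace_add[of A "B - A"] diff_M[of B A] by simp

end

text \<open>On the corner \<open>fMf\<close> of a projection of finite trace, the real part of the trace extends to
 a linear functional: shift the symmetric part of \<open>B\<close> by a multiple of \<open>f\<close> to make it positive.\<close>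

locale corner = traced_vna M \<tau> for M :: "'h::complex_hilbert_space bop set" and \<tau> +
 fixes f :: "'h bop"
 assumes f: "f : Pr" and finite: "\<tau> f < \<infinity>"
begin

definition cor :: "'h bop set" where "cor = {B : M. ALL v. f (B v) = B v & B (f v) = B v}"

definition shift :: "real => 'h bop => 'h bop" where "shift n B = n *\<^sub>R f + (1/2) *\<^sub>R (B + radj B)"

definition RT :: "'h bop => real" where
 "RT B = enn2real (\<tau> (shift (norm B) B)) - norm B * enn2real (\<tau> f)"

abbreviation tr :: "'h bop => real" where "tr A \<equiv> enn2real (\<tau> A)"

lemma corD: "B : cor ==> B : M" "B : cor ==> f (B v) = B v" "B : cor ==> B (f v) = B v"
 by(simp_all add: cor_def)

lemma f_radj:
 fixes A :: "'h bop"
 assumes A: "!!v. A (f v) = A v"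
 shows "f (radj A v) = radj A v"
proof -
 have "inner (f (radj A v)) u = inner (radj A v) u" for u
  using Pr_symm[OF f, of "radj A v" u] radj'[of v A "f u"] radj'[of v A u] A by simp
 thus ?thesis by(metis vector_eq_rdot)
qed

lemma radj_f:
 fixes A :: "'h bop"
 assumes A: "!!v. f (A v) = A v"
 shows "radj A (f v) = radj A v"
proof -
 have "inner (radj A (f v)) u = inner (radj A v) u" for u
  using Pr_symm[OF f, of v "A u"] radj'[of "f v" A u] radj'[of v A u] A by simp
 thus ?thesis by(metis vector_eq_rdot)
qed

lemma cor_compose_radj:
 fixes A B :: "'h bop"
 assumes "A : M" "!!v. A (f v) = A v" "B : M" "!!v. B (f v) = B v"
 shows "radj A oL B : cor"
 using assms by(simp add: cor_def compose_M radj_M f_radj)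

lemma radj_cor: "B : cor ==> radj B : cor"
 by(simp add: cor_def radj_M f_radj radj_f)

lemma add_cor: "A : cor ==> B : cor ==> A + B : cor"
 by(simp add: cor_def add_M blin_simps)

lemma scaleR_cor: "A : cor ==> r *\<^sub>R A : cor"
 by(simp add: cor_def scaleR_M blin_simps)

lemma compose_cor: "A : cor ==> B : cor ==> A oL B : cor"
 by(simp add: cor_def compose_M)

lemma zero_cor: "0 : cor"
 by(simp add: cor_def)

lemma Pr_cor: "P : Pr ==> (!!v. f v = 0 ==> P v = 0) ==> P : cor"
 using Pr_le_apply[OF _ f] by(auto simp: cor_def PrD)

lemma shift_M: "B : cor ==> shift n B : M"
 by(simp add: shift_def add_M scaleR_M radj_M corD PrD(1)[OF f])

lemma symm_shift: "symm (shift n B)"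
proof -
 have "symm (B + radj B)" by(simp add: symm_radj radj_add add.commute)
 thus ?thesis unfolding shift_def by(rule symm_add[OF symm_scale[OF orth_projectionD(2)[OF PrD(2)[OF f]]] symm_scale])
qed

lemma shift_form:
 assumes B: "B : cor"
 shows "inner (shift n B v) v = n * (norm (f v))^2 + inner (B (f v)) (f v)"
proof -
 have "inner (B v) v = inner (B (f v)) (f v)" using Pr_symm[OF f, of "B v" v] by(simp add: corD(2,3)[OF B])
 moreover have "inner (radj B v) v = inner (B v) v" by(simp add: radj[symmetric] inner_commute[of "radj B v"])
 moreover have "inner (f v) v = (norm (f v))^2" by(rule orth_projection_inner[OF PrD(2)[OF f]])
 ultimately show ?thesis by(simp add: shift_def blin_simps inner_add_left)
qed

lemma shift_psd:
 assumes B: "B : cor" and n: "!!v. norm (B v) <= n * norm v"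
 shows "psd (shift n B)"
proof -
 have "- inner (B (f v)) (f v) <= n * (norm (f v))^2" for v
  using norm_cauchy_schwarz[of "- B (f v)" "f v"] mult_right_mono[OF n[of "f v"], of "norm (f v)"]
  by(simp add: power2_eq_square)
 thus ?thesis unfolding psd_def using symm_shift by(simp add: shift_form[OF B] add.commute minus_le_iff) (smt (verit))
qed

lemma shift_finite:
 assumes B: "B : cor" and n: "!!v. norm (B v) <= n * norm v" "0 <= n"
 shows "\<tau> (shift n B) < \<infinity>"
proof -
 have B': "(-1) *\<^sub>R B : cor" by(rule scaleR_cor[OF B])
 have "(n + n) *\<^sub>R f - shift n B = shift n ((-1) *\<^sub>R B)"
  unfolding shift_def radj_scaleR scaleR_add_left[of n n] by(simp add: scaleR_add_right scaleR_diff_right)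
 moreover have "psd (shift n ((-1) *\<^sub>R B))" by(rule shift_psd[OF B']) (use n in "simp add: blinfun.minus_left")
 ultimately have "psd ((n + n) *\<^sub>R f - shift n B)" by simp
 hence "\<tau> (shift n B) <= \<tau> ((n + n) *\<^sub>R f)"
  by(intro trace_psd_mono shift_M[OF B] shift_psd[OF B] n scaleR_M PrD(1)[OF f])
 also have "... < \<infinity>" using finite n by(simp add: trace_scaleR PrD(1)[OF f] Pr_psd[OF f] ennreal_mult_less_top)
 finally show ?thesis .
qed

lemma tr_add:
 assumes "A : M" "psd A" "B : M" "psd B" "\<tau> A < \<infinity>" "\<tau> B < \<infinity>"
 shows "tr (A + B) = tr A + tr B"
 using assms by(simp add: trace_add enn2real_plus)

lemma tr_f: "0 <= r ==> tr (r *\<^sub>R f) = r * tr f" "0 <= r ==> \<tau> (r *\<^sub>R f) < \<infinity>"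
 using finite by(simp_all add: trace_scaleR PrD(1)[OF f] Pr_psd[OF f] enn2real_mult ennreal_mult_less_top)

text \<open>Every admissible bound n gives the same value, so operators of different norm can be
  shifted by amounts that add up; additivity rests on this.\<close>

lemma RT:
 assumes B: "B : cor" and n: "!!v. norm (B v) <= n * norm v" "0 <= n"
 shows "tr (shift n B) = RT B + n * tr f"
proof -
 have step: "tr (shift (n + m) B) = tr (shift n B) + m * tr f" if n: "!!v. norm (B v) <= n * norm v" "0 <= n" and m: "0 <= m" for n m
 proof -
  have "shift (n + m) B = shift n B + m *\<^sub>R f" by(simp add: shift_def algebra_simps)
  thus ?thesis
   using tr_add[OF shift_M[OF B] shift_psd[OF B n(1)] scaleR_M[OF PrD(1)[OF f]] psd_scale[OF Pr_psd[OF f] m] shift_finite[OF B n] tr_f(2)[OF m]]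
   by(simp add: tr_f m)
 qed
 have "tr (shift n B) + norm B * tr f = tr (shift (norm B) B) + n * tr f"
  using step[OF n, of "norm B"] step[OF norm_blinfun[of B], of n] n by(simp add: add.commute)
 thus ?thesis by(simp add: RT_def)
qed

lemmas RTn = RT[OF _ norm_blinfun norm_ge_zero]

lemma RT_add:
 assumes A: "A : cor" and B: "B : cor"
 shows "RT (A + B) = RT A + RT B"
proof -
 have n: "norm ((A + B) v) <= (norm A + norm B) * norm v" for v
  using norm_triangle_ineq[of "A v" "B v"] norm_blinfun[of A v] norm_blinfun[of B v] by(simp add: blinfun.add_left distrib_right)
 have s: "shift (norm A + norm B) (A + B) = shift (norm A) A + shift (norm B) B"
  by(simp add: shift_def radj_add algebra_simps)
 show ?thesis
  using RT[OF add_cor[OF A B] n] RTn[OF A] RTn[OF B]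
   tr_add[OF shift_M[OF A] shift_psd[OF A norm_blinfun] shift_M[OF B] shift_psd[OF B norm_blinfun] shift_finite[OF A norm_blinfun] shift_finite[OF B norm_blinfun]]
  by(simp add: s distrib_right)
qed

lemma RT_scaleR:
 assumes A: "A : cor" and r: "0 <= r"
 shows "RT (r *\<^sub>R A) = r * RT A"
proof -
 have n: "norm ((r *\<^sub>R A) v) <= (r * norm A) * norm v" for v
  using mult_left_mono[OF norm_blinfun[of A v] r] r by(simp add: blinfun.scaleR_left mult.assoc)
 have s: "shift (r * norm A) (r *\<^sub>R A) = r *\<^sub>R shift (norm A) A" by(simp add: shift_def radj_scaleR algebra_simps)
 have "tr (shift (r * norm A) (r *\<^sub>R A)) = r * tr (shift (norm A) A)"
  unfolding s using trace_scaleR[OF shift_M[OF A] shift_psd[OF A norm_blinfun] r] r by(simp add: enn2real_mult)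
 thus ?thesis using RT[OF scaleR_cor[OF A] n] r RTn[OF A] by(simp add: algebra_simps)
qed

lemma RT_psd:
 assumes B: "B : cor" "psd B"
 shows "RT B = tr B" "\<tau> B < \<infinity>"
proof -
 have rB: "radj B = B" using psd_symm[OF B(2)] symm_radj by blast
 have s: "shift (norm B) B = norm B *\<^sub>R f + B" by(simp add: shift_def rB scaleR_2[symmetric])
 have "\<tau> B <= \<tau> (shift (norm B) B)"
  unfolding s using B psd_scale[OF Pr_psd[OF f] norm_ge_zero] by(intro trace_psd_mono add_M scaleR_M corD PrD(1)[OF f]) simp_all
 thus fin: "\<tau> B < \<infinity>" using shift_finite[OF B(1) norm_blinfun] by(auto intro: le_less_trans)
 show "RT B = tr B"
  using RTn[OF B(1)] tr_add[OF scaleR_M[OF PrD(1)[OF f]] psd_scale[OF Pr_psd[OF f] norm_ge_zero[of B]] corD(1)[OF B(1)] B(2) tr_f(2)[OF norm_ge_zero[of B]] fin]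
  by(simp add: s tr_f)
qed

lemma RT_radj:
 assumes B: "B : cor"
 shows "RT (radj B) = RT B"
proof -
 have s: "shift n (radj B) = shift n B" for n by(simp add: shift_def add.commute)
 have n: "norm (radj B v) <= norm B * norm v" for v by(rule radj_bound[OF norm_blinfun])
 show ?thesis using RT[OF radj_cor[OF B] n] RTn[OF B] by(simp add: s)
qed

lemma psd_radj_compose: "psd (radj A oL A)"
 by(simp add: psd_def symm_radj radj_compose radj'[symmetric])

text \<open>Polarization of the tracial identity at A + B, using that \<open>RT\<close> does not
  change under adjoints.\<close>

lemma RT_tracial:
 assumes A: "A : cor" and B: "B : cor"
 shows "RT (radj A oL B) = RT (B oL radj A)"
proof -
 note rA = radj_cor[OF A] and rB = radj_cor[OF B]
 have sq: "RT (radj C oL C) = RT (C oL radj C)" if C: "C : cor" for C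
  using RT_psd(1)[OF compose_cor[OF radj_cor[OF C] C] psd_radj_compose] trace_tracial[OF corD(1)[OF C]]
   RT_psd(1)[OF compose_cor[OF C radj_cor[OF C]]] psd_radj_compose[of "radj C"] by simp
 have e1: "radj (A + B) oL (A + B) = (radj A oL A) + (radj A oL B) + (radj (radj A oL B)) + (radj B oL B)"
  by(rule blinfun_eqI) (simp add: radj_add radj_compose blin_simps)
 have e2: "(A + B) oL radj (A + B) = (A oL radj A) + radj (B oL radj A) + (B oL radj A) + (B oL radj B)"
  by(rule blinfun_eqI) (simp add: radj_add radj_compose blin_simps)
 note c = compose_cor[OF rA A] compose_cor[OF rA B] compose_cor[OF rB B] compose_cor[OF A rA] compose_cor[OF B rA] compose_cor[OF B rB]
 show ?thesis
  using sq[OF add_cor[OF A B]] sq[OF A] sq[OF B]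
  by(simp add: e1 e2 RT_add add_cor radj_cor c RT_radj)
qed

lemma Pr_finite: "P : Pr ==> (!!v. f v = 0 ==> P v = 0) ==> \<tau> P < \<infinity>"
 by(rule le_less_trans[OF trace_mono[OF _ f] finite])

lemma RT_le:
 assumes B: "B : cor" and b: "!!v. norm (B v) <= b * norm v" "0 <= b"
  and P: "P : Pr" "!!v. f v = 0 ==> P v = 0" and BP: "!!v. B (P v) = B v"
 shows "RT B <= b * tr P"
proof -
 note Pc = Pr_cor[OF P]
 have rP: "radj P = P" using orth_projectionD(2)[OF PrD(2)[OF P(1)]] symm_radj by blast
 \<comment> \<open>Traciality lets P be placed on the left as well, so that the form of C sees only
   the range of P.\<close>
 define C where "C = P oL B"
 have C: "C : cor" unfolding C_def by(rule compose_cor[OF Pc B])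
 have "B oL P = B" by(rule blinfun_eqI) (simp add: BP)
 hence eq: "RT C = RT B" using RT_tracial[OF Pc B] by(simp add: rP C_def)
 have bC: "norm (C v) <= b * norm v" for v
  using order_trans[OF norm_orth_projection_le[OF PrD(2)[OF P(1)]] b(1)] by(simp add: C_def)
 have "psd ((b *\<^sub>R f + b *\<^sub>R P) - shift b C)"
  unfolding psd_def
 proof (intro conjI allI)
  show "symm ((b *\<^sub>R f + b *\<^sub>R P) - shift b C)"
   by(intro symm_diff symm_add symm_scale symm_shift orth_projectionD(2) PrD(2) f P)
  fix v
  have "inner (shift b C v) v = b * (norm (f v))^2 + inner (C (f v)) (f v)" by(rule shift_form[OF C])
  also have "inner (C (f v)) (f v) = inner (B (P v)) (P v)"
   using Pr_symm[OF P(1), of "B v" "f v"] Pr_le_apply(1)[OF P(1) f P(2), of v] by(simp add: C_def corD[OF B] BP)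
  also have "... <= b * (norm (P v))^2"
   using norm_cauchy_schwarz[of "B (P v)" "P v"] mult_right_mono[OF b(1)[of "P v"], of "norm (P v)"] by(simp add: power2_eq_square)
  finally show "0 <= inner (((b *\<^sub>R f + b *\<^sub>R P) - shift b C) v) v"
   by(simp add: blin_simps inner_diff_left inner_add_left orth_projection_inner PrD(2)[OF f] PrD(2)[OF P(1)])
 qed
 hence le: "\<tau> (shift b C) <= \<tau> (b *\<^sub>R f + b *\<^sub>R P)"
  by(intro trace_psd_mono shift_M[OF C] shift_psd[OF C bC] add_M scaleR_M PrD(1)[OF f] PrD(1)[OF P(1)])
 have fP: "\<tau> (b *\<^sub>R P) < \<infinity>" using Pr_finite[OF P] b(2) by(simp add: trace_scaleR PrD(1)[OF P(1)] Pr_psd[OF P(1)] ennreal_mult_less_top)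
 have "tr (shift b C) <= tr (b *\<^sub>R f + b *\<^sub>R P)"
  using le fP tr_f(2)[OF b(2)] psd_scale[OF Pr_psd[OF f] b(2)] psd_scale[OF Pr_psd[OF P(1)] b(2)]
  by(intro enn2real_mono) (simp_all add: trace_add scaleR_M PrD(1)[OF f] PrD(1)[OF P(1)])
 also have "... = b * tr f + b * tr P"
  using tr_add[OF scaleR_M[OF PrD(1)[OF f]] psd_scale[OF Pr_psd[OF f] b(2)] scaleR_M[OF PrD(1)[OF P(1)]] psd_scale[OF Pr_psd[OF P(1)] b(2)] tr_f(2)[OF b(2)] fP] b(2)
  by(simp add: tr_f trace_scaleR PrD(1)[OF P(1)] Pr_psd[OF P(1)] enn2real_mult)
 finally show ?thesis using RT[OF C bC b(2)] eq by simp
qed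

lemma RT_ge:
 fixes A Q :: "'h bop"
 assumes A: "A : M" "!!v. A (f v) = A v" and s: "0 <= s" "!!v. s * norm (Q v) <= norm (A v)"
  and Q: "Q : Pr" "!!v. f v = 0 ==> Q v = 0"
 shows "s^2 * tr Q <= RT (radj A oL A)"
proof -
 have c: "radj A oL A : cor" by(rule cor_compose_radj[OF A A])
 have "psd ((radj A oL A) - s^2 *\<^sub>R Q)"
  unfolding psd_def
 proof (intro conjI allI)
  show "symm ((radj A oL A) - s^2 *\<^sub>R Q)"
   by(intro symm_diff symm_scale psd_symm[OF psd_radj_compose] orth_projectionD(2) PrD(2) Q)
  fix v
  have "(s * norm (Q v))^2 <= (norm (A v))^2" by(rule power_mono) (use s in auto)
  thus "0 <= inner (((radj A oL A) - s^2 *\<^sub>R Q) v) v"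
   by(simp add: blin_simps inner_diff_left orth_projection_inner PrD(2)[OF Q(1)] radj'[symmetric] power_mult_distrib power2_norm_eq_inner)
 qed
 hence "\<tau> (s^2 *\<^sub>R Q) <= \<tau> (radj A oL A)"
  by(intro trace_psd_mono scaleR_M PrD(1)[OF Q(1)] psd_scale Pr_psd[OF Q(1)] corD(1)[OF c]) simp_all
 hence "tr (s^2 *\<^sub>R Q) <= tr (radj A oL A)"
  using RT_psd(2)[OF c psd_radj_compose] by(intro enn2real_mono) auto
 thus ?thesis
  by(simp add: RT_psd(1)[OF c psd_radj_compose] trace_scaleR PrD(1)[OF Q(1)] Pr_psd[OF Q(1)] enn2real_mult)
qed

lemma RT_zero: "RT 0 = 0"
 using RT_scaleR[OF zero_cor, of 0] by simp

lemma RT_sum: "(!!k. k < n ==> B k : cor) ==> (\<Sum>k<n. B k) : cor & RT (\<Sum>k<n. B k) = (\<Sum>k<n. RT (B k))" for n :: nat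
 by(induction n) (simp_all add: zero_cor RT_zero RT_add add_cor)

end

section \<open>Subadditivity of the excess over a level\<close>

lemma abel_steps:
 fixes a :: "nat => real"
 shows "(\<Sum>k<K. (c + real (Suc k) * d) * (a k - a (Suc k))) = c * (a 0 - a K) + d * (\<Sum>k<K. a k - a K)"
proof (induction K)
 case (Suc K)
 have "(\<Sum>k<Suc K. a k - a (Suc K)) = (\<Sum>k<K. a k - a K) + real (Suc K) * (a K - a (Suc K))"
  by(simp add: sum_subtractf algebra_simps)
 moreover have "(\<Sum>k<Suc K. (c + real (Suc k) * d) * (a k - a (Suc k))) =
  (c * (a 0 - a K) + d * (\<Sum>k<K. a k - a K)) + (c + real (Suc K) * d) * (a K - a (Suc K))"
  by(simp only: sum.lessThan_Suc Suc)
 ultimately show ?case by(simp only:) (simp add: algebra_simps)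
qed simp

context lp_vna
begin

lemma strong_zero_add: "x : MO ==> strong_add (UNIV \<times> {0}) x = x"
 using strong_add_commute strong_add_zero zero_op_MO by metis

lemma decreasing_measurable:
 assumes "decreasing F" "0 <= a"
 shows "(%s. indicator {a<..} s * F s) : borel_measurable borel"
  and "(%s. indicator {a<..b} s * F s) : borel_measurable borel"
proof -
 have "(%s. indicator {0<..} s * F s) = (%u. indicator {0<..} u * F (1 * u powr (1 / 1)))"
  by(auto simp: indicator_def fun_eq_iff)
 hence m [measurable]: "(%s. indicator {0<..} s * F s) : borel_measurable borel"
  using lay_measurable[of 1 F 1] assms(1) by simp
 have "(%s. indicator {a<..} s * F s) = (%s. indicator {a<..} s * (indicator {0<..} s * F s))"
  "(%s. indicator {a<..b} s * F s) = (%s. indicator {a<..b} s * (indicator {0<..} s * F s))"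
  using assms(2) by(auto simp: indicator_def fun_eq_iff)
 thus "(%s. indicator {a<..} s * F s) : borel_measurable borel" "(%s. indicator {a<..b} s * F s) : borel_measurable borel"
  by simp_all
qed

lemma riemann:
 assumes F: "decreasing F" and a: "0 < a" and d: "0 < v"
 shows "(\<Sum>k<K. ennreal v * F (a + real (Suc k) * v)) <= (\<integral>\<^sup>+ s. indicator {a<..a + real K * v} s * F s \<partial>lborel)"
  and "(\<integral>\<^sup>+ s. indicator {a<..a + real K * v} s * F s \<partial>lborel) <= (\<Sum>k<K. ennreal v * F (a + real k * v))"
proof -
 have const: "(\<integral>\<^sup>+ s. indicator {b<..b + v} s * c \<partial>lborel) = ennreal v * c" for b and c :: ennreal
  using nn_integral_cmult_indicator[of "{b<..b + v}" lborel c] d by(simp add: mult.commute)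
 have piece1: "ennreal v * F (b + v) <= (\<integral>\<^sup>+ s. indicator {b<..b + v} s * F s \<partial>lborel)"
  and piece2: "(\<integral>\<^sup>+ s. indicator {b<..b + v} s * F s \<partial>lborel) <= ennreal v * F b" if b: "0 < b" for b
  using F b unfolding const[of b, symmetric] by(auto intro!: nn_integral_mono simp: indicator_def decreasing_def[OF p_pos])
 have split: "(\<integral>\<^sup>+ s. indicator {a<..a + real (Suc K) * v} s * F s \<partial>lborel)
  = (\<integral>\<^sup>+ s. indicator {a<..a + real K * v} s * F s \<partial>lborel) + (\<integral>\<^sup>+ s. indicator {a + real K * v<..(a + real K * v) + v} s * F s \<partial>lborel)" for K
 proof -
  have k: "0 <= real K * v" using d by simp
  have e: "a + real (Suc K) * v = (a + real K * v) + v" by(simp add: algebra_simps)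
  have "indicator {a<..m + v} s * F s = indicator {a<..m} s * F s + indicator {m<..m + v} s * F s" if "a <= m" for s m
   using that d by(cases "s <= m"; cases "a < s") (auto simp: indicator_def)
  from this[of "a + real K * v", folded e] have "indicator {a<..a + real (Suc K) * v} s * F s = indicator {a<..a + real K * v} s * F s + indicator {a + real K * v<..(a + real K * v) + v} s * F s" for s
   using k unfolding e by simp
  thus ?thesis
   using decreasing_measurable(2)[OF F, of a "a + real K * v"] decreasing_measurable(2)[OF F, of "a + real K * v" "(a + real K * v) + v"] a k
   by(simp add: nn_integral_add)
 qed
 have b: "0 < a + real K * v" for K using a d by(simp add: add_pos_nonneg)
 show "(\<Sum>k<K. ennreal v * F (a + real (Suc k) * v)) <= (\<integral>\<^sup>+ s. indicator {a<..a + real K * v} s * F s \<partial>lborel)"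
 proof (induction K)
  case (Suc K)
  thus ?case unfolding split sum.lessThan_Suc
   by(rule add_mono) (use piece1[OF b[of K]] in "simp add: algebra_simps")
 qed simp
 show "(\<integral>\<^sup>+ s. indicator {a<..a + real K * v} s * F s \<partial>lborel) <= (\<Sum>k<K. ennreal v * F (a + real k * v))"
 proof (induction K)
  case (Suc K)
  thus ?case unfolding split using piece2[OF b[of K]] by(simp add: add_mono)
 qed simp
qed

text \<open>By the layer formula this is the trace of (|x| - c)^+.\<close>

definition excess :: "'h uop => real => ennreal" where
 "excess x c = (\<integral>\<^sup>+ s. indicator {c<..} s * lam x s \<partial>lborel)"

lemma tail_orth:
 assumes x: "x : MO" and a: "(y, y') : x" "tail x s y = y" and b: "(w, w') : x" "tail x s w = 0"
 shows "inner y' w' = 0"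
proof -
 interpret cdd_op x by(rule MO_cdd[OF x])
 obtain u v where u: "y = opC u" "y' = opZ u" and v: "w = opC v" "w' = opZ v" using a b x_iff by meson
 have "(y, opZ (tail x s u)) : x" using a(2) unfolding x_iff u(1) tail_C by metis
 hence "y' = opZ (tail x s u)" using MO_single[OF x a(1)] by blast
 moreover have "(0, opZ (tail x s v)) : x" using b(2) unfolding x_iff v(1) tail_C by metis
 hence "opZ (tail x s v) = 0" using MO_single[OF x _ subspace_0[OF MO_subspace[OF x], unfolded zero_prod_def]] by blast
 hence "w' = opZ (v - tail x s v)" by(simp add: v blinfun.diff_right)
 ultimately show ?thesis using Z_orth by simp
qed

text \<open>The right support of the tail composed with g controls X, and its trace is at most that
  of the tail, which fixes the range of the composition.\<close>

lemma lam_restrict: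
 assumes x: "x : MO" and g: "g : Pr" and X: "X : M" "!!v. (g v, X v) : x" and s: "0 <= s"
 shows "lam (graph_of X) s <= lam x s"
proof -
 define C where "C = tail x s oL g"
 have C: "C : M" unfolding C_def by(intro compose_M PrD(1) tail_Pr x g)
 have "lam (graph_of X) s <= \<tau> (rproj C)"
 proof (rule lam_le[OF graph_of_MO[OF X(1)] rproj_Pr[OF C] s])
  fix v assume "rproj C v = 0"
  hence "tail x s (g v) = 0" by(simp add: rproj_zero_iff[OF C]) (simp add: C_def)
  then obtain w where "(g v, w) : x" "norm w <= s * norm (g v)" by(rule tail_good[OF x])
  hence "norm (X v) <= s * norm (g v)" using MO_single[OF x X(2)] by blast
  also have "... <= s * norm v" by(intro mult_left_mono norm_orth_projection_le PrD(2)[OF g] s)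
  finally show "EX w. (v, w) : graph_of X & norm w <= s * norm v" by simp
 qed
 also have "... <= lam x s" unfolding lam_def
  by(rule trace_rproj[OF C tail_Pr[OF x]]) (simp add: C_def PrD(3)[OF tail_Pr[OF x]])
 finally show ?thesis .
qed

end

locale lp_corner = lp_vna M \<tau> p + corner M \<tau> f
 for M :: "'h::complex_hilbert_space bop set" and \<tau> and p and f
begin

lemma tr_diff:
 assumes "P : Pr" "Q : Pr" "!!v. f v = 0 ==> Q v = 0" "!!v. Q v = 0 ==> P v = 0"
 shows "tr (Q - P) = tr Q - tr P"
proof -
 have q: "\<tau> Q = \<tau> (Q - P) + \<tau> P" by(rule trace_diff[OF assms(1,2,4)])
 have "\<tau> Q < \<infinity>" by(rule Pr_finite[OF assms(2,3)])
 thus ?thesis using q by(simp add: enn2real_plus)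
qed

text \<open>The upper half of the duality formula, discretized: on the band between consecutive
  levels B is bounded by the upper level, and Abel summation turns the weighted traces of the bands
  into a Riemann sum of \<open>lam\<close>. One mesh width times \<open>tr f\<close> is
  lost.\<close>

lemma RT_upper:
 assumes B: "B : cor" and X: "X : M" "!!v. X (f v) = X v" and BX: "!!v. norm (B v) <= norm (X v)"
  and c: "0 < c" and d: "0 < u" and E: "excess x c <= ennreal E" "0 <= E"
  and x: "x : MO" and lam: "!!s. 0 <= s ==> lam (graph_of X) s <= lam x s"
 shows "RT B <= (c + u) * tr f + E"
proof -
 obtain K :: nat where K: "norm X <= real K * u" using d reals_Archimedean2[of "norm X / u"] by(auto simp: pos_divide_less_eq intro: less_imp_le)
 define P where "P k = tail (graph_of X) (c + real k * u)" for k
 have s0: "0 < c + real k * u" for k using c d by(simp add: add_pos_nonneg)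
 have P: "P k : Pr" for k unfolding P_def by(rule tail_Pr[OF graph_of_MO[OF X(1)]])
 have Pf: "P k v = 0" if "f v = 0" for k v
  unfolding P_def using X(2)[of v] that s0[of k] by(intro tail_graph_kernel[OF X(1)]) (simp_all add: less_imp_le)
 have PS: "P (Suc k) v = 0" if "P k v = 0" for k v
  using cdd_op.tail_mono(1)[OF MO_cdd[OF graph_of_MO[OF X(1)]], of "c + real k * u" "c + real (Suc k) * u" v] that d
  by(simp add: P_def)
 have PK: "P K = 0"
 proof (rule trace_faithful[OF PrD(1)[OF P] Pr_psd[OF P]])
  show "\<tau> (P K) = 0" unfolding P_def lam_def[symmetric]
   by(rule lam_bounded[OF X(1) norm_blinfun]) (use K c s0[of K] in auto)
 qed
 define a where "a k = tr (P k)" for k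
 have piece: "RT (B oL (Q - P k)) <= (c + real k * u) * (tr Q - a k)"
  if Q: "Q : Pr" "!!v. f v = 0 ==> Q v = 0" "!!v. Q v = 0 ==> P k v = 0" for Q k
 proof -
  have R: "Q - P k : Pr" by(rule Pr_diff[OF P Q(1,3)])
  have Rf: "(Q - P k) v = 0" if "f v = 0" for v using Q(2)[OF that] Pf[OF that] by(simp add: blinfun.diff_left)
  have "norm (B ((Q - P k) v)) <= (c + real k * u) * norm v" for v
  proof -
   have "P k ((Q - P k) v) = 0" using Pr_le_apply(1)[OF P Q(1,3), of v] by(simp add: blin_simps PrD(3)[OF P])
   hence "norm (X ((Q - P k) v)) <= (c + real k * u) * norm ((Q - P k) v)"
    unfolding P_def by(rule tail_good[OF graph_of_MO[OF X(1)]]) (simp add: P_def)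
   also have "... <= (c + real k * u) * norm v"
    by(intro mult_left_mono norm_orth_projection_le PrD(2)[OF R]) (use s0[of k] in simp)
   finally show ?thesis using BX order_trans by blast
  qed
  hence "RT (B oL (Q - P k)) <= (c + real k * u) * tr (Q - P k)"
   using s0[of k] by(intro RT_le compose_cor B Pr_cor R Rf) (simp_all add: PrD(3)[OF R])
  thus ?thesis by(simp add: tr_diff[OF P Q] a_def)
 qed
 have fin: "\<tau> (P k) < \<infinity>" for k by(rule Pr_finite[OF P Pf])
 have cor1: "B oL (f - P 0) : cor" and cor2: "B oL (P k - P (Suc k)) : cor" for k
  using B by(simp_all add: cor_def compose_M diff_M PrD(1)[OF f] PrD(1)[OF P] blinfun.diff_left blinfun.diff_right Pr_le_apply(1)[OF P f Pf])
 have "B = (B oL (f - P 0)) + (\<Sum>k<K. B oL (P k - P (Suc k)))"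
 proof (rule blinfun_eqI)
  fix v
  have "(\<Sum>k<K. B (P k v) - B (P (Suc k) v)) = B (P 0 v)" using sum_lessThan_telescope'[of "%k. B (P k v)" K] PK by(simp)
  thus "B v = ((B oL (f - P 0)) + (\<Sum>k<K. B oL (P k - P (Suc k)))) v"
   by(simp add: blin_simps blinfun.sum_left corD(3)[OF B])
 qed
 hence "RT B = RT (B oL (f - P 0)) + (\<Sum>k<K. RT (B oL (P k - P (Suc k))))"
  using RT_sum[of K "%k. B oL (P k - P (Suc k))"] RT_add[OF cor1] cor2 by metis
 also have "... <= c * (tr f - a 0) + (\<Sum>k<K. (c + real (Suc k) * u) * (a k - a (Suc k)))"
  using piece[OF f _ Pf, of 0] piece[OF P Pf PS] by(intro add_mono sum_mono) (simp_all add: a_def)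
 also have "... = c * tr f + u * (\<Sum>k<K. a k)" unfolding abel_steps by(simp add: a_def PK algebra_simps)
 finally have main: "RT B <= c * tr f + u * (\<Sum>k<K. a k)" .
 \<comment> \<open>Shifting the index exposes a Riemann sum from below; the boundary term is at most
   \<open>tr f\<close>.\<close>
 have s1: "(\<Sum>k<K. a k) <= tr f + (\<Sum>k<K. a (Suc k))"
 proof -
  have "(\<Sum>k<K. a k) = a 0 - a K + (\<Sum>k<K. a (Suc k))" using sum_lessThan_telescope'[of a K] by(simp add: sum_subtractf)
  moreover have "a 0 <= tr f" unfolding a_def using trace_mono[OF P f Pf] finite by(intro enn2real_mono) auto
  ultimately show ?thesis by(simp add: a_def PK)
 qed
 have s2: "u * (\<Sum>k<K. a (Suc k)) <= E"
 proof -
  have "ennreal (u * (\<Sum>k<K. a (Suc k))) = (\<Sum>k<K. ennreal u * \<tau> (P (Suc k)))"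
  proof -
   have "ennreal u * \<tau> (P k) = ennreal (u * a k)" for k using d fin[of k] by(simp add: a_def ennreal_mult)
   thus ?thesis using d by(simp add: sum_distrib_left a_def)
  qed
  also have "... <= (\<Sum>k<K. ennreal u * lam x (c + real (Suc k) * u))"
   unfolding P_def lam_def[symmetric] by(intro sum_mono mult_left_mono lam less_imp_le[OF s0]) simp_all
  also have "... <= (\<integral>\<^sup>+ s. indicator {c<..c + real K * u} s * lam x s \<partial>lborel)"
   by(rule riemann(1)[OF decreasing_lam[OF x] c d])
  also have "... <= excess x c" unfolding excess_def by(intro nn_integral_mono) (auto simp: indicator_def)
  also have "... <= ennreal E" by(rule E)
  finally show ?thesis using E(2) by simp
 qed
 show ?thesis using main mult_left_mono[OF s1 less_imp_le[OF d]] s2 by(simp add: algebra_simps)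
qed

end

lemma radj_sum: "radj (\<Sum>k<n. A k) = (\<Sum>k<n. radj (A k))" for n :: nat
 using radj_scaleR[of 0 0] by(induction n) (simp_all add: radj_add)

context lp_vna
begin

text \<open>In the ideal version a polar part V of z on a spectral projection f attains the excess
  as Re \<tau>(V^*z) - (c + d) \<tau>(f), and V then tests x and y separately. Here V is a step
  approximation on the levels s k, at the price of 4 w times the trace.\<close>

lemma excess_add_step:
 assumes x: "x : MO" and y: "y : MO" and fin: "lam (strong_add x y) (c + d) < \<infinity>"
  and c: "0 < c" and d: "0 < d" and E: "excess x c <= ennreal E" "0 <= E" and D: "excess y d <= ennreal D" "0 <= D"
  and w: "0 < w" and K: "0 < K"
 defines "z \<equiv> strong_add x y" and "s \<equiv> %k. c + d + real k * w"
 shows "w * (\<Sum>k<K. enn2real (lam z (s k)) - enn2real (lam z (s K))) <= 4 * w * enn2real (lam z (c + d)) + E + D"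
proof -
 have z: "z : MO" unfolding z_def by(rule strong_add_MO[OF x y])
 have s0: "0 < s k" for k using c d w by(simp add: s_def add_pos_nonneg)
 have smono: "i <= j ==> s i <= s j" for i j using w by(simp add: s_def mult_right_mono)
 define T where "T k = tail z (s k)" for k
 have T: "T k : Pr" for k unfolding T_def by(rule tail_Pr[OF z])
 have TT: "T j (T i v) = T j v" "T i (T j v) = T j v" if "i <= j" for i j v
  unfolding T_def using cdd_op.tail_mono[OF MO_cdd[OF z] smono[OF that]] by auto
 have Tk: "T i v = 0 ==> i <= j ==> T j v = 0" for i j v using TT(1)[of i j v] by(simp)
 define f where "f = T 0 - T K"
 have f: "f : Pr" unfolding f_def by(rule Pr_diff[OF T T]) (rule Tk[OF _ le0])
 have T0fin: "\<tau> (T 0) < \<infinity>" using fin by(simp add: T_def s_def z_def lam_def)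
 have "\<tau> f <= \<tau> (T 0)" by(rule trace_mono[OF f T]) (use Tk[of 0 _ K] in "simp add: f_def blinfun.diff_left")
 hence ffin: "\<tau> f < \<infinity>" using T0fin by(rule le_less_trans)
 interpret lp_corner M \<tau> p f by unfold_locales (rule f ffin)+
 obtain A where A: "A : M" "!!v. (v - T K v, A v) : z" "!!v. norm (A v) <= s K * norm v"
  unfolding T_def by(rule truncation_exists[OF z less_imp_le[OF s0]]) blast
 define W where "W = A oL f"
 have W: "W : M" "W (f v) = W v" for v by(simp_all add: W_def compose_M A PrD[OF f])
 have Wz: "(u, W u) : z" if "f u = u" for u
 proof -
  have "T K (f u) = 0" using TT[of 0 K u] by(simp add: f_def blin_simps PrD(3)[OF T])
  hence "T K u = 0" using that by simp
  thus ?thesis using A(2)[of u] that by(simp add: W_def)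
 qed
 define Q where "Q k = T k - T (Suc k)" for k
 have Q: "Q k : Pr" for k unfolding Q_def by(rule Pr_diff[OF T T]) (rule Tk[OF _ le_SucI[OF order_refl]])
 have Qsum: "(\<Sum>k<K. Q k) = f" unfolding Q_def f_def by(rule sum_lessThan_telescope')
 have QT: "T k (Q k v) = Q k v" "T (Suc k) (Q k v) = 0" for k v
  by(simp_all add: Q_def blin_simps TT PrD(3)[OF T])
 have fQ: "f (Q k v) = Q k v" "Q k (f v) = Q k v" if "k < K" for k v
  using that by(simp_all add: Q_def f_def blin_simps TT PrD(3)[OF T])
 have Qf: "Q k v = 0" if "k < K" "f v = 0" for k v using fQ(2)[OF that(1), of v] that(2) by(simp)
 have WQz: "(Q k v, W (Q k v)) : z" if "k < K" for k v by(rule Wz[OF fQ(1)[OF that]])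
 have up: "norm (W (Q k v)) <= s (Suc k) * norm (Q k v)" if "k < K" for k v
  using tail_good[OF z QT(2)[unfolded T_def], of k v] MO_single[OF z WQz[OF that]] by metis
 have low: "s k * norm (Q k v) <= norm (W (Q k v))" if "k < K" for k v
 proof (cases "norm (W (Q k v)) <= s k * norm (Q k v)")
  case True
  hence "Q k v = 0"
   by(rule cdd_op.tail_strict[OF MO_cdd[OF z] WQz[OF that] QT(1)[unfolded T_def] less_imp_le[OF s0]])
  thus ?thesis by(simp)
 qed simp
 have orth: "inner (W (Q i u)) (W (Q j v)) = 0" if "i < K" "j < K" "i ~= j" for i j u v
 proof -
  have lt: "inner (W (Q j v)) (W (Q i u)) = 0" if "i < j" "i < K" "j < K" for i j u v
   by(rule tail_orth[where s = "s j", OF z WQz[OF that(3)] _ WQz[OF that(2)]], fold T_def)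
    (use QT(1)[of j v] Tk[OF QT(2)[of i u], of j] that in simp_all)
  show ?thesis using lt[of i j v u] lt[of j i u v] that by(cases "i < j") (auto simp: inner_commute)
 qed
 have Wsum: "W v = (\<Sum>k<K. W (Q k v))" for v
  using W(2)[of v] by(simp only: Qsum[symmetric]) (simp add: blinfun.sum_left blinfun.sum_right)
 \<comment> \<open>Approximate polar part: on the band between s k and s (Suc k) it is z divided by
   the upper level. Bands have orthogonal images, so V is a contraction.\<close>
 define V where "V = (\<Sum>k<K. (1 / s (Suc k)) *\<^sub>R (W oL Q k))"
 have VM: "(1 / s (Suc k)) *\<^sub>R (W oL Q k) : M" for k by(intro scaleR_M compose_M W PrD(1)[OF Q])
 have V: "V : M" unfolding V_def using VM by(induction K) (simp_all add: add_M)
 have Vf: "V (f v) = V v" for v unfolding V_def by(simp add: blinfun.sum_left blinfun.scaleR_left fQ(2))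
 have "norm (V v) <= 1 * norm v" for v
 proof -
  have "(norm (V v))^2 = (\<Sum>k<K. (norm ((1 / s (Suc k)) *\<^sub>R W (Q k v)))^2)"
   unfolding V_def blinfun.sum_left
   by(subst norm_sum_Pythagorean) (auto simp: pairwise_def orthogonal_def orth blinfun.scaleR_left)
  also have "... <= (\<Sum>k<K. (norm (Q k v))^2)"
   using up s0 by(intro sum_mono power_mono) (simp_all add: pos_divide_le_eq mult.commute abs_of_pos less_imp_le)
  also have "... = (norm (\<Sum>k<K. Q k v))^2"
  proof (subst norm_sum_Pythagorean)
   have lt: "inner (Q i v) (Q j v) = 0" if "i < j" for i j
    using Pr_symm[OF T[of j], of "Q i v" "Q j v"] QT(1)[of j v] Tk[OF QT(2)[of i v], of j] that by simp
   have "inner (Q i v) (Q j v) = 0" if "i ~= j" for i j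
    using lt[of i j] lt[of j i] that by(cases "i < j") (auto simp: inner_commute)
   thus "pairwise (%i j. orthogonal (Q i v) (Q j v)) {..<K}" by(simp add: pairwise_def orthogonal_def)
  qed simp_all
  also have "... = (norm (f v))^2" by(simp add: Qsum[symmetric] blinfun.sum_left)
  also have "... <= (norm v)^2" by(intro power_mono norm_orth_projection_le PrD(2)[OF f]) simp
  finally show ?thesis by(simp add: power2_le_iff_abs_le)
 qed
 hence Vc: "norm (radj V v) <= norm v" for v using radj_bound[of V 1] by simp
 have "radj V oL W = (\<Sum>k<K. (1 / s (Suc k)) *\<^sub>R (radj (W oL Q k) oL (W oL Q k)))"
 proof (rule blinfun_eqI)
  fix v
  have "radj (W oL Q k) (W v) = radj (W oL Q k) (W (Q k v))" if k: "k < K" for k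
  proof -
   have "inner u (radj (W oL Q k) (W v)) = inner u (radj (W oL Q k) (W (Q k v)))" for u
   proof -
    have "inner (W (Q k u)) (W v) = (\<Sum>j<K. inner (W (Q k u)) (W (Q j v)))" by(subst Wsum) (rule inner_sum_right)
    also have "... = inner (W (Q k u)) (W (Q k v))"
     using k orth by(subst sum.remove[of _ k]) (auto intro!: sum.neutral)
    finally show ?thesis by(simp add: radj[symmetric])
   qed
   thus ?thesis by(metis vector_eq_ldot)
  qed
  thus "(radj V oL W) v = (\<Sum>k<K. (1 / s (Suc k)) *\<^sub>R (radj (W oL Q k) oL (W oL Q k))) v"
   by(simp add: V_def radj_sum radj_scaleR blinfun.sum_left blinfun.scaleR_left)
 qed
 moreover have ck: "radj (W oL Q k) oL (W oL Q k) : cor" if "k < K" for k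
  using that by(intro cor_compose_radj compose_M W PrD(1)[OF Q]) (simp_all add: fQ)
 ultimately have RTV: "RT (radj V oL W) = (\<Sum>k<K. 1 / s (Suc k) * RT (radj (W oL Q k) oL (W oL Q k)))"
  using RT_sum[of K "%k. (1 / s (Suc k)) *\<^sub>R (radj (W oL Q k) oL (W oL Q k))"] s0
  by(simp add: scaleR_cor RT_scaleR less_imp_le)
 define a where "a k = tr (T k)" for k
 have trQ: "tr (Q k) = a k - a (Suc k)" for k
 proof -
  have "\<tau> (T k) < \<infinity>" by(rule le_less_trans[OF trace_mono[OF T T Tk[of 0 _ k]] T0fin]) simp_all
  thus ?thesis using trace_diff[OF T[of "Suc k"] T[of k] Tk[of k _ "Suc k"]] by(simp add: Q_def a_def enn2real_plus)
 qed
 have trf: "tr f = a 0 - a K"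
  using trace_diff[OF T[of K] T[of 0] Tk[of 0 _ K]] T0fin by(simp add: f_def a_def enn2real_plus)
 have lower: "(\<Sum>k<K. (c + d - 2 * w + real (Suc k) * w) * (a k - a (Suc k))) <= RT (radj V oL W)"
  unfolding RTV
 proof (rule sum_mono)
  fix k assume "k : {..<K}"
  hence k: "k < K" by simp
  \<comment> \<open>The first factor is s k - w and s (Suc k) = s k + w, so the product is (s k)^2 -
    w^2.\<close>
  have "(c + d - 2 * w + real (Suc k) * w) * s (Suc k) <= (s k)^2"
   using w by(simp add: s_def power2_eq_square algebra_simps)
  hence "c + d - 2 * w + real (Suc k) * w <= (s k)^2 / s (Suc k)" using s0[of "Suc k"] by(simp add: pos_le_divide_eq)
  hence "(c + d - 2 * w + real (Suc k) * w) * (a k - a (Suc k)) <= (s k)^2 / s (Suc k) * tr (Q k)"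
   unfolding trQ[symmetric] by(rule mult_right_mono) simp
  also have "... <= 1 / s (Suc k) * RT (radj (W oL Q k) oL (W oL Q k))"
   using RT_ge[of "W oL Q k" "s k" "Q k"] s0[of k] s0[of "Suc k"] low[OF k] fQ[OF k] Qf[OF k] Q
   by(simp add: compose_M W PrD(1)[OF Q] divide_right_mono)
  finally show "(c + d - 2 * w + real (Suc k) * w) * (a k - a (Suc k)) <= 1 / s (Suc k) * RT (radj (W oL Q k) oL (W oL Q k))" .
 qed
 \<comment> \<open>x and y need not be defined on the range of f. They are bounded on a
   subprojection g that misses a trace of at most b / s K, and on the rest W is bounded by s K,
   which costs b.\<close>
 have upper: "RT (radj V oL W) <= (c + w) * tr f + E + ((d + w) * tr f + D) + b" if b: "0 < b" for b
 proof -
  define e' where "e' = b / s K"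
  have e': "0 < e'" "0 < e' / 2" using b s0[of K] by(simp_all add: e'_def)
  obtain b1 where b1: "0 <= b1" "lam x b1 < ennreal (e' / 2)" by(rule lam_small[OF x e'(2)])
  obtain b2 where b2: "0 <= b2" "lam y b2 < ennreal (e' / 2)" by(rule lam_small[OF y e'(2)])
  obtain Ax where Ax: "Ax : M" "!!v. (v - tail x b1 v, Ax v) : x" by(rule truncation_exists[OF x b1(1)]) blast
  obtain Ay where Ay: "Ay : M" "!!v. (v - tail y b2 v, Ay v) : y" by(rule truncation_exists[OF y b2(1)]) blast
  define h where "h = join (tail x b1) (tail y b2)"
  note hj = join[OF PrD(1)[OF tail_Pr[OF x]] PrD(1)[OF tail_Pr[OF y]], of b1 b2, folded h_def]
  have th: "\<tau> h < ennreal e'" unfolding h_def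
   by(rule small_join[OF tail_Pr[OF x] tail_Pr[OF y]]) (use b1 b2 e' in "simp_all add: lam_def")
  note cf = Pr_compl[OF f]
  \<comment> \<open>g becomes the infimum of f and the complement of h, written through the join of
    complements.\<close>
  define J where "J = join (id_blinfun - f) h"
  note Jj = join[OF PrD(1)[OF cf] PrD(1)[OF hj(1)], folded J_def]
  define g where "g = id_blinfun - J"
  have g: "g : Pr" unfolding g_def by(rule Pr_compl[OF Jj(1)])
  have Jg: "J (g v) = 0" for v by(simp add: g_def blin_simps PrD(3)[OF Jj(1)])
  have fg: "f (g v) = g v" and hg: "h (g v) = 0" for v
   using Jg[of v] unfolding Jj(2) by(simp_all add: blinfun.diff_left)
  have gk: "g v = 0" if "f v = 0" for v
   using Pr_le_apply(2)[OF cf Jj(1), of v] Jj(2) that by(simp add: g_def blinfun.diff_left)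
  have gf: "g (f v) = g v" for v by(rule Pr_le_apply(1)[OF g f gk])
  define X where "X = Ax oL g"
  define Y where "Y = Ay oL g"
  have X: "X : M" "X (f v) = X v" and Y: "Y : M" "Y (f v) = Y v" for v
   by(simp_all add: X_def Y_def compose_M Ax Ay PrD(1)[OF g] gf)
  have t0: "tail x b1 (g v) = 0" "tail y b2 (g v) = 0" for v using hg[of v] unfolding hj(2) by simp_all
  have Xx: "(g v, X v) : x" and Yy: "(g v, Y v) : y" for v
   using Ax(2)[of "g v"] Ay(2)[of "g v"] by(simp_all add: t0 X_def Y_def)
  have Wg: "W (g v) = X v + Y v" for v
   using MO_single[OF z Wz[OF fg[of v]] strong_addI[OF Xx Yy, folded z_def]] .
  have R: "f - g : Pr" and Rk: "(f - g) v = 0" if "f v = 0" for v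
   using that by(simp_all add: Pr_diff[OF g f gk] blinfun.diff_left gk)
  have fJ: "f - g = J - (id_blinfun - f)" by(simp add: g_def)
  have "\<tau> (f - g) <= \<tau> h" unfolding fJ J_def by(rule trace_join_diff(2)[OF cf hj(1)])
  hence "tr (f - g) <= e'" using th e'(1) by(intro enn2real_leI) (auto intro: order_trans less_imp_le)
  hence small: "s K * tr (f - g) <= b" using s0[of K] by(simp add: e'_def pos_le_divide_eq mult.commute)
  have R: "f - g : Pr" by(rule Pr_diff[OF g f gk])
  define C where "C = W oL (f - g)"
  have C: "C : M" "C (f v) = C v" "C ((f - g) v) = C v" for v
   using PrD(3)[OF R, of v] by(simp_all add: C_def compose_M W PrD(1)[OF R] blinfun.diff_left gf PrD(3)[OF f])
  have cors: "radj V oL X : cor" "radj V oL Y : cor" "radj V oL C : cor"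
   by(intro cor_compose_radj V Vf X Y C)+
  have "radj V oL W = (radj V oL X) + (radj V oL Y) + (radj V oL C)"
  proof (rule blinfun_eqI)
   fix v
   have "W v = X v + Y v + C v" using Wg[of v] W(2)[of v] by(simp add: C_def blin_simps)
   thus "(radj V oL W) v = ((radj V oL X) + (radj V oL Y) + (radj V oL C)) v" by(simp add: blin_simps)
  qed
  hence "RT (radj V oL W) = RT (radj V oL X) + RT (radj V oL Y) + RT (radj V oL C)"
   by(simp add: RT_add add_cor cors)
  moreover have "RT (radj V oL X) <= (c + w) * tr f + E"
   by(rule RT_upper[OF cors(1) X _ c w E x lam_restrict[OF x g X(1) Xx]]) (simp_all add: Vc)
  moreover have "RT (radj V oL Y) <= (d + w) * tr f + D"
   by(rule RT_upper[OF cors(2) Y _ d w D y lam_restrict[OF y g Y(1) Yy]]) (simp_all add: Vc)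
  moreover have "RT (radj V oL C) <= s K * tr (f - g)"
  proof (rule RT_le[OF cors(3) _ less_imp_le[OF s0] R])
   fix v
   have "norm (C v) <= s K * norm (f ((f - g) v))" using A(3) by(simp add: C_def W_def)
   also have "... <= s K * norm v"
    using order_trans[OF norm_orth_projection_le[OF PrD(2)[OF f]] norm_orth_projection_le[OF PrD(2)[OF R]]] s0[of K]
    by(intro mult_left_mono) auto
   finally show "norm ((radj V oL C) v) <= s K * norm v" using order_trans[OF Vc[of "C v"]] by simp
  qed (simp_all add: C(3)[unfolded blinfun.diff_left] blinfun.diff_left gk)
  ultimately show ?thesis using small by linarith
 qed
 have "RT (radj V oL W) <= (c + w) * tr f + E + ((d + w) * tr f + D)"
  by(rule field_le_epsilon) (rule upper)
 \<comment> \<open>The 4 w collects 2 w from the lower estimate and w from each of the two upper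
   ones.\<close>
 hence "w * (\<Sum>k<K. a k - a K) <= 4 * w * tr f + E + D"
  using lower unfolding abel_steps trf by(simp add: algebra_simps)
 moreover have "4 * w * tr f <= 4 * w * a 0" unfolding trf using w by(simp add: a_def)
 ultimately show ?thesis by(simp add: a_def T_def lam_def s_def)
qed

lemma lam_finite: "x : LP ==> 0 < s ==> lam x s < \<infinity>"
 using le_less_trans[OF Phi_ge[of x s] LP_finite[of x]] by(auto simp: LP_MO ennreal_mult_less_top)

lemma nn_integral_limit_le:
 fixes f :: "nat => real => ennreal"
 assumes "!!n. f n : borel_measurable borel" "!!s. (%n. f n s) ----> F s" "!!n. (\<integral>\<^sup>+ s. f n s \<partial>lborel) <= C"
 shows "(\<integral>\<^sup>+ s. F s \<partial>lborel) <= C"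
proof -
 have "(\<integral>\<^sup>+ s. F s \<partial>lborel) = (\<integral>\<^sup>+ s. liminf (%n. f n s) \<partial>lborel)"
  using lim_imp_Liminf[OF _ assms(2)] by simp
 also have "... <= liminf (%n. \<integral>\<^sup>+ s. f n s \<partial>lborel)" by(rule nn_integral_liminf) (simp add: assms(1))
 also have "... <= limsup (%n. \<integral>\<^sup>+ s. f n s \<partial>lborel)" by(rule Liminf_le_Limsup) simp
 also have "... <= C" by(rule Limsup_bounded) (simp add: assms(3))
 finally show ?thesis .
qed

text \<open>The step estimate controls \<open>lam z\<close> only relative to its last value. So
  \<open>lam z b\<close> is subtracted on a finite interval, the mesh is refined, and then b grows;
  the subtracted value tends to 0.\<close>

lemma excess_add:
 assumes x: "x : LP" and y: "y : LP" and c: "0 < c" and d: "0 < d"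
 shows "excess (strong_add x y) (c + d) <= excess x c + excess y d"
proof (cases "excess x c + excess y d = top")
 case False
 then obtain E D where E: "excess x c = ennreal E" "0 <= E" and D: "excess y d = ennreal D" "0 <= D"
  by(cases "excess x c"; cases "excess y d") auto
 define z where "z = strong_add x y"
 have zL: "z : LP" unfolding z_def by(rule LP_add[OF x y])
 note z = LP_MO[OF zL]
 have cd: "0 < c + d" using c d by simp
 define l where "l s = enn2real (lam z s)" for s
 have l: "lam z s = ennreal (l s)" if "0 < s" for s using lam_finite[OF zL that] by(simp add: l_def)
 have l0: "0 <= l s" for s by(simp add: l_def)
 have part: "(\<integral>\<^sup>+ s. indicator {c + d<..b} s * (lam z s - lam z b) \<partial>lborel) <= ennreal (E + D)" if b: "c + d < b" for b
 proof (rule ennreal_le_epsilon)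
  fix e :: real assume e: "0 < e"
  \<comment> \<open>Makes the mesh so fine that the error 4 v l (c + d) is at most e.\<close>
  obtain K :: nat where K: "4 * (b - (c + d)) * l (c + d) / e < real K" using reals_Archimedean2 by blast
  define v where "v = (b - (c + d)) / real (Suc K)"
  have v: "0 < v" using b by(simp add: v_def)
  have bK: "c + d + real (Suc K) * v = b" unfolding v_def by(simp del: of_nat_Suc)
  have small: "4 * v * l (c + d) <= e"
  proof -
   have "4 * (b - (c + d)) * l (c + d) <= e * real (Suc K)" using K e by(simp add: pos_divide_less_eq algebra_simps)
   thus ?thesis unfolding v_def by(simp add: divide_le_eq del: of_nat_Suc)
  qed
  have "decreasing (%s. lam z s - lam z b)"
   unfolding decreasing_def[OF p_pos] by(auto intro!: ennreal_minus_mono lam_antimono z)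
  from riemann(2)[OF this cd v, of "Suc K"]
  have "(\<integral>\<^sup>+ s. indicator {c + d<..b} s * (lam z s - lam z b) \<partial>lborel)
   <= (\<Sum>k<Suc K. ennreal v * (lam z (c + d + real k * v) - lam z b))" by(simp only: bK)
  also have "... = ennreal (\<Sum>k<Suc K. v * (l (c + d + real k * v) - l b))"
  proof -
   have "ennreal v * (lam z (c + d + real k * v) - lam z b) = ennreal (v * (l (c + d + real k * v) - l b))"
    "0 <= v * (l (c + d + real k * v) - l b)" if "k : {..<Suc K}" for k
   proof -
    have "real k * v <= real (Suc K) * v" using that v by(intro mult_right_mono) auto
    hence kb: "c + d + real k * v <= b" using bK by linarith
    have s0: "0 < c + d + real k * v" "0 < b" using cd v b by(auto intro: add_pos_nonneg)
    have "l b <= l (c + d + real k * v)" using lam_antimono[OF z kb] by(simp add: l[OF s0(1)] l[OF s0(2)] ennreal_le_iff l0)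
    thus "ennreal v * (lam z (c + d + real k * v) - lam z b) = ennreal (v * (l (c + d + real k * v) - l b))"
     "0 <= v * (l (c + d + real k * v) - l b)"
     unfolding l[OF s0(1)] l[OF s0(2)] using v by(simp_all add: ennreal_minus l0 ennreal_mult)
   qed
   thus ?thesis by(subst sum_ennreal[symmetric]) (auto intro: sum.cong)
  qed
  also have "... <= ennreal (E + D + e)"
  proof (rule ennreal_leI)
   have "v * (\<Sum>k<Suc K. l (c + d + real k * v) - l b) <= 4 * v * l (c + d) + E + D"
    using excess_add_step[OF LP_MO[OF x] LP_MO[OF y] lam_finite[OF zL[unfolded z_def] cd] c d eq_refl[OF E(1)] E(2) eq_refl[OF D(1)] D(2) v, of "Suc K"]
    unfolding bK l_def z_def by simp
   thus "(\<Sum>k<Suc K. v * (l (c + d + real k * v) - l b)) <= E + D + e" using small unfolding sum_distrib_left[symmetric] by linarith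
  qed
  also have "... = ennreal (E + D) + ennreal e" using E D e by simp
  finally show "(\<integral>\<^sup>+ s. indicator {c + d<..b} s * (lam z s - lam z b) \<partial>lborel) <= ennreal (E + D) + ennreal e" .
 qed
 define b where "b n = c + d + real (Suc n)" for n
 have b: "c + d < b n" for n by(simp add: b_def)
 have lb: "(%n. lam z (b n)) ----> 0" by(rule lam_top[OF z]) (use cd in "simp add: b_def")
 have "excess z (c + d) <= ennreal (E + D)"
  unfolding excess_def
 proof (rule nn_integral_limit_le[OF _ _ part[OF b]])
  show "(%s. indicator {c + d<..b n} s * (lam z s - lam z (b n))) : borel_measurable borel" for n
   by(rule decreasing_measurable) (use cd in "auto simp: decreasing_def[OF p_pos] intro!: ennreal_minus_mono lam_antimono z")
  fix s
  show "(%n. indicator {c + d<..b n} s * (lam z s - lam z (b n))) ----> indicator {c + d<..} s * lam z s"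
  proof (cases "c + d < s")
   case True
   have "(%n. lam z s - lam z (b n)) ----> lam z s - 0"
    by(rule tendsto_diff_ennreal[OF tendsto_const lb]) (use lam_finite[OF zL, of s] True cd in auto)
   moreover obtain m where "s < real m" using reals_Archimedean2 by blast
   hence "lam z s - lam z (b n) = indicator {c + d<..b n} s * (lam z s - lam z (b n))" if "n >= m" for n
    using that True cd by(simp add: b_def indicator_def)
   hence "\<forall>\<^sub>F n in sequentially. lam z s - lam z (b n) = indicator {c + d<..b n} s * (lam z s - lam z (b n))"
    by(auto simp: eventually_sequentially)
   ultimately show ?thesis using True by(simp add: tendsto_cong)
  qed simp
 qed
 thus ?thesis using E D by(simp add: z_def)
qed auto

text \<open>The excess over c divided by c, after the substitution s = c v. Division by c turns
  joint subadditivity in x and c into convexity in x.\<close>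

definition mean_excess :: "'h uop => real => ennreal" where
 "mean_excess x c = (\<integral>\<^sup>+ v. indicator {1<..} v * lam x (c * v) \<partial>lborel)"

lemma excess_scale:
 assumes x: "x : MO" and c: "0 < c" and t: "0 < t"
 shows "excess (strong_scale (complex_of_real t) x) (t * c) = ennreal (t * c) * mean_excess x c"
proof -
 let ?y = "strong_scale (complex_of_real t) x"
 have "excess ?y (t * c) = ennreal \<bar>t * c\<bar> * (\<integral>\<^sup>+ v. indicator {t * c<..} (0 + t * c * v) * lam ?y (0 + t * c * v) \<partial>lborel)"
  unfolding excess_def using c t
  by(intro nn_integral_real_affine decreasing_measurable(1) decreasing_lam strong_scale_MO x) auto
 also have "(\<integral>\<^sup>+ v. indicator {t * c<..} (0 + t * c * v) * lam ?y (0 + t * c * v) \<partial>lborel) = mean_excess x c"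
  unfolding mean_excess_def
 proof (rule nn_integral_cong)
  fix v :: real
  show "indicator {t * c<..} (0 + t * c * v) * lam ?y (0 + t * c * v) = indicator {1<..} v * lam x (c * v)"
   using c t lam_scale[OF x, of "t * c * v" "complex_of_real t"]
   by(cases "1 < v") (simp_all add: indicator_def)
 qed
 finally show ?thesis using c t by simp
qed

lemma mean_excess_convex:
 assumes x: "x : LP" and y: "y : LP" and c: "0 < c" and t: "0 < t" "t < 1"
 shows "mean_excess (strong_add (strong_scale (complex_of_real (1 - t)) x) (strong_scale (complex_of_real t) y)) c
  <= ennreal (1 - t) * mean_excess x c + ennreal t * mean_excess y c" (is "mean_excess ?z c <= _")
proof -
 have t1: "0 < 1 - t" using t by simp
 note m = LP_MO[OF x] LP_MO[OF y]
 have zM: "?z : MO" by(intro MO_intros m)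
 have "ennreal c * mean_excess ?z c = excess ?z ((1 - t) * c + t * c)"
  using excess_scale[OF zM c zero_less_one] unfolding of_real_1 strong_scale_one[OF zM] by(simp add: algebra_simps)
 also have "... <= excess (strong_scale (complex_of_real (1 - t)) x) ((1 - t) * c) + excess (strong_scale (complex_of_real t) y) (t * c)"
  by(intro excess_add LP_scale x y mult_pos_pos t t1 c)
 also have "... = ennreal c * (ennreal (1 - t) * mean_excess x c + ennreal t * mean_excess y c)"
  unfolding excess_scale[OF m(1) c t1] excess_scale[OF m(2) c t(1)]
  using c t by(simp add: ennreal_mult distrib_left mult.assoc mult.left_commute)
 finally show ?thesis using c by(simp add: ennreal_mult_le_mult_iff)
qed

text \<open>Averaging over levels reproduces \<open>Phi\<close> up to a constant: by Fubini the
  inner integral at v is a dilated layer integral, which contributes v^(-p).\<close>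

lemma nn_integral_mean_excess:
 assumes x: "x : MO"
 shows "(\<integral>\<^sup>+ u. indicator {0<..} u * mean_excess x (u powr (1 / p)) \<partial>lborel) = (\<integral>\<^sup>+ v. indicator {1<..} v * ennreal (v powr (- p)) \<partial>lborel) * Phi x"
  and "(%u. indicator {0<..} u * mean_excess x (u powr (1 / p))) : borel_measurable borel"
proof -
 define G where "G s = indicator {0<..} s * lam x s" for s :: real
 have [measurable]: "G : borel_measurable borel" unfolding G_def by(rule decreasing_measurable(1)[OF decreasing_lam[OF x]]) simp
 define k where "k u v = indicator {0<..} u * (indicator {1<..} v * G (u powr (1 / p) * v))" for u v :: real
 have km [measurable]: "(%(u, v). k u v) : borel_measurable (lborel \<Otimes>\<^sub>M lborel)" unfolding k_def by measurable
 have k1: "k u v = indicator {0<..} u * (indicator {1<..} v * lam x (u powr (1 / p) * v))" for u v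
  by(simp add: k_def G_def indicator_def)
 have in1: "(\<integral>\<^sup>+ v. k u v \<partial>lborel) = indicator {0<..} u * mean_excess x (u powr (1 / p))" for u
  by(cases "0 < u") (simp_all add: k1 mean_excess_def)
 have in2: "(\<integral>\<^sup>+ u. k u v \<partial>lborel) = indicator {1<..} v * ennreal (v powr (- p)) * Phi x" for v
 proof (cases "1 < v")
  case True
  have "(\<integral>\<^sup>+ u. k u v \<partial>lborel) = L (%s. lam x (v * s))"
   unfolding lay_def[OF p_pos] using True by(intro nn_integral_cong) (simp add: k1 mult.commute)
  thus ?thesis using lay_dilate[OF p_pos decreasing_lam[OF x], of v] True by(simp add: Phi_def)
 qed (simp add: k1)
 show "(%u. indicator {0<..} u * mean_excess x (u powr (1 / p))) : borel_measurable borel"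
  unfolding in1[symmetric] by measurable
 have "(\<integral>\<^sup>+ u. indicator {0<..} u * mean_excess x (u powr (1 / p)) \<partial>lborel) = (\<integral>\<^sup>+ u. \<integral>\<^sup>+ v. k u v \<partial>lborel \<partial>lborel)"
  by(simp add: in1)
 also have "... = (\<integral>\<^sup>+ v. \<integral>\<^sup>+ u. k u v \<partial>lborel \<partial>lborel)" by(rule lborel_pair.Fubini'[symmetric]) simp
 also have "... = (\<integral>\<^sup>+ v. indicator {1<..} v * ennreal (v powr (- p)) \<partial>lborel) * Phi x"
  unfolding in2 by(rule nn_integral_multc) measurable
 finally show "(\<integral>\<^sup>+ u. indicator {0<..} u * mean_excess x (u powr (1 / p)) \<partial>lborel) = (\<integral>\<^sup>+ v. indicator {1<..} v * ennreal (v powr (- p)) \<partial>lborel) * Phi x" .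
qed

lemma Phi_convex:
 assumes x: "x : LP" and y: "y : LP" and t: "0 < t" "t < 1"
 shows "Phi (strong_add (strong_scale (complex_of_real (1 - t)) x) (strong_scale (complex_of_real t) y))
  <= ennreal (1 - t) * Phi x + ennreal t * Phi y" (is "Phi ?z <= _")
proof -
 note m = LP_MO[OF x] LP_MO[OF y]
 have zM: "?z : MO" by(intro MO_intros m)
 show ?thesis
 proof (cases "p = 1")
  \<comment> \<open>For p = 1 the averaging constant is infinite, so \<open>Phi\<close> is reached
    as the limit of the excess at levels tending to 0.\<close>
  case True
  have P: "Phi w = (\<integral>\<^sup>+ s. indicator {0<..} s * lam w s \<partial>lborel)" for w
   unfolding Phi_def lay_def[OF p_pos] by(rule nn_integral_cong) (simp add: True indicator_def)
  have le: "excess w c <= Phi w" if "0 < c" for w c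
   unfolding P excess_def by(intro nn_integral_mono) (use that in "auto simp: indicator_def")
  have part: "excess ?z (1 / real (Suc n)) <= ennreal (1 - t) * Phi x + ennreal t * Phi y" for n
  proof -
   define c where "c = 1 / real (Suc n)"
   have c: "0 < (1 - t) * c" "0 < t * c" using t by(simp_all add: c_def)
   have "excess ?z c = excess ?z ((1 - t) * c + t * c)" by(simp add: algebra_simps)
   also have "... <= excess (strong_scale (complex_of_real (1 - t)) x) ((1 - t) * c) + excess (strong_scale (complex_of_real t) y) (t * c)"
    by(intro excess_add LP_scale x y c)
   also have "... <= Phi (strong_scale (complex_of_real (1 - t)) x) + Phi (strong_scale (complex_of_real t) y)"
    by(intro add_mono le c)
   also have "... = ennreal (1 - t) * Phi x + ennreal t * Phi y"
    using t unfolding Phi_scale[OF m(1)] Phi_scale[OF m(2)] norm_of_real by(simp add: True)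
   finally show ?thesis by(simp add: c_def)
  qed
  show ?thesis
   unfolding P[of ?z]
  proof (rule nn_integral_limit_le[OF _ _ part[unfolded excess_def]])
   show "(%s. indicator {1 / real (Suc n)<..} s * lam ?z s) : borel_measurable borel" for n
    by(rule decreasing_measurable(1)[OF decreasing_lam[OF zM]]) simp
   fix s
   show "(%n. indicator {1 / real (Suc n)<..} s * lam ?z s) ----> indicator {0<..} s * lam ?z s"
   proof (cases "0 < s")
    case True
    then obtain m where "inverse (real (Suc m)) < s" using reals_Archimedean by blast
    hence m: "1 / real (Suc n) < s" if "n >= m" for n
     using that frac_le[of 1 1 "real (Suc m)" "real (Suc n)"] by(simp add: inverse_eq_divide)
    have "\<forall>\<^sub>F n in sequentially. indicator {0<..} s * lam ?z s = indicator {1 / real (Suc n)<..} s * lam ?z s"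
     unfolding eventually_sequentially using m True by(intro exI[of _ m]) (simp add: indicator_def)
    thus ?thesis by(rule Lim_transform_eventually[OF tendsto_const])
   next
    case False
    hence "\<not> 1 / real (Suc n) < s" for n using order_less_trans[of 0 "1 / real (Suc n)" s] by auto
    thus ?thesis using False by(simp add: indicator_def)
   qed
  qed
 next
  case False
  hence p1: "1 < p" using p_ge_1 by simp
  define \<kappa> where "\<kappa> = (\<integral>\<^sup>+ v. indicator {1<..} v * ennreal (v powr (- p)) \<partial>lborel)"
  have "\<kappa> <= (\<integral>\<^sup>+ v. ennreal (v powr (- p)) * indicator {1..} v \<partial>lborel)"
   unfolding \<kappa>_def by(intro nn_integral_mono) (auto simp: indicator_def)
  also have "... = ennreal (0 - 1 powr (1 - p) / (1 - p))"
  proof (rule nn_integral_FTC_atLeast[where F = "%v. v powr (1 - p) / (1 - p)"])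
   show "DERIV (%v. v powr (1 - p) / (1 - p)) v :> v powr (- p)" if "1 <= v" for v
    using DERIV_cdivide[OF has_real_derivative_powr[of v "1 - p"], of "1 - p"] that p1 by simp
   show "((%v. v powr (1 - p) / (1 - p)) \<longlongrightarrow> 0) at_top"
    using p1 by real_asymp
  qed auto
  finally have \<kappa>1: "\<kappa> < \<infinity>" by(rule le_less_trans) simp
  \<comment> \<open>A crude lower bound from (1, 2] alone makes the constant positive and hence
    cancellable.\<close>
  have "ennreal (2 powr (- p)) = (\<integral>\<^sup>+ v. ennreal (2 powr (- p)) * indicator {1<..2::real} v \<partial>lborel)"
   by(subst nn_integral_cmult_indicator) auto
  also have "... <= \<kappa>"
   unfolding \<kappa>_def
  proof (rule nn_integral_mono)
   fix v :: real
   have "2 powr (- p) <= v powr (- p)" if "1 < v" "v <= 2"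
    using that p1 by(intro powr_mono2') auto
   thus "ennreal (2 powr (- p)) * indicator {1<..2} v <= indicator {1<..} v * ennreal (v powr (- p))"
    by(auto simp: indicator_def ennreal_leI)
  qed
  finally have \<kappa>0: "0 < \<kappa>" by(rule less_le_trans[rotated]) simp
  have "\<kappa> * Phi ?z = (\<integral>\<^sup>+ u. indicator {0<..} u * mean_excess ?z (u powr (1 / p)) \<partial>lborel)"
   unfolding nn_integral_mean_excess(1)[OF zM] \<kappa>_def ..
  also have "... <= (\<integral>\<^sup>+ u. ennreal (1 - t) * (indicator {0<..} u * mean_excess x (u powr (1 / p)))
    + ennreal t * (indicator {0<..} u * mean_excess y (u powr (1 / p))) \<partial>lborel)"
   using mean_excess_convex[OF x y _ t] by(intro nn_integral_mono) (simp add: indicator_def)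
  also have "... = \<kappa> * (ennreal (1 - t) * Phi x + ennreal t * Phi y)"
   using nn_integral_mean_excess(2)[OF m(1)] nn_integral_mean_excess(2)[OF m(2)]
   by(simp add: nn_integral_add nn_integral_cmult nn_integral_mean_excess(1) m \<kappa>_def distrib_left mult.left_commute)
  finally show ?thesis using \<kappa>0 \<kappa>1 by(subst (asm) ennreal_mult_le_mult_iff) auto
 qed
qed

lemma Lp_norm_powr: "x : LP ==> Phi x = ennreal (Lp_norm \<tau> p x powr p)"
 using p_pos LP_finite[of x] by(simp add: Lp_norm_eq LP_MO powr_powr)

text \<open>Convexity of the p-th power plus homogeneity: with x and y normalized, the sum is a + b
  times their convex combination of weight t = b / (a + b).\<close>

lemma minkowski:
 assumes x: "x : LP" and y: "y : LP"
 shows "Lp_norm \<tau> p (strong_add x y) <= Lp_norm \<tau> p x + Lp_norm \<tau> p y"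
proof -
 note m = LP_MO[OF x] LP_MO[OF y]
 define a b where "a = Lp_norm \<tau> p x" and "b = Lp_norm \<tau> p y"
 have nn: "0 <= a" "0 <= b" by(simp_all add: a_def b_def Lp_norm_def)
 have z: "w = UNIV \<times> {0}" if "w : LP" "Lp_norm \<tau> p w = 0" for w
  by(rule Phi_eq_0) (use that p_pos in "simp_all add: LP_MO Lp_norm_powr")
 show ?thesis
 proof (cases "a = 0 \<or> b = 0")
  case True
  thus ?thesis
   using z[OF x] z[OF y] strong_zero_add[OF m(2)] strong_add_zero[OF m(1)] nn by(auto simp: a_def b_def)
 next
  case False
  hence ab: "0 < a" "0 < b" "0 < a + b" using nn by auto
  define t where "t = b / (a + b)"
  have t: "0 < t" "t < 1" "1 - t = a / (a + b)" using ab by(simp_all add: t_def field_simps)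
  define x' y' where "x' = strong_scale (complex_of_real (1 / a)) x" and "y' = strong_scale (complex_of_real (1 / b)) y"
  have xy': "x' : LP" "y' : LP" by(simp_all add: x'_def y'_def LP_scale x y)
  have "Phi x' = 1" "Phi y' = 1"
   using ab p_pos by(simp_all add: x'_def y'_def Phi_scale m Lp_norm_powr[OF x] Lp_norm_powr[OF y] a_def[symmetric] b_def[symmetric]
     ennreal_mult[symmetric] powr_mult[symmetric] del: of_real_divide)
  define z where "z = strong_add (strong_scale (complex_of_real (1 - t)) x') (strong_scale (complex_of_real t) y')"
  have zM: "z : MO" unfolding z_def by(intro MO_intros LP_MO xy')
  have "Phi z <= ennreal (1 - t) * 1 + ennreal t * 1"
   using Phi_convex[OF xy' t(1,2)] `Phi x' = 1` `Phi y' = 1` by(simp add: z_def)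
  also have "... = 1" using t by(simp flip: ennreal_plus)
  finally have z1: "Phi z <= 1" .
  have r: "(a + b) * ((1 - t) * (1 / a)) = 1" "(a + b) * (t * (1 / b)) = 1"
   unfolding t(3) unfolding t_def using ab by simp_all
  have "complex_of_real (a + b) * (complex_of_real (1 - t) * complex_of_real (1 / a)) = 1"
   "complex_of_real (a + b) * (complex_of_real t * complex_of_real (1 / b)) = 1"
   by(simp_all only: of_real_mult[symmetric] r of_real_1)
  hence "strong_scale (complex_of_real (a + b)) z = strong_add x y"
   unfolding z_def x'_def y'_def using m by(simp add: strong_scale_add strong_scale_scale strong_scale_one MO_intros del: of_real_add of_real_diff of_real_divide)
  hence "Phi (strong_add x y) = ennreal ((a + b) powr p) * Phi z"
   using Phi_scale[OF zM, of "complex_of_real (a + b)"] ab by(simp del: of_real_add)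
  also have "... <= ennreal ((a + b) powr p) * 1" by(intro mult_left_mono z1) simp
  finally have "enn2real (Phi (strong_add x y)) <= (a + b) powr p" by(simp add: enn2real_leI)
  hence "enn2real (Phi (strong_add x y)) powr (1 / p) <= ((a + b) powr p) powr (1 / p)"
   using p_pos by(intro powr_mono2) auto
  thus ?thesis using ab p_pos by(simp add: Lp_norm_eq MO_intros m powr_powr a_def b_def)
 qed
qed

end

section \<open>The two topologies\<close>

lemma mtopology_le:
 assumes d: "Metric_space X d" "Metric_space X e"
  and "!!x u. x : X ==> 0 < u ==> EX v>0. ALL y:X. d x y < v --> e x y < u"
  and U: "openin (Metric_space.mtopology X e) U"
 shows "openin (Metric_space.mtopology X d) U"
proof -
 note b = Metric_space.in_mball[OF d(1)] Metric_space.in_mball[OF d(2)]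
 have "EX r>0. Metric_space.mball X d x r \<subseteq> U" if x: "x : U" for x
 proof -
  obtain r where r: "0 < r" "Metric_space.mball X e x r \<subseteq> U" and xX: "x : X"
   using U x unfolding Metric_space.openin_mtopology[OF d(2)] by blast
  then obtain v where "0 < v" "ALL y:X. d x y < v --> e x y < r" using assms(3) by blast
  thus ?thesis using r(2) xX by(intro exI[of _ v]) (auto simp: b subset_iff)
 qed
 thus ?thesis using U unfolding Metric_space.openin_mtopology[OF d(1)] Metric_space.openin_mtopology[OF d(2)] by blast
qed

context lp_vna
begin

lemma Lp_norm_nonneg: "0 <= Lp_norm \<tau> p x"
 by(simp add: Lp_norm_def)

lemma Lp_norm_less_iff: "x : LP ==> 0 < r ==> Lp_norm \<tau> p x < r \<longleftrightarrow> Phi x < ennreal (r powr p)"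
 using p_pos Lp_norm_nonneg[of x] powr_less_mono2[of p "Lp_norm \<tau> p x" r] powr_mono2[of p r "Lp_norm \<tau> p x"]
 by(auto simp: Lp_norm_powr ennreal_less_iff not_less[symmetric])

lemma strong_diff_self: "x : MO ==> strong_diff x x = UNIV \<times> {0}"
 using strong_scale_left_add[of x 1 "-1"] by(simp add: strong_scale_one strong_scale_0 strong_diff_def)

lemma Metric_space_Lp: "Metric_space LP (Lp_dist M \<tau> p)"
proof
 note D = Lp_dist_def[of M \<tau> p]
 show "0 <= Lp_dist M \<tau> p x y" for x y by(simp add: D Lp_norm_nonneg)
 show "Lp_dist M \<tau> p x y = Lp_dist M \<tau> p y x" for x y
  by(simp add: D Lp_norm_eq LP_MO strong_diff_MO Phi_swap[of x y])
 show "Lp_dist M \<tau> p x y = 0 \<longleftrightarrow> x = y" if "x : LP" "y : LP" for x y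
 proof
  note m = LP_MO[OF that(1)] LP_MO[OF that(2)]
  assume "Lp_dist M \<tau> p x y = 0"
  hence "Phi (strong_diff x y) = 0" using that p_pos by(simp add: D Lp_norm_powr LP_diff)
  thus "x = y" by(rule strong_diff_eq_zero[OF m Phi_eq_0[OF strong_diff_MO[OF m]]])
 next
  assume "x = y"
  thus "Lp_dist M \<tau> p x y = 0"
   using that by(simp add: D strong_diff_self LP_MO Lp_norm_eq zero_op_MO Phi_zero)
 qed
 show "Lp_dist M \<tau> p x z <= Lp_dist M \<tau> p x y + Lp_dist M \<tau> p y z" if "x : LP" "y : LP" "z : LP" for x y z
  using minkowski[OF LP_diff[OF that(1,2)] LP_diff[OF that(2,3)]] that by(simp add: D strong_diff_trans LP_MO)
qed

lemma measure_dist_le: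
 assumes "x : MO" "y : MO" "0 <= r" "lam (strong_diff x y) r <= ennreal r"
 shows "measure_dist M \<tau> x y <= r"
proof -
 have "r : {t. 0 <= t & singular_value \<tau> (strong_diff x y) t <= ennreal t}"
  using assms by(simp add: sv_le_iff strong_diff_MO)
 thus ?thesis using assms(1,2) by(auto simp: measure_dist_def intro!: cInf_lower bdd_belowI[of _ 0])
qed

lemma lam_le_of_measure_dist:
 assumes xy: "x : MO" "y : MO" and r: "measure_dist M \<tau> x y < r"
 shows "lam (strong_diff x y) r <= ennreal r" "0 < r"
proof -
 let ?S = "{t. 0 <= t & singular_value \<tau> (strong_diff x y) t <= ennreal t}"
 note m = strong_diff_MO[OF xy]
 \<comment> \<open>The set must be nonempty for its real infimum to be meaningful; max s 1 is a
   member because \<open>lam\<close> is below 1 there.\<close>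
 obtain s where s: "0 <= s" "lam (strong_diff x y) s < ennreal 1" by(rule lam_small[OF m zero_less_one])
 have "lam (strong_diff x y) (max s 1) <= lam (strong_diff x y) s" by(rule lam_antimono[OF m]) simp
 also have "... <= ennreal (max s 1)" using s(2) by(rule order_trans[OF less_imp_le]) simp
 finally have "max s 1 : ?S" using s by(simp add: sv_le_iff m)
 hence ne: "?S ~= {}" by blast
 have "Inf ?S < r" using r xy by(simp add: measure_dist_def)
 then obtain t where t: "t : ?S" "t < r" using cInf_lessD[OF ne] by blast
 hence "0 <= t" "lam (strong_diff x y) t <= ennreal t" using sv_le_iff[OF m, of t t] by auto
 thus "lam (strong_diff x y) r <= ennreal r" "0 < r"
  using t(2) lam_antimono[OF m, of t r] ennreal_leI[of t r] by(auto intro: order_trans)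
qed

lemma Metric_space_measure: "Metric_space MO (measure_dist M \<tau>)"
proof
 have nn: "0 <= measure_dist M \<tau> x y" for x y
 proof (cases "x : MO & y : MO")
  case True
  thus ?thesis using lam_le_of_measure_dist(2)[of x y] by(intro leI notI) (metis less_irrefl)
 qed (auto simp: measure_dist_def)
 thus "0 <= measure_dist M \<tau> x y" for x y .
 have le: "measure_dist M \<tau> x y <= measure_dist M \<tau> y x" if "x : MO" "y : MO" for x y
 proof (rule field_le_epsilon)
  fix e :: real assume "0 < e"
  hence "measure_dist M \<tau> y x < measure_dist M \<tau> y x + e" by simp
  note l = lam_le_of_measure_dist[OF that(2,1) this]
  show "measure_dist M \<tau> x y <= measure_dist M \<tau> y x + e"
   using l that by(intro measure_dist_le) (simp_all add: lam_diff_swap[of x y])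
 qed
 show "measure_dist M \<tau> x y = measure_dist M \<tau> y x" for x y
  using le[of x y] le[of y x] by(cases "x : MO & y : MO") (auto simp: measure_dist_def)
 show "measure_dist M \<tau> x y = 0 \<longleftrightarrow> x = y" if "x : MO" "y : MO" for x y
 proof
  note m = strong_diff_MO[OF that]
  assume 0: "measure_dist M \<tau> x y = 0"
  have "lam (strong_diff x y) s = 0" if s: "0 < s" for s
  proof -
   have "lam (strong_diff x y) s <= 0 + ennreal e" if e: "0 < e" for e
   proof -
    have "lam (strong_diff x y) s <= lam (strong_diff x y) (min s e)" by(rule lam_antimono[OF m]) simp
    also have "... <= ennreal (min s e)" by(rule lam_le_of_measure_dist[OF `x : MO` `y : MO`]) (use 0 s e in simp)
    also have "... <= ennreal e" by(rule ennreal_leI) simp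
    finally show ?thesis by simp
   qed
   hence "lam (strong_diff x y) s <= 0" by(rule ennreal_le_epsilon)
   thus ?thesis by simp
  qed
  thus "x = y" by(rule strong_diff_eq_zero[OF that zero_op_of_lam[OF m]])
 next
  assume "x = y"
  hence "measure_dist M \<tau> x y <= 0"
   using that by(intro measure_dist_le) (simp_all add: strong_diff_self lam_zero_op)
  thus "measure_dist M \<tau> x y = 0" using nn[of x y] by simp
 qed
 show "measure_dist M \<tau> x z <= measure_dist M \<tau> x y + measure_dist M \<tau> y z" if "x : MO" "y : MO" "z : MO" for x y z
 proof (rule field_le_epsilon)
  fix e :: real assume e: "0 < e"
  define a b where "a = measure_dist M \<tau> x y + e / 2" and "b = measure_dist M \<tau> y z + e / 2"
  have a: "lam (strong_diff x y) a <= ennreal a" "0 < a" and b: "lam (strong_diff y z) b <= ennreal b" "0 < b"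
   using lam_le_of_measure_dist[OF that(1,2), of a] lam_le_of_measure_dist[OF that(2,3), of b] e by(simp_all add: a_def b_def)
  have "lam (strong_diff x z) (a + b) <= lam (strong_diff x y) a + lam (strong_diff y z) b"
   using lam_add[OF strong_diff_MO[OF that(1,2)] strong_diff_MO[OF that(2,3)], of a b] a b by(simp add: strong_diff_trans that)
  also have "... <= ennreal (a + b)" using a b add_mono[OF a(1) b(1)] by simp
  finally have "measure_dist M \<tau> x z <= a + b" using a b that by(intro measure_dist_le) simp_all
  thus "measure_dist M \<tau> x z <= measure_dist M \<tau> x y + measure_dist M \<tau> y z + e" by(simp add: a_def b_def)
 qed
qed

text \<open>Chebyshev's inequality always makes the norm topology finer on X. For the converse,
  scaling carries the uniform lower bound from unit vectors to all differences of norm at least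
  u.\<close>

lemma strongly_embeddedI:
 assumes X: "Lp_subspace M \<tau> p X" and s: "0 < s" "0 < b"
  and low: "!!z. z : X ==> Phi z = 1 ==> ennreal b < lam z s"
 shows "strongly_embedded M \<tau> p X"
proof -
 have XL: "X \<subseteq> LP" using X by(simp add: Lp_subspace_def)
 hence XM: "X \<subseteq> MO" using LP_MO by blast
 have diff: "strong_diff x y : X" if "x : X" "y : X" for x y
  using X that unfolding Lp_subspace_def strong_diff_def by blast
 have sL: "Submetric LP (Lp_dist M \<tau> p) X" and sM: "Submetric MO (measure_dist M \<tau>) X"
  using Metric_space_Lp Metric_space_measure XL XM by(auto simp: Submetric_def Submetric_axioms_def)
 note mL = Metric_space.subspace[OF Metric_space_Lp XL] and mM = Metric_space.subspace[OF Metric_space_measure XM]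
 have "openin (Metric_space.mtopology X (Lp_dist M \<tau> p)) U \<longleftrightarrow> openin (Metric_space.mtopology X (measure_dist M \<tau>)) U" for U
 proof
  assume "openin (Metric_space.mtopology X (measure_dist M \<tau>)) U"
  thus "openin (Metric_space.mtopology X (Lp_dist M \<tau> p)) U"
  proof (rule mtopology_le[OF mL mM, rotated])
   fix x and u :: real assume x: "x : X" and e: "0 < u"
   define r where "r = u / 2"
   \<comment> \<open>Chebyshev's inequality at level r asks for v^p = r^p r.\<close>
   define v where "v = (r powr p * r) powr (1 / p)"
   have r: "0 < r" "r < u" and d: "0 < v" using e by(simp_all add: r_def v_def)
   have dp: "v powr p = r powr p * r" using r p_pos by(simp add: v_def powr_powr)
   have "measure_dist M \<tau> x y < u" if y: "y : X" "Lp_dist M \<tau> p x y < v" for y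
   proof -
    have xy: "x : LP" "y : LP" using x y XL by auto
    note w = LP_diff[OF xy]
    have "Phi (strong_diff x y) < ennreal (v powr p)"
     using y(2) xy Lp_norm_less_iff[OF w d] by(simp add: Lp_dist_def)
    hence "ennreal (r powr p) * lam (strong_diff x y) r <= ennreal (r powr p) * ennreal r"
     using Phi_ge[OF LP_MO[OF w] r(1)] r by(simp add: dp ennreal_mult[symmetric])
    hence "lam (strong_diff x y) r <= ennreal r" using r by(subst (asm) ennreal_mult_le_mult_iff) auto
    thus ?thesis using measure_dist_le[of x y r] xy r by(simp add: LP_MO)
   qed
   thus "EX v>0. ALL y:X. Lp_dist M \<tau> p x y < v --> measure_dist M \<tau> x y < u" using d by blast
  qed
 next
  assume "openin (Metric_space.mtopology X (Lp_dist M \<tau> p)) U"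
  thus "openin (Metric_space.mtopology X (measure_dist M \<tau>)) U"
  proof (rule mtopology_le[OF mM mL, rotated])
   fix x and u :: real assume x: "x : X" and e: "0 < u"
   \<comment> \<open>A vector of norm a >= u has \<open>lam\<close> above b at level s a, hence at
     every level up to s u; closeness v in measure would bound it by v <= b.\<close>
   define v where "v = min (s * u) b"
   have d: "0 < v" using s e by(simp add: v_def)
   have "Lp_dist M \<tau> p x y < u" if y: "y : X" "measure_dist M \<tau> x y < v" for y
   proof (rule ccontr)
    assume n: "\<not> Lp_dist M \<tau> p x y < u"
    have xy: "x : LP" "y : LP" using x y XL by auto
    define w where "w = strong_diff x y"
    have w: "w : LP" "w : X" unfolding w_def using LP_diff[OF xy] diff[OF x y(1)] by auto
    define a where "a = Lp_norm \<tau> p w"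
    have a: "u <= a" "0 < a" using n e xy by(simp_all add: a_def w_def Lp_dist_def)
    have "strong_scale (complex_of_real (1 / a)) w : X" using X w(2) by(auto simp: Lp_subspace_def)
    moreover have "Phi (strong_scale (complex_of_real (1 / a)) w) = 1"
     using a p_pos by(simp add: Phi_scale LP_MO[OF w(1)] Lp_norm_powr[OF w(1)] a_def[symmetric] ennreal_mult[symmetric] powr_mult[symmetric] del: of_real_divide)
    ultimately have "ennreal b < lam (strong_scale (complex_of_real (1 / a)) w) s" by(rule low)
    also have "... = lam w (s * a)" using lam_scale[OF LP_MO[OF w(1)], of s "complex_of_real (1 / a)"] s a by(simp del: of_real_divide)
    also have "... <= lam w v"
     using mult_left_mono[OF a(1), of s] s by(intro lam_antimono LP_MO w) (simp add: v_def min.coboundedI1)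
    also have "... <= ennreal v" unfolding w_def using xy by(intro lam_le_of_measure_dist y(2) LP_MO)
    also have "... <= ennreal b" by(intro ennreal_leI) (simp add: v_def)
    finally show False by simp
   qed
   thus "EX v>0. ALL y:X. measure_dist M \<tau> x y < v --> Lp_dist M \<tau> p x y < u" using d by blast
  qed
 qed
 thus ?thesis
  unfolding strongly_embedded_def Lp_topology_def measure_topology_def
   Submetric.mtopology_submetric[OF sL, symmetric] Submetric.mtopology_submetric[OF sM, symmetric] topology_eq
  by blast
qed

end

section \<open>Almost isometric copies of \<open>\<ell>\<^sup>p\<close>\<close>

context lp_vna
begin

section \<open>Partial sums and norm limits\<close>

abbreviation "N \<equiv> Lp_norm \<tau> p"

lemma N_scale: "x : LP ==> N (strong_scale c x) = cmod c * N x"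
 using p_pos by(simp add: Lp_norm_eq MO_intros LP_MO Phi_scale enn2real_mult powr_mult powr_powr)

lemma N_swap: "x : LP ==> y : LP ==> N (strong_diff x y) = N (strong_diff y x)"
 by(simp add: Lp_norm_eq MO_intros LP_MO Phi_swap)

lemma N_perturb: "x : LP ==> y : LP ==> N x <= N y + N (strong_diff x y)"
 using minkowski[OF LP_diff, of x y y] by(simp add: strong_diff_add LP_MO)

lemma strong_scale_zero: "strong_scale c (UNIV \<times> {0}) = (UNIV \<times> {0} :: 'h uop)"
proof -
 have "scaleC_op c oL (0 :: 'h bop) = 0" by(rule blinfun_eqI) (simp del: scaleC_op_apply add: blinfun.zero_right)
 thus ?thesis by(simp add: zero_op graph_of_scale)
qed

primrec psum :: "(nat => complex) => (nat => 'h uop) => nat => 'h uop" where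
 "psum a z 0 = UNIV \<times> {0}"
| "psum a z (Suc n) = strong_add (psum a z n) (strong_scale (a n) (z n))"

lemma psum_MO: "(!!k. z k : MO) ==> psum a z n : MO"
 by(induction n) (auto intro: MO_intros)

lemma psum_add:
 assumes z: "!!k. z k : MO"
 shows "psum (%k. a k + b k) z n = strong_add (psum a z n) (psum b z n)"
proof (induction n)
 case (Suc n)
 thus ?case
  using strong_add_interchange[OF psum_MO[of z a n, OF z] psum_MO[of z b n, OF z] strong_scale_MO[OF z, of "a n" n] strong_scale_MO[OF z, of "b n" n]]
  by(simp add: strong_scale_left_add z)
qed (simp add: strong_add_zero zero_op_MO)

lemma psum_scale:
 assumes z: "!!k. z k : MO"
 shows "psum (%k. c * a k) z n = strong_scale c (psum a z n)"
proof (induction n)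
 case (Suc n)
 thus ?case
  using strong_scale_add[OF psum_MO[of z a n, OF z] strong_scale_MO[OF z, of "a n" n]]
  by(simp add: strong_scale_scale z)
qed (simp add: strong_scale_zero)

lemma psum_diff:
 assumes z: "!!k. z k : MO"
 shows "psum (%k. a k - b k) z n = strong_diff (psum a z n) (psum b z n)"
 using psum_add[of z a "%k. (-1) * b k" n, OF z] psum_scale[of z "-1" b n, OF z] by(simp add: strong_diff_def)

lemma psum_diff_right:
 assumes z: "!!k. z k : MO" and y: "!!k. y k : MO"
 shows "psum a (%k. strong_diff (z k) (y k)) n = strong_diff (psum a z n) (psum a y n)"
proof (induction n)
 case (Suc n)
 thus ?case
  using strong_diff_interchange[OF psum_MO[of z a n, OF z] strong_scale_MO[OF z, of "a n" n] psum_MO[of y a n, OF y] strong_scale_MO[OF y, of "a n" n]]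
  by(simp add: strong_diff_scale z y)
qed (simp add: strong_diff_zero zero_op_MO)

lemma psum_graph: "(!!k. w k : M) ==> psum a (%k. graph_of (w k)) n = graph_of (csum a w n)"
proof (induction n)
 case (Suc n)
 thus ?case
  by(simp add: graph_of_scale graph_of_add[OF csum_M scaleC_compose_M]) (simp add: csum_def)
qed (simp add: csum_def zero_op)

text \<open>Lets two partial sums be subtracted as sums of the same length.\<close>

lemma psum_cut:
 assumes z: "!!k. z k : MO" and nm: "n <= m"
 shows "psum a z n = psum (%k. if k < n then a k else 0) z m"
proof -
 have le: "psum a z i = psum (%k. if k < n then a k else 0) z i" if "i <= n" for i
  using that by(induction i) simp_all
 show ?thesis
  using nm
 proof (induction m rule: dec_induct)
  case (step m)
  thus ?case
   using strong_add_zero[OF psum_MO[of z "%k. if k < n then a k else 0" m, OF z]] by(simp add: strong_scale_0 z)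
 qed (rule le, simp)
qed

lemma zero_LP: "UNIV \<times> {0} : LP"
 by(simp add: LP_iff zero_op_MO Phi_zero)

lemma psum_LP: "(!!k. z k : LP) ==> psum a z n : LP"
 by(induction n) (simp_all add: zero_LP LP_add LP_scale)

lemma N_psum_le: "(!!k. z k : LP) ==> N (psum a z n) <= (\<Sum>k<n. cmod (a k) * N (z k))"
proof (induction n)
 case 0 thus ?case using p_pos by(simp add: Lp_norm_eq zero_op_MO Phi_zero)
next
 case (Suc n)
 thus ?case using minkowski[OF psum_LP LP_scale, of z "z n" a n "a n"] by(simp add: N_scale)
qed

definition plim :: "'h uop => (nat => 'h uop) => bool" where
 "plim y u \<longleftrightarrow> y : LP & (ALL n. u n : LP) & (%n. N (strong_diff y (u n))) ----> 0"

lemma plimD: "plim y u ==> y : LP" "plim y u ==> u n : LP" "plim y u ==> (%n. N (strong_diff y (u n))) ----> 0"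
 by(simp_all add: plim_def)

lemma plim_add:
 assumes y: "plim y u" and x: "plim x v"
 shows "plim (strong_add y x) (%n. strong_add (u n) (v n))"
proof -
 note m = plimD[OF y] plimD[OF x]
 have "N (strong_diff (strong_add y x) (strong_add (u n) (v n))) <= N (strong_diff y (u n)) + N (strong_diff x (v n))" for n
  using minkowski[OF LP_diff LP_diff] m by(simp add: strong_diff_interchange LP_MO)
 hence "(%n. N (strong_diff (strong_add y x) (strong_add (u n) (v n)))) ----> 0"
  by(intro tendsto_0_le[OF tendsto_add_zero[OF m(3,6)], of _ 1]) (auto simp: Lp_norm_nonneg)
 thus ?thesis using m by(simp add: plim_def LP_add)
qed

lemma plim_scale: "plim y u ==> plim (strong_scale c y) (%n. strong_scale c (u n))"
 by(simp add: plim_def LP_scale strong_diff_scale LP_MO N_scale LP_diff tendsto_mult_right_zero)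

lemma plim_norm:
 assumes y: "plim y u"
 shows "(%n. N (u n)) ----> N y"
proof -
 note m = plimD[OF y]
 have "\<bar>N (u n) - N y\<bar> <= N (strong_diff y (u n))" for n
  using N_perturb[OF m(1,2), of n] N_perturb[OF m(2,1), of n] N_swap[OF m(1,2), of n] by linarith
 thus ?thesis by(intro LIM_zero_cancel[OF tendsto_0_le[OF m(3), of _ 1]]) (simp add: Lp_norm_nonneg)
qed

lemma N_zero: "N (UNIV \<times> {0}) = 0"
 using p_pos by(simp add: Lp_norm_eq zero_op_MO Phi_zero)

lemma N_zeroD: "x : LP ==> N x = 0 ==> x = UNIV \<times> {0}"
 by(rule Phi_eq_0) (simp_all add: LP_MO Lp_norm_powr)

lemma plim_unique:
 assumes y: "plim y u" and x: "plim x u"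
 shows "y = x"
proof -
 note m = plimD[OF y] plimD[OF x]
 have "N (strong_diff y x) <= N (strong_diff y (u n)) + N (strong_diff x (u n))" for n
  using minkowski[OF LP_diff[OF m(1,2)] LP_diff[OF m(2,4)], of n n] N_swap[OF m(4,2), of n] by(simp add: strong_diff_trans LP_MO m)
 hence "N (strong_diff y x) <= 0" by(intro LIMSEQ_le_const[OF tendsto_add_zero[OF m(3,6)]]) simp
 hence "strong_diff y x = UNIV \<times> {0}" using Lp_norm_nonneg[of "strong_diff y x"] by(intro N_zeroD LP_diff m) simp
 thus ?thesis by(rule strong_diff_eq_zero[OF LP_MO[OF m(1)] LP_MO[OF m(4)]])
qed

lemma plim_exists:
 assumes u: "!!n. u n : LP" and cauchy: "!!e. 0 < e ==> EX K. ALL m>=K. ALL n>=m. N (strong_diff (u n) (u m)) < e"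
 obtains y where "plim y u"
proof -
 note m = LP_MO[OF u]
 have "EX K. ALL i>=K. ALL n>=K. Phi (strong_diff (u i) (u n)) <= ennreal v" if e: "0 < v" for v
 proof -
  have e': "0 < v powr (1 / p)" "(v powr (1 / p)) powr p = v" using e p_pos by(simp_all add: powr_powr)
  obtain K where K: "ALL i>=K. ALL n>=i. N (strong_diff (u n) (u i)) < v powr (1 / p)" using cauchy[OF e'(1)] by blast
  have "Phi (strong_diff (u i) (u n)) <= ennreal v" if "i >= K" "n >= K" for i n
  proof -
   have "N (strong_diff (u i) (u n)) < v powr (1 / p)"
    using K[rule_format, OF that(1), of n] K[rule_format, OF that(2), of i] N_swap[OF u u, of i n] by(cases "i <= n") simp_all
   thus ?thesis using Lp_norm_less_iff[OF LP_diff[OF u u] e'(1)] by(simp add: e'(2))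
  qed
  thus ?thesis by blast
 qed
 then obtain y where y: "y : MO" "!!v. 0 < v ==> EX K. ALL n>=K. Phi (strong_diff y (u n)) <= ennreal v"
  using Phi_complete[of u, OF m] by blast
 obtain n where "Phi (strong_diff y (u n)) <= ennreal 1" using y(2)[of 1] by auto
 hence "strong_diff y (u n) : LP" using y(1) m[of n] by(auto simp: LP_iff MO_intros intro: le_less_trans)
 hence yL: "y : LP" using LP_add[OF _ u[of n]] strong_diff_add[OF y(1) m[of n]] by metis
 have "(%n. N (strong_diff y (u n))) ----> 0"
 proof (rule LIMSEQ_I)
  fix r :: real assume r: "0 < r"
  hence r2: "0 < (r / 2) powr p" "(r / 2) powr p < r powr p" using p_pos by(simp_all add: powr_less_mono2)
  obtain K where K: "!!n. n >= K ==> Phi (strong_diff y (u n)) <= ennreal ((r / 2) powr p)" using y(2)[OF r2(1)] by blast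
  have "N (strong_diff y (u n)) < r" if "n >= K" for n
   unfolding Lp_norm_less_iff[OF LP_diff[OF yL u] r]
   by(rule le_less_trans[OF K[OF that]]) (use r2 in "simp add: ennreal_less_iff")
  thus "EX K. ALL n>=K. norm (N (strong_diff y (u n)) - 0) < r" by(auto simp: Lp_norm_nonneg)
 qed
 thus ?thesis using that[of y] u yL by(simp add: plim_def)
qed

lemma closedin_plim:
 assumes cl: "closedin (Lp_topology M \<tau> p) X" and y: "plim y u" and u: "!!n. u n : X"
 shows "y : X"
proof (rule ccontr)
 assume "y \<notin> X"
 then obtain r where r: "0 < r" "disjnt X (Metric_space.mball LP (Lp_dist M \<tau> p) y r)"
  using cl plimD(1)[OF y] unfolding Lp_topology_def Metric_space.closedin_metric[OF Metric_space_Lp] by blast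
 obtain n where "N (strong_diff y (u n)) < r"
  using order_tendstoD(2)[OF plimD(3)[OF y] r(1)] by(auto simp: eventually_sequentially)
 thus False using r(2) u[of n] plimD[OF y] by(auto simp: disjnt_iff Metric_space.in_mball[OF Metric_space_Lp] Lp_dist_def)
qed

end

text \<open>The allowed errors add up to \<eta> over all k, which absorbs any coefficients of
  modulus at most 1; \<eta> < 1/2 keeps the lower bound 1 - 2 \<eta> positive.\<close>

locale almost_disjoint = lp_vna M \<tau> p for M :: "'h::complex_hilbert_space bop set" and \<tau> and p +
 fixes z :: "nat => 'h uop" and w :: "nat => 'h bop" and \<eta> :: real
 assumes z: "z k : LP" and N_z: "N (z k) = 1" and w: "w k : M" and gw: "graph_of (w k) : LP"
  and left: "j ~= k ==> radj (w j) (w k v) = 0" and right: "j ~= k ==> w j (radj (w k) v) = 0"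
  and close: "N (strong_diff (z k) (graph_of (w k))) <= \<eta> * (1/2) ^ Suc k" and \<eta>: "0 < \<eta>" "\<eta> < 1/2"
begin

definition mass :: "(nat => complex) => nat => real" where "mass a n = (\<Sum>k<n. cmod (a k) powr p)"

abbreviation "R a n \<equiv> mass a n powr (1 / p)"
abbreviation "S a n \<equiv> psum a z n"

lemma mass_nonneg: "0 <= mass a n" by(simp add: mass_def sum_nonneg)

lemma mass_mono: "n <= m ==> mass a n <= mass a m"
 unfolding mass_def by(intro sum_mono2) auto

lemmas z_MO = LP_MO[OF z]
lemmas S_LP = psum_LP[of z, OF z]

lemma coeff_le: "k < n ==> cmod (a k) <= R a n"
proof -
 assume "k < n"
 hence "cmod (a k) powr p <= mass a n" unfolding mass_def by(intro member_le_sum) auto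
 hence "(cmod (a k) powr p) powr (1 / p) <= R a n" using p_pos by(intro powr_mono2) auto
 thus ?thesis using p_pos by(simp add: powr_powr)
qed

lemma N_gw: "1 - \<eta> <= N (graph_of (w k))" "N (graph_of (w k)) <= 1 + \<eta>"
proof -
 have "(1/2::real) ^ Suc k <= 1" by(rule power_le_one) auto
 hence "N (strong_diff (z k) (graph_of (w k))) <= \<eta>" using close[of k] mult_left_le[of "(1/2) ^ Suc k" \<eta>] \<eta> by linarith
 thus "1 - \<eta> <= N (graph_of (w k))" "N (graph_of (w k)) <= 1 + \<eta>"
  using N_perturb[OF z gw, of k k] N_perturb[OF gw z, of k k] N_swap[OF z gw, of k k] N_z[of k] by linarith+
qed

text \<open>The p-th root of the mass dominates every coefficient and can be taken out; the
  remaining geometric sum is below 1.\<close>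

lemma N_error: "N (strong_diff (S a n) (graph_of (csum a w n))) <= \<eta> * R a n"
proof -
 have "N (strong_diff (S a n) (graph_of (csum a w n))) = N (psum a (%k. strong_diff (z k) (graph_of (w k))) n)"
  by(simp add: psum_diff_right[of z "%k. graph_of (w k)", OF z_MO graph_of_MO[OF w]] psum_graph w)
 also have "... <= (\<Sum>k<n. cmod (a k) * N (strong_diff (z k) (graph_of (w k))))" by(intro N_psum_le LP_diff z gw)
 also have "... <= (\<Sum>k<n. R a n * (\<eta> * (1/2) ^ Suc k))"
  by(intro sum_mono mult_mono coeff_le close) (auto simp: Lp_norm_nonneg)
 also have "... = \<eta> * R a n * (\<Sum>k<n. (1/2) ^ Suc k)" by(simp add: sum_distrib_left mult_ac)
 also have "(\<Sum>k<n. (1/2::real) ^ Suc k) = 1 - (1/2) ^ n" by(induction n) auto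
 also have "\<eta> * R a n * (1 - (1/2) ^ n) <= \<eta> * R a n" using \<eta> by(intro mult_left_le) auto
 finally show ?thesis .
qed

lemma N_csum: "(1 - \<eta>) * R a n <= N (graph_of (csum a w n))" "N (graph_of (csum a w n)) <= (1 + \<eta>) * R a n"
proof -
 have "Phi (graph_of (csum a w n)) = (\<Sum>k<n. ennreal (cmod (a k) powr p * N (graph_of (w k)) powr p))"
  by(simp add: Phi_csum[of w, OF w left right] Lp_norm_powr[OF gw] ennreal_mult)
 hence eq: "N (graph_of (csum a w n)) = (\<Sum>k<n. cmod (a k) powr p * N (graph_of (w k)) powr p) powr (1 / p)"
  by(simp add: Lp_norm_eq graph_of_MO csum_M w sum_nonneg)
 have c: "c * R a n = (\<Sum>k<n. cmod (a k) powr p * c powr p) powr (1 / p)" if "0 <= c" for c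
 proof -
  have "(\<Sum>k<n. cmod (a k) powr p * c powr p) = mass a n * c powr p" by(simp add: mass_def sum_distrib_right)
  thus ?thesis using that p_pos mass_nonneg[of a n] by(simp add: powr_mult powr_powr)
 qed
 show "(1 - \<eta>) * R a n <= N (graph_of (csum a w n))" "N (graph_of (csum a w n)) <= (1 + \<eta>) * R a n"
  using \<eta> p_pos N_gw unfolding eq
  by(subst c; (intro powr_mono2 sum_mono mult_left_mono sum_nonneg mult_nonneg_nonneg)?; simp add: Lp_norm_nonneg)+
qed

lemma N_S: "(1 - 2 * \<eta>) * R a n <= N (S a n)" "N (S a n) <= (1 + 2 * \<eta>) * R a n"
proof -
 have s: "graph_of (csum a w n) : LP" using psum_LP[of "%k. graph_of (w k)" a n, OF gw] by(simp add: psum_graph w)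
 show "(1 - 2 * \<eta>) * R a n <= N (S a n)" "N (S a n) <= (1 + 2 * \<eta>) * R a n"
  using N_perturb[OF S_LP s, of a n] N_perturb[OF s S_LP, of a n] N_swap[OF S_LP s, of a n] N_error[of a n] N_csum[of a n]
  by(simp_all add: algebra_simps)
qed

lemma limit_exists:
 assumes a: "a : seq_lp p"
 shows "EX y. plim y (S a)"
proof -
 have sm: "summable (%k. cmod (a k) powr p)" using a by(simp add: seq_lp_def)
 have diff: "N (strong_diff (S a n) (S a m)) <= 2 * (\<Sum>k\<in>{m..<n}. cmod (a k) powr p) powr (1 / p)" if mn: "m <= n" for m n
 proof -
  \<comment> \<open>The difference of two partial sums is the longer sum with its first m
    coefficients set to 0, so the upper estimate applies to the block.\<close>
  let ?b = "%k. a k - (if k < m then a k else 0)"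
  have "strong_diff (S a n) (S a m) = S ?b n"
   unfolding psum_diff[of z, OF z_MO] by(simp add: psum_cut[of z, OF z_MO mn])
  moreover have "mass ?b n = (\<Sum>k\<in>{m..<n}. cmod (a k) powr p)"
   unfolding mass_def by(rule sum.mono_neutral_cong_right) (use p_pos in auto)
  moreover have "(1 + 2 * \<eta>) * R ?b n <= 2 * R ?b n" using \<eta> by(intro mult_right_mono) auto
  ultimately show ?thesis using N_S(2)[of ?b n] by simp
 qed
 have "EX K. ALL m>=K. ALL n>=m. N (strong_diff (S a n) (S a m)) < e" if e: "0 < e" for e
 proof -
  obtain K where K: "!!m n. m >= K ==> norm (\<Sum>k\<in>{m..<n}. cmod (a k) powr p) < (e / 2) powr p"
   using summable_Cauchy[THEN iffD1, OF sm] e by(metis half_gt_zero powr_gt_zero less_irrefl)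
  have "N (strong_diff (S a n) (S a m)) < e" if "m >= K" "n >= m" for m n
  proof -
   have "(\<Sum>k\<in>{m..<n}. cmod (a k) powr p) powr (1 / p) < ((e / 2) powr p) powr (1 / p)"
    using K[OF that(1), of n] p_pos by(intro powr_less_mono2) (auto simp: sum_nonneg)
   thus ?thesis using diff[OF that(2)] e p_pos by(simp add: powr_powr)
  qed
  thus ?thesis by blast
 qed
 thus ?thesis using plim_exists[of "S a", OF S_LP] by blast
qed

definition T :: "(nat => complex) => 'h uop" where "T a = (SOME y. plim y (S a))"

lemma T: "a : seq_lp p ==> plim (T a) (S a)"
 unfolding T_def by(rule someI_ex[OF limit_exists])

lemma T_eq: "plim y (S a) ==> T a = y"
 unfolding T_def by(rule plim_unique[OF someI[of "%y. plim y (S a)"]])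

lemma lp_linear_T: "lp_linear p T"
 unfolding lp_linear_def
proof (intro conjI ballI allI)
 fix a b assume ab: "a : seq_lp p" "b : seq_lp p"
 show "T (%n. a n + b n) = strong_add (T a) (T b)"
  using plim_add[OF T[OF ab(1)] T[OF ab(2)]] by(intro T_eq) (simp add: psum_add[of z, OF z_MO])
next
 fix c a assume a: "a : seq_lp p"
 show "T (%n. c * a n) = strong_scale c (T a)"
  using plim_scale[OF T[OF a], of c] by(intro T_eq) (simp add: psum_scale[of z, OF z_MO])
qed

lemma plim_lower:
 assumes y: "plim y (S a)"
 shows "(1 - 2 * \<eta>) * R a n <= N y"
proof (rule LIMSEQ_le_const[OF plim_norm[OF y]], intro exI allI impI)
 fix m assume "n <= m"
 hence "(1 - 2 * \<eta>) * R a n <= (1 - 2 * \<eta>) * R a m"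
  using \<eta> p_pos by(intro mult_left_mono powr_mono2 mass_mono) (auto simp: mass_nonneg)
 thus "(1 - 2 * \<eta>) * R a n <= N (S a m)" using N_S(1)[of a m] by linarith
qed

text \<open>The lower bound passes to limits and dominates every single coefficient, so a limit of
  norm 0 forces all coefficients of the difference to vanish.\<close>

lemma inj_T: "inj_on T (seq_lp p)"
proof (rule inj_onI)
 fix a b assume a: "a : seq_lp p" and b: "b : seq_lp p" and eq: "T a = T b"
 have "plim (strong_diff (T a) (T b)) (S (%k. a k + (-1) * b k))"
  using plim_add[OF T[OF a] plim_scale[OF T[OF b], of "-1"]]
  unfolding psum_add[of z, OF z_MO] psum_scale[of z, OF z_MO] strong_diff_def .
 moreover have "N (strong_diff (T a) (T b)) = 0"
  using plimD(1)[OF T[OF b]] by(simp add: eq strong_diff_self LP_MO N_zero)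
 ultimately have "(1 - 2 * \<eta>) * R (%k. a k + (-1) * b k) (Suc n) <= 0" for n using plim_lower by metis
 hence "R (%k. a k + (-1) * b k) (Suc n) <= 0" for n using \<eta> by(simp add: mult_le_0_iff)
 hence "cmod (a n + (-1) * b n) <= 0" for n
  using coeff_le[of n "Suc n" "%k. a k + (-1) * b k"] by(meson lessI order_trans)
 thus "a = b" by(simp add: fun_eq_iff)
qed

lemma N_T:
 assumes a: "a : seq_lp p"
 shows "N (T a) <= (1 + 2 * \<eta>) * seq_norm p a" "(1 - 2 * \<eta>) * seq_norm p a <= N (T a)"
proof -
 have "(%n. mass a n) ----> (\<Sum>k. cmod (a k) powr p)" unfolding mass_def using a by(simp add: seq_lp_def summable_LIMSEQ)
 hence "(%n. R a n) ----> seq_norm p a"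
  unfolding seq_norm_def using p_pos by(intro tendsto_powr2) (auto simp: mass_nonneg)
 hence "(%n. c * R a n) ----> c * seq_norm p a" for c by(intro tendsto_intros)
 thus "N (T a) <= (1 + 2 * \<eta>) * seq_norm p a" "(1 - 2 * \<eta>) * seq_norm p a <= N (T a)"
  using plim_norm[OF T[OF a]] N_S[of a] by(blast intro: LIMSEQ_le)+
qed

lemma op_norms:
 "op_norm (seq_lp p) (seq_norm p) N T * op_norm (T ` seq_lp p) N (seq_norm p) (inv_into (seq_lp p) T)
  <= ennreal ((1 + 2 * \<eta>) / (1 - 2 * \<eta>))"
proof -
 have "op_norm (seq_lp p) (seq_norm p) N T <= ennreal (1 + 2 * \<eta>)"
  unfolding op_norm_def
 proof (rule SUP_least, rule ennreal_leI)
  fix a assume "a : {v : seq_lp p. seq_norm p v <= 1}"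
  hence "N (T a) <= (1 + 2 * \<eta>) * seq_norm p a" "(1 + 2 * \<eta>) * seq_norm p a <= (1 + 2 * \<eta>) * 1"
   using N_T(1)[of a] \<eta> by(auto intro!: mult_left_mono)
  thus "N (T a) <= 1 + 2 * \<eta>" by(metis mult.right_neutral order_trans)
 qed
 moreover have "op_norm (T ` seq_lp p) N (seq_norm p) (inv_into (seq_lp p) T) <= ennreal (1 / (1 - 2 * \<eta>))"
  unfolding op_norm_def
 proof (rule SUP_least, rule ennreal_leI)
  fix v assume "v : {v : T ` seq_lp p. N v <= 1}"
  then obtain a where a: "a : seq_lp p" "v = T a" "N (T a) <= 1" by blast
  hence "(1 - 2 * \<eta>) * seq_norm p a <= 1" using N_T(2)[of a] by simp
  thus "seq_norm p (inv_into (seq_lp p) T v) <= 1 / (1 - 2 * \<eta>)"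
   unfolding a(2) inv_into_f_f[OF inj_T a(1)] using \<eta> by(simp add: pos_le_divide_eq mult.commute)
 qed
 ultimately have "op_norm (seq_lp p) (seq_norm p) N T * op_norm (T ` seq_lp p) N (seq_norm p) (inv_into (seq_lp p) T)
  <= ennreal (1 + 2 * \<eta>) * ennreal (1 / (1 - 2 * \<eta>))" by(intro mult_mono) auto
 also have "... = ennreal ((1 + 2 * \<eta>) / (1 - 2 * \<eta>))" using \<eta> by(subst ennreal_mult[symmetric]) auto
 finally show ?thesis .
qed

end

context lp_vna
begin

lemma almost_isometric_copies:
 assumes X: "Lp_subspace M \<tau> p X" and cl: "closedin (Lp_topology M \<tau> p) X"
  and H: "!!s \<eta>. 0 < s ==> 0 < \<eta> ==> EX z:X. Phi z = 1 & lam z s <= ennreal \<eta>"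
 shows "contains_almost_isometric_lp \<tau> p X"
 unfolding contains_almost_isometric_lp_def
proof (intro allI impI)
 fix u :: real assume e: "0 < u"
 \<comment> \<open>For \<eta> <= 1/4 the ratio (1 + 2 \<eta>) / (1 - 2 \<eta>) is at most 1 + 8
   \<eta>.\<close>
 define \<eta> where "\<eta> = min (1/4) (u / 8)"
 have \<eta>: "0 < \<eta>" "\<eta> <= 1/4" "8 * \<eta> <= u" using e by(simp_all add: \<eta>_def)
 \<comment> \<open>The p-th power appears because \<open>gliding_hump\<close> measures distances by
   \<open>Phi\<close>.\<close>
 have gk: "0 < (\<eta> * (1/2) ^ Suc k) powr p" for k using \<eta> by simp
 have XLP: "X \<subseteq> LP" using X by(simp add: Lp_subspace_def)
 obtain z w where zw: "!!k. z k : X" "!!k. Phi (z k) = 1" "!!k. w k : M"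
  "!!j k v. j ~= k ==> radj (w j) (w k v) = 0" "!!j k v. j ~= k ==> w j (radj (w k) v) = 0"
  "!!k. Phi (strong_diff (z k) (graph_of (w k))) <= ennreal ((\<eta> * (1/2) ^ Suc k) powr p)"
  by(rule gliding_hump[where g = "%k. (\<eta> * (1/2) ^ Suc k) powr p", OF XLP H gk]) blast+
 have zL: "z k : LP" for k using zw(1) XLP by blast
 have dM: "strong_diff (z k) (graph_of (w k)) : MO" "strong_diff (graph_of (w k)) (z k) : MO" for k
  by(intro MO_intros LP_MO zL zw(3))+
 have dL: "strong_diff (z k) (graph_of (w k)) : LP" for k
  using le_less_trans[OF zw(6)[of k], of top] dM by(simp add: LP_iff)
 have "graph_of (w k) : LP" for k
 proof -
  have "strong_diff (graph_of (w k)) (z k) : LP"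
   using dL[of k] dM(2)[of k] Phi_swap[OF LP_MO[OF zL] graph_of_MO[OF zw(3)], of k k] by(simp add: LP_iff)
  thus ?thesis using LP_add[OF _ zL[of k]] strong_diff_add[OF graph_of_MO[OF zw(3)] LP_MO[OF zL], of k k] by metis
 qed
 moreover have "N (z k) = 1" for k by(simp add: Lp_norm_eq LP_MO zL zw(2))
 moreover have "N (strong_diff (z k) (graph_of (w k))) <= \<eta> * (1/2) ^ Suc k" for k
  using zw(6)[of k] \<eta> p_pos unfolding Lp_norm_powr[OF dL] not_less[symmetric]
  by(auto simp: Lp_norm_nonneg ennreal_less_iff intro: powr_less_mono2)
 ultimately interpret ad: almost_disjoint M \<tau> p z w \<eta>
  using \<eta> zL zw(3,4,5) by unfold_locales auto
 have S: "ad.S a n : X" for a n using X zw(1) by(induction n) (auto simp: Lp_subspace_def)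
 have "ad.T ` seq_lp p \<subseteq> X" using closedin_plim[OF cl ad.T S] by blast
 moreover have "(1 + 2 * \<eta>) / (1 - 2 * \<eta>) <= 1 + u"
 proof -
  have "(1 + 2 * \<eta>) <= (1 + 8 * \<eta>) * (1 - 2 * \<eta>)" using mult_left_mono[OF \<eta>(2), of "16 * \<eta>"] \<eta>(1) by(simp add: algebra_simps)
  also have "... <= (1 + u) * (1 - 2 * \<eta>)" using \<eta> by(intro mult_right_mono) auto
  finally show ?thesis using \<eta> by(simp add: pos_divide_le_eq)
 qed
 ultimately show "EX T. lp_linear p T & inj_on T (seq_lp p) & T ` seq_lp p \<subseteq> X &
   op_norm (seq_lp p) (seq_norm p) N T * op_norm (T ` seq_lp p) N (seq_norm p) (inv_into (seq_lp p) T) <= ennreal (1 + u)"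
  using ad.lp_linear_T ad.inj_T order_trans[OF ad.op_norms ennreal_leI] by blast
qed

end

theorem theorem3p11:
  fixes M :: "('h::complex_hilbert_space bop) set"
    and \<tau> :: "('h bop) \<Rightarrow> ennreal"
    and p :: real
    and X :: "('h \<times> 'h) set set"
  assumes "semifinite_von_neumann_algebra M"
    and "fns_trace M \<tau>"
    and "1 \<le> p"
    and "Lp_subspace M \<tau> p X"
    and "closedin (Lp_topology M \<tau> p) X"
  shows "contains_almost_isometric_lp \<tau> p X \<or> strongly_embedded M \<tau> p X"
proof -
 interpret lp_vna M \<tau> p
  by unfold_locales (use assms in \<open>simp_all add: semifinite_von_neumann_algebra_def\<close>)
 show ?thesis
 \<comment> \<open>The negation bounds \<open>lam z s\<close> below by one \<eta> at one level s,
   uniformly over the unit sphere of X; a trivial X falls into this second case.\<close>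
 proof (cases "\<forall>s>0. \<forall>\<eta>>0. \<exists>z\<in>X. Phi z = 1 \<and> lam z s \<le> ennreal \<eta>")
  case True
  then show ?thesis using almost_isometric_copies[OF assms(4,5)] by blast
 next
  case False
  then obtain s \<eta> where "0 < s" "0 < \<eta>" "\<And>z. z \<in> X \<Longrightarrow> Phi z = 1 \<Longrightarrow> ennreal \<eta> < lam z s"
   by (auto simp: not_le)
  then show ?thesis using strongly_embeddedI[OF assms(4)] by blast
 qed
qed

end
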